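(* Let $s\in\mathbb{C}$, $0<\operatorname{Re}s<1$, $s\neq\frac12$. For each $(f_1,f_2)\in\ker(\tilde{\mathcal{L}}_s-1)$, the restriction of $f_1$ to $(-1,1)$ extends to a real-analytic function $g$ on $(-\varphi^2,\varphi)$ which belongs to ${}^4\mathrm{FE}_s(-\varphi^2,\varphi)_\omega$; the set $W$ of functions $g$ so obtained is a subspace of ${}^4\mathrm{FE}_s(-\varphi^2,\varphi)_\omega$, and $\theta$ maps $W$ onto the image of $H^1_{\mathrm{par}}(\Gamma;\mathcal{V}^\omega_s,\mathcal{V}^{\mathrm{smp}}_s)$ in $H^1(\Gamma;\mathcal{V}^{\mathrm{fs}}_s)$.
   Context: $\tilde{\mathcal{L}}_s$ acts on pairs $(f_1,f_2)$ of functions continuous on the closed unit disk, holomorphic inside, by $\tilde{\mathcal{L}}_s(f_1,f_2)=(F_1,F_2)$, $F_1(z)=\sum_{n\ge3}(z+n)^{-2s}f_1(\frac{-1}{z+n})+\sum_{n\ge2}(n-z)^{-2s}f_2(\frac{1}{n-z})$, $F_2(z)=\sum_{n\ge2}(z+n)^{-2s}f_1(\frac{-1}{z+n})+\sum_{n\ge3}(n-z)^{-2s}f_2(\frac1{n-z})$, convergent for $\operatorname{Re}s>\frac12$ and defined otherwise (for $\operatorname{Re}s>0$, $s\neq\frac12$) by meromorphic continuation in $s$. $\Gamma=\mathrm{PSL}_2(\mathbb{Z})$, $S=\begin{bmatrix}0&-1\\1&0\end{bmatrix}$, $T=\begin{bmatrix}1&1\\0&1\end{bmatrix}$. Right action $(h|M)(x)=|ad-bc|^s|cx+d|^{-2s}h(\frac{ax+b}{cx+d})$,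 extended linearly to the group ring. For open $I\subset\mathbb{P}^1(\mathbb{R})$, $\mathcal{V}^\omega_s(I)$ = real-analytic functions on $I\cap\mathbb{R}$ with $x\mapsto|x|^{-2s}h(-1/x)$ real-analytic near $0$ if $\infty\in I$; $\mathcal{V}^\omega_s=\mathcal{V}^\omega_s(\mathbb{P}^1(\mathbb{R}))$; $\mathcal{V}^{\mathrm{fs}}_s$ = inductive limit of $\mathcal{V}^\omega_s(\mathbb{P}^1(\mathbb{R})\setminus E)$, $E$ finite (minimal $E$ = singularities); $\mathcal{V}^{\mathrm{smp}}_s$ = those $h\in\mathcal{V}^{\mathrm{fs}}_s$ such that at each singularity $x_0\in\mathbb{R}$, $(x-x_0)h(x)$ is smooth at $x_0$, and at a singularity $\infty$, $y\mapsto y|y|^{-2s}h(-1/y)$ is smooth at $0$. Cyclic interval $(a,b)_c=(a,\infty)\cup\{\infty\}\cup(-\infty,b)$ for $a>b$. Cohomology: $Z^1(\Gamma;V)$ = maps $\psi$ with $\psi_{\gamma\delta}=\psi_\gamma|\delta+\psi_\delta$; $B^1$ = maps $\gamma\mapsto v|(1-\gamma)$; $H^1=Z^1/B^1$; $H^1_{\mathrm{par}}(\Gamma;V,W)$ (for $V\subset W$) = classes of $\psi\in Z^1(\Gamma;V)$ with $\psi_T\in W|(1-T)$, a subspace of $H^1(\Gamma;V)$, mapped to $H^1(\Gamma;\mathcal{V}^{\mathrm{fs}}_s)$ via inclusion when $V=\mathcal{V}^\omega_s$; $H^1_{\mathrm{Fib}}(\Gamma;V)$ = classes of $\psi$ with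 $\psi_{TST^2}\in V|(1-TST^2)$. $\varphi=\frac{1+\sqrt5}2$. ${}^4\mathrm{FE}_s(X)_\omega$ ($X\subset\mathbb{R}$) = real-analytic $g$ on $X$ with $g+g|ST^2=g|T^{-1}+g|T^{-1}ST^{-2}$ on $X\cap T^{-2}SX\cap TX\cap T^2STX$. The map $\theta$: for $g\in{}^4\mathrm{FE}_s(-\varphi^2,\varphi)_\omega$, put $h=g+g|ST^2$ on $(-\varphi,\varphi)$, $k=g|T^{-1}+h|STS$ on $(-\varphi,\varphi^{-1})$; let $c_1\in\mathcal{V}^{\mathrm{fs}}_s$ be $k$ on $(-\varphi,\varphi^{-1})$ and $-k|S$ on $(\varphi^{-1},-\varphi)_c$, and $c_2$ be $h$ on $(-\varphi,\varphi)$ and $-h|(T^{-1}S+ST)$ on $(\varphi,-\varphi)_c$. There is a unique $\psi\in Z^1(\Gamma;\mathcal{V}^{\mathrm{fs}}_s)$ with $\psi_S=-c_1$, $\psi_{T^{-1}S}=-c_2$; $\theta(g)$ is its class, an element of $H^1_{\mathrm{Fib}}(\Gamma;\mathcal{V}^{\mathrm{fs}}_s)\subset H^1(\Gamma;\mathcal{V}^{\mathrm{fs}}_s)$. *)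

theory Defs
  imports "HOL-Complex_Analysis.Complex_Analysis" "HOL-Library.Function_Algebras"
begin

section \<open>The transfer operator\<close>

definition disk_algebra :: "(complex \<Rightarrow> complex) set" where
  "disk_algebra = {f. continuous_on (cball 0 1) f \<and> f holomorphic_on ball 0 1}"

definition transfer1_series ::
  "(complex \<Rightarrow> complex) \<Rightarrow> (complex \<Rightarrow> complex) \<Rightarrow> complex \<Rightarrow> complex \<Rightarrow> complex" where
  "transfer1_series f1 f2 z s =
     (\<Sum>\<^sub>\<infinity>n\<in>{3::nat..}. (z + of_nat n) powr (-2 * s) * f1 (-1 / (z + of_nat n)))
   + (\<Sum>\<^sub>\<infinity>n\<in>{2::nat..}. (of_nat n - z) powr (-2 * s) * f2 (1 / (of_nat n - z)))"

definition transfer2_series ::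
  "(complex \<Rightarrow> complex) \<Rightarrow> (complex \<Rightarrow> complex) \<Rightarrow> complex \<Rightarrow> complex \<Rightarrow> complex" where
  "transfer2_series f1 f2 z s =
     (\<Sum>\<^sub>\<infinity>n\<in>{2::nat..}. (z + of_nat n) powr (-2 * s) * f1 (-1 / (z + of_nat n)))
   + (\<Sum>\<^sub>\<infinity>n\<in>{3::nat..}. (of_nat n - z) powr (-2 * s) * f2 (1 / (of_nat n - z)))"

text \<open>Value at \<open>s\<close> of the meromorphic continuation of \<open>F\<close> from \<open>Re s > 1/2\<close> to \<open>Re s > 0\<close>, with
  \<open>1/2\<close> as the only possible pole. It is unique for \<open>s \<noteq> 1/2\<close>, because the half plane
  without \<open>1/2\<close> is connected.\<close>

definition continued_value :: "(complex \<Rightarrow> complex) \<Rightarrow> complex \<Rightarrow> complex" where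
  "continued_value F s = (THE w. \<exists>G. G meromorphic_on {t. 0 < Re t}
      \<and> G holomorphic_on ({t. 0 < Re t} - {1/2})
      \<and> (\<forall>t. 1/2 < Re t \<longrightarrow> G t = F t) \<and> w = G s)"

definition transfer_op :: "complex \<Rightarrow> (complex \<Rightarrow> complex) \<times> (complex \<Rightarrow> complex)
    \<Rightarrow> (complex \<Rightarrow> complex) \<times> (complex \<Rightarrow> complex)" where
  "transfer_op s = (\<lambda>(f1, f2). (\<lambda>z. continued_value (transfer1_series f1 f2 z) s,
                               \<lambda>z. continued_value (transfer2_series f1 f2 z) s))"

text \<open>The functions of the disk algebra matter on the closed unit disk only, hence so does
  the eigenfunction equation.\<close>

definition transfer_fixed :: "complex \<Rightarrow> ((complex \<Rightarrow> complex) \<times> (complex \<Rightarrow> complex)) set" where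
  "transfer_fixed s = {(f1, f2). f1 \<in> disk_algebra \<and> f2 \<in> disk_algebra \<and>
     (\<forall>z\<in>cball 0 1. fst (transfer_op s (f1, f2)) z = f1 z \<and> snd (transfer_op s (f1, f2)) z = f2 z)}"


section \<open>The modular group\<close>

lemma det_uminus_2: "det (- A) = det (A :: int^2^2)"
  by (simp add: det_2)

lemma uminus_matrix_mult_left: "(- A) ** B = - (A ** (B :: int^2^2))"
  by (simp add: matrix_matrix_mult_def vec_eq_iff sum_negf)

lemma uminus_matrix_mult_right: "A ** (- B) = - (A ** (B :: int^2^2))"
  by (simp add: matrix_matrix_mult_def vec_eq_iff sum_negf)

definition psl_rel :: "int^2^2 \<Rightarrow> int^2^2 \<Rightarrow> bool" where
  "psl_rel A B \<longleftrightarrow> det A = 1 \<and> (B = A \<or> B = - A)"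

quotient_type psl2z = "int^2^2" / partial: psl_rel
proof (rule part_equivpI)
  show "\<exists>A. psl_rel A A" by (rule exI[of _ "mat 1"]) (simp add: psl_rel_def)
  show "symp psl_rel" by (auto simp: symp_def psl_rel_def det_uminus_2)
  show "transp psl_rel" by (auto simp: transp_def psl_rel_def)
qed

definition adjugate2 :: "int^2^2 \<Rightarrow> int^2^2" where
  "adjugate2 A = vector [vector [A$2$2, - (A$1$2)], vector [- (A$2$1), A$1$1]]"

lemma adjugate2_nth:
  "adjugate2 A $ 1 $ 1 = A$2$2" "adjugate2 A $ 1 $ 2 = - (A$1$2)"
  "adjugate2 A $ 2 $ 1 = - (A$2$1)" "adjugate2 A $ 2 $ 2 = A$1$1"
  by (simp_all add: adjugate2_def)

lemma adjugate2_uminus: "adjugate2 (- A) = - adjugate2 A"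
  by (simp add: vec_eq_iff forall_2 adjugate2_nth)

lemma det_adjugate2: "det (adjugate2 A) = det A"
  by (simp add: det_2 adjugate2_nth)

instantiation psl2z :: "{monoid_mult, inverse}"
begin

lift_definition one_psl2z :: psl2z is "mat 1"
  by (simp add: psl_rel_def)

lift_definition times_psl2z :: "psl2z \<Rightarrow> psl2z \<Rightarrow> psl2z" is "(**)"
  by (auto simp: psl_rel_def det_mul uminus_matrix_mult_left uminus_matrix_mult_right)

lift_definition inverse_psl2z :: "psl2z \<Rightarrow> psl2z" is adjugate2
  by (auto simp: psl_rel_def det_adjugate2 adjugate2_uminus)

definition divide_psl2z :: "psl2z \<Rightarrow> psl2z \<Rightarrow> psl2z" where
  "divide_psl2z A B = A * inverse B"

instance
  by standard (transfer; auto simp: psl_rel_def det_mul matrix_mul_assoc)+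

end

lemma psl2z_left_inverse: "inverse A * A = (1 :: psl2z)"
proof (transfer, goal_cases)
  case (1 A)
  then have d: "A$1$1 * A$2$2 - A$1$2 * A$2$1 = 1"
    by (simp add: psl_rel_def det_2)
  then have "adjugate2 A ** A = mat 1"
    by (simp add: vec_eq_iff forall_2 matrix_matrix_mult_def sum_2 adjugate2_nth mat_def algebra_simps)
  then show ?case by (simp add: psl_rel_def)
qed

lift_definition gS :: psl2z is "vector [vector [0, -1], vector [1, 0]] :: int^2^2"
  by (simp add: psl_rel_def det_2)

lift_definition gT :: psl2z is "vector [vector [1, 1], vector [0, 1]] :: int^2^2"
  by (simp add: psl_rel_def det_2)

datatype rp1 = Fin real | Infty

fun moebius_mat :: "int^2^2 \<Rightarrow> rp1 \<Rightarrow> rp1" where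
  "moebius_mat A (Fin x) =
     (let p = of_int (A$1$1) * x + of_int (A$1$2); q = of_int (A$2$1) * x + of_int (A$2$2)
      in if q = 0 then Infty else Fin (p / q))"
| "moebius_mat A Infty =
     (if A$2$1 = 0 then Infty else Fin (of_int (A$1$1) / of_int (A$2$1)))"

lemma moebius_mat_uminus: "moebius_mat (- A) p = moebius_mat A p"
proof (cases p)
  case (Fin x)
  have e: "of_int (- a) * x + of_int (- b) = - (of_int a * x + of_int b :: real)" for a b :: int by simp
  show ?thesis
    by (simp only: Fin moebius_mat.simps Let_def vector_uminus_component e
        neg_equal_0_iff_equal minus_divide_divide)
qed simp

lift_definition moebius :: "psl2z \<Rightarrow> rp1 \<Rightarrow> rp1" is moebius_mat
  by (auto simp: psl_rel_def moebius_mat_uminus fun_eq_iff)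


section \<open>The slash action\<close>

text \<open>The formula is applied to total functions. For a function given on a subset of the real line it
  is meaningful at those points whose image under the group element lies in that subset.\<close>

definition slash_mat :: "complex \<Rightarrow> (real \<Rightarrow> complex) \<Rightarrow> int^2^2 \<Rightarrow> real \<Rightarrow> complex" where
  "slash_mat s h A x =
     (let p = of_int (A$1$1) * x + of_int (A$1$2); q = of_int (A$2$1) * x + of_int (A$2$2)
      in of_real \<bar>of_int (det A)\<bar> powr s * of_real \<bar>q\<bar> powr (-2 * s) * h (p / q))"

lemma slash_mat_uminus: "slash_mat s h (- A) = slash_mat s h A"
proof
  fix x
  have e: "of_int (- a) * x + of_int (- b) = - (of_int a * x + of_int b :: real)" for a b :: int by simp
  show "slash_mat s h (- A) x = slash_mat s h A x"
    by (simp only: slash_mat_def Let_def vector_uminus_component e det_uminus_2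
        abs_minus_cancel minus_divide_divide)
qed

lift_definition slash :: "complex \<Rightarrow> (real \<Rightarrow> complex) \<Rightarrow> psl2z \<Rightarrow> real \<Rightarrow> complex" is slash_mat
  by (auto simp: psl_rel_def slash_mat_uminus)

text \<open>In the inductive limit over finite sets of singularities, two functions are identified
  if they agree outside a finite set. The following type consists of all functions modulo this relation.\<close>

definition eq_cofinite :: "(real \<Rightarrow> complex) \<Rightarrow> (real \<Rightarrow> complex) \<Rightarrow> bool" where
  "eq_cofinite f g \<longleftrightarrow> finite {x. f x \<noteq> g x}"

lemma eq_cofinite_refl [simp]: "eq_cofinite f f"
  by (simp add: eq_cofinite_def)

quotient_type cfun = "real \<Rightarrow> complex" / eq_cofinite
  morphisms rep_cfun class_of
proof (rule equivpI)
  show "reflp eq_cofinite" by (simp add: reflp_def)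
  show "symp eq_cofinite" by (simp add: symp_def eq_cofinite_def eq_commute)
  show "transp eq_cofinite"
  proof (rule transpI)
    fix f g h assume "eq_cofinite f g" "eq_cofinite g h"
    then have "finite ({x. f x \<noteq> g x} \<union> {x. g x \<noteq> h x})" by (simp add: eq_cofinite_def)
    then show "eq_cofinite f h" unfolding eq_cofinite_def by (rule rev_finite_subset) auto
  qed
qed

instantiation cfun :: ab_group_add
begin

lift_definition zero_cfun :: cfun is "\<lambda>_. 0" .

lift_definition plus_cfun :: "cfun \<Rightarrow> cfun \<Rightarrow> cfun" is "\<lambda>f g x. f x + g x"
  unfolding eq_cofinite_def
  by (erule (1) rev_finite_subset[OF finite_UnI]) auto

lift_definition minus_cfun :: "cfun \<Rightarrow> cfun \<Rightarrow> cfun" is "\<lambda>f g x. f x - g x"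
  unfolding eq_cofinite_def
  by (erule (1) rev_finite_subset[OF finite_UnI]) auto

lift_definition uminus_cfun :: "cfun \<Rightarrow> cfun" is "\<lambda>f x. - f x"
  unfolding eq_cofinite_def by simp

instance
  by standard (transfer; simp add: algebra_simps)+

end

lemma eq_cofinite_slash:
  assumes "eq_cofinite f g"
  shows "eq_cofinite (slash s f A) (slash s g A)"
  using assms
proof (transfer, goal_cases)
  case (1 f g s A)
  define a b c d where abcd: "a = real_of_int (A$1$1)" "b = real_of_int (A$1$2)"
    "c = real_of_int (A$2$1)" "d = real_of_int (A$2$2)"
  have "A$1$1 * A$2$2 - A$1$2 * A$2$1 = 1" using 1 by (simp add: psl_rel_def det_2)
  then have det: "a * d - b * c = 1"
    unfolding abcd by (metis of_int_1 of_int_diff of_int_mult)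
  have inj: "inj_on (\<lambda>x. (a * x + b) / (c * x + d)) {x. c * x + d \<noteq> 0}"
  proof (rule inj_onI, clarsimp)
    fix x y assume nz: "c * x + d \<noteq> 0" "c * y + d \<noteq> 0"
      and eq: "(a * x + b) / (c * x + d) = (a * y + b) / (c * y + d)"
    from nz eq have "(a * x + b) * (c * y + d) = (a * y + b) * (c * x + d)"
      by (simp add: frac_eq_eq)
    then have "(a * d - b * c) * x = (a * d - b * c) * y" by algebra
    then show "x = y" by (simp add: det)
  qed
  have "finite ((\<lambda>x. (a * x + b) / (c * x + d)) -` {y. f y \<noteq> g y} \<inter> {x. c * x + d \<noteq> 0})"
    by (rule finite_vimage_IntI[OF _ inj]) (use 1 in \<open>simp add: eq_cofinite_def\<close>)
  then show ?case unfolding eq_cofinite_def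
    by (rule rev_finite_subset) (auto simp: slash_mat_def Let_def abcd)
qed

lift_definition cslash :: "complex \<Rightarrow> cfun \<Rightarrow> psl2z \<Rightarrow> cfun" is slash
  by (rule eq_cofinite_slash)


section \<open>Spaces of real-analytic functions\<close>

definition real_analytic_at :: "(real \<Rightarrow> complex) \<Rightarrow> real \<Rightarrow> bool" where
  "real_analytic_at h x \<longleftrightarrow>
     (\<exists>a r. r > 0 \<and> (\<forall>y. \<bar>y - x\<bar> < r \<longrightarrow> (\<lambda>n. a n * of_real (y - x) ^ n) sums h y))"

definition smooth_at :: "(real \<Rightarrow> complex) \<Rightarrow> real \<Rightarrow> bool" where
  "smooth_at h x \<longleftrightarrow> (\<exists>U D. open U \<and> x \<in> U \<and> D 0 = h \<and>
     (\<forall>n. \<forall>y\<in>U. (D n has_vector_derivative D (Suc n) y) (at y)))"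

definition analytic_functions :: "complex \<Rightarrow> rp1 set \<Rightarrow> (real \<Rightarrow> complex) set" where
  "analytic_functions s I = {h. (\<forall>x. Fin x \<in> I \<longrightarrow> real_analytic_at h x) \<and>
     (Infty \<in> I \<longrightarrow> (\<exists>k. real_analytic_at k 0 \<and>
        (\<forall>\<^sub>F x in at 0. k x = of_real \<bar>x\<bar> powr (-2 * s) * h (-1 / x))))}"

text \<open>For cofinite \<open>I\<close> an analytic function on \<open>I\<close> is determined by its class in \<open>cfun\<close>; the set
  below is used for such \<open>I\<close> only.\<close>

definition V_omega_on :: "complex \<Rightarrow> rp1 set \<Rightarrow> cfun set" where
  "V_omega_on s I = class_of ` analytic_functions s I"

definition V_omega :: "complex \<Rightarrow> cfun set" where
  "V_omega s = V_omega_on s UNIV"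

definition V_fs :: "complex \<Rightarrow> cfun set" where
  "V_fs s = (\<Union>E\<in>{E. finite E}. V_omega_on s (UNIV - E))"

text \<open>The least finite set \<open>E\<close> such that \<open>h\<close> is analytic outside \<open>E\<close>.\<close>

definition singularities :: "complex \<Rightarrow> cfun \<Rightarrow> rp1 set" where
  "singularities s h = \<Inter>{E. finite E \<and> h \<in> V_omega_on s (UNIV - E)}"

fun simple_at :: "complex \<Rightarrow> (real \<Rightarrow> complex) \<Rightarrow> rp1 \<Rightarrow> bool" where
  "simple_at s h (Fin x0) = (\<exists>k. smooth_at k x0 \<and>
     (\<forall>\<^sub>F x in at x0. k x = of_real (x - x0) * h x))"
| "simple_at s h Infty = (\<exists>k. smooth_at k 0 \<and>
     (\<forall>\<^sub>F y in at 0. k y = of_real y * of_real \<bar>y\<bar> powr (-2 * s) * h (-1 / y)))"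

text \<open>The choice of the representative \<open>h\<close> is irrelevant, since \<open>simple_at\<close> depends on punctured
  neighbourhoods only.\<close>

definition V_smp :: "complex \<Rightarrow> cfun set" where
  "V_smp s = {class_of h | h. class_of h \<in> V_fs s \<and>
     (\<forall>p\<in>singularities s (class_of h). simple_at s h p)}"


section \<open>Cohomology\<close>

definition Z1 :: "complex \<Rightarrow> cfun set \<Rightarrow> (psl2z \<Rightarrow> cfun) set" where
  "Z1 s V = {\<psi>. range \<psi> \<subseteq> V \<and> (\<forall>\<gamma> \<delta>. \<psi> (\<gamma> * \<delta>) = cslash s (\<psi> \<gamma>) \<delta> + \<psi> \<delta>)}"

definition B1 :: "complex \<Rightarrow> cfun set \<Rightarrow> (psl2z \<Rightarrow> cfun) set" where
  "B1 s V = {\<lambda>\<gamma>. v - cslash s v \<gamma> | v. v \<in> V}"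

definition cohomologous ::
  "complex \<Rightarrow> cfun set \<Rightarrow> ((psl2z \<Rightarrow> cfun) \<times> (psl2z \<Rightarrow> cfun)) set" where
  "cohomologous s V = {(\<psi>, \<psi>'). \<psi> \<in> Z1 s V \<and> \<psi>' \<in> Z1 s V \<and> \<psi> - \<psi>' \<in> B1 s V}"

definition coh_class :: "complex \<Rightarrow> cfun set \<Rightarrow> (psl2z \<Rightarrow> cfun) \<Rightarrow> (psl2z \<Rightarrow> cfun) set" where
  "coh_class s V \<psi> = cohomologous s V `` {\<psi>}"

definition H1 :: "complex \<Rightarrow> cfun set \<Rightarrow> (psl2z \<Rightarrow> cfun) set set" where
  "H1 s V = Z1 s V // cohomologous s V"

definition H1_par :: "complex \<Rightarrow> cfun set \<Rightarrow> cfun set \<Rightarrow> (psl2z \<Rightarrow> cfun) set set" where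
  "H1_par s V W = {C \<in> H1 s V. \<exists>\<psi>\<in>C. \<psi> gT \<in> {w - cslash s w gT | w. w \<in> W}}"

text \<open>The map from \<open>H1 s V\<close> to \<open>H1 s V'\<close> induced by an inclusion \<open>V \<subseteq> V'\<close>: it sends the class of a
  cocycle for \<open>V\<close>, a set of cocycles, to the class for \<open>V'\<close> which contains that set.\<close>

definition H1_incl :: "complex \<Rightarrow> cfun set \<Rightarrow> (psl2z \<Rightarrow> cfun) set \<Rightarrow> (psl2z \<Rightarrow> cfun) set" where
  "H1_incl s V' C = cohomologous s V' `` C"


section \<open>The four term equation and the map to cohomology\<close>

definition phi :: real where "phi = (1 + sqrt 5) / 2"

text \<open>A function on a subset \<open>X\<close> of the real line is encoded as a total function vanishing
  outside \<open>X\<close>.\<close>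

definition analytic_fun_on :: "real set \<Rightarrow> (real \<Rightarrow> complex) set" where
  "analytic_fun_on X = {g. (\<forall>x\<in>X. real_analytic_at g x) \<and> (\<forall>x. x \<notin> X \<longrightarrow> g x = 0)}"

definition FE4 :: "complex \<Rightarrow> real set \<Rightarrow> (real \<Rightarrow> complex) set" where
  "FE4 s X = {g \<in> analytic_fun_on X. \<forall>x.
     Fin x \<in> Fin ` X \<inter> moebius ((inverse gT)^2 * gS) ` Fin ` X \<inter> moebius gT ` Fin ` X
        \<inter> moebius (gT^2 * gS * gT) ` Fin ` X \<longrightarrow>
     (g + slash s g (gS * gT^2)) x =
     (slash s g (inverse gT) + slash s g (inverse gT * gS * (inverse gT)^2)) x}"

text \<open>For \<open>g\<close> on \<open>(-phi\<^sup>2, phi)\<close>, the functions \<open>theta_h\<close> and \<open>theta_k\<close> are meaningful on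
  \<open>(-phi, phi)\<close> and \<open>(-phi, 1/phi)\<close>, and only their values there enter in \<open>theta_c1\<close> and
  \<open>theta_c2\<close>, up to finitely many points (the end points of the intervals).\<close>

definition theta_h :: "complex \<Rightarrow> (real \<Rightarrow> complex) \<Rightarrow> real \<Rightarrow> complex" where
  "theta_h s g = g + slash s g (gS * gT^2)"

definition theta_k :: "complex \<Rightarrow> (real \<Rightarrow> complex) \<Rightarrow> real \<Rightarrow> complex" where
  "theta_k s g = slash s g (inverse gT) + slash s (theta_h s g) (gS * gT * gS)"

definition theta_c1 :: "complex \<Rightarrow> (real \<Rightarrow> complex) \<Rightarrow> cfun" where
  "theta_c1 s g = class_of (\<lambda>x. if x \<in> {- phi <..< 1 / phi} then theta_k s g x
     else - slash s (theta_k s g) gS x)"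

definition theta_c2 :: "complex \<Rightarrow> (real \<Rightarrow> complex) \<Rightarrow> cfun" where
  "theta_c2 s g = class_of (\<lambda>x. if x \<in> {- phi <..< phi} then theta_h s g x
     else - (slash s (theta_h s g) (inverse gT * gS) x + slash s (theta_h s g) (gS * gT) x))"

definition theta_cocycle :: "complex \<Rightarrow> (real \<Rightarrow> complex) \<Rightarrow> psl2z \<Rightarrow> cfun" where
  "theta_cocycle s g = (THE \<psi>. \<psi> \<in> Z1 s (V_fs s) \<and>
     \<psi> gS = - theta_c1 s g \<and> \<psi> (inverse gT * gS) = - theta_c2 s g)"

definition theta :: "complex \<Rightarrow> (real \<Rightarrow> complex) \<Rightarrow> (psl2z \<Rightarrow> cfun) set" where
  "theta s g = coh_class s (V_fs s) (theta_cocycle s g)"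

definition analytic_extension :: "(complex \<Rightarrow> complex) \<Rightarrow> (real \<Rightarrow> complex) \<Rightarrow> bool" where
  "analytic_extension f g \<longleftrightarrow>
     g \<in> analytic_fun_on {-(phi^2) <..< phi} \<and> (\<forall>x\<in>{-1<..<1}. g x = f (of_real x))"

definition eigen_space :: "complex \<Rightarrow> (real \<Rightarrow> complex) set" where
  "eigen_space s = {g. \<exists>(f1, f2)\<in>transfer_fixed s. analytic_extension f1 g}"

definition cscale :: "complex \<Rightarrow> (real \<Rightarrow> complex) \<Rightarrow> real \<Rightarrow> complex" where
  "cscale c g = (\<lambda>x. c * g x)"

interpretation cscale: vector_space cscale
  by unfold_locales (auto simp: cscale_def fun_eq_iff algebra_simps)

end

theory Submission
  imports Defs
begin

text \<open>Regularizing the divergent sums gives meaning to the transfer operator for all \<open>Re s > 0\<close>. An eigenfunction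
  splits as \<open>g = q\<^sub>- + q\<^sub>+\<close> into two such sums, and comparing consecutive terms of each sum yields the four term
  equation. On \<open>T\<close> the cocycle of \<open>g\<close> is the coboundary of the function \<open>q\<close> glued from \<open>- q\<^sub>-|T\<^sup>-\<^sup>1\<close> and
  \<open>q\<^sub>+ - c\<^sub>2\<close>. Both halves of \<open>q\<close> have the same asymptotic expansion at infinity and extend to opposite
  sectors, so Cauchy integrals over the two sectors (an additive Cousin problem) produce a \<open>w\<close>, analytic on the
  line and with a simple singularity at infinity, such that \<open>q + w\<close> is regular at infinity; subtracting the
  coboundary of \<open>q + w\<close> makes the cocycle analytic everywhere. Conversely, for an analytic cocycle \<open>\<psi>\<close> with
  \<open>\<psi>\<^sub>T = w|(1 - T)\<close> the equation \<open>v|(1 - TST\<^sup>2) = \<psi>\<close> at the hyperbolic element is solved by a geometric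
  series, and the asymptotics of \<open>w\<close> identify the resulting function with its regularized sums.\<close>

section \<open>Real-analytic functions\<close>

text \<open>The golden ratio enters twice: \<open>phi\<^sup>2\<close> is the attracting fixed point
  of \<open>b \<mapsto> 3 - 1 / b\<close>, which governs how far one application of the operator
  enlarges the interval of analyticity, and \<open>1 / phi\<close>, \<open>- phi\<close> are the
  fixed points of TST^2, which control the singularities of the cocycle. As the series diverge for
  Re s <= 1/2, they cannot be manipulated term by term; a regularized sum is instead characterized
  by its difference equation together with its leading term P(0) / (2s - 1) w^(1 - 2s). The pair
  (f1, f2) is replaced by a single function, because after analytic extension f2(x) = f1(x - 1) on
  the real line. In the passage to analytic cocycles the obstacle is infinity: the expansion of
  \<open>q\<close> there is known only as an asymptotic one, so that no local extension is at hand,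
  and yet the correcting \<open>w\<close> must be analytic on the whole line. The weight (1 +
  x^2)^(-s), invariant under S for the slash action, reduces this to an unweighted problem for
  Cauchy integrals.\<close>

text \<open>Closure properties of real-analytic functions are drawn from those of holomorphic ones:
  this rule and \<open>real_analytic_atE\<close> translate between the power series of the
  definition and a local holomorphic extension.\<close>

lemma real_analytic_atI:
  assumes "open S" "F holomorphic_on S" "of_real x \<in> S" "\<forall>\<^sub>F y in nhds x. h y = F (of_real y)"
  shows "real_analytic_at h x"
proof -
  obtain r1 where r1: "r1 > 0" "ball (of_real x) r1 \<subseteq> S"
    using assms(1,3) open_contains_ball by meson
  obtain r2 where r2: "r2 > 0" "\<And>y. dist y x < r2 \<Longrightarrow> h y = F (of_real y)"
    using assms(4) unfolding eventually_nhds_metric by auto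
  have "(\<lambda>n. (deriv ^^ n) F (of_real x) / fact n * of_real (y - x) ^ n) sums h y"
    if "\<bar>y - x\<bar> < min r1 r2" for y
  proof -
    have "of_real y \<in> ball (complex_of_real x) r1"
      using that by (simp add: dist_norm abs_minus_commute flip: of_real_diff)
    with holomorphic_power_series[of F "of_real x" r1 "of_real y"] holomorphic_on_subset[OF assms(2) r1(2)]
    show ?thesis using r2(2)[of y] that by (simp add: dist_norm)
  qed
  then show ?thesis
    unfolding real_analytic_at_def using r1(1) r2(1)
    by (intro exI[of _ "\<lambda>n. (deriv ^^ n) F (of_real x) / fact n"] exI[of _ "min r1 r2"]) auto
qed

text \<open>Convergence is assumed at real points only, but a power series that converges at
  distance \<open>t\<close> from its centre converges in the whole open disk of radius
  \<open>t\<close>. This provides the extension to complex arguments.\<close>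

lemma real_power_series_holomorphic:
  assumes r: "r > 0" and a: "\<And>y. \<bar>y - x\<bar> < r \<Longrightarrow> (\<lambda>n. a n * of_real (y - x) ^ n) sums h y"
  shows "(\<lambda>z. \<Sum>n. a n * (z - of_real x) ^ n) holomorphic_on ball (of_real x) r"
    and "\<And>z. z \<in> ball (of_real x) r \<Longrightarrow> summable (\<lambda>n. a n * (z - of_real x) ^ n)"
    and "\<And>y. \<bar>y - x\<bar> < r \<Longrightarrow> h y = (\<Sum>n. a n * (of_real y - of_real x) ^ n)"
proof -
  show s: "summable (\<lambda>n. a n * (z - of_real x) ^ n)" if z: "z \<in> ball (of_real x) r" for z
  proof -
    obtain t where t: "cmod (z - of_real x) < t" "t < r"
      using z dense[of "cmod (z - of_real x)" r] by (auto simp: dist_norm norm_minus_commute)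
    have "t > 0" using t(1) norm_ge_zero le_less_trans by blast
    then have "summable (\<lambda>n. a n * of_real t ^ n)"
      using a[of "x + t"] t(2) by (simp add: sums_iff)
    from powser_inside[OF this] t \<open>t > 0\<close> show ?thesis by simp
  qed
  show "(\<lambda>z. \<Sum>n. a n * (z - of_real x) ^ n) holomorphic_on ball (of_real x) r"
    by (rule power_series_holomorphic[where a = a]) (use s in \<open>simp add: summable_sums\<close>)
  show "h y = (\<Sum>n. a n * (of_real y - of_real x) ^ n)" if "\<bar>y - x\<bar> < r" for y
    using a[OF that] by (simp add: sums_iff)
qed

lemma real_analytic_atE:
  assumes "real_analytic_at h x"
  obtains r F where "r > 0" "F holomorphic_on ball (of_real x) r"
    "\<And>y. \<bar>y - x\<bar> < r \<Longrightarrow> h y = F (of_real y)"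
proof -
  obtain a r where r: "r > 0" "\<And>y. \<bar>y - x\<bar> < r \<Longrightarrow> (\<lambda>n. a n * of_real (y - x) ^ n) sums h y"
    using assms unfolding real_analytic_at_def by auto
  show ?thesis
    by (rule that[OF r(1) real_power_series_holomorphic(1)[OF r] real_power_series_holomorphic(3)[OF r]])
qed

lemma eventually_nhds_abs:
  "(\<And>y::real. \<bar>y - x\<bar> < r \<Longrightarrow> P y) \<Longrightarrow> r > 0 \<Longrightarrow> \<forall>\<^sub>F y in nhds x. P y"
  unfolding eventually_nhds_metric by (auto simp: dist_norm)

lemma real_analytic_at_cong:
  assumes "real_analytic_at h x" "\<forall>\<^sub>F y in nhds x. h' y = h y"
  shows "real_analytic_at h' x"
proof -
  obtain r F where F: "r > 0" "F holomorphic_on ball (of_real x) r"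
    "\<And>y. \<bar>y - x\<bar> < r \<Longrightarrow> h y = F (of_real y)"
    using real_analytic_atE[OF assms(1)] by blast
  have "\<forall>\<^sub>F y in nhds x. h y = F (of_real y)"
    by (rule eventually_nhds_abs[OF F(3) F(1)])
  with assms(2) have "\<forall>\<^sub>F y in nhds x. h' y = F (of_real y)"
    by eventually_elim simp
  then show ?thesis by (intro real_analytic_atI[OF open_ball F(2)]) (use F(1) in simp_all)
qed

lemma real_analytic_at_compose:
  assumes h: "real_analytic_at h (m x)" and S: "open S" "\<mu> holomorphic_on S" "of_real x \<in> S"
    and m: "\<forall>\<^sub>F y in nhds x. of_real (m y) = \<mu> (of_real y)"
  shows "real_analytic_at (\<lambda>y. h (m y)) x"
proof -
  obtain r F where F: "r > 0" "F holomorphic_on ball (of_real (m x)) r"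
    "\<And>y. \<bar>y - m x\<bar> < r \<Longrightarrow> h y = F (of_real y)"
    using real_analytic_atE[OF h] by blast
  define U where "U = S \<inter> \<mu> -` ball (of_real (m x)) r"
  have mx: "of_real (m x) = \<mu> (of_real x)"
    using m by (rule eventually_nhds_x_imp_x)
  have U: "open U" unfolding U_def
    by (rule continuous_open_preimage[OF holomorphic_on_imp_continuous_on[OF S(2)] S(1) open_ball])
  have xU: "of_real x \<in> U" using S(3) mx F(1) by (simp add: U_def)
  have hol: "(\<lambda>z. F (\<mu> z)) holomorphic_on U"
    using holomorphic_on_compose_gen[OF holomorphic_on_subset[OF S(2)] F(2), of U]
    by (auto simp: U_def o_def)
  have "\<forall>\<^sub>F y in nhds x. complex_of_real y \<in> U"
    by (rule eventually_compose_filterlim[of "\<lambda>z. z \<in> U" "nhds (complex_of_real x)"])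
       (use U xU in \<open>auto simp: eventually_nhds intro!: tendsto_intros filterlim_ident\<close>)
  with m have "\<forall>\<^sub>F y in nhds x. h (m y) = F (\<mu> (of_real y))"
  proof eventually_elim
    case (elim y)
    then have "cmod (of_real (m y) - of_real (m x)) < r"
      by (simp add: U_def dist_norm norm_minus_commute)
    then have "\<bar>m y - m x\<bar> < r" by (simp flip: of_real_diff)
    with elim show ?case by (simp add: F(3))
  qed
  then show ?thesis by (rule real_analytic_atI[OF U hol xU])
qed

text \<open>Since the operation is only asked to preserve holomorphy, sum, difference and product
  share one proof; both extensions are restricted to the smaller disk.\<close>

lemma real_analytic_at_binop:
  assumes "real_analytic_at f x" "real_analytic_at g x"
    and op: "\<And>F G S. F holomorphic_on S \<Longrightarrow> G holomorphic_on S \<Longrightarrow> (\<lambda>z. op (F z) (G z)) holomorphic_on S"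
  shows "real_analytic_at (\<lambda>y. op (f y) (g y)) x"
proof -
  obtain r F where F: "r > 0" "F holomorphic_on ball (of_real x) r"
    "\<And>y. \<bar>y - x\<bar> < r \<Longrightarrow> f y = F (of_real y)"
    using real_analytic_atE[OF assms(1)] by blast
  obtain q G where G: "q > 0" "G holomorphic_on ball (of_real x) q"
    "\<And>y. \<bar>y - x\<bar> < q \<Longrightarrow> g y = G (of_real y)"
    using real_analytic_atE[OF assms(2)] by blast
  show ?thesis
  proof (rule real_analytic_atI[where S = "ball (of_real x) (min r q)"])
    show "(\<lambda>z. op (F z) (G z)) holomorphic_on ball (of_real x) (min r q)"
      by (intro op holomorphic_on_subset[OF F(2)] holomorphic_on_subset[OF G(2)]) auto
    show "\<forall>\<^sub>F y in nhds x. op (f y) (g y) = op (F (of_real y)) (G (of_real y))"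
      by (rule eventually_nhds_abs[where r = "min r q"]) (use F G in auto)
  qed (use F G in auto)
qed

lemma real_analytic_at_add: "real_analytic_at f x \<Longrightarrow> real_analytic_at g x \<Longrightarrow> real_analytic_at (\<lambda>y. f y + g y) x"
  by (rule real_analytic_at_binop) (auto intro!: holomorphic_intros)

lemma real_analytic_at_diff: "real_analytic_at f x \<Longrightarrow> real_analytic_at g x \<Longrightarrow> real_analytic_at (\<lambda>y. f y - g y) x"
  by (rule real_analytic_at_binop) (auto intro!: holomorphic_intros)

lemma real_analytic_at_mult: "real_analytic_at f x \<Longrightarrow> real_analytic_at g x \<Longrightarrow> real_analytic_at (\<lambda>y. f y * g y) x"
  by (rule real_analytic_at_binop) (auto intro!: holomorphic_intros)

lemma real_analytic_at_holomorphic: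
  "open S \<Longrightarrow> F holomorphic_on S \<Longrightarrow> of_real x \<in> S \<Longrightarrow> real_analytic_at (\<lambda>y. F (of_real y)) x"
  by (rule real_analytic_atI[of S F]) auto

lemma real_analytic_at_const: "real_analytic_at (\<lambda>y. c) x"
  by (rule real_analytic_at_holomorphic[of UNIV "\<lambda>_. c"]) auto

lemma real_analytic_at_of_real: "real_analytic_at of_real x"
  using real_analytic_at_holomorphic[of UNIV "\<lambda>z. z" x] by (simp add: holomorphic_intros)

lemma real_analytic_at_minus: "real_analytic_at f x \<Longrightarrow> real_analytic_at (\<lambda>y. - f y) x"
  using real_analytic_at_diff[OF real_analytic_at_const[of 0], of f x] by simp

lemma real_analytic_at_sum:
  "(\<And>i. i \<in> I \<Longrightarrow> real_analytic_at (f i) x) \<Longrightarrow> real_analytic_at (\<lambda>y. \<Sum>i\<in>I. f i y) x"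
  by (induction I rule: infinite_finite_induct)
     (auto intro!: real_analytic_at_const real_analytic_at_add)

lemma real_analytic_at_moebius:
  assumes "real_analytic_at h ((a * x + b) / (c * x + d))" "c * x + d \<noteq> 0"
  shows "real_analytic_at (\<lambda>y. h ((a * y + b) / (c * y + d))) x"
proof (rule real_analytic_at_compose[where m = "\<lambda>y. (a * y + b) / (c * y + d)"
      and S = "{z. of_real c * z + of_real d \<noteq> 0}"
      and \<mu> = "\<lambda>z. (of_real a * z + of_real b) / (of_real c * z + of_real d)", OF assms(1)])
  show "open {z. complex_of_real c * z + complex_of_real d \<noteq> 0}"
    by (intro open_Collect_neq continuous_intros)
  show "complex_of_real x \<in> {z. complex_of_real c * z + complex_of_real d \<noteq> 0}"
    using assms(2) by (simp flip: of_real_mult of_real_add)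
qed (auto intro!: holomorphic_intros)

text \<open>The absolute value is not holomorphic, but near a point with
  \<open>c * x + d \<noteq> 0\<close> it equals \<open>e * (c * y + d)\<close> with a constant sign
  \<open>e\<close>, and this stays in the right half plane, where the principal power is
  holomorphic.\<close>

lemma real_analytic_at_abs_powr:
  assumes "c * x + d \<noteq> 0"
  shows "real_analytic_at (\<lambda>y. of_real \<bar>c * y + d\<bar> powr t) x"
proof -
  define e where "e = sgn (c * x + d)"
  have e: "e = 1 \<or> e = -1" using assms by (auto simp: e_def sgn_if)
  let ?S = "{z. 0 < Re (of_real e * (of_real c * z + of_real d))}"
  show ?thesis
  proof (rule real_analytic_atI[where S = ?S and F = "\<lambda>z. (of_real e * (of_real c * z + of_real d)) powr t"])
    show "open ?S" by (intro open_Collect_less continuous_intros)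
    show "(\<lambda>z. (of_real e * (of_real c * z + of_real d)) powr t) holomorphic_on ?S"
      by (intro holomorphic_intros) (auto simp: complex_nonpos_Reals_iff)
    have x: "0 < e * (c * x + d)" using assms by (simp add: e_def sgn_if)
    then show "complex_of_real x \<in> ?S" by simp
    have "\<forall>\<^sub>F y in nhds x. 0 < e * (c * y + d)"
      by (rule order_tendstoD[OF _ x]) (auto intro!: tendsto_intros filterlim_ident)
    then show "\<forall>\<^sub>F y in nhds x. of_real \<bar>c * y + d\<bar> powr t =
        (of_real e * (of_real c * of_real y + of_real d)) powr t"
    proof eventually_elim
      case (elim y)
      then have "\<bar>c * y + d\<bar> = e * (c * y + d)" using e by auto
      then show ?case by simp
    qed
  qed
qed

lemma real_analytic_at_isCont:
  assumes "real_analytic_at h x" shows "isCont h x"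
proof -
  obtain r F where F: "r > 0" "F holomorphic_on ball (of_real x) r"
    "\<And>y. \<bar>y - x\<bar> < r \<Longrightarrow> h y = F (of_real y)"
    using real_analytic_atE[OF assms] by blast
  have "continuous_on (ball (of_real x) r) F" using F(2) holomorphic_on_imp_continuous_on by blast
  then have "isCont F (of_real x)" using F(1) by (simp add: continuous_on_eq_continuous_at)
  then have "isCont (\<lambda>y. F (of_real y)) x"
    by (intro isCont_o2[where f = complex_of_real and g = F]) (auto intro!: continuous_intros)
  moreover have "\<forall>\<^sub>F y in nhds x. h y = F (of_real y)"
    by (rule eventually_nhds_abs[OF F(3) F(1)])
  ultimately show ?thesis using isCont_cong[of h "\<lambda>y. F (of_real y)" x] by simp
qed

text \<open>Equality of classes gives equality of functions only off a finite set; for continuous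
  representatives it passes to the remaining points.\<close>

lemma eventually_at_eq_imp_nhds_eq:
  fixes f g :: "real \<Rightarrow> complex"
  assumes "isCont f x" "isCont g x" "\<forall>\<^sub>F y in at x. f y = g y"
  shows "f x = g x" "\<forall>\<^sub>F y in nhds x. f y = g y"
proof -
  have "(f \<longlongrightarrow> g x) (at x)"
    using assms(2) unfolding isCont_def by (rule Lim_transform_eventually) (use assms(3) in eventually_elim, simp)
  with assms(1) show "f x = g x" unfolding isCont_def using tendsto_unique[of "at x"] by auto
  with assms(3) show "\<forall>\<^sub>F y in nhds x. f y = g y"
    by (auto simp: eventually_at_filter elim!: eventually_mono)
qed

lemma real_analytic_at_zero_or_nonzero:
  assumes "real_analytic_at h x"
  shows "(\<forall>\<^sub>F y in nhds x. h y = 0) \<or> (\<forall>\<^sub>F y in at x. h y \<noteq> 0)"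
proof -
  obtain r F where F: "r > 0" "F holomorphic_on ball (of_real x) r"
    "\<And>y. \<bar>y - x\<bar> < r \<Longrightarrow> h y = F (of_real y)"
    using real_analytic_atE[OF assms] by blast
  show ?thesis
  proof (cases "\<forall>z\<in>ball (of_real x) r. F z = 0")
    case True
    have "\<forall>\<^sub>F y in nhds x. h y = 0"
      by (rule eventually_nhds_abs[OF _ F(1)])
         (use True F(3) in \<open>simp add: dist_norm abs_minus_commute flip: of_real_diff\<close>)
    then show ?thesis ..
  next
    case False
    then obtain \<beta> where b: "\<beta> \<in> ball (of_real x) r" "F \<beta> \<noteq> 0" by auto
    have "\<forall>\<^sub>F z in at (complex_of_real x). F z \<noteq> 0 \<and> z \<in> ball (of_real x) r"
      by (rule non_zero_neighbour_alt[OF F(2) open_ball _ _ b]) (use F(1) in auto)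
    then have "\<forall>\<^sub>F y in at x. F (of_real y) \<noteq> 0 \<and> complex_of_real y \<in> ball (of_real x) r"
      by (rule eventually_compose_filterlim)
         (auto simp: filterlim_at eventually_at_filter intro!: tendsto_intros)
    then have "\<forall>\<^sub>F y in at x. h y \<noteq> 0"
    proof eventually_elim
      case (elim y)
      then have "\<bar>y - x\<bar> < r" by (simp add: dist_norm abs_minus_commute flip: of_real_diff)
      with elim F(3) show ?case by simp
    qed
    then show ?thesis ..
  qed
qed

text \<open>Connectedness: the points near which the difference vanishes identically
  (\<open>A\<close>) and those with no other zero nearby (\<open>B\<close>) form disjoint open sets,
  and they cover \<open>I\<close> by \<open>real_analytic_at_zero_or_nonzero\<close>.\<close>

lemma real_analytic_identity:
  assumes an: "\<And>x. x \<in> I \<Longrightarrow> real_analytic_at f x" "\<And>x. x \<in> I \<Longrightarrow> real_analytic_at g x"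
    and I: "open I" "connected I" and x0: "x0 \<in> I" and eq: "\<forall>\<^sub>F y in nhds x0. f y = g y" and x: "x \<in> I"
  shows "f x = g x"
proof -
  define h where "h y = f y - g y" for y
  have h: "real_analytic_at h y" if "y \<in> I" for y
    unfolding h_def by (rule real_analytic_at_diff) (use an that in auto)
  define A where "A = {y \<in> I. \<forall>\<^sub>F z in nhds y. h z = 0}"
  define B where "B = {y \<in> I. \<forall>\<^sub>F z in at y. h z \<noteq> 0}"
  have "open A"
  proof (subst open_subopen, safe)
    fix y assume "y \<in> A"
    then have "y \<in> I" "\<forall>\<^sub>F z in nhds y. h z = 0" by (auto simp: A_def)
    then have "\<forall>\<^sub>F w in nhds y. w \<in> A"
      using eventually_nhds_in_open[OF I(1), of y] eventually_eventually[of "\<lambda>z. h z = 0" y]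
      by (auto simp: A_def eventually_conj_iff)
    then show "\<exists>T. open T \<and> y \<in> T \<and> T \<subseteq> A" by (auto simp: eventually_nhds)
  qed
  moreover have "open B"
  proof (subst open_subopen, safe)
    fix y assume y: "y \<in> B"
    then have "y \<in> I" "\<forall>\<^sub>F z in at y. h z \<noteq> 0" by (auto simp: B_def)
    then obtain U where U: "open U" "y \<in> U" "\<And>z. z \<in> U \<Longrightarrow> z \<noteq> y \<Longrightarrow> h z \<noteq> 0"
      unfolding eventually_at_topological by auto
    have "z \<in> B" if z: "z \<in> U \<inter> I" for z
    proof (cases "z = y")
      case True then show ?thesis using y by simp
    next
      case False
      have "\<forall>\<^sub>F w in nhds z. w \<in> U - {y}"
        by (rule eventually_nhds_in_open) (use U z False in auto)
      then have "\<forall>\<^sub>F w in at z. h w \<noteq> 0"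
        unfolding eventually_at_filter by eventually_elim (use U in auto)
      then show ?thesis using z by (simp add: B_def)
    qed
    then show "\<exists>T. open T \<and> y \<in> T \<and> T \<subseteq> B"
      using U(1,2) I(1) \<open>y \<in> I\<close> by (intro exI[of _ "U \<inter> I"]) auto
  qed
  moreover have "A \<inter> B = {}"
  proof -
    have False if "\<forall>\<^sub>F z in nhds y. h z = 0" "\<forall>\<^sub>F z in at y. h z \<noteq> 0" for y
    proof -
      have "\<forall>\<^sub>F z in at y. h z = 0" using that(1) by (simp add: eventually_at_filter eventually_mono)
      with that(2) have "\<forall>\<^sub>F z in at y. False" by eventually_elim simp
      then show False by (simp add: trivial_limit_def[symmetric])
    qed
    then show ?thesis unfolding A_def B_def by auto
  qed
  moreover have "I \<subseteq> A \<union> B" using real_analytic_at_zero_or_nonzero[OF h] by (auto simp: A_def B_def)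
  moreover have "A \<inter> I \<noteq> {}" using x0 eq by (auto simp: A_def h_def intro!: exI[of _ x0])
  ultimately have "B \<inter> I = {}" using I(2) unfolding connected_def by blast
  then have "x \<in> A" using x \<open>I \<subseteq> A \<union> B\<close> by auto
  then have "\<forall>\<^sub>F z in nhds x. h z = 0" by (simp add: A_def)
  then have "h x = 0" by (rule eventually_nhds_x_imp_x)
  then show ?thesis by (simp add: h_def)
qed

section \<open>The slash action on functions with finitely many singularities\<close>

text \<open>Integer entries serve as coordinates on the quotient type: products, inverses and
  equality of group elements become integer arithmetic.\<close>

definition psl :: "int \<Rightarrow> int \<Rightarrow> int \<Rightarrow> int \<Rightarrow> psl2z" where
  "psl a b c d = abs_psl2z (vector [vector [a, b], vector [c, d]])"

lemma psl_rel_vector: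
  "psl_rel (vector [vector [a, b], vector [c, d]]) (vector [vector [a', b'], vector [c', d']]) \<longleftrightarrow>
     a * d - b * c = 1 \<and> (a' = a \<and> b' = b \<and> c' = c \<and> d' = d \<or> a' = -a \<and> b' = -b \<and> c' = -c \<and> d' = -d)"
  by (auto simp: psl_rel_def det_2 vec_eq_iff forall_2 vector_2)

lemma psl_cases:
  obtains a b c d where "a * d - b * c = 1" "\<gamma> = psl a b c d"
proof -
  obtain A where A: "psl_rel A A" "\<gamma> = abs_psl2z A"
    using Quotient_psl2z by (metis Quotient_abs_rep Quotient_rep_reflp)
  have "vector [vector [A$1$1, A$1$2], vector [A$2$1, A$2$2]] = A"
    by (simp add: vec_eq_iff forall_2 vector_2)
  moreover have "A$1$1 * A$2$2 - A$1$2 * A$2$1 = 1" using A(1) by (simp add: psl_rel_def det_2)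
  ultimately show ?thesis using that A(2) by (metis psl_def)
qed

lemma psl_mult:
  assumes "a * d - b * c = 1" "a' * d' - b' * c' = 1"
  shows "psl a b c d * psl a' b' c' d' = psl (a*a' + b*c') (a*b' + b*d') (c*a' + d*c') (c*b' + d*d')"
proof -
  have "(vector [vector [a, b], vector [c, d]] :: int^2^2) ** (vector [vector [a', b'], vector [c', d']] :: int^2^2)
     = vector [vector [a*a' + b*c', a*b' + b*d'], vector [c*a' + d*c', c*b' + d*d']]"
    by (simp add: vec_eq_iff forall_2 matrix_matrix_mult_def sum_2 vector_2)
  then show ?thesis unfolding psl_def
    by (subst times_psl2z.abs_eq) (use assms in \<open>auto simp: psl_rel_vector\<close>)
qed

lemma psl_inverse:
  assumes "a * d - b * c = 1"
  shows "inverse (psl a b c d) = psl d (-b) (-c) a"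
proof -
  have "adjugate2 (vector [vector [a, b], vector [c, d]]) = vector [vector [d, -b], vector [-c, a]]"
    by (simp add: vec_eq_iff forall_2 adjugate2_nth vector_2)
  then show ?thesis unfolding psl_def
    by (subst inverse_psl2z.abs_eq) (use assms in \<open>auto simp: psl_rel_vector\<close>)
qed

lemma psl_eq_iff:
  assumes "a * d - b * c = 1" "a' * d' - b' * c' = 1"
  shows "psl a b c d = psl a' b' c' d' \<longleftrightarrow>
     (a' = a \<and> b' = b \<and> c' = c \<and> d' = d \<or> a' = -a \<and> b' = -b \<and> c' = -c \<and> d' = -d)"
proof -
  have "psl_rel A A \<Longrightarrow> psl_rel B B \<Longrightarrow> abs_psl2z A = abs_psl2z B \<longleftrightarrow> psl_rel A B" for A B
    using Quotient_rel[OF Quotient_psl2z, of A B] by simp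
  then show ?thesis unfolding psl_def using assms by (auto simp: psl_rel_vector)
qed

lemma psl_minus: "a * d - b * c = 1 \<Longrightarrow> psl (-a) (-b) (-c) (-d) = psl a b c d"
  by (subst psl_eq_iff) auto

lemma gS_psl: "gS = psl 0 (-1) 1 0" by (simp add: gS_def psl_def)
lemma gT_psl: "gT = psl 1 1 0 1" by (simp add: gT_def psl_def)
lemma one_psl: "1 = psl 1 0 0 1"
proof -
  have "(mat 1 :: int^2^2) = vector [vector [1, 0], vector [0, 1]]"
    by (simp add: vec_eq_iff forall_2 mat_def vector_2)
  then show ?thesis by (simp add: one_psl2z_def psl_def)
qed
lemma gT_inverse_psl: "inverse gT = psl 1 (-1) 0 1" by (simp add: gT_psl psl_inverse)

text \<open>Rewriting with these rules evaluates a word in the generators to an explicit matrix and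
  decides equality up to a common sign.\<close>

lemmas psl_words = gS_psl gT_psl gT_inverse_psl one_psl psl_mult psl_inverse psl_eq_iff power2_eq_square

text \<open>Real entries, because the hyperbolic element is later conjugated by an irrational
  matrix. The determinant factor of the slash action is absent, as the matrices in use have
  determinant 1.\<close>

definition rslash :: "complex \<Rightarrow> (real \<Rightarrow> complex) \<Rightarrow> real \<Rightarrow> real \<Rightarrow> real \<Rightarrow> real \<Rightarrow> real \<Rightarrow> complex" where
  "rslash s h a b c d x = of_real \<bar>c * x + d\<bar> powr (-2 * s) * h ((a * x + b) / (c * x + d))"

fun rmoebius :: "real \<Rightarrow> real \<Rightarrow> real \<Rightarrow> real \<Rightarrow> rp1 \<Rightarrow> rp1" where
  "rmoebius a b c d (Fin x) = (if c * x + d = 0 then Infty else Fin ((a * x + b) / (c * x + d)))"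
| "rmoebius a b c d Infty = (if c = 0 then Infty else Fin (a / c))"

lemma slash_psl:
  assumes "a * d - b * c = 1"
  shows "slash s h (psl a b c d) = rslash s h (of_int a) (of_int b) (of_int c) (of_int d)"
  unfolding psl_def
  by (subst slash.abs_eq)
     (use assms in \<open>auto simp: psl_rel_vector slash_mat_def rslash_def det_2 vector_2 fun_eq_iff Let_def\<close>)

lemma moebius_psl:
  assumes "a * d - b * c = 1"
  shows "moebius (psl a b c d) p = rmoebius (of_int a) (of_int b) (of_int c) (of_int d) p"
  unfolding psl_def
  by (subst moebius.abs_eq, use assms in \<open>auto simp: psl_rel_vector\<close>, cases p) (auto simp: vector_2 Let_def)

lemma abs_powr_mult:
  "complex_of_real \<bar>a\<bar> powr t * of_real \<bar>b\<bar> powr t = of_real \<bar>a * b\<bar> powr t"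
  by (simp add: abs_mult powr_times_real)

text \<open>The factors are multiplicative: if \<open>y\<close> is the image of \<open>x\<close>
  under the second matrix, \<open>(c' * x + d') * (c * y + d)\<close> is the denominator of the
  product matrix.\<close>

lemma rslash_rslash:
  assumes "c' * x + d' \<noteq> 0"
  shows "rslash s (rslash s h a b c d) a' b' c' d' x =
     rslash s h (a*a' + b*c') (a*b' + b*d') (c*a' + d*c') (c*b' + d*d') x"
proof -
  let ?y = "(a' * x + b') / (c' * x + d')"
  have 1: "(c' * x + d') * (c * ?y + d) = (c*a' + d*c') * x + (c*b' + d*d')"
    using assms by (simp add: field_simps)
  have 2: "(c' * x + d') * (a * ?y + b) = (a*a' + b*c') * x + (a*b' + b*d')"
    using assms by (simp add: field_simps)
  have 3: "(a * ?y + b) / (c * ?y + d) = ((a*a' + b*c') * x + (a*b' + b*d')) / ((c*a' + d*c') * x + (c*b' + d*d'))"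
    using assms by (simp flip: 1 2)
  show ?thesis unfolding rslash_def 3
    by (subst mult.assoc[symmetric], subst abs_powr_mult, subst 1, rule refl)
qed

lemma rslash_one: "rslash s h 1 0 0 1 x = h x"
  by (simp add: rslash_def)

text \<open>Only punctured neighbourhoods enter, so removable errors at finitely many points do not
  matter and the notion descends to \<open>cfun\<close>. At infinity it is the condition in
  \<open>analytic_functions\<close>.\<close>

definition regular_fun :: "complex \<Rightarrow> (real \<Rightarrow> complex) \<Rightarrow> rp1 \<Rightarrow> bool" where
  "regular_fun s h p = (case p of
     Fin x \<Rightarrow> \<exists>k. real_analytic_at k x \<and> (\<forall>\<^sub>F y in at x. k y = h y)
   | Infty \<Rightarrow> \<exists>k. real_analytic_at k 0 \<and> (\<forall>\<^sub>F x in at 0. k x = of_real \<bar>x\<bar> powr (-2 * s) * h (-1 / x)))"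

lemma regular_fun_Fin: "regular_fun s h (Fin x) \<longleftrightarrow> (\<exists>k. real_analytic_at k x \<and> (\<forall>\<^sub>F y in at x. k y = h y))"
  by (simp add: regular_fun_def)

lemma regular_fun_Infty: "regular_fun s h Infty \<longleftrightarrow> regular_fun s (rslash s h 0 (-1) 1 0) (Fin 0)"
  by (simp add: regular_fun_def rslash_def)

lemma regular_fun_cong:
  assumes "\<forall>\<^sub>F y in at x. h y = h' y"
  shows "regular_fun s h (Fin x) \<longleftrightarrow> regular_fun s h' (Fin x)"
proof -
  have "(\<forall>\<^sub>F y in at x. k y = h y) \<longleftrightarrow> (\<forall>\<^sub>F y in at x. k y = h' y)" for k
    by (rule eventually_cong[OF assms]) simp
  then show ?thesis by (simp add: regular_fun_Fin)
qed

lemma regular_fun_analytic: "real_analytic_at h x \<Longrightarrow> regular_fun s h (Fin x)"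
  unfolding regular_fun_Fin by (intro exI[of _ h]) simp

text \<open>Regularity lives on punctured neighbourhoods, so besides continuity the injectivity of
  the Moebius map is needed.\<close>

lemma filterlim_moebius_at:
  fixes a b c d x :: real
  assumes det: "a * d - b * c = 1" and q: "c * x + d \<noteq> 0"
  shows "filterlim (\<lambda>y. (a * y + b) / (c * y + d)) (at ((a * x + b) / (c * x + d))) (at x)"
proof -
  have t: "((\<lambda>y. (a * y + b) / (c * y + d)) \<longlongrightarrow> (a * x + b) / (c * x + d)) (at x)"
    using q by (auto intro!: tendsto_intros)
  have "\<forall>\<^sub>F y in at x. c * y + d \<noteq> 0"
    by (rule tendsto_imp_eventually_ne[of _ "c * x + d"]) (use q in \<open>auto intro!: tendsto_intros\<close>)
  then have "\<forall>\<^sub>F y in at x. (a * y + b) / (c * y + d) \<noteq> (a * x + b) / (c * x + d)"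
    using eventually_neq_at_within[of x x UNIV]
  proof eventually_elim
    case (elim y)
    show ?case
    proof
      assume "(a * y + b) / (c * y + d) = (a * x + b) / (c * x + d)"
      with elim q have "(a * y + b) * (c * x + d) = (a * x + b) * (c * y + d)" by (simp add: frac_eq_eq)
      then have "(a * d - b * c) * y = (a * d - b * c) * x" by algebra
      with det elim show False by simp
    qed
  qed
  with t show ?thesis by (simp add: filterlim_at)
qed

lemma regular_fun_rslash_finite:
  assumes det: "a * d - b * c = 1" and q: "c * x + d \<noteq> 0"
    and "regular_fun s h (Fin ((a * x + b) / (c * x + d)))"
  shows "regular_fun s (rslash s h a b c d) (Fin x)"
proof -
  obtain k where k: "real_analytic_at k ((a * x + b) / (c * x + d))"
    "\<forall>\<^sub>F y in at ((a * x + b) / (c * x + d)). k y = h y"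
    using assms(3) by (auto simp: regular_fun_Fin)
  have "\<forall>\<^sub>F y in at x. k ((a * y + b) / (c * y + d)) = h ((a * y + b) / (c * y + d))"
    by (rule eventually_compose_filterlim[OF k(2) filterlim_moebius_at[OF det q]])
  then have "\<forall>\<^sub>F y in at x. rslash s k a b c d y = rslash s h a b c d y"
    by eventually_elim (simp add: rslash_def)
  moreover have "real_analytic_at (rslash s k a b c d) x"
    unfolding rslash_def
    by (intro real_analytic_at_mult real_analytic_at_abs_powr real_analytic_at_moebius k(1) q)
  ultimately show ?thesis unfolding regular_fun_Fin by blast
qed

lemma eventually_nonzero_linear:
  fixes a b x :: real
  assumes "a \<noteq> 0 \<or> b \<noteq> 0"
  shows "\<forall>\<^sub>F y in at x. a * y + b \<noteq> 0"
proof (cases "a * x + b = 0")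
  case True
  with assms have "a \<noteq> 0" by auto
  have "\<forall>\<^sub>F y in at x. y \<noteq> x" by (rule eventually_neq_at_within)
  then show ?thesis
  proof eventually_elim
    case (elim y)
    have "a * y + b = a * (y - x)" using True by (simp add: algebra_simps)
    then show ?case using elim \<open>a \<noteq> 0\<close> by simp
  qed
next
  case False
  then show ?thesis by (intro tendsto_imp_eventually_ne[of _ "a * x + b"]) (auto intro!: tendsto_intros)
qed

lemma regular_fun_rslash:
  assumes det: "a * d - b * c = 1" and p: "regular_fun s h (rmoebius a b c d p)"
  shows "regular_fun s (rslash s h a b c d) p"
proof -
  have fin: "regular_fun s (rslash s h a b c d) (Fin x)"
    if det: "a * d - b * c = 1" and p: "regular_fun s h (rmoebius a b c d (Fin x))" for a b c d x
  proof (cases "c * x + d = 0")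
    case False
    then show ?thesis using regular_fun_rslash_finite[OF det, of x s h] p by simp
  next
    case True
    have ne: "a * x + b \<noteq> 0"
    proof
      assume "a * x + b = 0"
      with True have "a * (c * x + d) - c * (a * x + b) = 0" by simp
      with det show False by (simp add: algebra_simps)
    qed
    have S: "regular_fun s (rslash s h 0 (-1) 1 0) (Fin 0)"
      using p True by (simp add: regular_fun_Infty)
    \<comment> \<open>A pole is reduced to the finite case by factoring the matrix as S times (c, d;
      -a, -b), whose denominator does not vanish at \<open>x\<close>.\<close>
    have "regular_fun s (rslash s (rslash s h 0 (-1) 1 0) c d (-a) (-b)) (Fin x)"
    proof (rule regular_fun_rslash_finite)
      have eq: "(c * x + d) / (- a * x + - b) = 0" using True by simp
      show "regular_fun s (rslash s h 0 (-1) 1 0) (Fin ((c * x + d) / (- a * x + - b)))"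
        unfolding eq by (rule S)
    qed (use det ne in \<open>auto simp: algebra_simps\<close>)
    moreover have "\<forall>\<^sub>F y in at x. rslash s (rslash s h 0 (-1) 1 0) c d (-a) (-b) y = rslash s h a b c d y"
    proof (rule eventually_mono[OF eventually_nonzero_linear[of "-a" "-b" x]])
      show "- a \<noteq> 0 \<or> - b \<noteq> 0" using ne by auto
      fix y assume "- a * y + - b \<noteq> 0"
      then show "rslash s (rslash s h 0 (-1) 1 0) c d (-a) (-b) y = rslash s h a b c d y"
        by (subst rslash_rslash) auto
    qed
    ultimately show ?thesis using regular_fun_cong by blast
  qed
  show ?thesis
  proof (cases p)
    case (Fin x)
    with fin[OF det] p show ?thesis by simp
  next
    case Infty
    \<comment> \<open>Infinity is S(0), and the matrix times S is (b, -a; d, -c); so the finite case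
      is applied at 0.\<close>
    have "regular_fun s (rslash s h b (-a) d (-c)) (Fin 0)"
      by (rule fin) (use det p Infty in \<open>auto split: if_splits\<close>)
    moreover have "\<forall>\<^sub>F y in at 0. rslash s (rslash s h a b c d) 0 (-1) 1 0 y = rslash s h b (-a) d (-c) y"
      using eventually_neq_at_within[of 0 0 UNIV]
      by eventually_elim (subst rslash_rslash; simp)
    ultimately show ?thesis
      unfolding Infty regular_fun_Infty using regular_fun_cong by blast
  qed
qed

lemma regular_fun_binop:
  assumes "regular_fun s f p" "regular_fun s g p"
    and op: "\<And>f g x. real_analytic_at f x \<Longrightarrow> real_analytic_at g x \<Longrightarrow> real_analytic_at (\<lambda>y. op (f y) (g y)) x"
    and lin: "\<And>c a b. c * op a b = op (c * a) (c * b)"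
  shows "regular_fun s (\<lambda>x. op (f x) (g x)) p"
proof -
  have fin: "regular_fun s (\<lambda>x. op (f x) (g x)) (Fin x)"
    if f: "regular_fun s f (Fin x)" and g: "regular_fun s g (Fin x)" for f g x
  proof -
    obtain k where k: "real_analytic_at k x" "\<forall>\<^sub>F y in at x. k y = f y"
      using f by (auto simp: regular_fun_Fin)
    obtain l where l: "real_analytic_at l x" "\<forall>\<^sub>F y in at x. l y = g y"
      using g by (auto simp: regular_fun_Fin)
    have "\<forall>\<^sub>F y in at x. op (k y) (l y) = op (f y) (g y)"
      using k(2) l(2) by eventually_elim simp
    with op[OF k(1) l(1)] show ?thesis unfolding regular_fun_Fin by blast
  qed
  show ?thesis
  proof (cases p)
    case Infty
    have "rslash s (\<lambda>x. op (f x) (g x)) 0 (-1) 1 0 = (\<lambda>x. op (rslash s f 0 (-1) 1 0 x) (rslash s g 0 (-1) 1 0 x))"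
      by (simp add: rslash_def lin fun_eq_iff)
    then show ?thesis using assms(1,2) fin by (simp add: Infty regular_fun_Infty)
  qed (use assms(1,2) fin in simp)
qed

lemma regular_fun_add: "regular_fun s f p \<Longrightarrow> regular_fun s g p \<Longrightarrow> regular_fun s (\<lambda>x. f x + g x) p"
  by (rule regular_fun_binop) (auto intro: real_analytic_at_add simp: algebra_simps)

lemma regular_fun_diff: "regular_fun s f p \<Longrightarrow> regular_fun s g p \<Longrightarrow> regular_fun s (\<lambda>x. f x - g x) p"
  by (rule regular_fun_binop) (auto intro: real_analytic_at_diff simp: algebra_simps)

lemma regular_fun_zero: "regular_fun s (\<lambda>x. 0) p"
  unfolding regular_fun_def by (cases p) (auto intro!: exI[of _ "\<lambda>_. 0"] real_analytic_at_const)

lemma eventually_at_not_in_finite: "finite X \<Longrightarrow> \<forall>\<^sub>F y in at x. y \<notin> X" for x :: real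
proof (induction X rule: finite_induct)
  case (insert z X)
  have "\<forall>\<^sub>F y in at x. y \<noteq> z" by (rule eventually_neq_at_within)
  with insert(3) show ?case by eventually_elim simp
qed simp

lemma eq_cofinite_eventually: "eq_cofinite f g \<Longrightarrow> \<forall>\<^sub>F y in at x. f y = g y"
  unfolding eq_cofinite_def by (drule eventually_at_not_in_finite[where x = x]) simp

lemma eq_cofinite_sym: "eq_cofinite f g \<Longrightarrow> eq_cofinite g f"
  by (simp add: eq_cofinite_def eq_commute)

lemma eq_cofiniteI: "finite X \<Longrightarrow> (\<And>x. x \<notin> X \<Longrightarrow> f x = g x) \<Longrightarrow> eq_cofinite f g"
  unfolding eq_cofinite_def by (erule rev_finite_subset) auto

lemma regular_fun_cofinite:
  assumes "eq_cofinite f g" shows "regular_fun s f p \<longleftrightarrow> regular_fun s g p"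
proof (cases p)
  case (Fin x)
  show ?thesis unfolding Fin by (rule regular_fun_cong) (rule eq_cofinite_eventually[OF assms])
next
  case Infty
  have "eq_cofinite (slash s f gS) (slash s g gS)" by (rule eq_cofinite_slash[OF assms])
  then have "eq_cofinite (rslash s f 0 (-1) 1 0) (rslash s g 0 (-1) 1 0)"
    by (simp add: gS_psl slash_psl)
  then show ?thesis unfolding Infty regular_fun_Infty
    by (intro regular_fun_cong eq_cofinite_eventually)
qed

section \<open>The slash action on classes modulo finite sets\<close>

lift_definition regular :: "complex \<Rightarrow> cfun \<Rightarrow> rp1 \<Rightarrow> bool" is regular_fun
  by (simp add: fun_eq_iff regular_fun_cofinite)

lemma class_of_eq_iff: "class_of f = class_of g \<longleftrightarrow> eq_cofinite f g"
  by (rule cfun.abs_eq_iff)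

lemma class_of_cases: obtains h where "f = class_of h"
  using that[of "rep_cfun f"] Quotient_abs_rep[OF Quotient_cfun, of f] by simp

lemma regular_class_of [simp]: "regular s (class_of h) p = regular_fun s h p"
  by (simp add: regular.abs_eq)

lemma class_of_arith:
  "class_of f + class_of g = class_of (\<lambda>x. f x + g x)"
  "class_of f - class_of g = class_of (\<lambda>x. f x - g x)"
  "- class_of f = class_of (\<lambda>x. - f x)"
  "cslash s (class_of f) \<gamma> = class_of (slash s f \<gamma>)"
  "0 = class_of (\<lambda>x. 0)"
  by (simp_all add: plus_cfun.abs_eq minus_cfun.abs_eq uminus_cfun.abs_eq cslash.abs_eq zero_cfun_def)

lemma regular_zero: "regular s 0 p" by (simp add: class_of_arith regular_fun_zero)

lemma regular_add: "regular s f p \<Longrightarrow> regular s g p \<Longrightarrow> regular s (f + g) p"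
  by (cases f rule: class_of_cases, cases g rule: class_of_cases) (simp add: class_of_arith regular_fun_add)

lemma regular_diff: "regular s f p \<Longrightarrow> regular s g p \<Longrightarrow> regular s (f - g) p"
  by (cases f rule: class_of_cases, cases g rule: class_of_cases) (simp add: class_of_arith regular_fun_diff)

lemma regular_uminus: "regular s f p \<Longrightarrow> regular s (- f) p"
  using regular_diff[OF regular_zero] by fastforce

lemma slash_linear:
  "slash s (\<lambda>x. f x + g x) \<gamma> = (\<lambda>x. slash s f \<gamma> x + slash s g \<gamma> x)"
  "slash s (\<lambda>x. f x - g x) \<gamma> = (\<lambda>x. slash s f \<gamma> x - slash s g \<gamma> x)"
  "slash s (\<lambda>x. - f x) \<gamma> = (\<lambda>x. - slash s f \<gamma> x)"
  by (cases \<gamma> rule: psl_cases; simp add: slash_psl rslash_def fun_eq_iff algebra_simps)+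

lemma cslash_linear:
  "cslash s (f + g) \<gamma> = cslash s f \<gamma> + cslash s g \<gamma>"
  "cslash s (f - g) \<gamma> = cslash s f \<gamma> - cslash s g \<gamma>"
  "cslash s (- f) \<gamma> = - cslash s f \<gamma>"
  "cslash s 0 \<gamma> = 0"
proof -
  show "cslash s (f - g) \<gamma> = cslash s f \<gamma> - cslash s g \<gamma>" for f g
    by (cases f rule: class_of_cases, cases g rule: class_of_cases) (simp add: class_of_arith slash_linear)
  from this[of 0 0] show "cslash s 0 \<gamma> = 0" by simp
qed (cases f rule: class_of_cases, cases g rule: class_of_cases; simp add: class_of_arith slash_linear)+

lemma slash_pole_finite: 
  fixes c d :: int
  assumes "c \<noteq> 0 \<or> d \<noteq> 0" shows "finite {x::real. of_int c * x + of_int d = 0}"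
proof (cases "c = 0")
  case False
  then have "{x::real. of_int c * x + of_int d = 0} \<subseteq> {- of_int d / of_int c}" by (auto simp: field_simps eq_neg_iff_add_eq_0)
  then show ?thesis by (rule finite_subset) simp
qed (use assms in auto)

lemma slash_slash:
  assumes "a * d - b * c = 1" "of_int c * x + of_int d \<noteq> (0::real)"
  shows "slash s (slash s h \<gamma>) (psl a b c d) x = slash s h (\<gamma> * psl a b c d) x"
proof (cases \<gamma> rule: psl_cases)
  case (1 a' b' c' d')
  have "(a'*a + b'*c) * (c'*b + d'*d) - (a'*b + b'*d) * (c'*a + d'*c) = (a' * d' - b' * c') * (a * d - b * c)"
    by algebra
  then show ?thesis using 1 assms by (simp add: psl_mult slash_psl rslash_rslash)
qed

text \<open>For functions the composition law may fail at the pole of the second matrix. Classes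
  ignore this point, so on them the slash operation is a genuine right action.\<close>

lemma cslash_cslash: "cslash s (cslash s f A) B = cslash s f (A * B)"
proof (cases f rule: class_of_cases)
  case (1 h)
  obtain a b c d where B: "a * d - b * c = 1" "B = psl a b c d" by (rule psl_cases)
  have "eq_cofinite (slash s (slash s h A) B) (slash s h (A * B))"
    by (rule eq_cofiniteI[OF slash_pole_finite[of c d]]) (use B in \<open>auto simp: slash_slash\<close>)
  then show ?thesis by (simp add: 1 class_of_arith class_of_eq_iff)
qed

lemma cslash_one: "cslash s f 1 = f"
proof (cases f rule: class_of_cases)
  case (1 h)
  have "slash s h 1 = h" unfolding one_psl by (rule ext) (simp add: slash_psl rslash_one)
  then show ?thesis by (simp add: 1 class_of_arith(4))
qed

lemma psl_right_inverse: "A * inverse A = (1::psl2z)"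
  by (metis mult.assoc mult_1_left mult_1_right psl2z_left_inverse)

lemma rmoebius_rmoebius:
  assumes A: "a * d - b * c = 1" and B: "a' * d' - b' * c' = 1"
  shows "rmoebius a b c d (rmoebius a' b' c' d' p) =
    rmoebius (a*a' + b*c') (a*b' + b*d') (c*a' + d*c') (c*b' + d*d') p"
proof (cases p)
  case (Fin x)
  have q: "(c*a' + d*c') * x + (c*b' + d*d') = c * (a' * x + b') + d * (c' * x + d')"
    by (simp add: algebra_simps)
  have p: "(a*a' + b*c') * x + (a*b' + b*d') = a * (a' * x + b') + b * (c' * x + d')"
    by (simp add: algebra_simps)
  show ?thesis
  proof (cases "c' * x + d' = 0")
    case True
    have "a' * x + b' \<noteq> 0"
    proof
      assume "a' * x + b' = 0"
      with True have "a' * (c' * x + d') - c' * (a' * x + b') = 0" by simp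
      then show False using B by (simp add: algebra_simps)
    qed
    with True show ?thesis by (simp only: Fin rmoebius.simps p q) auto
  next
    case False
    have e1: "c * (a' * x + b') + d * (c' * x + d') = (c' * x + d') * (c * ((a' * x + b') / (c' * x + d')) + d)"
      using False by (simp add: field_simps)
    have e2: "a * (a' * x + b') + b * (c' * x + d') = (c' * x + d') * (a * ((a' * x + b') / (c' * x + d')) + b)"
      using False by (simp add: field_simps)
    show ?thesis using False by (simp only: Fin rmoebius.simps p q e1 e2) auto
  qed
next
  case Infty
  show ?thesis
  proof (cases "c' = 0")
    case True
    then have "a' \<noteq> 0" using B by auto
    with True show ?thesis by (simp add: Infty)
  next
    case False
    have e1: "c * a' + d * c' = c' * (c * (a' / c') + d)" using False by (simp add: field_simps)
    have e2: "a * a' + b * c' = c' * (a * (a' / c') + b)" using False by (simp add: field_simps)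
    show ?thesis using False by (simp only: Infty rmoebius.simps e1 e2) auto
  qed
qed

lemma moebius_mult: "moebius (A * B) p = moebius A (moebius B p)"
proof -
  obtain a b c d where A: "a * d - b * c = 1" "A = psl a b c d" by (rule psl_cases)
  obtain a' b' c' d' where B: "a' * d' - b' * c' = 1" "B = psl a' b' c' d'" by (rule psl_cases)
  have "(a*a' + b*c') * (c*b' + d*d') - (a*b' + b*d') * (c*a' + d*c') = (a * d - b * c) * (a' * d' - b' * c')"
    by algebra
  then have AB: "(a*a' + b*c') * (c*b' + d*d') - (a*b' + b*d') * (c*a' + d*c') = 1" using A B by simp
  have rA: "real_of_int a * of_int d - of_int b * of_int c = 1"
    using A(1) by (metis of_int_1 of_int_diff of_int_mult)
  have rB: "real_of_int a' * of_int d' - of_int b' * of_int c' = 1"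
    using B(1) by (metis of_int_1 of_int_diff of_int_mult)
  show ?thesis
    by (simp only: A B psl_mult moebius_psl AB rmoebius_rmoebius[OF rA rB] of_int_add of_int_mult)
qed

lemma moebius_one: "moebius 1 p = p"
  unfolding one_psl by (cases p) (simp_all add: moebius_psl)

text \<open>One direction is \<open>regular_fun_rslash\<close>; the other is the same statement for
  the inverse element.\<close>

lemma regular_cslash: "regular s (cslash s f \<gamma>) p \<longleftrightarrow> regular s f (moebius \<gamma> p)"
proof -
  have *: "regular s (cslash s f \<gamma>) p" if "regular s f (moebius \<gamma> p)" for f \<gamma> p
  proof (cases f rule: class_of_cases)
    case (1 h)
    obtain a b c d where g: "a * d - b * c = 1" "\<gamma> = psl a b c d" by (rule psl_cases)
    have "real_of_int a * of_int d - of_int b * of_int c = 1" using g(1) by (metis of_int_1 of_int_diff of_int_mult)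
    from regular_fun_rslash[OF this] that show ?thesis
      by (simp add: 1 g class_of_arith slash_psl moebius_psl)
  qed
  show ?thesis
  proof
    assume "regular s (cslash s f \<gamma>) p"
    then have "regular s (cslash s f \<gamma>) (moebius (inverse \<gamma>) (moebius \<gamma> p))"
      by (simp add: moebius_mult[symmetric] psl2z_left_inverse moebius_one)
    from *[OF this] show "regular s f (moebius \<gamma> p)" by (simp add: cslash_cslash psl_right_inverse cslash_one)
  qed (rule *)
qed

section \<open>Cocycles and words in the generators\<close>

lemma inj_on_moebius:
  fixes a b c d :: real
  assumes "a * d - b * c = 1"
  shows "inj_on (\<lambda>x. (a * x + b) / (c * x + d)) {x. c * x + d \<noteq> 0}"
proof (rule inj_onI, unfold mem_Collect_eq)
  fix x y assume nz: "c * x + d \<noteq> 0" "c * y + d \<noteq> 0"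
    and eq: "(a * x + b) / (c * x + d) = (a * y + b) / (c * y + d)"
  from nz eq have "(a * x + b) * (c * y + d) = (a * y + b) * (c * x + d)" by (simp add: frac_eq_eq)
  then have "(a * d - b * c) * x = (a * d - b * c) * y" by algebra
  then show "x = y" by (simp add: assms)
qed

section \<open>The function spaces in terms of pointwise regularity\<close>

text \<open>Infinity can always be added to the finite exceptional set, so only the real
  singularities of a representative count.\<close>

lemma V_fs_iff: "f \<in> V_fs s \<longleftrightarrow> (\<exists>h X. finite X \<and> f = class_of h \<and> (\<forall>x. x \<notin> X \<longrightarrow> real_analytic_at h x))"
proof
  assume "f \<in> V_fs s"
  then obtain E h where E: "finite E" "f = class_of h" "h \<in> analytic_functions s (UNIV - E)"
    unfolding V_fs_def V_omega_on_def by blast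
  have "finite (Fin -` E)" by (rule finite_vimageI[OF E(1)]) (simp add: inj_def)
  with E show "\<exists>h X. finite X \<and> f = class_of h \<and> (\<forall>x. x \<notin> X \<longrightarrow> real_analytic_at h x)"
    by (intro exI[of _ h] exI[of _ "Fin -` E"]) (simp add: analytic_functions_def)
next
  assume "\<exists>h X. finite X \<and> f = class_of h \<and> (\<forall>x. x \<notin> X \<longrightarrow> real_analytic_at h x)"
  then obtain h X where h: "finite X" "f = class_of h" "\<And>x. x \<notin> X \<Longrightarrow> real_analytic_at h x" by blast
  then have "h \<in> analytic_functions s (UNIV - (insert Infty (Fin ` X)))"
    by (auto simp: analytic_functions_def)
  then have "f \<in> V_omega_on s (UNIV - (insert Infty (Fin ` X)))"
    unfolding V_omega_on_def h(2) by (rule imageI)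
  then show "f \<in> V_fs s" unfolding V_fs_def using h(1)
    by (intro UN_I[of "insert Infty (Fin ` X)"]) simp_all
qed

lemma V_omega_on_regular: "f \<in> V_omega_on s I \<Longrightarrow> p \<in> I \<Longrightarrow> regular s f p"
  unfolding V_omega_on_def analytic_functions_def
  by (cases p) (auto intro!: regular_fun_analytic simp: regular_fun_def[of _ _ Infty])

text \<open>Regularity supplies a local representative at each point. A representative that is
  analytic off a finite set is good elsewhere already, so it suffices to correct its values at the
  finitely many bad points by those of the local ones.\<close>

lemma V_omega_onI:
  assumes f: "f \<in> V_fs s" and reg: "\<And>p. p \<in> I \<Longrightarrow> regular s f p"
  shows "f \<in> V_omega_on s I"
proof -
  obtain h X where h: "finite X" "f = class_of h" "\<And>x. x \<notin> X \<Longrightarrow> real_analytic_at h x"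
    using f by (auto simp: V_fs_iff)
  define k where "k x = (SOME k. real_analytic_at k x \<and> (\<forall>\<^sub>F y in at x. k y = h y))" for x
  have k: "real_analytic_at (k x) x" "\<forall>\<^sub>F y in at x. k x y = h y" if "Fin x \<in> I" for x
  proof -
    have "\<exists>k. real_analytic_at k x \<and> (\<forall>\<^sub>F y in at x. k y = h y)"
      using reg[OF that] h(2) by (simp add: regular_fun_Fin)
    then have "real_analytic_at (k x) x \<and> (\<forall>\<^sub>F y in at x. k x y = h y)"
      unfolding k_def by (rule someI_ex)
    then show "real_analytic_at (k x) x" "\<forall>\<^sub>F y in at x. k x y = h y" by auto
  qed
  define h' where "h' x = (if Fin x \<in> I \<and> x \<in> X then k x x else h x)" for x
  have eq: "eq_cofinite h h'" by (rule eq_cofiniteI[OF h(1)]) (simp add: h'_def)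
  then have f': "f = class_of h'" by (simp add: h(2) class_of_eq_iff)
  have ev: "\<forall>\<^sub>F y in at x. h' y = h y" for x
    by (rule eq_cofinite_eventually[OF eq_cofinite_sym[OF eq]])
  have "real_analytic_at h' x" if x: "Fin x \<in> I" for x
  proof (cases "x \<in> X")
    case True
    show ?thesis
    proof (rule real_analytic_at_cong[OF k(1)[OF x]])
      have "\<forall>\<^sub>F y in at x. h' y = k x y" using k(2)[OF x] ev[of x] by eventually_elim simp
      then show "\<forall>\<^sub>F y in nhds x. h' y = k x y"
        unfolding eventually_at_filter
        by (rule eventually_mono) (use True x in \<open>auto simp: h'_def\<close>)
    qed
  next
    case False
    show ?thesis
    proof (rule real_analytic_at_cong[OF h(3)[OF False]])
      show "\<forall>\<^sub>F y in nhds x. h' y = h y" using ev[of x] unfolding eventually_at_filter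
        by (rule eventually_mono) (use False in \<open>auto simp: h'_def\<close>)
    qed
  qed
  moreover have "\<exists>k. real_analytic_at k 0 \<and> (\<forall>\<^sub>F x in at 0. k x = of_real \<bar>x\<bar> powr (-2 * s) * h' (-1 / x))"
    if "Infty \<in> I" using reg[OF that] by (simp add: f' regular_fun_def)
  ultimately show ?thesis unfolding V_omega_on_def f' analytic_functions_def by blast
qed

lemma V_omega_subset_V_fs: "V_omega s \<subseteq> V_fs s"
  using UN_upper[of "{}" "Collect finite" "\<lambda>E. V_omega_on s (UNIV - E)"] by (simp add: V_omega_def V_fs_def)

lemma V_omega_iff: "f \<in> V_omega s \<longleftrightarrow> f \<in> V_fs s \<and> (\<forall>p. regular s f p)"
  using V_omega_subset_V_fs[of s] V_omega_on_regular[of f s UNIV] V_omega_onI[of f s UNIV]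
  by (auto simp: V_omega_def)

text \<open>By \<open>V_omega_onI\<close> a regular point can be removed from any finite exceptional
  set, while a nonregular point belongs to all of them.\<close>

lemma singularities_iff: "f \<in> V_fs s \<Longrightarrow> p \<in> singularities s f \<longleftrightarrow> \<not> regular s f p"
proof -
  assume f: "f \<in> V_fs s"
  obtain E0 where E0: "finite E0" "f \<in> V_omega_on s (UNIV - E0)" using f by (auto simp: V_fs_def)
  show ?thesis
  proof
    assume p: "p \<in> singularities s f"
    show "\<not> regular s f p"
    proof
      assume r: "regular s f p"
      have "f \<in> V_omega_on s (UNIV - (E0 - {p}))"
        by (rule V_omega_onI[OF f]) (use r V_omega_on_regular[OF E0(2)] in auto)
      with p E0(1) show False by (auto simp: singularities_def)
    qed
  next
    assume "\<not> regular s f p"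
    then show "p \<in> singularities s f"
      unfolding singularities_def by (auto dest: V_omega_on_regular[of f s _ p])
  qed
qed

lemma finite_nonregular: "f \<in> V_fs s \<Longrightarrow> finite {p. \<not> regular s f p}"
proof -
  assume "f \<in> V_fs s"
  then obtain E0 where "finite E0" "f \<in> V_omega_on s (UNIV - E0)" by (auto simp: V_fs_def)
  then show ?thesis by (elim rev_finite_subset) (auto dest: V_omega_on_regular)
qed

lemma V_fs_add: "f \<in> V_fs s \<Longrightarrow> g \<in> V_fs s \<Longrightarrow> f + g \<in> V_fs s"
  unfolding V_fs_iff
proof (elim exE conjE)
  fix h X h' X'
  assume "finite X" "f = class_of h" "\<forall>x. x \<notin> X \<longrightarrow> real_analytic_at h x"
    and "finite X'" "g = class_of h'" "\<forall>x. x \<notin> X' \<longrightarrow> real_analytic_at h' x"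
  then show "\<exists>h X. finite X \<and> f + g = class_of h \<and> (\<forall>x. x \<notin> X \<longrightarrow> real_analytic_at h x)"
    by (intro exI[of _ "\<lambda>x. h x + h' x"] exI[of _ "X \<union> X'"])
       (auto simp: class_of_arith intro!: real_analytic_at_add)
qed

lemma V_fs_uminus: "f \<in> V_fs s \<Longrightarrow> - f \<in> V_fs s"
  unfolding V_fs_iff
proof (elim exE conjE)
  fix h X
  assume "finite X" "f = class_of h" "\<forall>x. x \<notin> X \<longrightarrow> real_analytic_at h x"
  then show "\<exists>h X. finite X \<and> - f = class_of h \<and> (\<forall>x. x \<notin> X \<longrightarrow> real_analytic_at h x)"
    by (intro exI[of _ "\<lambda>x. - h x"] exI[of _ "X"])
       (auto simp: class_of_arith intro!: real_analytic_at_minus)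
qed

lemma V_fs_diff: "f \<in> V_fs s \<Longrightarrow> g \<in> V_fs s \<Longrightarrow> f - g \<in> V_fs s"
  using V_fs_add[of f s "- g"] V_fs_uminus[of g s] by simp

lemma V_fs_zero: "0 \<in> V_fs s"
  unfolding V_fs_iff class_of_arith(5) using real_analytic_at_const by blast

lemma V_fs_cslash: assumes "f \<in> V_fs s" shows "cslash s f \<gamma> \<in> V_fs s"
proof -
  obtain h X where h: "finite X" "f = class_of h" "\<And>x. x \<notin> X \<Longrightarrow> real_analytic_at h x"
    using assms by (auto simp: V_fs_iff)
  obtain a b c d where g: "a * d - b * c = 1" "\<gamma> = psl a b c d" by (rule psl_cases)
  have rdet: "real_of_int a * of_int d - of_int b * of_int c = 1" using g(1) by (metis of_int_1 of_int_diff of_int_mult)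
  let ?Y = "{x::real. c * x + d = 0} \<union> {x::real. c * x + d \<noteq> 0 \<and> (a * x + b) / (c * x + d) \<in> X}"
  have "finite {x::real. c * x + d \<noteq> 0 \<and> (a * x + b) / (c * x + d) \<in> X}"
  proof -
    have "finite ((\<lambda>x::real. (a * x + b) / (c * x + d)) -` X \<inter> {x::real. c * x + d \<noteq> 0})"
      by (rule finite_vimage_IntI[OF h(1) inj_on_moebius[OF rdet]])
    then show ?thesis by (rule rev_finite_subset) auto
  qed
  moreover have "finite {x::real. c * x + d = 0}" by (rule slash_pole_finite) (use g in auto)
  moreover have "real_analytic_at (slash s h \<gamma>) x" if "x \<notin> ?Y" for x
    unfolding g(2) slash_psl[OF g(1)] rslash_def
    by (intro real_analytic_at_mult real_analytic_at_abs_powr real_analytic_at_moebius h) (use that in auto)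
  ultimately show ?thesis unfolding V_fs_iff h(2) class_of_arith
    by (intro exI[of _ "slash s h \<gamma>"] exI[of _ ?Y]) auto
qed


section \<open>The generators S of order 2 and U of order 3\<close>

text \<open>The group is the free product of the cyclic groups generated by S and by this element of
  order 3; the data defining \<open>theta_cocycle\<close> are its values at these two.\<close>

definition gU :: psl2z where "gU = inverse gT * gS"

lemma gU_psl: "gU = psl (-1) (-1) 1 0"
  by (simp add: psl_words gU_def)

lemmas psl_word_simps = psl_words gU_psl

lemma gS_gS: "gS * gS = 1" by (simp add: psl_word_simps)
lemma gU_gU: "gU * gU = gS * gT" by (simp add: psl_word_simps)
lemma gU_gU_gU: "gU * gU * gU = 1" by (simp add: psl_word_simps)
lemma gT_eq: "gT = gS * gU * gU" by (simp add: psl_word_simps)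
lemma gT_inverse_eq: "inverse gT = gU * gS" by (simp add: psl_word_simps)
lemma gT_inverse: "gT * inverse gT = 1" "inverse gT * gT = 1" by (simp_all add: psl_word_simps)

text \<open>Euclid's algorithm on the lower left entry: multiplying by a power of T and by S
  replaces \<open>c\<close> by a remainder modulo \<open>c\<close>, until a power of T is left.
  Powers of T are words in \<open>gS\<close> and \<open>gU\<close>.\<close>

lemma psl_induct:
  assumes 1: "P 1" and S: "\<And>\<gamma>. P \<gamma> \<Longrightarrow> P (\<gamma> * gS)" and U: "\<And>\<gamma>. P \<gamma> \<Longrightarrow> P (\<gamma> * gU)"
  shows "P \<gamma>"
proof -
  have T: "P (\<gamma> * gT)" if "P \<gamma>" for \<gamma>
    using U[OF U[OF S[OF that]]] by (simp add: gT_eq mult.assoc)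
  have T': "P (\<gamma> * inverse gT)" if "P \<gamma>" for \<gamma>
    using S[OF U[OF that]] by (simp add: gT_inverse_eq mult.assoc)
  have Tn: "P (\<gamma> * psl 1 n 0 1)" if \<gamma>: "P \<gamma>" for \<gamma> n
  proof (induction n rule: int_induct[where k = 0])
    case base then show ?case using \<gamma> by (simp flip: one_psl)
  next
    case (step1 i)
    have "psl 1 (i + 1) 0 1 = psl 1 i 0 1 * gT" by (simp add: psl_word_simps)
    then show ?case using T[OF step1(2)] by (simp add: mult.assoc)
  next
    case (step2 i)
    have "psl 1 (i - 1) 0 1 = psl 1 i 0 1 * inverse gT" by (simp add: psl_word_simps)
    then show ?case using T'[OF step2(2)] by (simp add: mult.assoc)
  qed
  have main: "P (psl a b c d)" if "a * d - b * c = 1" for a b c d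
    using that
  proof (induction "nat \<bar>c\<bar>" arbitrary: a b c d rule: less_induct)
    case less
    note det = less(2)
    show ?case
    proof (cases "c = 0")
      case True
      with det have ad: "a * d = 1" by simp
      then have "a = 1 \<and> d = 1 \<or> a = -1 \<and> d = -1" by (auto simp: zmult_eq_1_iff)
      then have "psl a b c d = psl 1 (a * b) 0 1" using True by (auto simp: psl_eq_iff)
      then show ?thesis using Tn[OF 1, of "a * b"] by simp
    next
      case False
      \<comment> \<open>With this \<open>n\<close> the matrix times T^n S has lower left entry
        \<open>d mod c\<close>, so the induction hypothesis applies to it.\<close>
      define n where "n = - (d div c)"
      have d': "d + n * c = d mod c" unfolding n_def by (simp add: minus_div_mult_eq_mod)
      have det': "(b + n * a) * (-c) - (-a) * (d + n * c) = 1" using det by (simp add: algebra_simps)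
      have "P (psl (b + n * a) (-a) (d + n * c) (-c))"
      proof (rule less(1))
        show "nat \<bar>d + n * c\<bar> < nat \<bar>c\<bar>" unfolding d' using False abs_mod_less[of c d] by simp
      qed (rule det')
      from Tn[OF S[OF this], of "-n"]
      have "P (psl (b + n * a) (-a) (d + n * c) (-c) * gS * psl 1 (-n) 0 1)" .
      also have "psl (b + n * a) (-a) (d + n * c) (-c) * gS = psl (-a) (-b - n * a) (-c) (-d - n * c)"
        unfolding gS_psl by (subst psl_mult) (use det' in \<open>simp_all add: algebra_simps\<close>)
      also have "\<dots> * psl 1 (-n) 0 1 = psl (-a) (-b) (-c) (-d)"
        by (subst psl_mult) (use det' in \<open>simp_all add: algebra_simps\<close>)
      finally show ?thesis using psl_minus[OF det] by simp
    qed
  qed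
  show ?thesis by (cases \<gamma> rule: psl_cases) (simp add: main)
qed

lemma Z1D:
  assumes "\<psi> \<in> Z1 s V"
  shows "\<psi> (\<gamma> * \<delta>) = cslash s (\<psi> \<gamma>) \<delta> + \<psi> \<delta>" "\<psi> \<gamma> \<in> V"
  using assms by (auto simp: Z1_def)

lemma Z1_one: "\<psi> \<in> Z1 s V \<Longrightarrow> \<psi> 1 = 0"
  using Z1D(1)[of \<psi> s V 1 1] by (simp add: cslash_one)

lemma Z1_inverse: "\<psi> \<in> Z1 s V \<Longrightarrow> \<psi> (inverse \<gamma>) = - cslash s (\<psi> \<gamma>) (inverse \<gamma>)"
  using Z1D(1)[of \<psi> s V \<gamma> "inverse \<gamma>"] Z1_one[of \<psi> s V]
  by (simp add: psl_right_inverse add_eq_0_iff)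

lemma Z1_eqI:
  assumes "\<psi> \<in> Z1 s V" "\<psi>' \<in> Z1 s V'" "\<psi> gS = \<psi>' gS" "\<psi> gU = \<psi>' gU"
  shows "\<psi> = \<psi>'"
proof
  show "\<psi> \<gamma> = \<psi>' \<gamma>" for \<gamma>
    by (induction \<gamma> rule: psl_induct)
       (simp_all only: Z1_one[OF assms(1)] Z1_one[OF assms(2)] Z1D(1)[OF assms(1)] Z1D(1)[OF assms(2)] assms(3,4))
qed

section \<open>Cocycles with prescribed values on the generators, via the Farey tessellation\<close>

lift_definition edge_size :: "psl2z \<Rightarrow> nat" is
  "\<lambda>A :: int^2^2. nat (\<bar>A$1$1\<bar> + \<bar>A$1$2\<bar> + \<bar>A$2$1\<bar> + \<bar>A$2$2\<bar>)"
  by (auto simp: psl_rel_def)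

text \<open>Read \<open>\<gamma>\<close> as the oriented edge from \<open>\<gamma> 0\<close> to \<open>\<gamma> \<infinity>\<close> of the Farey tessellation: \<open>\<gamma> * gS\<close> is the
  reversed edge, and \<open>\<gamma> * gU\<close>, \<open>\<gamma> * gU * gU\<close> are the other edges of one of the two triangles at the edge.
  The edge is the shortest one of that triangle iff \<open>shortest_edge \<gamma>\<close>.\<close>

lift_definition shortest_edge :: "psl2z \<Rightarrow> bool" is "\<lambda>A :: int^2^2. A$1$1 * A$1$2 \<le> 0 \<and> A$2$1 * A$2$2 \<le> 0"
  by (auto simp: psl_rel_def)

lemma edge_size_psl: "a * d - b * c = 1 \<Longrightarrow> edge_size (psl a b c d) = nat (\<bar>a\<bar> + \<bar>b\<bar> + \<bar>c\<bar> + \<bar>d\<bar>)"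
  unfolding psl_def by (subst edge_size.abs_eq) (auto simp: psl_rel_vector vector_2)

lemma shortest_edge_psl: "a * d - b * c = 1 \<Longrightarrow> shortest_edge (psl a b c d) \<longleftrightarrow> a * b \<le> 0 \<and> c * d \<le> 0"
  unfolding psl_def by (subst shortest_edge.abs_eq) (auto simp: psl_rel_vector vector_2)

lemma psl_mult_gS: "a * d - b * c = 1 \<Longrightarrow> psl a b c d * gS = psl b (-a) d (-c)"
  unfolding gS_psl by (subst psl_mult) simp_all

lemma psl_mult_gU: "a * d - b * c = 1 \<Longrightarrow> psl a b c d * gU = psl (b - a) (-a) (d - c) (-c)"
  unfolding gU_psl by (subst psl_mult) simp_all

lemma psl_mult_gU_gU: "a * d - b * c = 1 \<Longrightarrow> psl a b c d * gU * gU = psl (-b) (a - b) (-d) (c - d)"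
  by (subst psl_mult_gU, assumption, subst psl_mult_gU) (simp_all add: algebra_simps)

text \<open>By the determinant condition the product equals \<open>k * (k + 1)\<close> with
  \<open>k = b * c\<close>, and consecutive integers never have opposite signs. Hence
  \<open>a * b\<close> and \<open>c * d\<close> are both nonnegative as soon as one of them is
  positive.\<close>

lemma int_det_sign:
  assumes "a * d - b * c = (1::int)" shows "0 \<le> (a * b) * (c * d)"
proof -
  have "(a * b) * (c * d) = (b * c) * (b * c + 1)" using assms by algebra
  moreover have "0 \<le> k * (k + 1)" for k :: int by (cases "k \<ge> 0") (auto simp: zero_le_mult_iff)
  ultimately show ?thesis by metis
qed

text \<open>Reversing an edge exchanges the two triangles at it. An edge is the shortest one in
  exactly one of them, except for the edge between 0 and infinity, which is so in both and is the
  root of the recursion.\<close>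

lemma shortest_edge_gS:
  shows "\<not> shortest_edge \<gamma> \<Longrightarrow> shortest_edge (\<gamma> * gS)"
    and "shortest_edge \<gamma> \<Longrightarrow> \<gamma> \<noteq> 1 \<Longrightarrow> \<gamma> \<noteq> gS \<Longrightarrow> \<not> shortest_edge (\<gamma> * gS)"
    and "edge_size (\<gamma> * gS) = edge_size \<gamma>"
proof -
  obtain a b c d where g: "a * d - b * c = 1" "\<gamma> = psl a b c d" by (rule psl_cases)
  have g': "b * (-c) - (-a) * d = 1" using g(1) by (simp add: algebra_simps)
  note * = g(2) psl_mult_gS[OF g(1)] shortest_edge_psl[OF g(1)] shortest_edge_psl[OF g']
    edge_size_psl[OF g(1)] edge_size_psl[OF g']
  show "edge_size (\<gamma> * gS) = edge_size \<gamma>" by (simp add: * add_ac)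
  show "shortest_edge (\<gamma> * gS)" if "\<not> shortest_edge \<gamma>"
  proof -
    have "a * b > 0 \<or> c * d > 0" using that by (simp add: *) linarith
    then have "0 \<le> a * b \<and> 0 \<le> c * d" using int_det_sign[OF g(1)]
      by (metis le_less linorder_not_less mult_less_0_iff)
    then show ?thesis by (simp add: * mult.commute)
  qed
  show "\<not> shortest_edge (\<gamma> * gS)" if "shortest_edge \<gamma>" "\<gamma> \<noteq> 1" "\<gamma> \<noteq> gS"
  proof
    assume "shortest_edge (\<gamma> * gS)"
    with that(1) have z: "a * b = 0" "c * d = 0" by (auto simp: * mult.commute)
    show False
    proof (cases "a = 0")
      case True
      then have bc: "b * c = -1" using g(1) by simp
      then have "d = 0" using z by auto
      moreover have "b = 1 \<and> c = -1 \<or> b = -1 \<and> c = 1"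
        using bc zmult_eq_1_iff[of b "-c"] by auto
      ultimately have "\<gamma> = gS" using True by (auto simp: g(2) gS_psl psl_eq_iff)
      with that show False by simp
    next
      case False
      then have b: "b = 0" using z by simp
      then have ad: "a * d = 1" using g(1) by simp
      then have "c = 0" using z by auto
      moreover have "a = 1 \<and> d = 1 \<or> a = -1 \<and> d = -1" using ad by (auto simp: zmult_eq_1_iff)
      ultimately have "\<gamma> = 1" using b by (auto simp: g(2) one_psl psl_eq_iff)
      with that show False by simp
    qed
  qed
qed

lemma abs_diff_same_sign: "x * x \<le> x * y \<Longrightarrow> \<bar>y - x\<bar> + \<bar>x\<bar> = \<bar>y\<bar>" for x y :: int
proof -
  assume "x * x \<le> x * y"
  then have "0 \<le> x * (y - x)" by (simp add: algebra_simps)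
  then show ?thesis by (auto simp: zero_le_mult_iff)
qed

text \<open>The columns of the matrix are two vertices of the triangle, their difference is the
  third. If \<open>a * b\<close> and \<open>c * d\<close> are nonnegative, one column dominates the
  other entrywise in absolute value, and the dominated column together with the difference forms the
  shortest edge.\<close>

lemma shortest_edge_gU:
  shows "shortest_edge \<gamma> \<Longrightarrow> \<not> shortest_edge (\<gamma> * gU) \<and> \<not> shortest_edge (\<gamma> * gU * gU)"
    and "\<not> shortest_edge \<gamma> \<Longrightarrow>
      shortest_edge (\<gamma> * gU) \<and> edge_size (\<gamma> * gU) < edge_size \<gamma> \<or>
      shortest_edge (\<gamma> * gU * gU) \<and> edge_size (\<gamma> * gU * gU) < edge_size \<gamma>"
proof -
  obtain a b c d where g: "a * d - b * c = 1" "\<gamma> = psl a b c d" by (rule psl_cases)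
  have g1: "(b - a) * (-c) - (-a) * (d - c) = 1" using g(1) by (simp add: algebra_simps)
  have g2: "(-b) * (c - d) - (a - b) * (-d) = 1" using g(1) by (simp add: algebra_simps)
  note * = g(2) psl_mult_gU[OF g(1)] psl_mult_gU_gU[OF g(1)] shortest_edge_psl[OF g(1)]
    shortest_edge_psl[OF g1] shortest_edge_psl[OF g2]
    edge_size_psl[OF g(1)] edge_size_psl[OF g1] edge_size_psl[OF g2]
  have e1: "shortest_edge (\<gamma> * gU) \<longleftrightarrow> a * a \<le> a * b \<and> c * c \<le> c * d"
    by (simp add: * algebra_simps)
  have e2: "shortest_edge (\<gamma> * gU * gU) \<longleftrightarrow> b * b \<le> b * a \<and> d * d \<le> d * c"
    unfolding g(2) psl_mult_gU_gU[OF g(1)] shortest_edge_psl[OF g2] by (simp add: algebra_simps)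
  show "\<not> shortest_edge (\<gamma> * gU) \<and> \<not> shortest_edge (\<gamma> * gU * gU)" if "shortest_edge \<gamma>"
  proof -
    have le: "a * b \<le> 0" "c * d \<le> 0" using that by (auto simp: *)
    have sq: "x * x \<le> 0 \<Longrightarrow> x = 0" for x :: int by (metis mult_le_0_iff order_antisym)
    have "\<not> (a * a \<le> a * b \<and> c * c \<le> c * d)"
    proof
      assume "a * a \<le> a * b \<and> c * c \<le> c * d"
      then have "a = 0" "c = 0" using le sq[of a] sq[of c] by auto
      then show False using g(1) by simp
    qed
    moreover have "\<not> (b * b \<le> b * a \<and> d * d \<le> d * c)"
    proof
      assume "b * b \<le> b * a \<and> d * d \<le> d * c"
      then have "b = 0" "d = 0" using le sq[of b] sq[of d] by (auto simp: mult.commute)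
      then show False using g(1) by simp
    qed
    ultimately show ?thesis by (simp add: e1 e2)
  qed
  assume neg: "\<not> shortest_edge \<gamma>"
  have "0 \<le> a * b \<and> 0 \<le> c * d"
  proof -
    have "a * b > 0 \<or> c * d > 0" using neg by (simp add: *) linarith
    then show ?thesis using int_det_sign[OF g(1)]
      by (metis le_less linorder_not_less mult_less_0_iff)
  qed
  then have ab: "a * b = \<bar>a\<bar> * \<bar>b\<bar>" and cd: "c * d = \<bar>c\<bar> * \<bar>d\<bar>"
    by (simp_all flip: abs_mult)
  have cmp: "\<bar>y\<bar> < \<bar>x\<bar>" if "\<not> x * x \<le> x * y" "x * y = \<bar>x\<bar> * \<bar>y\<bar>" for x y :: int
  proof -
    have "\<bar>x\<bar> * \<bar>y\<bar> < \<bar>x\<bar> * \<bar>x\<bar>" using that by simp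
    moreover have "\<bar>x\<bar> * \<bar>x\<bar> \<le> \<bar>x\<bar> * \<bar>y\<bar>" if "\<bar>x\<bar> \<le> \<bar>y\<bar>"
      using that by (intro mult_left_mono) auto
    ultimately show ?thesis by linarith
  qed
  \<comment> \<open>If one column were larger in one row and smaller in the other, the determinant
    would have absolute value at least 1 + |q| + |r|, hence exceed 1 unless \<open>q\<close> and
    \<open>r\<close> vanish.\<close>
  have big: False if "\<bar>q\<bar> < \<bar>p\<bar>" "\<bar>r\<bar> < \<bar>t\<bar>" "\<bar>p * t - q * r\<bar> = 1" "q \<noteq> 0 \<or> r \<noteq> 0" for p q r t :: int
  proof -
    have "(\<bar>q\<bar> + 1) * (\<bar>r\<bar> + 1) \<le> \<bar>p\<bar> * \<bar>t\<bar>" by (rule mult_mono) (use that in auto)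
    then have "\<bar>q\<bar> * \<bar>r\<bar> + \<bar>q\<bar> + \<bar>r\<bar> + 1 \<le> \<bar>p * t\<bar>" by (simp add: algebra_simps abs_mult)
    moreover have "\<bar>p * t\<bar> \<le> 1 + \<bar>q\<bar> * \<bar>r\<bar>" using that(3) abs_triangle_ineq2[of "p * t" "q * r"] by (simp add: abs_mult)
    ultimately show False using that(4) by linarith
  qed
  have ne: "\<not> (a * b = 0 \<and> c * d = 0)" using neg by (auto simp: *)
  have "(a * a \<le> a * b \<and> c * c \<le> c * d) \<or> (b * b \<le> b * a \<and> d * d \<le> d * c)"
  proof (rule ccontr)
    assume "\<not> ?thesis"
    then have "(\<bar>b\<bar> < \<bar>a\<bar> \<or> \<bar>d\<bar> < \<bar>c\<bar>) \<and> (\<bar>a\<bar> < \<bar>b\<bar> \<or> \<bar>c\<bar> < \<bar>d\<bar>)"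
      using cmp[of a b] cmp[of c d] cmp[of b a] cmp[of d c] ab cd by (auto simp: mult.commute)
    then have "\<bar>b\<bar> < \<bar>a\<bar> \<and> \<bar>c\<bar> < \<bar>d\<bar> \<or> \<bar>d\<bar> < \<bar>c\<bar> \<and> \<bar>a\<bar> < \<bar>b\<bar>" by linarith
    then show False
    proof
      assume "\<bar>b\<bar> < \<bar>a\<bar> \<and> \<bar>c\<bar> < \<bar>d\<bar>"
      then show False using big[of b a c d] g(1) ne by auto
    next
      assume "\<bar>d\<bar> < \<bar>c\<bar> \<and> \<bar>a\<bar> < \<bar>b\<bar>"
      then show False using big[of a b d c] g(1) ne by (auto simp: algebra_simps)
    qed
  qed
  then show "shortest_edge (\<gamma> * gU) \<and> edge_size (\<gamma> * gU) < edge_size \<gamma> \<or>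
      shortest_edge (\<gamma> * gU * gU) \<and> edge_size (\<gamma> * gU * gU) < edge_size \<gamma>"
  proof
    assume 1: "a * a \<le> a * b \<and> c * c \<le> c * d"
    have eq: "\<bar>b - a\<bar> + \<bar>- a\<bar> + \<bar>d - c\<bar> + \<bar>- c\<bar> = \<bar>b\<bar> + \<bar>d\<bar>"
      using abs_diff_same_sign[of a b] abs_diff_same_sign[of c d] 1 by simp
    have "a \<noteq> 0 \<or> c \<noteq> 0" using g(1) by auto
    then have "0 < \<bar>a\<bar> + \<bar>c\<bar>" by (metis abs_ge_zero add_nonneg_pos add_pos_nonneg zero_less_abs_iff)
    then have "edge_size (\<gamma> * gU) < edge_size \<gamma>"
      unfolding g(2) psl_mult_gU[OF g(1)] edge_size_psl[OF g(1)] edge_size_psl[OF g1] eq by (simp add: add_ac)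
    then show ?thesis using 1 e1 by simp
  next
    assume 1: "b * b \<le> b * a \<and> d * d \<le> d * c"
    have eq: "\<bar>- b\<bar> + \<bar>a - b\<bar> + \<bar>- d\<bar> + \<bar>c - d\<bar> = \<bar>a\<bar> + \<bar>c\<bar>"
      using abs_diff_same_sign[of b a] abs_diff_same_sign[of d c] 1 by simp
    have "b \<noteq> 0 \<or> d \<noteq> 0" using g(1) by auto
    then have "0 < \<bar>b\<bar> + \<bar>d\<bar>" by (metis abs_ge_zero add_nonneg_pos add_pos_nonneg zero_less_abs_iff)
    then have "edge_size (\<gamma> * gU * gU) < edge_size \<gamma>"
      unfolding g(2) psl_mult_gU_gU[OF g(1)] edge_size_psl[OF g(1)] edge_size_psl[OF g2] eq by (simp add: add_ac)
    then show ?thesis using 1 e2 by simp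
  qed
qed

lemma shortest_edge_base: "shortest_edge 1" "shortest_edge gS"
  by (simp_all add: one_psl gS_psl shortest_edge_psl)

lemma gS_neq_1: "gS \<noteq> 1" by (simp add: psl_word_simps)

text \<open>The recursion moves from an edge to a shorter one, along the dual tree of the Farey tessellation.
  Hence any values on \<open>gS\<close> and \<open>gU\<close> that respect the relations extend to a cocycle.\<close>

function cocycle_ext :: "complex \<Rightarrow> cfun \<Rightarrow> cfun \<Rightarrow> psl2z \<Rightarrow> cfun" where
  "cocycle_ext s x y \<gamma> =
     (if \<gamma> = 1 then 0
      else if shortest_edge \<gamma> then cslash s (cocycle_ext s x y (\<gamma> * gS)) gS + x
      else if shortest_edge (\<gamma> * gU)
        then cslash s (cocycle_ext s x y (\<gamma> * gU)) (gU * gU) + (cslash s y gU + y)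
      else cslash s (cocycle_ext s x y (\<gamma> * gU * gU)) gU + y)"
  by pat_completeness auto
termination
\<comment> \<open>A step by U shortens the edge, and the factor 2 makes this outweigh both flags. A
  step by S keeps the size and clears the flag \<open>shortest_edge\<close>, except at
  \<open>gS\<close>, where the last flag drops instead.\<close>
proof (relation "Wellfounded.measure (\<lambda>(s, x, y, \<gamma>). 2 * edge_size \<gamma> + of_bool (shortest_edge \<gamma>) + of_bool (\<gamma> \<noteq> 1))",
    goal_cases)
  case (2 s x y \<gamma>)
  show ?case
  proof (cases "\<gamma> = gS")
    case True
    then show ?thesis using shortest_edge_gS(3)[of \<gamma>] shortest_edge_base
      by (simp add: gS_gS gS_neq_1)
  next
    case False
    then show ?thesis using 2 shortest_edge_gS[of \<gamma>] by simp
  qed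
next
  case (3 s x y \<gamma>)
  then have "edge_size (\<gamma> * gU) < edge_size \<gamma>"
    using shortest_edge_gU(2)[of \<gamma>] shortest_edge_gU(1)[of "\<gamma> * gU"] by auto
  then have "of_bool (\<gamma> * gU \<noteq> 1) + 2 * edge_size (\<gamma> * gU) < 2 * edge_size \<gamma>"
    by (cases "\<gamma> * gU = 1") simp_all
  then show ?case using 3 by (simp split del: if_split)
next
  case (4 s x y \<gamma>)
  then have "edge_size (\<gamma> * gU * gU) < edge_size \<gamma>" using shortest_edge_gU(2)[of \<gamma>] by auto
  then have "of_bool (shortest_edge (\<gamma> * gU * gU)) + of_bool (\<gamma> * gU * gU \<noteq> 1)
      + 2 * edge_size (\<gamma> * gU * gU) < 2 * edge_size \<gamma> + 1"
    by (cases "\<gamma> * gU * gU = 1") (simp_all add: of_bool_def)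
  then show ?case using 4 by (simp split del: if_split)
qed simp

declare cocycle_ext.simps [simp del]

text \<open>The hypotheses on \<open>x\<close> and \<open>y\<close> are what \<open>gS_gS\<close>
  and \<open>gU_gU_gU\<close> impose on the values of a cocycle. They suffice because the dual graph
  is a tree: the recursion obeys the cocycle rule for one further factor \<open>gS\<close> or
  \<open>gU\<close>, and induction on words does the rest.\<close>

lemma cocycle_exists:
  assumes V: "x \<in> V_fs s" "y \<in> V_fs s"
    and x: "cslash s x gS + x = 0" and y: "cslash s y (gU * gU) + cslash s y gU + y = 0"
  obtains \<psi> where "\<psi> \<in> Z1 s (V_fs s)" "\<psi> gS = x" "\<psi> gU = y"
proof -
  let ?e = "cocycle_ext s x y"
  have one: "?e 1 = 0" by (subst cocycle_ext.simps) simp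
  have S: "?e (\<gamma> * gS) = cslash s (?e \<gamma>) gS + x" for \<gamma>
  proof (cases "shortest_edge \<gamma>")
    case True
    show ?thesis
    proof (cases "\<gamma> = 1")
      case True
      then show ?thesis using one
        by (subst cocycle_ext.simps) (simp add: gS_neq_1 shortest_edge_base gS_gS)
    next
      case False
      have "?e \<gamma> = cslash s (?e (\<gamma> * gS)) gS + x"
        by (subst cocycle_ext.simps) (simp add: False True)
      then have "cslash s (?e \<gamma>) gS + x = ?e (\<gamma> * gS) + (cslash s x gS + x)"
        by (simp add: cslash_linear cslash_cslash gS_gS cslash_one add.assoc)
      then show ?thesis by (simp add: x)
    qed
  next
    case False
    then have "shortest_edge (\<gamma> * gS)" by (rule shortest_edge_gS)
    moreover have "\<gamma> * gS \<noteq> 1"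
    proof
      assume "\<gamma> * gS = 1"
      then have "\<gamma> * gS * gS = gS" by simp
      then have "\<gamma> = gS" by (simp add: mult.assoc gS_gS)
      with False show False by (simp add: shortest_edge_base)
    qed
    ultimately show ?thesis
      by (subst cocycle_ext.simps) (simp add: mult.assoc gS_gS)
  qed
  have U: "?e (\<gamma> * gU) = cslash s (?e \<gamma>) gU + y" for \<gamma>
  proof -
    have ne: "\<not> shortest_edge \<delta> \<Longrightarrow> \<delta> \<noteq> 1" for \<delta> using shortest_edge_base by auto
    have U3: "\<delta> * gU * gU * gU = \<delta>" for \<delta> using gU_gU_gU by (simp add: mult.assoc)
    \<comment> \<open>The position of the shortest edge in the triangle decides which clause of the
      recursion applies to \<open>\<gamma>\<close> and to \<open>\<gamma> * gU\<close>; only the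
      second case uses the relation for \<open>y\<close>.\<close>
    consider "shortest_edge \<gamma>" | "\<not> shortest_edge \<gamma>" "shortest_edge (\<gamma> * gU)"
      | "\<not> shortest_edge \<gamma>" "\<not> shortest_edge (\<gamma> * gU)" "shortest_edge (\<gamma> * gU * gU)"
      using shortest_edge_gU(2)[of \<gamma>] by blast
    then show ?thesis
    proof cases
      case 1
      then have "\<not> shortest_edge (\<gamma> * gU)" "\<not> shortest_edge (\<gamma> * gU * gU)"
        using shortest_edge_gU(1)[of \<gamma>] by auto
      moreover from this have "\<gamma> * gU \<noteq> 1" by (intro ne)
      ultimately show ?thesis by (subst cocycle_ext.simps) (simp only: if_False U3)
    next
      case 2
      with ne[OF 2(1)] have "?e \<gamma> = cslash s (?e (\<gamma> * gU)) (gU * gU) + (cslash s y gU + y)"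
        by (subst cocycle_ext.simps) (simp only: if_False if_True)
      then have "cslash s (?e \<gamma>) gU + y = ?e (\<gamma> * gU) + (cslash s y (gU * gU) + cslash s y gU + y)"
        by (simp add: cslash_linear cslash_cslash gU_gU_gU cslash_one add.assoc del: mult.assoc)
      then show ?thesis by (simp add: y)
    next
      case 3
      with ne[OF 3(1)] have "?e \<gamma> = cslash s (?e (\<gamma> * gU * gU)) gU + y"
        by (subst cocycle_ext.simps) (simp only: if_False)
      moreover have "?e (\<gamma> * gU) = cslash s (?e (\<gamma> * gU * gU)) (gU * gU) + (cslash s y gU + y)"
        using ne[OF 3(2)] 3 by (subst cocycle_ext.simps) (simp only: if_False if_True)
      ultimately show ?thesis by (simp add: cslash_linear cslash_cslash add.assoc)
    qed
  qed
  have "?e (\<gamma> * \<delta>) = cslash s (?e \<gamma>) \<delta> + ?e \<delta>" for \<gamma> \<delta>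
    by (induction \<delta> rule: psl_induct)
       (simp_all only: one cslash_one mult_1_right S U cslash_linear cslash_cslash add.assoc add_0_right mult.assoc[symmetric])
  moreover have "?e \<gamma> \<in> V_fs s" for \<gamma>
    by (induction \<gamma> rule: psl_induct) (simp_all only: one V_fs_zero S U V_fs_add V_fs_cslash V)
  ultimately have "?e \<in> Z1 s (V_fs s)" by (auto simp: Z1_def)
  moreover have "?e gS = x" using S[of 1] by (simp add: one cslash_linear)
  moreover have "?e gU = y" using U[of 1] by (simp add: one cslash_linear)
  ultimately show ?thesis by (rule that)
qed

section \<open>Regularized sums\<close>

lemma norm_powr_right_half:
  assumes "Re w > 0"
  shows "cmod (w powr t) \<le> cmod w powr Re t * exp (pi * \<bar>Im t\<bar>)"
proof -
  have "- Im t * Arg w \<le> \<bar>Im t\<bar> * \<bar>Arg w\<bar>" by (metis abs_ge_self abs_minus_cancel abs_mult)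
  also have "\<dots> \<le> \<bar>Im t\<bar> * pi"
    using Arg_bounded[of w] by (intro mult_left_mono) auto
  finally show ?thesis by (simp add: norm_powr_complex mult_left_mono mult.commute)
qed

lemma cmod_add_of_real_ge:
  assumes "Re w > 0" "x \<ge> 0"
  shows "cmod w \<le> cmod (w + of_real x)" "x \<le> cmod (w + of_real x)"
proof -
  have "(Re w)\<^sup>2 \<le> (Re w + x)\<^sup>2" using assms by (intro power_mono) auto
  then show "cmod w \<le> cmod (w + of_real x)" by (simp add: cmod_def)
  show "x \<le> cmod (w + of_real x)" using complex_Re_le_cmod[of "w + of_real x"] assms by simp
qed

text \<open>For \<open>Re s \<le> 1/2\<close> the terms \<open>w powr (-2 * s) * P (1 / w)\<close>
  are in general not summable along w + n. Subtracting telescoping terms with the same leading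
  behaviour leaves the order |w|^(-2 Re s - 1), and the factor \<open>2 * s - 1\<close> avoids a
  pole at 1/2.\<close>

definition reg_num :: "complex \<Rightarrow> (complex \<Rightarrow> complex) \<Rightarrow> complex \<Rightarrow> complex" where
  "reg_num s P w = (2 * s - 1) * (w powr (-2 * s) * P (1 / w))
     - P 0 * (w powr (1 - 2 * s) - (w + 1) powr (1 - 2 * s))"

text \<open>The first summand stands for the sum of the telescoping terms. For
  \<open>Re s > 1/2\<close> the result is the plain series, see \<open>infsum_plain\<close>.\<close>

definition reg_sum :: "complex \<Rightarrow> (complex \<Rightarrow> complex) \<Rightarrow> complex \<Rightarrow> complex" where
  "reg_sum s P w = (P 0 * w powr (1 - 2 * s) + (\<Sum>n. reg_num s P (w + of_nat n))) / (2 * s - 1)"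

text \<open>Strong enough for the decay of the summands, yet weak enough to cover
  \<open>\<lambda>y. p (Re y)\<close>, the encoding of a function of a real variable, which need not
  be holomorphic.\<close>

definition lipschitz0 :: "(complex \<Rightarrow> complex) \<Rightarrow> bool" where
  "lipschitz0 P \<longleftrightarrow> (\<exists>L \<rho>. \<rho> > 0 \<and> (\<forall>y. cmod y < \<rho> \<longrightarrow> cmod (P y - P 0) \<le> L * cmod y))"

text \<open>Taylor's formula for \<open>v powr (1 - 2 * s)\<close> on the segment from
  \<open>w\<close> to \<open>w + 1\<close>, where |v| >= |w|: the left-hand side is the remainder
  after the linear term.\<close>

lemma powr_second_difference:
  assumes s: "Re s > 0" and w: "Re w > 0"
  shows "cmod ((2 * s - 1) * w powr (-2 * s) - (w powr (1 - 2 * s) - (w + 1) powr (1 - 2 * s)))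
    \<le> cmod (2 * s - 1) * cmod (2 * s) * exp (2 * pi * \<bar>Im s\<bar>) * cmod w powr (-2 * Re s - 1)"
proof -
  define f where "f i v = (if i = 0 then v powr (1 - 2 * s) else if i = 1 then (1 - 2 * s) * v powr (-2 * s)
      else (1 - 2 * s) * (-2 * s) * v powr (-2 * s - 1))" for i :: nat and v
  define B where "B = cmod (2 * s - 1) * cmod (2 * s) * exp (2 * pi * \<bar>Im s\<bar>) * cmod w powr (-2 * Re s - 1)"
  define S where "S = closed_segment w (w + 1)"
  have S: "Re v > 0 \<and> cmod w \<le> cmod v" if v: "v \<in> S" for v
  proof -
    obtain u where u: "0 \<le> u" "u \<le> 1" "v = w + of_real u"
      using v by (auto simp: S_def in_segment algebra_simps scaleR_conv_of_real)
    then show ?thesis using w cmod_add_of_real_ge(1)[OF w u(1)] by simp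
  qed
  have "cmod (f 0 (w + 1) - (\<Sum>i\<le>1. f i w * (w + 1 - w) ^ i / fact i)) \<le> B * cmod (w + 1 - w) ^ Suc 1 / fact 1"
  proof (rule complex_Taylor[where S = S])
    show "convex S" unfolding S_def by (rule convex_closed_segment)
    show "(f i has_field_derivative f (Suc i) v) (at v within S)" if vS: "v \<in> S" and i1: "i \<le> 1" for i v
    proof -
      have nz: "v \<notin> \<real>\<^sub>\<le>\<^sub>0" using S[OF vS] by (auto simp: complex_nonpos_Reals_iff)
      consider "i = 0" | "i = 1" using i1 by linarith
      then show ?thesis
      proof cases
        case 1
        have "((\<lambda>v. v powr (1 - 2 * s)) has_field_derivative (1 - 2 * s) * v powr (1 - 2 * s - 1)) (at v within S)"
          by (rule has_field_derivative_powr[OF nz, THEN has_field_derivative_at_within])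
        then show ?thesis using 1 by (simp add: f_def[abs_def])
      next
        case 2
        have "((\<lambda>v. (1 - 2 * s) * v powr (-2 * s)) has_field_derivative (1 - 2 * s) * ((-2 * s) * v powr (-2 * s - 1))) (at v within S)"
          by (intro DERIV_cmult has_field_derivative_powr[OF nz, THEN has_field_derivative_at_within])
        then show ?thesis using 2 by (simp add: f_def[abs_def] mult.assoc)
      qed
    qed
    show "cmod (f (Suc 1) v) \<le> B" if "v \<in> S" for v
    proof -
      have v: "Re v > 0" "cmod w \<le> cmod v" using S[OF that] by auto
      have "cmod (v powr (-2 * s - 1)) \<le> cmod v powr (-2 * Re s - 1) * exp (2 * pi * \<bar>Im s\<bar>)"
        using norm_powr_right_half[OF v(1), of "-2 * s - 1"] by (simp add: abs_mult mult_ac)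
      also have "\<dots> \<le> cmod w powr (-2 * Re s - 1) * exp (2 * pi * \<bar>Im s\<bar>)"
        using v(2) w s by (intro mult_right_mono powr_mono2') auto
      finally have *: "cmod (v powr (-2 * s - 1)) \<le> cmod w powr (-2 * Re s - 1) * exp (2 * pi * \<bar>Im s\<bar>)" .
      have "f (Suc 1) v = (2 * s - 1) * ((2 * s) * v powr (-2 * s - 1))" by (simp add: f_def algebra_simps)
      then have "cmod (f (Suc 1) v) = cmod (2 * s - 1) * (cmod (2 * s) * cmod (v powr (-2 * s - 1)))"
        by (simp only: norm_mult[of "2 * s - 1"] norm_mult[of "2 * s"])
      also have "\<dots> \<le> cmod (2 * s - 1) * (cmod (2 * s) * (cmod w powr (-2 * Re s - 1) * exp (2 * pi * \<bar>Im s\<bar>)))"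
        by (intro mult_left_mono *) auto
      finally show ?thesis unfolding B_def by (simp only: mult_ac)
    qed
  qed (auto simp: S_def)
  then have "cmod ((w + 1) powr (1 - 2 * s) - (w powr (1 - 2 * s) + (1 - 2 * s) * w powr (-2 * s))) \<le> B"
    by (simp add: f_def)
  also have "(w + 1) powr (1 - 2 * s) - (w powr (1 - 2 * s) + (1 - 2 * s) * w powr (-2 * s)) =
      (2 * s - 1) * w powr (-2 * s) - (w powr (1 - 2 * s) - (w + 1) powr (1 - 2 * s))"
    by (simp add: algebra_simps)
  finally show ?thesis unfolding B_def .
qed

text \<open>The constants \<open>L\<close> and \<open>N\<close> depend on \<open>P\<close> only and
  the dependence on \<open>s\<close> is explicit, so that one bound serves for holomorphy in
  \<open>w\<close> as well as in \<open>s\<close>.\<close>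

lemma reg_num_bound:
  assumes "lipschitz0 P"
  obtains L N where "L \<ge> 0" "N > 0"
    "\<And>s w n. Re s > 0 \<Longrightarrow> Re w > 0 \<Longrightarrow> n \<ge> N \<Longrightarrow>
       cmod (reg_num s P (w + of_nat n)) \<le>
       cmod (2 * s - 1) * (L + cmod (P 0) * cmod (2 * s)) * exp (2 * pi * \<bar>Im s\<bar>) * real n powr (-2 * Re s - 1)"
proof -
  obtain L0 \<rho> where P: "\<rho> > 0" "\<And>y. cmod y < \<rho> \<Longrightarrow> cmod (P y - P 0) \<le> L0 * cmod y"
    using assms by (auto simp: lipschitz0_def)
  define L where "L = max L0 0"
  obtain N where N: "N > 0" "1 / real N < \<rho>"
    using P(1) by (metis nat_approx_posE zero_less_Suc)
  show ?thesis
  proof (rule that[of L N])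
    fix s w n assume s: "Re s > 0" and w: "Re w > 0" and n: "n \<ge> N"
    let ?v = "w + of_nat n"
    have n0: "real n > 0" using N(1) n by simp
    have v: "Re ?v > 0" using w by simp
    have nv: "real n \<le> cmod ?v" using cmod_add_of_real_ge(2)[OF w, of "real n"] by simp
    have "cmod (1 / ?v) \<le> 1 / real n" using nv n0 by (simp add: norm_divide frac_le)
    also have "\<dots> \<le> 1 / real N" using n N(1) by (simp add: frac_le)
    finally have "cmod (1 / ?v) < \<rho>" using N(2) by simp
    then have lip: "cmod (P (1 / ?v) - P 0) \<le> L * cmod (1 / ?v)"
      using P(2)[of "1 / ?v"] mult_right_mono[of L0 L "cmod (1 / ?v)"] by (simp add: L_def del: norm_divide)
    have eq: "reg_num s P ?v = (2 * s - 1) * (?v powr (-2 * s) * (P (1 / ?v) - P 0)) +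
        P 0 * ((2 * s - 1) * ?v powr (-2 * s) - (?v powr (1 - 2 * s) - (?v + 1) powr (1 - 2 * s)))"
      by (simp add: reg_num_def algebra_simps)
    define E where "E = exp (2 * pi * \<bar>Im s\<bar>)"
    have "cmod (?v powr (-2 * s)) \<le> cmod ?v powr (-2 * Re s) * E"
      using norm_powr_right_half[OF v, of "-2 * s"] by (simp add: abs_mult mult_ac E_def)
    then have "cmod (?v powr (-2 * s) * (P (1 / ?v) - P 0)) \<le> (cmod ?v powr (-2 * Re s) * E) * (L * cmod (1 / ?v))"
      unfolding norm_mult by (intro mult_mono lip) (auto simp: L_def E_def)
    also have "\<dots> = L * E * (cmod ?v powr (-2 * Re s) / cmod ?v)" by (simp add: norm_divide)
    also have "cmod ?v powr (-2 * Re s) / cmod ?v = cmod ?v powr (-2 * Re s - 1)"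
      using nv n0 by (simp add: powr_diff)
    finally have b1: "cmod (?v powr (-2 * s) * (P (1 / ?v) - P 0)) \<le> L * E * cmod ?v powr (-2 * Re s - 1)" .
    have "cmod (reg_num s P ?v) \<le> cmod (2 * s - 1) * (L * E * cmod ?v powr (-2 * Re s - 1)) +
        cmod (P 0) * (cmod (2 * s - 1) * cmod (2 * s) * E * cmod ?v powr (-2 * Re s - 1))"
      unfolding eq E_def
      by (rule norm_triangle_le, unfold norm_mult[of "2 * s - 1"] norm_mult[of "P 0"], rule add_mono)
         (use b1 powr_second_difference[OF s v] in \<open>auto simp: E_def intro!: mult_left_mono\<close>)
    also have "\<dots> = cmod (2 * s - 1) * (L + cmod (P 0) * cmod (2 * s)) * E * cmod ?v powr (-2 * Re s - 1)"
      by (simp add: algebra_simps)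
    also have "\<dots> \<le> cmod (2 * s - 1) * (L + cmod (P 0) * cmod (2 * s)) * E * real n powr (-2 * Re s - 1)"
      using nv n0 s by (intro mult_left_mono powr_mono2') (auto simp: L_def E_def)
    finally show "cmod (reg_num s P ?v) \<le>
       cmod (2 * s - 1) * (L + cmod (P 0) * cmod (2 * s)) * exp (2 * pi * \<bar>Im s\<bar>) * real n powr (-2 * Re s - 1)"
      by (simp add: E_def)
  qed (use N in \<open>auto simp: L_def\<close>)
qed

lemma summable_powr_Re: "Re s > 0 \<Longrightarrow> summable (\<lambda>n. C * real n powr (-2 * Re s - 1))"
  by (intro summable_mult) (simp add: summable_real_powr_iff)

lemma reg_num_bound_uniform:
  assumes "lipschitz0 P" "Re s > 0"
  obtains C where "\<forall>\<^sub>F n in sequentially. \<forall>w. Re w > 0 \<longrightarrow>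
     cmod (reg_num s P (w + of_nat n)) \<le> C * real n powr (-2 * Re s - 1)"
proof -
  obtain L N where "\<And>s w n. Re s > 0 \<Longrightarrow> Re w > 0 \<Longrightarrow> n \<ge> N \<Longrightarrow>
       cmod (reg_num s P (w + of_nat n)) \<le>
       cmod (2 * s - 1) * (L + cmod (P 0) * cmod (2 * s)) * exp (2 * pi * \<bar>Im s\<bar>) * real n powr (-2 * Re s - 1)"
    using reg_num_bound[OF assms(1)] by metis
  with assms(2) show ?thesis
    by (intro that[of "cmod (2 * s - 1) * (L + cmod (P 0) * cmod (2 * s)) * exp (2 * pi * \<bar>Im s\<bar>)"]
        eventually_sequentiallyI[of N]) auto
qed

lemma reg_num_summable:
  assumes "lipschitz0 P" "Re s > 0" "Re w > 0"
  shows "summable (\<lambda>n. reg_num s P (w + of_nat n))"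
proof -
  obtain C where C: "\<forall>\<^sub>F n in sequentially. \<forall>w. Re w > 0 \<longrightarrow>
     cmod (reg_num s P (w + of_nat n)) \<le> C * real n powr (-2 * Re s - 1)"
    using reg_num_bound_uniform[OF assms(1,2)] .
  have "\<forall>\<^sub>F n in sequentially. cmod (reg_num s P (w + of_nat n)) \<le> C * real n powr (-2 * Re s - 1)"
    using C by eventually_elim (use assms(3) in simp)
  then show ?thesis by (rule summable_comparison_test_ev[OF _ summable_powr_Re[OF assms(2)]])
qed

lemma holomorphic_suminf:
  assumes S: "open S" and f: "\<And>n. f n holomorphic_on S"
    and bd: "\<And>x. x \<in> S \<Longrightarrow> \<exists>d>0. \<exists>h. summable h \<and> (\<forall>\<^sub>F n in sequentially. \<forall>y\<in>ball x d \<inter> S. cmod (f n y) \<le> h n)"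
  shows "(\<lambda>x. \<Sum>n. f n x) holomorphic_on S"
proof (rule holomorphic_uniform_sequence[OF S, where f = "\<lambda>n x. \<Sum>i<n. f i x"])
  show "(\<lambda>x. \<Sum>i<n. f i x) holomorphic_on S" for n by (intro holomorphic_intros f)
  fix x assume x: "x \<in> S"
  obtain d h where d: "d > 0" "summable h" "\<forall>\<^sub>F n in sequentially. \<forall>y\<in>ball x d \<inter> S. cmod (f n y) \<le> h n"
    using bd[OF x] by blast
  obtain e where e: "e > 0" "cball x e \<subseteq> S" using S x open_contains_cball by blast
  define r where "r = min (d / 2) e"
  have r: "r > 0" "cball x r \<subseteq> S" "cball x r \<subseteq> ball x d" using d e by (auto simp: r_def)
  have "uniform_limit (cball x r) (\<lambda>n x. \<Sum>i<n. f i x) (\<lambda>x. suminf (\<lambda>i. f i x)) sequentially"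
    by (rule Weierstrass_m_test_ev[OF _ d(2)]) (use d(3) in eventually_elim, use r in blast)
  with r show "\<exists>d>0. cball x d \<subseteq> S \<and> uniform_limit (cball x d) (\<lambda>n x. \<Sum>i<n. f i x) (\<lambda>x. \<Sum>n. f n x) sequentially"
    by blast
qed

lemma reg_sum_holomorphic:
  assumes P: "lipschitz0 P" "Re s > 0" and W: "open W" "\<And>w. w \<in> W \<Longrightarrow> Re w > 0"
    and hol: "\<And>n. (\<lambda>w. P (1 / (w + of_nat n))) holomorphic_on W"
  shows "reg_sum s P holomorphic_on W"
proof -
  obtain C where C: "\<forall>\<^sub>F n in sequentially. \<forall>w. Re w > 0 \<longrightarrow>
     cmod (reg_num s P (w + of_nat n)) \<le> C * real n powr (-2 * Re s - 1)"
    using reg_num_bound_uniform[OF P] .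
  have nz: "w + of_nat n \<notin> \<real>\<^sub>\<le>\<^sub>0" "w + of_nat n + 1 \<notin> \<real>\<^sub>\<le>\<^sub>0" "w \<notin> \<real>\<^sub>\<le>\<^sub>0" if "w \<in> W" for w and n :: nat
    using W(2)[OF that] by (auto simp: complex_nonpos_Reals_iff)
  have "(\<lambda>w. \<Sum>n. reg_num s P (w + of_nat n)) holomorphic_on W"
  proof (rule holomorphic_suminf[OF W(1)])
    show "(\<lambda>w. reg_num s P (w + of_nat n)) holomorphic_on W" for n
      unfolding reg_num_def by (intro holomorphic_intros hol) (use nz in auto)
    have "\<forall>\<^sub>F n in sequentially. \<forall>y\<in>ball x 1 \<inter> W. cmod (reg_num s P (y + of_nat n)) \<le> C * real n powr (-2 * Re s - 1)" for x
      using C by eventually_elim (use W(2) in auto)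
    then show "\<exists>d>0. \<exists>h. summable h \<and> (\<forall>\<^sub>F n in sequentially. \<forall>y\<in>ball x d \<inter> W. cmod (reg_num s P (y + of_nat n)) \<le> h n)"
      for x using summable_powr_Re[OF P(2), of C] zero_less_one by blast
  qed
  then show ?thesis unfolding reg_sum_def[abs_def] divide_inverse
    by (intro holomorphic_intros) (use nz in auto)
qed

lemma reg_sum_rec:
  assumes "lipschitz0 P" "Re s > 0" "Re w > 0" "s \<noteq> 1/2"
  shows "reg_sum s P w = w powr (-2 * s) * P (1 / w) + reg_sum s P (w + 1)"
proof -
  have s: "2 * s - 1 \<noteq> 0" using assms(4) by (auto simp: field_simps)
  have "(\<Sum>n. reg_num s P (w + of_nat n)) = reg_num s P w + (\<Sum>n. reg_num s P (w + 1 + of_nat n))"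
    using suminf_split_head[OF reg_num_summable[OF assms(1-3)]] by (simp add: add_ac)
  then show ?thesis using s by (simp add: reg_sum_def reg_num_def[of s P w] field_simps)
qed

text \<open>At \<open>w + n\<close> the regularizing part is exactly the subtracted power; what
  remains is the tail of a convergent series.\<close>

lemma reg_sum_asymp:
  assumes "lipschitz0 P" "Re s > 0" "Re w > 0"
  shows "(\<lambda>n. reg_sum s P (w + of_nat n) - P 0 / (2 * s - 1) * (w + of_nat n) powr (1 - 2 * s)) \<longlonglongrightarrow> 0"
proof -
  have "(\<lambda>n. (\<Sum>k. reg_num s P (w + of_nat (k + n)))) \<longlonglongrightarrow> 0"
    by (rule suminf_exist_split2[OF reg_num_summable[OF assms]])
  then have "(\<lambda>n. (\<Sum>k. reg_num s P (w + of_nat (k + n))) / (2 * s - 1)) \<longlonglongrightarrow> 0"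
    by (rule tendsto_divide_zero)
  then show ?thesis
    by (simp add: reg_sum_def add_divide_distrib add_ac)
qed

text \<open>Two solutions of the same difference equation differ by a constant along
  \<open>w + n\<close>, and equal leading terms force this constant to be 0. This is how a given
  function is recognized as a regularized sum.\<close>

lemma reg_sum_unique:
  assumes P: "lipschitz0 P" "Re s > 0" "Re w > 0" "s \<noteq> 1/2"
    and q: "\<And>n. q n - q (Suc n) = (w + of_nat n) powr (-2 * s) * P (1 / (w + of_nat n))"
    and lim: "(\<lambda>n. q n - P 0 / (2 * s - 1) * (w + of_nat n) powr (1 - 2 * s)) \<longlonglongrightarrow> 0"
  shows "q 0 = reg_sum s P w"
proof -
  define D where "D n = q n - reg_sum s P (w + of_nat n)" for n
  have D: "D n = D 0" for n
  proof (induction n)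
    case (Suc n)
    have "reg_sum s P (w + of_nat n) = (w + of_nat n) powr (-2 * s) * P (1 / (w + of_nat n)) + reg_sum s P (w + of_nat (Suc n))"
      using reg_sum_rec[OF P(1,2) _ P(4), of "w + of_nat n"] P(3) by (simp add: add_ac)
    then have "D (Suc n) = D n" using q[of n] by (simp add: D_def algebra_simps)
    then show ?case using Suc by simp
  qed simp
  have "D \<longlonglongrightarrow> 0"
    using tendsto_diff[OF lim reg_sum_asymp[OF P(1-3)]] by (simp add: D_def[abs_def])
  moreover have "D = (\<lambda>n. D 0)" by (rule ext) (rule D)
  ultimately have "(\<lambda>n. D 0) \<longlonglongrightarrow> 0" by metis
  then have "D 0 = 0" by (simp add: tendsto_const_iff)
  then show ?thesis by (simp add: D_def)
qed

text \<open>Only the values at 0 and at the points \<open>1 / (w + n)\<close> enter, so a function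
  may be exchanged for an extension or a restriction.\<close>

lemma reg_sum_cong:
  assumes "P 0 = Q 0" "\<And>n. P (1 / (w + of_nat n)) = Q (1 / (w + of_nat n))"
  shows "reg_sum s P w = reg_sum s Q w"
  using assms by (simp add: reg_sum_def reg_num_def)

section \<open>Comparison with the series and continuation in s\<close>

lemma plain_summable:
  assumes P: "lipschitz0 P" and s: "1/2 < Re s" and w: "Re w > 0"
  shows "summable (\<lambda>n. cmod ((w + of_nat n) powr (-2 * s) * P (1 / (w + of_nat n))))"
proof -
  obtain L \<rho> where L: "\<rho> > 0" "\<And>y. cmod y < \<rho> \<Longrightarrow> cmod (P y - P 0) \<le> L * cmod y"
    using P by (auto simp: lipschitz0_def)
  obtain N where N: "N > 0" "1 / real N < \<rho>"
    using L(1) by (metis nat_approx_posE zero_less_Suc)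
  define K where "K = cmod (P 0) + \<bar>L\<bar> * \<rho>"
  have "cmod ((w + of_nat n) powr (-2 * s) * P (1 / (w + of_nat n))) \<le> exp (2 * pi * \<bar>Im s\<bar>) * K * real n powr (-2 * Re s)"
    if n: "n \<ge> N" for n
  proof -
    let ?v = "w + of_nat n"
    have n0: "real n > 0" using N(1) n by simp
    have v: "Re ?v > 0" using w by simp
    have nv: "real n \<le> cmod ?v" using cmod_add_of_real_ge(2)[OF w, of "real n"] by simp
    have "cmod (1 / ?v) \<le> 1 / real n" using nv n0 by (simp add: norm_divide frac_le)
    also have "\<dots> \<le> 1 / real N" using n N(1) by (simp add: frac_le)
    finally have lt: "cmod (1 / ?v) < \<rho>" using N(2) by simp
    have "cmod (P (1 / ?v)) \<le> cmod (P 0) + cmod (P (1 / ?v) - P 0)"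
      using norm_triangle_ineq[of "P 0" "P (1 / ?v) - P 0"] by simp
    also have "cmod (P (1 / ?v) - P 0) \<le> \<bar>L\<bar> * \<rho>"
    proof -
      have "L * cmod (1 / ?v) \<le> \<bar>L\<bar> * \<rho>" using lt by (intro mult_mono) (auto simp del: norm_divide)
      with L(2)[OF lt] show ?thesis by linarith
    qed
    finally have PK: "cmod (P (1 / ?v)) \<le> K" by (simp add: K_def)
    have "cmod (?v powr (-2 * s)) \<le> cmod ?v powr (-2 * Re s) * exp (2 * pi * \<bar>Im s\<bar>)"
      using norm_powr_right_half[OF v, of "-2 * s"] by (simp add: abs_mult mult_ac)
    also have "\<dots> \<le> real n powr (-2 * Re s) * exp (2 * pi * \<bar>Im s\<bar>)"
      using nv n0 s by (intro mult_right_mono powr_mono2') auto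
    finally have "cmod (?v powr (-2 * s) * P (1 / ?v)) \<le> (real n powr (-2 * Re s) * exp (2 * pi * \<bar>Im s\<bar>)) * K"
      unfolding norm_mult using PK by (intro mult_mono) auto
    then show ?thesis by (simp add: mult_ac)
  qed
  then have "\<forall>\<^sub>F n in sequentially. norm (cmod ((w + of_nat n) powr (-2 * s) * P (1 / (w + of_nat n)))) \<le>
      exp (2 * pi * \<bar>Im s\<bar>) * K * real n powr (-2 * Re s)"
    by (intro eventually_sequentiallyI[of N]) simp
  then show ?thesis
    by (rule summable_comparison_test_ev) (intro summable_mult, use s in \<open>simp add: summable_real_powr_iff\<close>)
qed

text \<open>The tails of the convergent series satisfy the difference equation, and for
  \<open>Re s > 1/2\<close> the prescribed leading term tends to 0 itself, so
  \<open>reg_sum_unique\<close> applies.\<close>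

lemma infsum_plain:
  assumes P: "lipschitz0 P" and s: "1/2 < Re s" and w: "Re w > 0"
  shows "(\<Sum>\<^sub>\<infinity>n. (w + of_nat n) powr (-2 * s) * P (1 / (w + of_nat n))) = reg_sum s P w"
proof -
  let ?t = "\<lambda>n. (w + of_nat n) powr (-2 * s) * P (1 / (w + of_nat n))"
  have sm: "summable (\<lambda>n. cmod (?t n))" by (rule plain_summable[OF assms])
  then have sm': "summable ?t" by (rule summable_norm_cancel)
  have "(?t has_sum (\<Sum>n. ?t n)) UNIV"
    by (rule norm_summable_imp_has_sum[OF sm summable_sums[OF sm']])
  then have "infsum ?t UNIV = (\<Sum>n. ?t n)" by (rule infsumI)
  also have "\<dots> = reg_sum s P w"
  proof -
    define q where "q n = (\<Sum>k. ?t (k + n))" for n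
    have "q 0 = reg_sum s P w"
    proof (rule reg_sum_unique[OF P _ w])
      show "q n - q (Suc n) = ?t n" for n
        using suminf_split_head[OF summable_ignore_initial_segment[OF sm', of n]] by (simp add: q_def)
      have "(\<lambda>n. (w + of_nat n) powr (1 - 2 * s)) \<longlonglongrightarrow> 0"
      proof (rule Lim_null_comparison[where g = "\<lambda>n. exp (2 * pi * \<bar>Im s\<bar>) * real n powr (1 - 2 * Re s)"])
        have "cmod ((w + of_nat n) powr (1 - 2 * s)) \<le> exp (2 * pi * \<bar>Im s\<bar>) * real n powr (1 - 2 * Re s)" if "n \<ge> 1" for n
        proof -
          have v: "Re (w + of_nat n) > 0" using w by simp
          have nv: "real n \<le> cmod (w + of_nat n)" using cmod_add_of_real_ge(2)[OF w, of "real n"] by simp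
          have "cmod ((w + of_nat n) powr (1 - 2 * s)) \<le> cmod (w + of_nat n) powr (1 - 2 * Re s) * exp (2 * pi * \<bar>Im s\<bar>)"
            using norm_powr_right_half[OF v, of "1 - 2 * s"] by (simp add: abs_mult mult_ac)
          also have "\<dots> \<le> real n powr (1 - 2 * Re s) * exp (2 * pi * \<bar>Im s\<bar>)"
            using nv that s by (intro mult_right_mono powr_mono2') auto
          finally show ?thesis by (simp add: mult_ac)
        qed
        then show "\<forall>\<^sub>F n in sequentially. cmod ((w + of_nat n) powr (1 - 2 * s)) \<le> exp (2 * pi * \<bar>Im s\<bar>) * real n powr (1 - 2 * Re s)"
          by (intro eventually_sequentiallyI[of 1])
        have "(\<lambda>n. real n powr (1 - 2 * Re s)) \<longlonglongrightarrow> 0"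
          by (rule tendsto_neg_powr[OF _ filterlim_real_sequentially]) (use s in simp)
        then show "(\<lambda>n. exp (2 * pi * \<bar>Im s\<bar>) * real n powr (1 - 2 * Re s)) \<longlonglongrightarrow> 0"
          by (rule tendsto_mult_right_zero)
      qed
      then have "(\<lambda>n. P 0 / (2 * s - 1) * (w + of_nat n) powr (1 - 2 * s)) \<longlonglongrightarrow> 0"
        by (rule tendsto_mult_right_zero)
      moreover have "q \<longlonglongrightarrow> 0" unfolding q_def by (rule suminf_exist_split2[OF sm'])
      ultimately have "(\<lambda>n. q n - P 0 / (2 * s - 1) * (w + of_nat n) powr (1 - 2 * s)) \<longlonglongrightarrow> 0 - 0"
        by (intro tendsto_diff)
      then show "(\<lambda>n. q n - P 0 / (2 * s - 1) * (w + of_nat n) powr (1 - 2 * s)) \<longlonglongrightarrow> 0" by simp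
      show "Re s > 0" using s by simp
      show "s \<noteq> 1/2"
      proof
        assume "s = 1/2"
        then have "Re s = Re (1/2)" by (rule arg_cong)
        with s show False by simp
      qed
    qed
    then show ?thesis by (simp add: q_def)
  qed
  finally show ?thesis .
qed

lemma reg_sum_numerator_holomorphic:
  assumes P: "lipschitz0 P" and w: "Re w > 0"
  shows "(\<lambda>t. P 0 * w powr (1 - 2 * t) + (\<Sum>n. reg_num t P (w + of_nat n))) holomorphic_on {t. 0 < Re t}"
proof -
  have w0: "w \<noteq> 0" "w + of_nat n \<noteq> 0" "w + of_nat n + 1 \<noteq> 0" for n :: nat
    using w by (auto simp: complex_eq_iff)
  obtain L N where L: "L \<ge> 0" "\<And>s w n. Re s > 0 \<Longrightarrow> Re w > 0 \<Longrightarrow> n \<ge> N \<Longrightarrow>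
       cmod (reg_num s P (w + of_nat n)) \<le>
       cmod (2 * s - 1) * (L + cmod (P 0) * cmod (2 * s)) * exp (2 * pi * \<bar>Im s\<bar>) * real n powr (-2 * Re s - 1)"
    using reg_num_bound[OF P] by metis
  have "(\<lambda>t. \<Sum>n. reg_num t P (w + of_nat n)) holomorphic_on {t. 0 < Re t}"
  proof (rule holomorphic_suminf)
    show "open {t. 0 < Re t}" by (rule open_halfspace_Re_gt)
    show "(\<lambda>t. reg_num t P (w + of_nat n)) holomorphic_on {t. 0 < Re t}" for n
      unfolding reg_num_def using w0 by (intro holomorphic_intros)
    fix x :: complex assume x: "x \<in> {t. 0 < Re t}"
    \<comment> \<open>On the disk of this radius \<open>Re y \<ge> Re x / 2\<close>, which yields
      one summable majorant.\<close>
    define d where "d = Re x / 2"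
    define K where "K t = cmod (2 * t - 1) * (L + cmod (P 0) * cmod (2 * t)) * exp (2 * pi * \<bar>Im t\<bar>)" for t
    have "continuous_on (cball x d) K" unfolding K_def by (intro continuous_intros)
    then have "bounded (K ` cball x d)"
      by (intro compact_imp_bounded compact_continuous_image) auto
    then obtain B where "\<forall>k\<in>K ` cball x d. norm k \<le> B" unfolding bounded_iff by blast
    then have B: "K t \<le> B" if "t \<in> cball x d" for t
      using that abs_ge_self[of "K t"] by (metis imageI order_trans real_norm_def)
    show "\<exists>d>0. \<exists>h. summable h \<and> (\<forall>\<^sub>F n in sequentially. \<forall>y\<in>ball x d \<inter> {t. 0 < Re t}. cmod (reg_num y P (w + of_nat n)) \<le> h n)"
    proof (intro exI[of _ d] conjI exI[of _ "\<lambda>n. B * real n powr (-2 * Re (x / 2) - 1)"])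
      show "d > 0" using x by (simp add: d_def)
      show "summable (\<lambda>n. B * real n powr (-2 * Re (x / 2) - 1))" by (rule summable_powr_Re) (use x in simp)
      show "\<forall>\<^sub>F n in sequentially. \<forall>y\<in>ball x d \<inter> {t. 0 < Re t}. cmod (reg_num y P (w + of_nat n)) \<le> B * real n powr (-2 * Re (x / 2) - 1)"
      proof (rule eventually_sequentiallyI[of "max N 1"], safe)
        fix n y assume n: "max N 1 \<le> n" and y: "y \<in> ball x d" "0 < Re y"
        have "\<bar>Re (x - y)\<bar> < d" using abs_Re_le_cmod[of "x - y"] y(1) by (simp add: dist_norm)
        then have Re: "Re y \<ge> Re x / 2" unfolding d_def minus_complex.simps by linarith
        have "cmod (reg_num y P (w + of_nat n)) \<le> K y * real n powr (-2 * Re y - 1)"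
          using L(2)[OF y(2) w, of n] n by (simp add: K_def)
        also have "\<dots> \<le> B * real n powr (-2 * Re (x / 2) - 1)"
        proof (intro mult_mono powr_mono)
          show KB: "K y \<le> B" by (rule B) (use y(1) in auto)
          have "0 \<le> K y" using L(1) unfolding K_def by (intro mult_nonneg_nonneg add_nonneg_nonneg) auto
          then show "0 \<le> B" using KB by linarith
        qed (use n Re in auto)
        finally show "cmod (reg_num y P (w + of_nat n)) \<le> B * real n powr (-2 * Re (x / 2) - 1)" .
      qed
    qed
  qed
  then show ?thesis using w0 by (intro holomorphic_intros) auto
qed

text \<open>The numerators are holomorphic on the half plane, so dividing by
  \<open>2 * t - 1\<close> gives an admissible continuation; any other one agrees with it by the
  identity theorem, because the half plane without 1/2 is connected.\<close>

lemma continued_value_reg_sum: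
  assumes P: "lipschitz0 P" "lipschitz0 Q" and w: "Re w > 0" "Re v > 0"
    and F: "\<And>t. 1/2 < Re t \<Longrightarrow> F t = reg_sum t P w + reg_sum t Q v"
    and s: "Re s > 0" "s \<noteq> 1/2"
  shows "continued_value F s = reg_sum s P w + reg_sum s Q v"
proof -
  let ?H = "{t::complex. 0 < Re t}"
  have opH: "open ?H" by (rule open_halfspace_Re_gt)
  define N where "N t = (P 0 * w powr (1 - 2 * t) + (\<Sum>n. reg_num t P (w + of_nat n)))
     + (Q 0 * v powr (1 - 2 * t) + (\<Sum>n. reg_num t Q (v + of_nat n)))" for t
  define G where "G t = N t / (2 * t - 1)" for t
  have G: "G t = reg_sum t P w + reg_sum t Q v" for t
    by (simp add: G_def N_def reg_sum_def add_divide_distrib)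
  have N: "N holomorphic_on ?H" unfolding N_def
    by (intro holomorphic_on_add reg_sum_numerator_holomorphic P w)
  have hol: "G holomorphic_on (?H - {1/2})" unfolding G_def
    by (intro holomorphic_intros holomorphic_on_subset[OF N]) (auto simp: field_simps)
  have mer: "G meromorphic_on ?H" unfolding G_def
  proof (intro meromorphic_intros)
    show "N meromorphic_on ?H"
      using N by (intro analytic_on_imp_meromorphic_on) (simp add: analytic_on_open opH)
  qed
  show ?thesis unfolding continued_value_def
  proof (rule the_equality)
    show "\<exists>G. G meromorphic_on ?H \<and> G holomorphic_on ?H - {1/2} \<and> (\<forall>t. 1/2 < Re t \<longrightarrow> G t = F t)
        \<and> reg_sum s P w + reg_sum s Q v = G s"
      using hol mer G F by (intro exI[of _ G]) auto
    fix x assume "\<exists>G. G meromorphic_on ?H \<and> G holomorphic_on ?H - {1/2} \<and> (\<forall>t. 1/2 < Re t \<longrightarrow> G t = F t) \<and> x = G s"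
    then obtain G' where G': "G' holomorphic_on ?H - {1/2}" "\<And>t. 1/2 < Re t \<Longrightarrow> G' t = F t" "x = G' s" by blast
    have "G' s = G s"
    proof (rule analytic_continuation_open[of "{t. 1/2 < Re t}" "?H - {1/2}" G' G])
      show "open {t. 1/2 < Re t}" by (rule open_halfspace_Re_gt)
      show "connected (?H - {1/2})"
        by (rule connected_open_delete[OF opH convex_connected[OF convex_halfspace_Re_gt]]) simp
      show "{t. 1/2 < Re t} \<noteq> {}" by (auto intro!: exI[of _ 1])
    qed (use opH G' hol G F s in auto)
    then show "x = reg_sum s P w + reg_sum s Q v" using G' G by simp
  qed
qed

lemma lipschitz0_holomorphic:
  assumes "F holomorphic_on ball 0 r" "r > 0" "\<And>y. cmod y < r \<Longrightarrow> P y = F y"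
  shows "lipschitz0 P"
proof -
  have "(F has_field_derivative deriv F 0) (at 0)"
    using holomorphic_derivI[OF assms(1) open_ball, of 0] assms(2) by simp
  then have "((\<lambda>y. (F y - F 0) / y) \<longlongrightarrow> deriv F 0) (at 0)"
    by (simp add: has_field_derivative_iff)
  then have "\<forall>\<^sub>F y in at 0. dist ((F y - F 0) / y) (deriv F 0) < 1"
    by (rule tendstoD) simp
  then obtain d where d: "d > 0" "\<And>y. y \<noteq> 0 \<Longrightarrow> cmod y < d \<Longrightarrow> dist ((F y - F 0) / y) (deriv F 0) < 1"
    unfolding eventually_at by auto
  have "cmod (P y - P 0) \<le> (cmod (deriv F 0) + 1) * cmod y" if "cmod y < min d r" for y
  proof (cases "y = 0")
    case False
    then have "cmod ((F y - F 0) / y) < cmod (deriv F 0) + 1"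
      using d(2)[of y] that norm_triangle_sub[of "(F y - F 0) / y" "deriv F 0"] by (simp add: dist_norm)
    then show ?thesis using False that assms(2,3) by (simp add: norm_divide divide_less_eq)
  qed simp
  then show ?thesis unfolding lipschitz0_def using d(1) assms(2)
    by (intro exI[of _ "cmod (deriv F 0) + 1"] exI[of _ "min d r"]) auto
qed

lemma disk_algebra_lipschitz0:
  assumes "f \<in> disk_algebra" shows "lipschitz0 f" "lipschitz0 (\<lambda>y. f (- y))"
proof -
  have f: "f holomorphic_on ball 0 1" using assms by (simp add: disk_algebra_def)
  show "lipschitz0 f" by (rule lipschitz0_holomorphic[OF f]) auto
  have "(\<lambda>y. f (- y)) holomorphic_on ball 0 1"
    using holomorphic_on_compose_gen[OF _ f, of "\<lambda>y. - y" "ball 0 1"]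
    by (simp add: o_def image_subset_iff holomorphic_on_minus holomorphic_on_ident)
  then show "lipschitz0 (\<lambda>y. f (- y))" by (rule lipschitz0_holomorphic) auto
qed

lemma infsum_shift:
  fixes f :: "nat \<Rightarrow> complex"
  shows "infsum f {k..} = infsum (\<lambda>n. f (n + k)) UNIV"
proof -
  have "{k..} = range (\<lambda>n. n + k)"
    by (auto simp: image_iff) (metis le_add_diff_inverse2)
  then show ?thesis using infsum_reindex[of "\<lambda>n. n + k" UNIV f] by (simp add: o_def)
qed

text \<open>The starting index is absorbed into the argument: summation from \<open>k\<close>
  becomes a regularized sum at \<open>z + k\<close> or at \<open>k - z\<close>, which stays in the
  right half plane on the closed disk since \<open>k \<ge> 2\<close>.\<close>

lemma transfer_op_eq:
  assumes f: "f1 \<in> disk_algebra" "f2 \<in> disk_algebra" and z: "z \<in> cball 0 1" and s: "Re s > 0" "s \<noteq> 1/2"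
  shows "fst (transfer_op s (f1, f2)) z = reg_sum s (\<lambda>y. f1 (- y)) (z + 3) + reg_sum s f2 (2 - z)"
    and "snd (transfer_op s (f1, f2)) z = reg_sum s (\<lambda>y. f1 (- y)) (z + 2) + reg_sum s f2 (3 - z)"
proof -
  have Re: "\<bar>Re z\<bar> \<le> 1" using z abs_Re_le_cmod[of z] by simp
  note lip = disk_algebra_lipschitz0[OF f(1)] disk_algebra_lipschitz0[OF f(2)]
  have p: "(\<Sum>\<^sub>\<infinity>n\<in>{k..}. (z + of_nat n) powr (-2 * t) * f1 (-1 / (z + of_nat n))) =
      reg_sum t (\<lambda>y. f1 (- y)) (z + of_nat k)" if "1/2 < Re t" "k \<ge> 2" for t and k :: nat
    using infsum_plain[OF lip(2) that(1), of "z + of_nat k"] Re that(2)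
    by (simp add: infsum_shift add_ac)
  have m: "(\<Sum>\<^sub>\<infinity>n\<in>{k..}. (of_nat n - z) powr (-2 * t) * f2 (1 / (of_nat n - z))) =
      reg_sum t f2 (of_nat k - z)" if "1/2 < Re t" "k \<ge> 2" for t and k :: nat
    using infsum_plain[OF lip(3) that(1), of "of_nat k - z"] Re that(2)
    by (simp add: infsum_shift algebra_simps)
  show "fst (transfer_op s (f1, f2)) z = reg_sum s (\<lambda>y. f1 (- y)) (z + 3) + reg_sum s f2 (2 - z)"
    unfolding transfer_op_def prod.case fst_conv
  proof (rule continued_value_reg_sum[OF lip(2,3) _ _ _ s])
    show "transfer1_series f1 f2 z t = reg_sum t (\<lambda>y. f1 (- y)) (z + 3) + reg_sum t f2 (2 - z)" if "1/2 < Re t" for t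
      using p[OF that, of 3] m[OF that, of 2] by (simp add: transfer1_series_def)
  qed (use Re in auto)
  show "snd (transfer_op s (f1, f2)) z = reg_sum s (\<lambda>y. f1 (- y)) (z + 2) + reg_sum s f2 (3 - z)"
    unfolding transfer_op_def prod.case snd_conv
  proof (rule continued_value_reg_sum[OF lip(2,3) _ _ _ s])
    show "transfer2_series f1 f2 z t = reg_sum t (\<lambda>y. f1 (- y)) (z + 2) + reg_sum t f2 (3 - z)" if "1/2 < Re t" for t
      using p[OF that, of 2] m[OF that, of 3] by (simp add: transfer2_series_def)
  qed (use Re in auto)
qed

lemma transfer_fixed_iff:
  assumes s: "Re s > 0" "s \<noteq> 1/2"
  shows "(f1, f2) \<in> transfer_fixed s \<longleftrightarrow> f1 \<in> disk_algebra \<and> f2 \<in> disk_algebra \<and>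
    (\<forall>z\<in>cball 0 1. f1 z = reg_sum s (\<lambda>y. f1 (- y)) (z + 3) + reg_sum s f2 (2 - z) \<and>
                   f2 z = reg_sum s (\<lambda>y. f1 (- y)) (z + 2) + reg_sum s f2 (3 - z))"
  unfolding transfer_fixed_def using transfer_op_eq[OF _ _ _ s] by (auto simp: eq_commute[of "f1 _"] eq_commute[of "f2 _"])

lemma reg_sum_linear:
  assumes "lipschitz0 P" "lipschitz0 Q" "Re s > 0" "Re w > 0"
  shows "reg_sum s (\<lambda>y. a * P y + b * Q y) w = a * reg_sum s P w + b * reg_sum s Q w"
proof -
  have "reg_num s (\<lambda>y. a * P y + b * Q y) v = a * reg_num s P v + b * reg_num s Q v" for v
    by (simp add: reg_num_def algebra_simps)
  then have "(\<Sum>n. reg_num s (\<lambda>y. a * P y + b * Q y) (w + of_nat n)) =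
     a * (\<Sum>n. reg_num s P (w + of_nat n)) + b * (\<Sum>n. reg_num s Q (w + of_nat n))"
    using reg_num_summable[OF assms(1,3,4)] reg_num_summable[OF assms(2,3,4)]
    by (simp add: suminf_add[symmetric] suminf_mult summable_mult)
  then show ?thesis by (simp add: reg_sum_def algebra_simps flip: add_divide_distrib)
qed

section \<open>The eigenfunction equation on the real line\<close>

lemma phi_gt: "1 < phi" "phi < 2"
proof -
  have "sqrt 1 < sqrt 5" by (rule real_sqrt_less_mono) simp
  moreover have "sqrt 5 < sqrt 9" by (rule real_sqrt_less_mono) simp
  moreover have "sqrt 9 = 3" by (rule real_sqrt_unique) auto
  ultimately show "1 < phi" "phi < 2" by (simp_all add: phi_def)
qed

lemma phi_square: "phi * phi = phi + 1"
proof -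
  have "sqrt 5 * sqrt 5 = 5" by simp
  then show ?thesis by (simp add: phi_def field_simps)
qed

lemma phi_power2: "phi\<^sup>2 = phi + 1" using phi_square by (simp add: power2_eq_square)

lemma phi_inverse: "1 / phi = phi - 1" "1 / (phi + 1) = 2 - phi"
  using phi_square phi_gt by (simp_all add: field_simps)

abbreviation phi_interval :: "real set" where "phi_interval \<equiv> {- (phi\<^sup>2) <..< phi}"

text \<open>\<open>Re\<close> merely makes the function total on complex numbers; the sum evaluates
  \<open>p\<close> at 0 and at the real points \<open>1 / (x + n)\<close> only.\<close>

definition rreg :: "complex \<Rightarrow> (real \<Rightarrow> complex) \<Rightarrow> real \<Rightarrow> complex" where
  "rreg s p x = reg_sum s (\<lambda>y. p (Re y)) (of_real x)"

lemma of_real_inverse_add: "1 / (complex_of_real x + of_nat n) = of_real (1 / (x + real n))"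
  by simp

lemma lipschitz0_real:
  assumes "real_analytic_at p 0" shows "lipschitz0 (\<lambda>y. p (Re y))"
proof -
  obtain r F where F: "r > 0" "F holomorphic_on ball 0 r" "\<And>y. \<bar>y\<bar> < r \<Longrightarrow> p y = F (of_real y)"
    using real_analytic_atE[OF assms] by auto
  have "lipschitz0 F" by (rule lipschitz0_holomorphic[OF F(2,1)]) simp
  then obtain L \<rho> where L: "\<rho> > 0" "\<And>y. cmod y < \<rho> \<Longrightarrow> cmod (F y - F 0) \<le> L * cmod y"
    by (auto simp: lipschitz0_def)
  have "cmod (p (Re y) - p (Re 0)) \<le> \<bar>L\<bar> * cmod y" if "cmod y < min r \<rho>" for y
  proof -
    have R: "\<bar>Re y\<bar> \<le> cmod y" by (rule abs_Re_le_cmod)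
    have "cmod (p (Re y) - p (Re 0)) = cmod (F (of_real (Re y)) - F 0)"
      using F(1) F(3)[of "Re y"] F(3)[of 0] R that by simp
    also have "\<dots> \<le> L * \<bar>Re y\<bar>" using L(2)[of "of_real (Re y)"] R that by simp
    also have "\<dots> \<le> \<bar>L\<bar> * cmod y" using R by (intro mult_mono) auto
    finally show ?thesis .
  qed
  then show ?thesis unfolding lipschitz0_def using F(1) L(1)
    by (intro exI[of _ "\<bar>L\<bar>"] exI[of _ "min r \<rho>"]) auto
qed

lemma rreg_cong:
  assumes "p 0 = q 0" "\<And>n. p (1 / (x + real n)) = q (1 / (x + real n))"
  shows "rreg s p x = rreg s q x"
  unfolding rreg_def
  by (rule reg_sum_cong) (simp add: assms(1), unfold of_real_inverse_add Re_complex_of_real, rule assms(2))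

lemma reg_sum_of_real:
  assumes "\<And>y. P (of_real y) = p y" "w = of_real x"
  shows "reg_sum s P w = rreg s p x"
  unfolding rreg_def assms(2)
proof (rule reg_sum_cong)
  show "P 0 = p (Re 0)" using assms(1)[of 0] by simp
  show "P (1 / (of_real x + of_nat n)) = p (Re (1 / (of_real x + of_nat n)))" for n
    unfolding of_real_inverse_add Re_complex_of_real by (rule assms(1))
qed

lemma rreg_rec:
  assumes "real_analytic_at p 0" "Re s > 0" "s \<noteq> 1/2" "x > 0"
  shows "rreg s p x = of_real x powr (-2 * s) * p (1 / x) + rreg s p (x + 1)"
  using reg_sum_rec[OF lipschitz0_real[OF assms(1)] assms(2) _ assms(3), of "of_real x"] assms(4)
  by (simp add: rreg_def)

lemma rreg_rec_n:
  fixes N :: nat and x :: real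
  assumes "real_analytic_at p 0" "Re s > 0" "s \<noteq> 1/2" "x > 0"
  shows "rreg s p x = (\<Sum>n<N. of_real (x + n) powr (-2 * s) * p (1 / (x + n))) + rreg s p (x + N)"
proof (induction N)
  case (Suc N)
  with rreg_rec[OF assms(1-3), of "x + N"] assms(4) show ?case by (simp add: add_ac)
qed simp

text \<open>Far out all points \<open>1 / (y + n)\<close> lie in the disk of the holomorphic
  extension at 0, so \<open>reg_sum_holomorphic\<close> covers the tail; the first \<open>N\<close>
  summands are handled one by one.\<close>

lemma rreg_analytic:
  assumes p: "real_analytic_at p 0" "\<And>n::nat. real_analytic_at p (1 / (x + n))"
    and s: "Re s > 0" "s \<noteq> 1/2" and x: "x > 0"
  shows "real_analytic_at (rreg s p) x"
proof -
  obtain r F where F: "r > 0" "F holomorphic_on ball 0 r" "\<And>y. \<bar>y\<bar> < r \<Longrightarrow> p y = F (of_real y)"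
    using real_analytic_atE[OF p(1)] by auto
  obtain N :: nat where N: "1 / r < real N" using reals_Archimedean2 by blast
  let ?W = "{w. 1 / r < Re w}"
  have lipF: "lipschitz0 F" by (rule lipschitz0_holomorphic[OF F(2,1)]) simp
  have "reg_sum s F holomorphic_on ?W"
  proof (rule reg_sum_holomorphic[OF lipF s(1)])
    show "open ?W" by (rule open_halfspace_Re_gt)
    show W: "Re w > 0" if "w \<in> ?W" for w using that F(1) by (smt (verit) divide_pos_pos mem_Collect_eq)
    fix n :: nat
    have b: "1 / (w + of_nat n) \<in> ball 0 r" if "w \<in> ?W" for w
    proof -
      have "1 / r < Re w + real n" using that by (simp add: add_strict_increasing2 add.commute)
      also have "\<dots> \<le> cmod (w + of_nat n)" using complex_Re_le_cmod[of "w + of_nat n"] by simp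
      finally have 1: "1 / r < cmod (w + of_nat n)" .
      then have "0 < cmod (w + of_nat n)" using F(1) by (smt (verit) divide_pos_pos)
      with 1 show ?thesis using F(1) by (simp add: norm_divide field_simps)
    qed
    have "w + of_nat n \<noteq> 0" if "w \<in> ?W" for w
    proof
      assume "w + of_nat n = 0"
      then have "Re (w + of_nat n) = 0" by simp
      with W[OF that] show False by simp
    qed
    then have "(\<lambda>w. 1 / (w + of_nat n)) holomorphic_on ?W" by (intro holomorphic_intros) auto
    moreover have "(\<lambda>w. 1 / (w + of_nat n)) ` ?W \<subseteq> ball 0 r" using b by blast
    ultimately show "(\<lambda>w. F (1 / (w + of_nat n))) holomorphic_on ?W"
      using holomorphic_on_compose_gen[OF _ F(2), of "\<lambda>w. 1 / (w + of_nat n)" ?W] by (simp add: o_def)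
  qed
  then have "real_analytic_at (\<lambda>y. reg_sum s F (of_real y)) (x + N)"
    by (rule real_analytic_at_holomorphic[OF open_halfspace_Re_gt]) (use N x in simp)
  then have "real_analytic_at (\<lambda>y. reg_sum s F (of_real (y + N))) x"
    using real_analytic_at_moebius[of "\<lambda>y. reg_sum s F (of_real y)" 1 x N 0 1] by simp
  moreover have "real_analytic_at (\<lambda>y. \<Sum>n<N. of_real (y + n) powr (-2 * s) * p (1 / (y + n))) x"
  proof (intro real_analytic_at_sum real_analytic_at_mult)
    fix n
    have "real_analytic_at (\<lambda>y. of_real \<bar>1 * y + real n\<bar> powr (-2 * s)) x"
      by (rule real_analytic_at_abs_powr) (use x in simp)
    then show "real_analytic_at (\<lambda>y. of_real (y + n) powr (-2 * s)) x"
    proof (rule real_analytic_at_cong)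
      show "\<forall>\<^sub>F y in nhds x. of_real (y + n) powr (-2 * s) = of_real \<bar>1 * y + real n\<bar> powr (-2 * s)"
        by (rule eventually_nhds_abs[where r = x]) (use x in auto)
    qed
    show "real_analytic_at (\<lambda>y. p (1 / (y + real n))) x"
      using real_analytic_at_moebius[of p 0 x 1 1 "real n"] p(2)[of n] x by simp
  qed
  ultimately have "real_analytic_at (\<lambda>y. (\<Sum>n<N. of_real (y + n) powr (-2 * s) * p (1 / (y + n))) + reg_sum s F (of_real (y + N))) x"
    by (intro real_analytic_at_add)
  then show ?thesis
  proof (rule real_analytic_at_cong)
    have "rreg s p y = (\<Sum>n<N. of_real (y + n) powr (-2 * s) * p (1 / (y + n))) + reg_sum s F (of_real (y + N))"
      if "\<bar>y - x\<bar> < x" for y :: real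
    proof -
      have y: "y > 0" using that by linarith
      have "rreg s p (y + N) = reg_sum s F (of_real (y + N))" unfolding rreg_def
      proof (rule reg_sum_cong)
        show "p (Re 0) = F 0" using F(3)[of 0] F(1) by simp
        fix n
        have "1 / r < y + real N + real n" using N y by linarith
        then have "\<bar>1 / (y + real N + real n)\<bar> < r" using F(1) y by (simp add: field_simps)
        then show "p (Re (1 / (complex_of_real (y + real N) + of_nat n))) = F (1 / (complex_of_real (y + real N) + of_nat n))"
          unfolding of_real_inverse_add Re_complex_of_real by (rule F(3))
      qed
      then show ?thesis using rreg_rec_n[OF p(1) s y, where N = N] by simp
    qed
    then show "\<forall>\<^sub>F y in nhds x. rreg s p y =
        (\<Sum>n<N. of_real (y + n) powr (-2 * s) * p (1 / (y + n))) + reg_sum s F (of_real (y + N))"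
      by (rule eventually_nhds_abs[OF _ x])
  qed
qed

section \<open>Reduction to one function and growth of its interval of analyticity\<close>

text \<open>The eigenfunction equation with \<open>f2\<close> eliminated: the right-hand side for
  \<open>f2\<close> at \<open>x\<close> is the one for \<open>f1\<close> at \<open>x - 1\<close>, so
  \<open>g (x - 1)\<close> takes the place of \<open>f2\<close>.\<close>

definition real_eigen :: "complex \<Rightarrow> (real \<Rightarrow> complex) \<Rightarrow> bool" where
  "real_eigen s g \<longleftrightarrow> (\<forall>x\<in>phi_interval. g x = rreg s (\<lambda>y. g (- y)) (x + 3) + rreg s (\<lambda>y. g (y - 1)) (2 - x))"

lemma real_analytic_at_neg: "real_analytic_at p (- x) \<Longrightarrow> real_analytic_at (\<lambda>y. p (- y)) x"
  using real_analytic_at_moebius[of p "-1" x 0 0 1] by simp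

lemma real_analytic_at_shift: "real_analytic_at p (x + a) \<Longrightarrow> real_analytic_at (\<lambda>y. p (y + a)) x"
  using real_analytic_at_moebius[of p 1 x a 0 1] by simp

lemma real_analytic_at_reflect: "real_analytic_at p (a - x) \<Longrightarrow> real_analytic_at (\<lambda>y. p (a - y)) x"
  using real_analytic_at_moebius[of p "-1" x a 0 1] by simp

definition transfer_real :: "complex \<Rightarrow> (real \<Rightarrow> complex) \<Rightarrow> (real \<Rightarrow> complex) \<Rightarrow> real \<Rightarrow> complex" where
  "transfer_real s p q x = rreg s (\<lambda>y. p (- y)) (x + 3) + rreg s q (2 - x)"

text \<open>In the stated range \<open>x + 3\<close> and \<open>2 - x\<close> exceed
  \<open>1 / b\<close>, so the summands evaluate \<open>p\<close> on (-b, 0] and \<open>q\<close> on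
  [0, b) only.\<close>

lemma transfer_real_analytic:
  assumes p: "\<And>x. - b < x \<Longrightarrow> x \<le> 0 \<Longrightarrow> real_analytic_at p x"
    and q: "\<And>x. 0 \<le> x \<Longrightarrow> x < b \<Longrightarrow> real_analytic_at q x"
    and s: "Re s > 0" "s \<noteq> 1/2" and b: "b > 0" and x: "- (3 - 1 / b) < x" "x < 2 - 1 / b"
  shows "real_analytic_at (transfer_real s p q) x"
proof -
  have small: "0 \<le> 1 / (y + real n) \<and> 1 / (y + real n) < b" if "1 / b < y" for y and n :: nat
  proof -
    have y: "0 < y" using that b by (smt (verit) divide_pos_pos)
    have "1 / (y + real n) \<le> 1 / y" using y by (intro divide_left_mono) auto
    also have "\<dots> < b" using that b y by (simp add: field_simps)
    finally show ?thesis using y by simp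
  qed
  have b0: "0 < 1 / b" using b by simp
  have pos: "0 < x + 3" "0 < 2 - x" using x b0 by linarith+
  have "real_analytic_at (rreg s (\<lambda>y. p (- y))) (x + 3)"
    by (rule rreg_analytic[OF _ _ s])
       (use small[of "x + 3"] x b b0 pos in \<open>auto intro!: real_analytic_at_neg p simp del: minus_divide_left\<close>)
  then have "real_analytic_at (\<lambda>y. rreg s (\<lambda>y. p (- y)) (y + 3)) x"
    by (rule real_analytic_at_shift)
  moreover have "real_analytic_at (rreg s q) (2 - x)"
    by (rule rreg_analytic[OF _ _ s]) (use small[of "2 - x"] x b b0 pos in \<open>auto intro!: q\<close>)
  then have "real_analytic_at (\<lambda>y. rreg s q (2 - y)) x"
    by (rule real_analytic_at_reflect)
  ultimately show ?thesis unfolding transfer_real_def by (rule real_analytic_at_add)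
qed

lemma transfer_real_cong:
  assumes p: "\<And>x. - b < x \<Longrightarrow> x \<le> 0 \<Longrightarrow> p x = p' x" and q: "\<And>x. 0 \<le> x \<Longrightarrow> x < b \<Longrightarrow> q x = q' x"
    and b: "b > 0" and x: "- (3 - 1 / b) < x" "x < 2 - 1 / b"
  shows "transfer_real s p q x = transfer_real s p' q' x"
proof -
  have small: "0 \<le> 1 / (y + real n) \<and> 1 / (y + real n) < b" if "1 / b < y" for y and n :: nat
  proof -
    have y: "0 < y" using that b by (smt (verit) divide_pos_pos)
    have "1 / (y + real n) \<le> 1 / y" using y by (intro divide_left_mono) auto
    also have "\<dots> < b" using that b y by (simp add: field_simps)
    finally show ?thesis using y by simp
  qed
  have "rreg s (\<lambda>y. p (- y)) (x + 3) = rreg s (\<lambda>y. p' (- y)) (x + 3)"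
  proof (rule rreg_cong)
    show "p (- 0) = p' (- 0)" by (rule p) (use b in auto)
    show "p (- (1 / (x + 3 + real n))) = p' (- (1 / (x + 3 + real n)))" for n
      by (rule p) (use small[of "x + 3" n] x in auto)
  qed
  moreover have "rreg s q (2 - x) = rreg s q' (2 - x)"
  proof (rule rreg_cong)
    show "q 0 = q' 0" by (rule q) (use b in auto)
    show "q (1 / (2 - x + real n)) = q' (1 / (2 - x + real n))" for n
      by (rule q) (use small[of "2 - x" n] x in auto)
  qed
  ultimately show ?thesis by (simp add: transfer_real_def)
qed

text \<open>Extent of analyticity after \<open>j\<close> applications of the operator, starting with
  the unit disk; the recursion is that of \<open>transfer_real_analytic\<close>. Its limit is the
  fixed point \<open>phi + 1\<close>, that is \<open>phi\<^sup>2\<close>.\<close>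

fun itv :: "nat \<Rightarrow> real" where
  "itv 0 = 1" | "itv (Suc j) = 3 - 1 / itv j"

lemma itv_bounds: "1 \<le> itv j \<and> itv j < phi + 1"
proof (induction j)
  case (Suc j)
  have "1 / (phi + 1) < 1 / itv j" using Suc by (intro divide_strict_left_mono) auto
  moreover have "1 / itv j \<le> 1" using Suc by simp
  ultimately show ?case using phi_inverse by simp
qed (use phi_gt in simp)

lemma itv_ge_2: "2 \<le> itv (Suc j)"
proof -
  have "1 / itv j \<le> 1" using itv_bounds[of j] by simp
  then show ?thesis by simp
qed

lemma itv_mono: "itv j \<le> itv (Suc j)"
proof (induction j)
  case (Suc j)
  have "1 / itv (Suc j) \<le> 1 / itv j" using Suc itv_bounds[of j] by (intro divide_left_mono) auto
  then show ?case by simp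
qed simp

lemma itv_incseq: "j \<le> k \<Longrightarrow> itv j \<le> itv k"
  by (rule lift_Suc_mono_le[of itv, OF itv_mono])

text \<open>Because \<open>itv j \<ge> 1\<close>, one step shrinks the distance to the fixed point
  at least by the factor \<open>1 / (phi + 1)\<close>; the initial distance is
  \<open>phi\<close>.\<close>

lemma itv_tendsto: "phi + 1 - itv j \<le> phi / (phi + 1) ^ j"
proof (induction j)
  case (Suc j)
  let ?b = "itv j"
  have b: "1 \<le> ?b" "?b < phi + 1" using itv_bounds by auto
  have "phi + 1 - itv (Suc j) = 1 / ?b - 1 / (phi + 1)" using phi_inverse by simp
  also have "\<dots> = (phi + 1 - ?b) / (?b * (phi + 1))" using b phi_gt by (simp add: field_simps)
  also have "\<dots> \<le> (phi + 1 - ?b) / (phi + 1)"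
    using b phi_gt by (intro divide_left_mono) (auto simp: mult_le_cancel_right2)
  also have "\<dots> \<le> phi / (phi + 1) ^ j / (phi + 1)"
    using Suc phi_gt by (intro divide_right_mono) auto
  finally show ?case by (simp add: mult.commute)
qed simp

lemma itv_exhaust:
  assumes "x < phi + 1" obtains j where "x < itv j"
proof -
  have "(\<lambda>j. phi * (1 / (phi + 1)) ^ j) \<longlonglongrightarrow> phi * 0"
    by (intro tendsto_mult tendsto_const LIMSEQ_power_zero) (use phi_gt in auto)
  then have "\<forall>\<^sub>F j in sequentially. phi * (1 / (phi + 1)) ^ j < phi + 1 - x"
    by (rule order_tendstoD) (use assms in simp)
  then obtain j where "phi * (1 / (phi + 1)) ^ j < phi + 1 - x"
    using eventually_happens'[OF sequentially_bot] by blast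
  with itv_tendsto[of j] show ?thesis by (intro that[of j]) (simp add: power_one_over field_simps)
qed

text \<open>The operator does not change an eigenfunction, but its result is analytic on a larger
  interval than its input. The iterates agree wherever earlier ones are controlled, and by
  \<open>itv_exhaust\<close> they cover the whole interval, so they glue to
  \<open>g\<close>.\<close>

lemma transfer_fixed_imp_real_eigen:
  assumes s: "Re s > 0" "s \<noteq> 1/2" and f: "(f1, f2) \<in> transfer_fixed s"
  obtains g where "analytic_extension f1 g" "real_eigen s g"
proof -
  have da: "f1 \<in> disk_algebra" "f2 \<in> disk_algebra" and
    eq: "\<And>z. z \<in> cball 0 1 \<Longrightarrow> f1 z = reg_sum s (\<lambda>y. f1 (- y)) (z + 3) + reg_sum s f2 (2 - z)"
        "\<And>z. z \<in> cball 0 1 \<Longrightarrow> f2 z = reg_sum s (\<lambda>y. f1 (- y)) (z + 2) + reg_sum s f2 (3 - z)"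
    using f unfolding transfer_fixed_iff[OF s] by auto
  define r1 r2 where "r1 x = f1 (of_real x)" and "r2 x = f2 (of_real x)" for x
  have an0: "real_analytic_at r1 x" "real_analytic_at r2 x" if "\<bar>x\<bar> < 1" for x
    unfolding r1_def r2_def using da that
    by (auto simp: disk_algebra_def intro!: real_analytic_at_holomorphic[of "ball 0 1"])
  \<comment> \<open>The iterates on the real line. From index 1 on the second component is the shift
    of the first, which is the elimination of \<open>f2\<close>.\<close>
  define uv where "uv = rec_nat (r1, r2) (\<lambda>_ (u, v). (transfer_real s u v, \<lambda>x. transfer_real s u v (x - 1)))"
  define u v where "u j = fst (uv j)" and "v j = snd (uv j)" for j
  have uv0: "u 0 = r1" "v 0 = r2" by (simp_all add: u_def v_def uv_def)
  have uvS: "u (Suc j) = transfer_real s (u j) (v j)" "v (Suc j) = (\<lambda>x. u (Suc j) (x - 1))" for j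
    by (simp_all add: u_def v_def uv_def split_beta)
  have an: "(\<forall>x. - itv j < x \<and> x \<le> 0 \<longrightarrow> real_analytic_at (u j) x) \<and> (\<forall>x. 0 \<le> x \<and> x < itv j \<longrightarrow> real_analytic_at (v j) x)
     \<and> (\<forall>x. - itv (Suc j) < x \<and> x < itv (Suc j) - 1 \<longrightarrow> real_analytic_at (u (Suc j)) x)" for j
  proof (induction j)
    case 0
    have "real_analytic_at (u (Suc 0)) x" if "- itv (Suc 0) < x \<and> x < itv (Suc 0) - 1" for x
      unfolding uvS uv0 by (rule transfer_real_analytic[of 1]) (use that an0 s in auto)
    with an0 show ?case by (auto simp: uv0)
  next
    case (Suc j)
    have 1: "real_analytic_at (u (Suc j)) x" if "- itv (Suc j) < x \<and> x < itv (Suc j) - 1" for x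
      using Suc that by blast
    have u: "real_analytic_at (u (Suc j)) x" if "- itv (Suc j) < x" "x \<le> 0" for x
      by (rule 1) (use that itv_ge_2[of j] in linarith)
    have v: "real_analytic_at (v (Suc j)) x" if "0 \<le> x" "x < itv (Suc j)" for x
      unfolding uvS(2)[of j] diff_conv_add_uminus
      by (intro real_analytic_at_shift 1) (use that itv_ge_2[of j] in linarith)
    have "real_analytic_at (u (Suc (Suc j))) x" if "- itv (Suc (Suc j)) < x \<and> x < itv (Suc (Suc j)) - 1" for x
      unfolding uvS(1)[of "Suc j"]
      by (rule transfer_real_analytic[OF u v s]) (use that itv_bounds[of "Suc j"] in auto)
    with u v show ?case by blast
  qed
  \<comment> \<open>For \<open>j = 0\<close> this is the eigenfunction equation on the closed disk;
    afterwards equal inputs on the smaller interval give equal outputs on the larger one.\<close>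
  have stab: "(\<forall>x. - itv j < x \<and> x \<le> 0 \<longrightarrow> u (Suc j) x = u j x) \<and> (\<forall>x. 0 \<le> x \<and> x < itv j \<longrightarrow> v (Suc j) x = v j x)" for j
  proof (induction j)
    case 0
    have A: "transfer_real s r1 r2 x = r1 x" if "\<bar>x\<bar> \<le> 1" for x
    proof -
      have "r1 x = reg_sum s (\<lambda>y. f1 (- y)) (of_real x + 3) + reg_sum s f2 (2 - of_real x)"
        unfolding r1_def by (rule eq(1)) (use that in simp)
      moreover have "reg_sum s (\<lambda>y. f1 (- y)) (of_real x + 3) = rreg s (\<lambda>y. r1 (- y)) (x + 3)"
        by (rule reg_sum_of_real) (simp_all add: r1_def)
      moreover have "reg_sum s f2 (2 - of_real x) = rreg s r2 (2 - x)"
        by (rule reg_sum_of_real) (simp_all add: r2_def)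
      ultimately show ?thesis by (simp add: transfer_real_def)
    qed
    have B: "transfer_real s r1 r2 (x - 1) = r2 x" if "\<bar>x\<bar> \<le> 1" for x
    proof -
      have "r2 x = reg_sum s (\<lambda>y. f1 (- y)) (of_real x + 2) + reg_sum s f2 (3 - of_real x)"
        unfolding r2_def by (rule eq(2)) (use that in simp)
      moreover have "reg_sum s (\<lambda>y. f1 (- y)) (of_real x + 2) = rreg s (\<lambda>y. r1 (- y)) (x + 2)"
        by (rule reg_sum_of_real) (simp_all add: r1_def)
      moreover have "reg_sum s f2 (3 - of_real x) = rreg s r2 (3 - x)"
        by (rule reg_sum_of_real) (simp_all add: r2_def)
      ultimately show ?thesis by (simp add: transfer_real_def algebra_simps)
    qed
    show ?case unfolding uvS uv0 itv.simps
      by (intro conjI allI impI; (rule A | rule B); simp)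
  next
    case (Suc j)
    have b: "itv j > 0" using itv_bounds[of j] by linarith
    have 1: "u (Suc (Suc j)) x = u (Suc j) x" if "- itv (Suc j) < x" "x < itv (Suc j) - 1" for x
      unfolding uvS(1)[of "Suc j"] uvS(1)[of j]
      by (rule transfer_real_cong[of "itv j"]) (use Suc that b in \<open>auto simp flip: uvS\<close>)
    then show ?case using itv_ge_2[of j] by (auto simp: uvS(2)[of "Suc j"] uvS(2)[of j])
  qed
  have stab1: "u (Suc (Suc j)) x = u (Suc j) x" if "- itv (Suc j) < x" "x < itv (Suc j) - 1" for x j
  proof -
    have b: "itv j > 0" using itv_bounds[of j] by linarith
    show ?thesis unfolding uvS(1)[of "Suc j"] uvS(1)[of j]
      by (rule transfer_real_cong[of "itv j"]) (use stab[of j] that b in \<open>auto simp flip: uvS\<close>)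
  qed
  have stab2: "u (Suc j + k) x = u (Suc j) x" if "- itv (Suc j) < x" "x < itv (Suc j) - 1" for x j k
  proof (induction k)
    case (Suc k)
    have "itv (Suc j) \<le> itv (Suc (j + k))" by (rule itv_incseq) simp
    then have "u (Suc (Suc (j + k))) x = u (Suc (j + k)) x" by (intro stab1) (use that in auto)
    with Suc show ?case by simp
  qed simp
  have ex: "\<exists>j. - itv (Suc j) < x \<and> x < itv (Suc j) - 1" if "x \<in> phi_interval" for x
  proof -
    have x: "- x < phi + 1" "x + 1 < phi + 1" using that by (auto simp: phi_power2)
    obtain j1 where j1: "- x < itv j1" using itv_exhaust[OF x(1)] .
    obtain j2 where j2: "x + 1 < itv j2" using itv_exhaust[OF x(2)] .
    have "itv j1 \<le> itv (Suc (max j1 j2))" "itv j2 \<le> itv (Suc (max j1 j2))"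
      by (rule itv_incseq, simp)+
    with j1 j2 show ?thesis by (intro exI[of _ "max j1 j2"]) linarith
  qed
  \<comment> \<open>By \<open>stab2\<close> every admissible index gives the same value, so the
    choice is immaterial.\<close>
  define g where "g x = (if x \<in> phi_interval then u (Suc (SOME j. - itv (Suc j) < x \<and> x < itv (Suc j) - 1)) x else 0)" for x
  have g: "g x = u (Suc j) x" if x: "- itv (Suc j) < x" "x < itv (Suc j) - 1" for j x
  proof -
    have I: "x \<in> phi_interval" using x itv_bounds[of "Suc j"] by (simp add: phi_power2)
    define k where "k = (SOME j. - itv (Suc j) < x \<and> x < itv (Suc j) - 1)"
    have k: "- itv (Suc k) < x" "x < itv (Suc k) - 1" using someI_ex[OF ex[OF I]] by (simp_all add: k_def)
    have "u (Suc k) x = u (Suc (max j k)) x"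
      using stab2[OF k, of "max j k - k"] by simp
    also have "\<dots> = u (Suc j) x" using stab2[OF x, of "max j k - j"] by simp
    finally show ?thesis unfolding g_def k_def[symmetric] using I by (simp del: itv.simps)
  qed
  have gan: "real_analytic_at g x" if "x \<in> phi_interval" for x
  proof -
    obtain j where j: "- itv (Suc j) < x" "x < itv (Suc j) - 1" using ex[OF \<open>x \<in> phi_interval\<close>] by blast
    show ?thesis
    proof (rule real_analytic_at_cong)
      show "real_analytic_at (u (Suc j)) x" using an j by blast
      have "\<forall>\<^sub>F y in nhds x. y \<in> {- itv (Suc j) <..< itv (Suc j) - 1}"
        by (rule eventually_nhds_in_open) (use j in auto)
      then show "\<forall>\<^sub>F y in nhds x. g y = u (Suc j) y" by eventually_elim (use g in auto)
    qed
  qed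
  have ge: "g x = rreg s (\<lambda>y. g (- y)) (x + 3) + rreg s (\<lambda>y. g (y - 1)) (2 - x)" if "x \<in> phi_interval" for x
  proof -
    obtain j where j: "- itv (Suc j) < x" "x < itv (Suc j) - 1" using ex[OF \<open>x \<in> phi_interval\<close>] by blast
    have j': "- itv (Suc (Suc j)) < x" "x < itv (Suc (Suc j)) - 1" using j itv_mono[of "Suc j"] by linarith+
    have "g x = u (Suc (Suc j)) x" by (rule g) (use j' in auto)
    also have "\<dots> = transfer_real s g (\<lambda>y. g (y - 1)) x"
      unfolding uvS(1)[of "Suc j"]
    proof (rule transfer_real_cong[of "itv (Suc j)"])
      show "u (Suc j) y = g y" if "- itv (Suc j) < y" "y \<le> 0" for y
        by (rule g[symmetric]) (use that itv_ge_2[of j] in linarith)+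
      show "v (Suc j) y = g (y - 1)" if "0 \<le> y" "y < itv (Suc j)" for y
        unfolding uvS(2)[of j] by (rule g[symmetric]) (use that itv_ge_2[of j] in linarith)+
    qed (use j' itv_ge_2[of j] in auto)
    finally show ?thesis by (simp add: transfer_real_def)
  qed
  show ?thesis
  proof (rule that)
    have "g x = r1 x" if "\<bar>x\<bar> < 1" for x
    proof -
      have "g x = u (Suc 0) x" by (rule g) (use that in auto)
      also have "\<dots> = transfer_real s r1 r2 x" by (simp add: uvS uv0)
      also have "\<dots> = r1 x"
      proof -
        have "r1 x = reg_sum s (\<lambda>y. f1 (- y)) (of_real x + 3) + reg_sum s f2 (2 - of_real x)"
          unfolding r1_def by (rule eq(1)) (use that in simp)
        moreover have "reg_sum s (\<lambda>y. f1 (- y)) (of_real x + 3) = rreg s (\<lambda>y. r1 (- y)) (x + 3)"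
          by (rule reg_sum_of_real) (simp_all add: r1_def)
        moreover have "reg_sum s f2 (2 - of_real x) = rreg s r2 (2 - x)"
          by (rule reg_sum_of_real) (simp_all add: r2_def)
        ultimately show ?thesis by (simp add: transfer_real_def)
      qed
      finally show ?thesis .
    qed
    moreover have "g x = 0" if "x \<notin> phi_interval" for x
      unfolding g_def using that by (rule if_not_P)
    ultimately show "analytic_extension f1 g"
      unfolding analytic_extension_def analytic_fun_on_def using gan by (auto simp: r1_def)
    show "real_eigen s g" unfolding real_eigen_def using ge by blast
  qed
qed

lemma analytic_extension_unique:
  assumes "analytic_extension f g" "analytic_extension f h"
  shows "g = h"
proof
  fix x
  show "g x = h x"
  proof (cases "x \<in> phi_interval")
    case True
    show ?thesis
    proof (rule real_analytic_identity[of phi_interval g h 0])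
      have "\<forall>\<^sub>F y in nhds (0::real). y \<in> {-1<..<1}" by (rule eventually_nhds_in_open) auto
      then show "\<forall>\<^sub>F y in nhds 0. g y = h y"
        by eventually_elim (use assms in \<open>auto simp: analytic_extension_def\<close>)
    qed (use assms True phi_gt in \<open>auto simp: analytic_extension_def analytic_fun_on_def phi_power2\<close>)
  qed (use assms in \<open>auto simp: analytic_extension_def analytic_fun_on_def\<close>)
qed

text \<open>The bounds come from X and TX, since \<open>- (phi\<^sup>2) + 1 = - phi\<close>.\<close>

lemma FE4_intersection:
  assumes "Fin x \<in> Fin ` phi_interval \<inter> moebius ((inverse gT)^2 * gS) ` Fin ` phi_interval \<inter> moebius gT ` Fin ` phi_interval
        \<inter> moebius (gT^2 * gS * gT) ` Fin ` phi_interval"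
  shows "- phi < x \<and> x < phi"
proof -
  have 1: "Fin x \<in> moebius gT ` Fin ` phi_interval" and 2: "Fin x \<in> Fin ` phi_interval"
    using assms by (simp_all only: Int_iff)
  from 1 obtain p where p: "Fin x = moebius gT p" "p \<in> Fin ` phi_interval" by (rule imageE)
  from p(2) obtain y where y: "p = Fin y" "y \<in> phi_interval" by (rule imageE)
  from 2 obtain x' where x': "Fin x = Fin x'" "x' \<in> phi_interval" by (rule imageE)
  have "x = y + 1" using p(1) y(1) by (simp add: gT_psl moebius_psl)
  then show ?thesis using y(2) x' by (simp add: phi_power2)
qed

lemma slash_words:
  "slash s g (gS * gT\<^sup>2) x = of_real \<bar>x + 2\<bar> powr (-2 * s) * g (-1 / (x + 2))"
  "slash s g (inverse gT) x = g (x - 1)"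
  "slash s g (inverse gT * gS * (inverse gT)\<^sup>2) x = of_real \<bar>x - 2\<bar> powr (-2 * s) * g ((1 - x) / (x - 2))"
proof -
  have 1: "gS * gT\<^sup>2 = psl 0 (-1) 1 2" by (simp add: psl_word_simps)
  have 2: "inverse gT * gS * (inverse gT)\<^sup>2 = psl (-1) 1 1 (-2)" by (simp add: psl_word_simps)
  show "slash s g (gS * gT\<^sup>2) x = of_real \<bar>x + 2\<bar> powr (-2 * s) * g (-1 / (x + 2))"
    by (simp add: 1 slash_psl rslash_def)
  show "slash s g (inverse gT) x = g (x - 1)"
    by (simp add: gT_inverse_psl slash_psl rslash_def)
  show "slash s g (inverse gT * gS * (inverse gT)\<^sup>2) x = of_real \<bar>x - 2\<bar> powr (-2 * s) * g ((1 - x) / (x - 2))"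
    by (simp add: 2 slash_psl rslash_def)
qed

lemma real_eigen_FE4:
  assumes s: "Re s > 0" "s \<noteq> 1/2" and g: "g \<in> analytic_fun_on phi_interval" and e: "real_eigen s g"
    and x: "- phi < x" "x < phi"
  shows "(g + slash s g (gS * gT^2)) x = (slash s g (inverse gT) + slash s g (inverse gT * gS * (inverse gT)^2)) x"
proof -
  define A B where "A = rreg s (\<lambda>y. g (- y))" and "B = rreg s (\<lambda>y. g (y - 1))"
  have an: "real_analytic_at g y" if "y \<in> phi_interval" for y using g that by (simp add: analytic_fun_on_def)
  have g1: "g x = A (x + 3) + B (2 - x)" using e x phi_gt by (simp add: real_eigen_def A_def B_def phi_power2)
  have "x - 1 \<in> phi_interval" using x by (simp add: phi_power2)
  then have "g (x - 1) = A (x - 1 + 3) + B (2 - (x - 1))" using e by (auto simp: real_eigen_def A_def B_def)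
  then have g2: "g (x - 1) = A (x + 2) + B (3 - x)" by (simp add: algebra_simps)
  \<comment> \<open>The summand split off here is g|ST^2; the one split off from \<open>B\<close> is
    g|T^(-1)ST^(-2), by the identity for \<open>1 / (2 - x) - 1\<close> below.\<close>
  have A: "A (x + 2) = of_real (x + 2) powr (-2 * s) * g (- (1 / (x + 2))) + A (x + 2 + 1)"
    unfolding A_def
    by (rule rreg_rec[OF _ s]) (use x phi_gt in \<open>auto intro!: real_analytic_at_neg an simp: phi_power2\<close>)
  have B: "B (2 - x) = of_real (2 - x) powr (-2 * s) * g (1 / (2 - x) - 1) + B (2 - x + 1)"
    unfolding B_def
    by (rule rreg_rec[OF _ s]) (use x phi_gt in \<open>auto intro!: real_analytic_at_shift[of g _ "-1", simplified] an simp: phi_power2\<close>)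
  have "1 / (2 - x) - 1 = (1 - x) / (x - 2)" using x phi_gt by (simp add: field_simps)
  then show ?thesis using g1 g2 A B x phi_gt
    unfolding plus_fun_apply slash_words by (simp add: algebra_simps)
qed

lemma real_eigen_imp_FE4:
  assumes "Re s > 0" "s \<noteq> 1/2" "g \<in> analytic_fun_on phi_interval" "real_eigen s g"
  shows "g \<in> FE4 s phi_interval"
  unfolding FE4_def using assms(3) real_eigen_FE4[OF assms] FE4_intersection by blast

section \<open>Holomorphic extension of eigenfunctions\<close>

lemma holomorphic_eq_from_reals:
  assumes S: "open S" "connected S" and hol: "F holomorphic_on S" "G holomorphic_on S"
    and \<rho>: "of_real \<rho> \<in> S" "\<forall>\<^sub>F y in nhds \<rho>. F (of_real y) = G (of_real y)" and w: "w \<in> S"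
  shows "F w = G w"
proof -
  obtain e1 where e1: "e1 > 0" "ball (of_real \<rho>) e1 \<subseteq> S" using S(1) \<rho>(1) open_contains_ball by blast
  obtain e2 where e2: "e2 > 0" "\<And>y. \<bar>y - \<rho>\<bar> < e2 \<Longrightarrow> F (of_real y) = G (of_real y)"
    using \<rho>(2) unfolding eventually_nhds_metric by (auto simp: dist_norm)
  define e where "e = min e1 e2"
  have e: "e > 0" "e \<le> e1" "e \<le> e2" using e1 e2 by (auto simp: e_def)
  define U where "U = complex_of_real ` {\<rho> - e <..< \<rho> + e}"
  have "(\<lambda>z. F z - G z) w = 0"
  proof (rule analytic_continuation[where f = "\<lambda>z. F z - G z" and U = U and \<xi> = "of_real \<rho>", OF _ S _ _ _ _ w])
    show "(\<lambda>z. F z - G z) holomorphic_on S" by (intro holomorphic_intros hol)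
    show "U \<subseteq> S"
    proof
      fix z assume "z \<in> U"
      then have "z \<in> ball (of_real \<rho>) e1"
        using e by (auto simp: U_def dist_norm abs_less_iff simp flip: of_real_diff)
      then show "z \<in> S" using e1 by blast
    qed
    show "complex_of_real \<rho> islimpt U"
    proof (unfold islimpt_approachable, intro allI impI)
      fix d :: real assume d: "d > 0"
      define y where "y = \<rho> + min d e / 2"
      have "complex_of_real y \<in> U" unfolding U_def by (rule imageI) (use d e in \<open>auto simp: y_def\<close>)
      moreover have "complex_of_real y \<noteq> of_real \<rho>" using d e by (simp add: y_def)
      moreover have "\<bar>y - \<rho>\<bar> < d" using d e by (simp add: y_def)
      then have "dist (complex_of_real y) (of_real \<rho>) < d" by (simp add: dist_norm flip: of_real_diff)
      ultimately show "\<exists>x'\<in>U. x' \<noteq> complex_of_real \<rho> \<and> dist x' (complex_of_real \<rho>) < d" by blast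
    qed
    show "F z - G z = 0" if "z \<in> U" for z
      using that e e2(2) by (auto simp: U_def abs_less_iff)
  qed (rule \<rho>(1))
  then show ?thesis by simp
qed

lemma holomorphic_on_shift:
  assumes "f holomorphic_on T" "\<And>z. z \<in> S \<Longrightarrow> z + b \<in> T"
  shows "(\<lambda>z. f (z + b)) holomorphic_on S"
proof -
  have "(\<lambda>z. z + b) holomorphic_on S" by (intro holomorphic_intros)
  from holomorphic_on_compose_gen[OF this assms(1)] assms(2) show ?thesis
    by (simp add: o_def image_subset_iff)
qed

lemma holomorphic_on_reflect:
  assumes "f holomorphic_on T" "\<And>z. z \<in> S \<Longrightarrow> b - z \<in> T"
  shows "(\<lambda>z. f (b - z)) holomorphic_on S"
proof -
  have "(\<lambda>z. b - z) holomorphic_on S" by (intro holomorphic_intros)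
  from holomorphic_on_compose_gen[OF this assms(1)] assms(2) show ?thesis
    by (simp add: o_def image_subset_iff)
qed

text \<open>A Lebesgue number for the covering of the segment by disks of local extensions gives one
  width for all points. Extensions at two centres agree on the intersection of their disks, which is
  convex and meets the real line, so they patch together.\<close>

lemma real_analytic_strip_extension:
  fixes a b :: real
  assumes g: "\<And>x. a \<le> x \<Longrightarrow> x \<le> b \<Longrightarrow> real_analytic_at g x"
  obtains \<eta> F where "\<eta> > 0" "F holomorphic_on {z. a < Re z \<and> Re z < b \<and> \<bar>Im z\<bar> < \<eta>}"
    "\<And>x. a < x \<Longrightarrow> x < b \<Longrightarrow> F (of_real x) = g x"
proof -
  define good where "good x r F \<longleftrightarrow> F holomorphic_on ball (of_real x) r \<and>
     (\<forall>y. \<bar>y - x\<bar> < r \<longrightarrow> g y = F (of_real y))" for x :: real and r :: real and F :: "complex \<Rightarrow> complex"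
  define \<G> where "\<G> = {ball (complex_of_real x) r | x r. r > 0 \<and> (\<exists>F. good x r F)}"
  have "\<exists>e>0. \<forall>x\<in>complex_of_real ` {a..b}. \<exists>G\<in>\<G>. ball x e \<subseteq> G"
  proof (rule Heine_Borel_lemma)
    show "compact (complex_of_real ` {a..b})"
      by (intro compact_continuous_image continuous_intros) auto
    show "complex_of_real ` {a..b} \<subseteq> \<Union> \<G>"
    proof
      fix z assume "z \<in> complex_of_real ` {a..b}"
      then obtain x where x: "z = of_real x" "a \<le> x" "x \<le> b" by auto
      obtain r F where F: "r > 0" "F holomorphic_on ball (of_real x) r" "\<And>y. \<bar>y - x\<bar> < r \<Longrightarrow> g y = F (of_real y)"
        using real_analytic_atE[OF g[OF x(2,3)]] by blast
      then have "ball (of_real x) r \<in> \<G>" unfolding \<G>_def good_def by blast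
      moreover have "z \<in> ball (of_real x) r" using F(1) x(1) by simp
      ultimately show "z \<in> \<Union> \<G>" by blast
    qed
    show "open G" if "G \<in> \<G>" for G using that by (auto simp: \<G>_def)
  qed blast
  then obtain \<eta> where \<eta>: "\<eta> > 0" "\<And>x. x \<in> {a..b} \<Longrightarrow> \<exists>G\<in>\<G>. ball (complex_of_real x) \<eta> \<subseteq> G" by blast
  have ex: "\<exists>F. good x \<eta> F" if x: "x \<in> {a..b}" for x
  proof -
    obtain x' r F where F: "good x' r F" "ball (complex_of_real x) \<eta> \<subseteq> ball (of_real x') r"
      using \<eta>(2)[OF x] by (auto simp: \<G>_def)
    have "good x \<eta> F" unfolding good_def
    proof (intro conjI allI impI)
      show "F holomorphic_on ball (of_real x) \<eta>" using F holomorphic_on_subset by (auto simp: good_def)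
      fix y assume "\<bar>y - x\<bar> < \<eta>"
      then have "complex_of_real y \<in> ball (of_real x) \<eta>"
        by (simp add: dist_norm abs_minus_commute flip: of_real_diff)
      then have "complex_of_real y \<in> ball (of_real x') r" using F(2) by blast
      then have "\<bar>y - x'\<bar> < r" by (simp add: dist_norm abs_minus_commute flip: of_real_diff)
      then show "g y = F (of_real y)" using F(1) by (simp add: good_def)
    qed
    then show ?thesis by blast
  qed
  define E where "E x = (SOME F. good x \<eta> F)" for x
  have E: "good x \<eta> (E x)" if "x \<in> {a..b}" for x unfolding E_def by (rule someI_ex[OF ex[OF that]])
  \<comment> \<open>The extension centred at the foot point of \<open>z\<close> is used;
    \<open>loc\<close> shows that any other disk containing \<open>z\<close> gives the same
    value.\<close>
  define F where "F z = E (Re z) z" for z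
  let ?S = "{z. a < Re z \<and> Re z < b \<and> \<bar>Im z\<bar> < \<eta>}"
  have loc: "F z = E x z" if z: "z \<in> ?S" and x: "x \<in> {a..b}" and zx: "z \<in> ball (of_real x) \<eta>" for z x
  proof -
    let ?U = "ball (complex_of_real x) \<eta> \<inter> ball (complex_of_real (Re z)) \<eta>"
    have R: "Re z \<in> {a..b}" using z by simp
    have near: "\<bar>Re z - x\<bar> < \<eta>"
      using zx abs_Re_le_cmod[of "of_real x - z"] by (simp add: dist_norm abs_minus_commute)
    have "E (Re z) z = E x z"
    proof (rule holomorphic_eq_from_reals[of ?U "E (Re z)" "E x" "Re z" z])
      show "open ?U" by auto
      show "connected ?U" by (intro convex_connected convex_Int) auto
      show "E (Re z) holomorphic_on ?U" "E x holomorphic_on ?U"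
        using E[OF R] E[OF x] by (auto simp: good_def elim: holomorphic_on_subset)
      show "complex_of_real (Re z) \<in> ?U"
        using near \<eta>(1) by (simp add: dist_norm abs_minus_commute flip: of_real_diff)
      have "\<forall>\<^sub>F y in nhds (Re z). y \<in> ball x \<eta> \<inter> ball (Re z) \<eta>"
        by (rule eventually_nhds_in_open) (use near \<eta>(1) in \<open>auto simp: dist_norm abs_minus_commute\<close>)
      then show "\<forall>\<^sub>F y in nhds (Re z). E (Re z) (of_real y) = E x (of_real y)"
      proof eventually_elim
        case (elim y)
        then have "g y = E (Re z) (of_real y)" "g y = E x (of_real y)"
          using E[OF R] E[OF x] by (auto simp: good_def dist_norm abs_minus_commute)
        then show ?case by simp
      qed
      have "cmod (z - of_real (Re z)) = \<bar>Im z\<bar>" by (simp add: cmod_def)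
      then show "z \<in> ?U" using zx z by (simp add: dist_norm norm_minus_commute)
    qed
    then show ?thesis by (simp add: F_def)
  qed
  have op: "open ?S"
    by (intro open_Collect_conj open_Collect_less continuous_intros)
  have hol: "F holomorphic_on ?S"
  proof (rule holomorphic_onI)
    fix z assume z: "z \<in> ?S"
    let ?U = "?S \<inter> ball (of_real (Re z)) \<eta>"
    have R: "Re z \<in> {a..b}" using z by simp
    have "cmod (z - of_real (Re z)) = \<bar>Im z\<bar>" by (simp add: cmod_def)
    then have zU: "z \<in> ?U" using z by (simp add: dist_norm norm_minus_commute)
    have opU: "open ?U" using op by auto
    have "E (Re z) holomorphic_on ?U" using E[OF R] by (auto simp: good_def elim: holomorphic_on_subset)
    then have "F holomorphic_on ?U" by (rule holomorphic_transform) (use loc R in auto)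
    then have "F field_differentiable at z" using opU zU holomorphic_on_imp_differentiable_at by blast
    then show "F field_differentiable at z within ?S" by (rule field_differentiable_at_within)
  qed
  show ?thesis
  proof (rule that[OF \<eta>(1) hol])
    fix x assume x: "a < x" "x < b"
    then have "good x \<eta> (E x)" by (intro E) auto
    then show "F (of_real x) = g x" using \<eta>(1) by (simp add: F_def good_def)
  qed
qed

text \<open>The real parts fill an interval that contains 0 and -1, where the numerators of the two
  sums are expanded, and whose closure lies in \<open>phi_interval\<close>. For such
  \<open>z\<close> both \<open>z + 3\<close> and \<open>2 - z\<close> have real part above 3/2, so
  the points evaluated by the sums have real part in it again.\<close>

definition strip :: "real \<Rightarrow> complex set" where
  "strip \<eta> = {z. - (3/2) < Re z \<and> Re z < 1/2 \<and> \<bar>Im z\<bar> < \<eta>}"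

lemma open_strip: "open (strip \<eta>)"
  unfolding strip_def by (intro open_Collect_conj open_Collect_less continuous_intros)

lemma convex_strip: "convex (strip \<eta>)"
proof -
  have "strip \<eta> = {z. Re z > - (3/2)} \<inter> {z. Re z < 1/2} \<inter> ({z. Im z > - \<eta>} \<inter> {z. Im z < \<eta>})"
    by (auto simp: strip_def)
  then show ?thesis
    by (simp only:) (intro convex_Int convex_halfspace_Re_gt convex_halfspace_Re_lt
        convex_halfspace_Im_gt convex_halfspace_Im_lt)
qed

lemma reciprocal_Re_Im:
  assumes "r < Re v" "r > 0"
  shows "0 < Re (1 / v)" "Re (1 / v) < 1 / r" "\<bar>Im (1 / v)\<bar> \<le> \<bar>Im v\<bar> / r\<^sup>2" "\<bar>Im (1 / v)\<bar> < 1 / r" "cmod (1 / v) < 1 / r"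
proof -
  have nv: "r < cmod v" using complex_Re_le_cmod[of v] assms by linarith
  have sq: "(cmod v)\<^sup>2 = (Re v)\<^sup>2 + (Im v)\<^sup>2" by (rule cmod_power2)
  have pos: "0 < (Re v)\<^sup>2 + (Im v)\<^sup>2" using assms by (auto intro: add_pos_nonneg)
  show "0 < Re (1 / v)" using assms pos by (simp add: Re_divide)
  show n: "cmod (1 / v) < 1 / r" using nv assms by (simp add: norm_divide frac_less2)
  show "Re (1 / v) < 1 / r" using complex_Re_le_cmod[of "1 / v"] n by linarith
  show "\<bar>Im (1 / v)\<bar> < 1 / r" using abs_Im_le_cmod[of "1 / v"] n by linarith
  have "r\<^sup>2 \<le> (Re v)\<^sup>2" using assms by (intro power_mono) auto
  then have "r\<^sup>2 \<le> (Re v)\<^sup>2 + (Im v)\<^sup>2" by (simp add: add_increasing2)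
  then have "\<bar>Im v\<bar> / ((Re v)\<^sup>2 + (Im v)\<^sup>2) \<le> \<bar>Im v\<bar> / r\<^sup>2" using assms pos by (intro divide_left_mono) auto
  moreover have "\<bar>Im (1 / v)\<bar> = \<bar>Im v\<bar> / ((Re v)\<^sup>2 + (Im v)\<^sup>2)"
    using pos by (simp add: Im_divide abs_divide)
  ultimately show "\<bar>Im (1 / v)\<bar> \<le> \<bar>Im v\<bar> / r\<^sup>2" by simp
qed

text \<open>Inversion divides the imaginary part by at least (3/2)^2 = 9/4 > 2; this gain is what
  allows the width to be doubled in \<open>strip_extension\<close>.\<close>

lemma strip_reciprocal:
  assumes "Re w > 3/2" "\<bar>Im w\<bar> < 2 * \<eta>"
  shows "- (1 / w) \<in> strip \<eta>" "1 / w - 1 \<in> strip \<eta>"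
proof -
  note * = reciprocal_Re_Im[of "3/2" w]
  have "\<bar>Im w\<bar> / (3/2)\<^sup>2 < \<eta>" using assms(2) by (simp add: power2_eq_square)
  then have "\<bar>Im (1 / w)\<bar> < \<eta>" using *(3)[OF assms(1)] by simp
  then show "- (1 / w) \<in> strip \<eta>" "1 / w - 1 \<in> strip \<eta>"
    using *(1,2)[OF assms(1)] by (simp_all add: strip_def)
qed

text \<open>Here \<open>1 / w\<close> has modulus below 4/3, so a strip of half-width 2 catches it
  whatever the imaginary part of \<open>w\<close>. This is why the extension is taken as far as
  \<open>strip 2\<close>.\<close>

lemma strip_reciprocal2:
  assumes "Re w > 3/4" shows "- (1 / w) \<in> strip 2" "1 / w - 1 \<in> strip 2"
proof -
  note * = reciprocal_Re_Im[of "3/4" w, OF assms]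
  show "- (1 / w) \<in> strip 2" "1 / w - 1 \<in> strip 2"
    using *(1,2,4) by (simp_all add: strip_def)
qed

lemma lipschitz0_strip:
  assumes F: "F holomorphic_on strip \<eta>" and \<eta>: "\<eta> > 0"
  shows "lipschitz0 (\<lambda>y. F (- y))" "lipschitz0 (\<lambda>y. F (y - 1))"
proof -
  define r where "r = min (1/4) \<eta>"
  have r: "r > 0" using \<eta> by (simp add: r_def)
  have in1: "- y \<in> strip \<eta>" "y - 1 \<in> strip \<eta>" if "y \<in> ball 0 r" for y
    using that abs_Re_le_cmod[of y] abs_Im_le_cmod[of y] by (auto simp: strip_def r_def)
  have "(\<lambda>y. F (- y)) holomorphic_on ball 0 r"
    using holomorphic_on_compose_gen[OF _ F, of "\<lambda>y. - y" "ball 0 r"] in1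
    by (simp add: o_def image_subset_iff holomorphic_on_minus holomorphic_on_ident)
  then show "lipschitz0 (\<lambda>y. F (- y))" by (rule lipschitz0_holomorphic[OF _ r]) simp
  have "(\<lambda>y. F (y - 1)) holomorphic_on ball 0 r"
    using holomorphic_on_shift[OF F, of "ball 0 r" "-1"] in1 by simp
  then show "lipschitz0 (\<lambda>y. F (y - 1))" by (rule lipschitz0_holomorphic[OF _ r]) simp
qed

lemma reg_sum_strip_holomorphic:
  assumes F: "F holomorphic_on strip \<eta>" and \<eta>: "\<eta> > 0" and s: "Re s > 0"
    and W: "open W" "\<And>w. w \<in> W \<Longrightarrow> Re w > 0"
    and img: "\<And>w n. w \<in> W \<Longrightarrow> - (1 / (w + of_nat n)) \<in> strip \<eta> \<and> 1 / (w + of_nat n) - 1 \<in> strip \<eta>"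
  shows "reg_sum s (\<lambda>y. F (- y)) holomorphic_on W" "reg_sum s (\<lambda>y. F (y - 1)) holomorphic_on W"
proof -
  have nz: "w + of_nat n \<noteq> 0" if "w \<in> W" for w and n :: nat
  proof
    assume "w + of_nat n = 0"
    then have "Re (w + of_nat n) = 0" by simp
    with W(2)[OF that] show False by simp
  qed
  have "(\<lambda>w. - (1 / (w + of_nat n))) holomorphic_on W" "(\<lambda>w. 1 / (w + of_nat n) - 1) holomorphic_on W" for n
    by (intro holomorphic_intros; use nz in auto)+
  then have "(\<lambda>w. F (- (1 / (w + of_nat n)))) holomorphic_on W" "(\<lambda>w. F (1 / (w + of_nat n) - 1)) holomorphic_on W" for n
    using holomorphic_on_compose_gen[OF _ F, of "\<lambda>w. - (1 / (w + of_nat n))" W]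
      holomorphic_on_compose_gen[OF _ F, of "\<lambda>w. 1 / (w + of_nat n) - 1" W] img
    by (simp_all add: o_def image_subset_iff)
  then show "reg_sum s (\<lambda>y. F (- y)) holomorphic_on W" "reg_sum s (\<lambda>y. F (y - 1)) holomorphic_on W"
    using reg_sum_holomorphic[OF lipschitz0_strip(1)[OF F \<eta>] s W] reg_sum_holomorphic[OF lipschitz0_strip(2)[OF F \<eta>] s W]
    by blast+
qed

lemma reg_sum_strip_real:
  assumes F: "\<And>x. - (3/2) < x \<Longrightarrow> x < 1/2 \<Longrightarrow> F (of_real x) = g x" and x: "x > 3/4"
  shows "reg_sum s (\<lambda>y. F (- y)) (of_real x) = rreg s (\<lambda>y. g (- y)) x"
    "reg_sum s (\<lambda>y. F (y - 1)) (of_real x) = rreg s (\<lambda>y. g (y - 1)) x"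
proof -
  have b: "0 < 1 / (x + real n) \<and> 1 / (x + real n) < 3/2" for n
  proof -
    have "1 / (x + real n) \<le> 1 / x" using x by (intro divide_left_mono) auto
    also have "\<dots> < 3/2" using x by (simp add: field_simps)
    finally show ?thesis using x by simp
  qed
  show "reg_sum s (\<lambda>y. F (- y)) (of_real x) = rreg s (\<lambda>y. g (- y)) x"
    unfolding rreg_def
  proof (rule reg_sum_cong)
    show "F (- 0) = g (- Re 0)" using F[of 0] by simp
    show "F (- (1 / (of_real x + of_nat n))) = g (- Re (1 / (of_real x + of_nat n)))" for n
      unfolding of_real_inverse_add Re_complex_of_real of_real_minus[symmetric] by (rule F) (use b[of n] in linarith)+
  qed
  show "reg_sum s (\<lambda>y. F (y - 1)) (of_real x) = rreg s (\<lambda>y. g (y - 1)) x"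
    unfolding rreg_def
  proof (rule reg_sum_cong)
    show "F (0 - 1) = g (Re 0 - 1)" using F[of "-1"] by simp
    have "F (of_real (1 / (x + real n)) - 1) = F (of_real (1 / (x + real n) - 1))" for n by simp
    then show "F (1 / (of_real x + of_nat n) - 1) = g (Re (1 / (of_real x + of_nat n)) - 1)" for n
      unfolding of_real_inverse_add Re_complex_of_real using F[of "1 / (x + real n) - 1"] b[of n] by simp
  qed
qed

lemma strip_subset_phi_interval: "- (3/2) \<le> x \<Longrightarrow> x \<le> 1/2 \<Longrightarrow> x \<in> phi_interval"
  using phi_gt by (simp add: phi_power2)

text \<open>Bootstrapping: the right-hand side of the eigenfunction equation makes sense on a strip
  twice as wide as the one on which the function is known, and it continues the same real
  function.\<close>

lemma strip_extension:
  assumes s: "Re s > 0" "s \<noteq> 1/2" and g: "g \<in> analytic_fun_on phi_interval" and e: "real_eigen s g"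
  obtains F where "F holomorphic_on strip 2" "\<And>x. - (3/2) < x \<Longrightarrow> x < 1/2 \<Longrightarrow> F (of_real x) = g x"
proof -
  have an: "real_analytic_at g x" if "- (3/2) \<le> x" "x \<le> 1/2" for x
    using g strip_subset_phi_interval[OF that] by (simp add: analytic_fun_on_def)
  obtain \<eta> F0 where F0: "\<eta> > 0" "F0 holomorphic_on strip \<eta>" "\<And>x. - (3/2) < x \<Longrightarrow> x < 1/2 \<Longrightarrow> F0 (of_real x) = g x"
  proof (rule real_analytic_strip_extension[of "- (3/2)" "1/2" g])
    fix \<eta> F assume "\<eta> > 0" "F holomorphic_on {z. - (3/2) < Re z \<and> Re z < 1/2 \<and> \<bar>Im z\<bar> < \<eta>}"
      "\<And>x. - (3/2) < x \<Longrightarrow> x < 1/2 \<Longrightarrow> F (of_real x) = g x"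
    then show ?thesis by (intro that[of \<eta> F]) (simp_all add: strip_def)
  qed (rule an)
  have "\<exists>F. F holomorphic_on strip (2 ^ k * \<eta>) \<and> (\<forall>x. - (3/2) < x \<and> x < 1/2 \<longrightarrow> F (of_real x) = g x)" for k
  proof (induction k)
    case 0 then show ?case using F0 by auto
  next
    case (Suc k)
    define \<epsilon> where "\<epsilon> = 2 ^ k * \<eta>"
    have \<epsilon>: "\<epsilon> > 0" using F0(1) by (simp add: \<epsilon>_def)
    obtain F where F: "F holomorphic_on strip \<epsilon>" "\<And>x. - (3/2) < x \<Longrightarrow> x < 1/2 \<Longrightarrow> F (of_real x) = g x"
      using Suc unfolding \<epsilon>_def by blast
    let ?W = "{w. Re w > 3/2 \<and> \<bar>Im w\<bar> < 2 * \<epsilon>}"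
    have W: "open ?W" by (intro open_Collect_conj open_Collect_less continuous_intros)
    have img: "- (1 / (w + of_nat n)) \<in> strip \<epsilon> \<and> 1 / (w + of_nat n) - 1 \<in> strip \<epsilon>" if "w \<in> ?W" for w and n :: nat
      using strip_reciprocal[of "w + of_nat n" \<epsilon>] that by auto
    have Wpos: "0 < Re w" if "w \<in> ?W" for w using that by simp
    note hol = reg_sum_strip_holomorphic[OF F(1) \<epsilon> s(1) W Wpos img]
    define F' where "F' z = reg_sum s (\<lambda>y. F (- y)) (z + 3) + reg_sum s (\<lambda>y. F (y - 1)) (2 - z)" for z
    have "(\<lambda>z. reg_sum s (\<lambda>y. F (- y)) (z + 3)) holomorphic_on strip (2 * \<epsilon>)"
      by (rule holomorphic_on_shift[OF hol(1)]) (auto simp: strip_def)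
    moreover have "(\<lambda>z. reg_sum s (\<lambda>y. F (y - 1)) (2 - z)) holomorphic_on strip (2 * \<epsilon>)"
      by (rule holomorphic_on_reflect[OF hol(2)]) (auto simp: strip_def)
    ultimately have "F' holomorphic_on strip (2 * \<epsilon>)" unfolding F'_def by (rule holomorphic_on_add)
    moreover have "2 ^ Suc k * \<eta> = 2 * \<epsilon>" by (simp add: \<epsilon>_def)
    ultimately have "F' holomorphic_on strip (2 ^ Suc k * \<eta>)" by (simp only:)
    moreover have "F' (of_real x) = g x" if x: "- (3/2) < x" "x < 1/2" for x
    proof -
      have "F' (of_real x) = rreg s (\<lambda>y. g (- y)) (x + 3) + rreg s (\<lambda>y. g (y - 1)) (2 - x)"
        using reg_sum_strip_real(1)[of F g "x + 3", OF F(2)] reg_sum_strip_real(2)[of F g "2 - x", OF F(2)] x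
        by (simp add: F'_def)
      also have "\<dots> = g x" using e strip_subset_phi_interval[of x] x unfolding real_eigen_def by auto
      finally show ?thesis .
    qed
    ultimately show ?case by blast
  qed
  note ext = this
  obtain k :: nat where "2 / \<eta> < 2 ^ k" using real_arch_pow[of 2 "2 / \<eta>"] by auto
  then have "2 \<le> 2 ^ k * \<eta>" using F0(1) by (simp add: field_simps)
  then have sub: "strip 2 \<subseteq> strip (2 ^ k * \<eta>)" by (auto simp: strip_def)
  obtain F where "F holomorphic_on strip (2 ^ k * \<eta>)" "\<forall>x. - (3/2) < x \<and> x < 1/2 \<longrightarrow> F (of_real x) = g x"
    using ext[of k] by blast
  then show ?thesis using holomorphic_on_subset[OF _ sub] by (intro that[of F]) auto
qed

text \<open>The pair is defined by the two right-hand sides, formed with the extension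
  \<open>F\<close>. The identity theorem shows that \<open>f1\<close> agrees with \<open>F\<close>,
  and \<open>f2\<close> with the shift of \<open>F\<close>, at all points which the sums evaluate,
  so that \<open>F\<close> may be replaced by the pair.\<close>

lemma real_eigen_imp_transfer_fixed:
  assumes s: "Re s > 0" "s \<noteq> 1/2" and g: "g \<in> analytic_fun_on phi_interval" and e: "real_eigen s g"
  obtains f1 f2 where "(f1, f2) \<in> transfer_fixed s" "analytic_extension f1 g"
proof -
  have phi_gt': "3/2 < phi"
  proof -
    have "sqrt 4 < sqrt 5" by (rule real_sqrt_less_mono) simp
    then show ?thesis by (simp add: phi_def)
  qed
  obtain F where F: "F holomorphic_on strip 2" "\<And>x. - (3/2) < x \<Longrightarrow> x < 1/2 \<Longrightarrow> F (of_real x) = g x"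
    using strip_extension[OF assms] by blast
  let ?W = "{w. Re w > 3/4}"
  have W: "open ?W" by (rule open_halfspace_Re_gt)
  have Wpos: "0 < Re w" if "w \<in> ?W" for w using that by simp
  have img: "- (1 / (w + of_nat n)) \<in> strip 2 \<and> 1 / (w + of_nat n) - 1 \<in> strip 2" if "w \<in> ?W" for w and n :: nat
    using strip_reciprocal2[of "w + of_nat n"] that by auto
  note hol = reg_sum_strip_holomorphic[OF F(1) _ s(1) W Wpos img, simplified]
  define f1 where "f1 z = reg_sum s (\<lambda>y. F (- y)) (z + 3) + reg_sum s (\<lambda>y. F (y - 1)) (2 - z)" for z
  define f2 where "f2 z = reg_sum s (\<lambda>y. F (- y)) (z + 2) + reg_sum s (\<lambda>y. F (y - 1)) (3 - z)" for z
  \<comment> \<open>The radius exceeds 1, and it still guarantees \<open>Re (2 - z) > 3/4\<close>,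
    the range of \<open>strip_reciprocal2\<close>.\<close>
  let ?B = "ball (0::complex) (5/4)"
  have B: "3/4 < Re (z + 3)" "3/4 < Re (2 - z)" "3/4 < Re (z + 2)" "3/4 < Re (3 - z)" if "z \<in> ?B" for z
    using that abs_Re_le_cmod[of z] by auto
  have comp1: "(\<lambda>z. reg_sum s (\<lambda>y. F (- y)) (z + 3)) holomorphic_on ?B"
    "(\<lambda>z. reg_sum s (\<lambda>y. F (- y)) (z + 2)) holomorphic_on ?B"
    by (rule holomorphic_on_shift[OF hol(1)], use B in simp)+
  have comp2: "(\<lambda>z. reg_sum s (\<lambda>y. F (y - 1)) (2 - z)) holomorphic_on ?B"
    "(\<lambda>z. reg_sum s (\<lambda>y. F (y - 1)) (3 - z)) holomorphic_on ?B"
    by (rule holomorphic_on_reflect[OF hol(2)], use B in simp)+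
  have f1: "f1 holomorphic_on ?B" unfolding f1_def by (intro holomorphic_on_add comp1 comp2)
  have f2: "f2 holomorphic_on ?B" unfolding f2_def by (intro holomorphic_on_add comp1 comp2)
  have da: "f1 \<in> disk_algebra" "f2 \<in> disk_algebra"
    using f1 f2 unfolding disk_algebra_def
    by (auto intro!: holomorphic_on_imp_continuous_on elim!: holomorphic_on_subset)
  have r1: "f1 (of_real x) = g x" if x: "- (5/4) < x" "x < 5/4" for x
  proof -
    have "f1 (of_real x) = rreg s (\<lambda>y. g (- y)) (x + 3) + rreg s (\<lambda>y. g (y - 1)) (2 - x)"
      using reg_sum_strip_real(1)[of F g "x + 3", OF F(2)] reg_sum_strip_real(2)[of F g "2 - x", OF F(2)] x
      by (simp add: f1_def)
    also have "\<dots> = g x" using e x phi_gt' unfolding real_eigen_def by (simp add: phi_power2)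
    finally show ?thesis .
  qed
  have r2: "f2 (of_real x) = g (x - 1)" if x: "- (1/4) < x" "x < 5/4" for x
  proof -
    have "f2 (of_real x) = rreg s (\<lambda>y. g (- y)) (x + 2) + rreg s (\<lambda>y. g (y - 1)) (3 - x)"
      using reg_sum_strip_real(1)[of F g "x + 2", OF F(2)] reg_sum_strip_real(2)[of F g "3 - x", OF F(2)] x
      by (simp add: f2_def)
    also have "\<dots> = rreg s (\<lambda>y. g (- y)) (x - 1 + 3) + rreg s (\<lambda>y. g (y - 1)) (2 - (x - 1))"
      by (simp add: algebra_simps)
    also have "\<dots> = g (x - 1)"
    proof -
      have "x - 1 \<in> phi_interval" using x phi_gt' by (simp add: phi_power2)
      then show ?thesis using e unfolding real_eigen_def by auto
    qed
    finally show ?thesis .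
  qed
  have id1: "f1 z = F z" if z: "z \<in> ?B \<inter> strip 2" for z
  proof (rule holomorphic_eq_from_reals[of "?B \<inter> strip 2" f1 F 0])
    show "open (?B \<inter> strip 2)" using open_strip by auto
    show "connected (?B \<inter> strip 2)" by (intro convex_connected convex_Int convex_strip) auto
    show "f1 holomorphic_on ?B \<inter> strip 2" "F holomorphic_on ?B \<inter> strip 2"
      using f1 F(1) by (auto elim: holomorphic_on_subset)
    have "\<forall>\<^sub>F y in nhds (0::real). y \<in> {-1<..<1/2}" by (rule eventually_nhds_in_open) auto
    then show "\<forall>\<^sub>F y in nhds 0. f1 (of_real y) = F (of_real y)"
      by eventually_elim (simp add: r1 F(2))
  qed (use z in \<open>auto simp: strip_def\<close>)
  let ?B' = "ball (-1::complex) (5/4)"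
  have B': "z + 1 \<in> ?B" if "z \<in> ?B'" for z
    using that norm_minus_commute[of "-1" z] by (simp add: dist_norm add.commute)
  have id2: "f2 (z + 1) = F z" if z: "z \<in> ?B' \<inter> strip 2" for z
  proof (rule holomorphic_eq_from_reals[of "?B' \<inter> strip 2" "\<lambda>z. f2 (z + 1)" F "-1/2"])
    show "open (?B' \<inter> strip 2)" using open_strip by auto
    show "connected (?B' \<inter> strip 2)" by (intro convex_connected convex_Int convex_strip) auto
    have "(\<lambda>z. f2 (z + 1)) holomorphic_on ?B'"
      by (rule holomorphic_on_shift[OF f2 B'])
    then show "(\<lambda>z. f2 (z + 1)) holomorphic_on ?B' \<inter> strip 2" "F holomorphic_on ?B' \<inter> strip 2"
      using F(1) by (auto elim: holomorphic_on_subset)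
    have "\<forall>\<^sub>F y in nhds (-1/2::real). y \<in> {-1<..<0}" by (rule eventually_nhds_in_open) auto
    then show "\<forall>\<^sub>F y in nhds (-1/2). f2 (of_real y + 1) = F (of_real y)"
    proof eventually_elim
      case (elim y)
      then have "f2 (of_real (y + 1)) = g y" using r2[of "y + 1"] by simp
      then show ?case using elim F(2)[of y] by simp
    qed
    have "cmod (- 1 - complex_of_real (-1/2)) = 1/2" by (simp add: norm_divide flip: of_real_diff)
    then show "complex_of_real (-1/2) \<in> ?B' \<inter> strip 2" by (auto simp: strip_def dist_norm)
  qed (use z in auto)
  have eq: "reg_sum s (\<lambda>y. f1 (- y)) w = reg_sum s (\<lambda>y. F (- y)) w \<and> reg_sum s f2 w = reg_sum s (\<lambda>y. F (y - 1)) w"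
    if w: "Re w \<ge> 1" for w
  proof -
    have p: "f1 (- y) = F (- y)" "f2 y = F (y - 1)" if "cmod y < 5/4" "- (y) \<in> strip 2" "y - 1 \<in> strip 2" for y
    proof -
      show "f1 (- y) = F (- y)" by (rule id1) (use that in auto)
      have "y - 1 \<in> ?B'" using that(1) by (simp add: dist_norm norm_minus_commute)
      then show "f2 y = F (y - 1)" using id2[of "y - 1"] that by simp
    qed
    have n: "cmod (1 / (w + of_nat n)) < 5/4 \<and> - (1 / (w + of_nat n)) \<in> strip 2 \<and> 1 / (w + of_nat n) - 1 \<in> strip 2" for n
    proof -
      have "Re (w + of_nat n) > 4/5" using w by simp
      then show ?thesis
        using reciprocal_Re_Im(5)[of "4/5" "w + of_nat n"] strip_reciprocal2[of "w + of_nat n"] by simp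
    qed
    have 0: "f1 (- 0) = F (- 0)" "f2 0 = F (0 - 1)" by (rule p; simp add: strip_def)+
    show ?thesis
    proof
      show "reg_sum s (\<lambda>y. f1 (- y)) w = reg_sum s (\<lambda>y. F (- y)) w"
      proof (rule reg_sum_cong)
        show "f1 (- (1 / (w + of_nat n))) = F (- (1 / (w + of_nat n)))" for n by (rule p(1)) (use n in blast)+
      qed (rule 0(1))
      show "reg_sum s f2 w = reg_sum s (\<lambda>y. F (y - 1)) w"
      proof (rule reg_sum_cong)
        show "f2 (1 / (w + of_nat n)) = F (1 / (w + of_nat n) - 1)" for n by (rule p(2)) (use n in blast)+
      qed (rule 0(2))
    qed
  qed
  have "(f1, f2) \<in> transfer_fixed s"
    unfolding transfer_fixed_iff[OF s]
  proof (intro conjI ballI da)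
    fix z :: complex assume "z \<in> cball 0 1"
    then have z: "\<bar>Re z\<bar> \<le> 1" using abs_Re_le_cmod[of z] by simp
    show "f1 z = reg_sum s (\<lambda>y. f1 (- y)) (z + 3) + reg_sum s f2 (2 - z)"
      using eq[of "z + 3"] eq[of "2 - z"] z by (simp add: f1_def)
    show "f2 z = reg_sum s (\<lambda>y. f1 (- y)) (z + 2) + reg_sum s f2 (3 - z)"
      using eq[of "z + 2"] eq[of "3 - z"] z by (simp add: f2_def)
  qed
  moreover have "analytic_extension f1 g"
    unfolding analytic_extension_def using g r1 by auto
  ultimately show ?thesis by (rule that)
qed

lemma eigen_space_iff:
  assumes s: "Re s > 0" "s \<noteq> 1/2"
  shows "g \<in> eigen_space s \<longleftrightarrow> g \<in> analytic_fun_on phi_interval \<and> real_eigen s g"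
proof
  assume "g \<in> eigen_space s"
  then obtain f1 f2 where f: "(f1, f2) \<in> transfer_fixed s" "analytic_extension f1 g"
    unfolding eigen_space_def by auto
  obtain g' where g': "analytic_extension f1 g'" "real_eigen s g'"
    using transfer_fixed_imp_real_eigen[OF s f(1)] .
  have "g' = g" by (rule analytic_extension_unique[OF g'(1) f(2)])
  then show "g \<in> analytic_fun_on phi_interval \<and> real_eigen s g"
    using g' by (simp add: analytic_extension_def)
next
  assume "g \<in> analytic_fun_on phi_interval \<and> real_eigen s g"
  then obtain f1 f2 where "(f1, f2) \<in> transfer_fixed s" "analytic_extension f1 g"
    using real_eigen_imp_transfer_fixed[OF s] by blast
  then show "g \<in> eigen_space s" unfolding eigen_space_def by blast
qed

lemma rreg_linear:
  assumes "real_analytic_at p 0" "real_analytic_at q 0" "Re s > 0" "x > 0"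
  shows "rreg s (\<lambda>y. a * p y + b * q y) x = a * rreg s p x + b * rreg s q x"
  unfolding rreg_def
  by (rule reg_sum_linear[OF lipschitz0_real lipschitz0_real]) (use assms in auto)

lemma eigen_space_combination:
  assumes s: "Re s > 0" "s \<noteq> 1/2" and "g \<in> eigen_space s" "h \<in> eigen_space s"
  shows "(\<lambda>x. a * g x + b * h x) \<in> eigen_space s"
proof -
  have g: "g \<in> analytic_fun_on phi_interval" "real_eigen s g"
    and h: "h \<in> analytic_fun_on phi_interval" "real_eigen s h"
    using assms(3,4) by (simp_all add: eigen_space_iff[OF s])
  have an: "real_analytic_at f x" if "f \<in> analytic_fun_on phi_interval" "x \<in> phi_interval" for f x
    using that by (simp add: analytic_fun_on_def)
  have 0: "(0::real) \<in> phi_interval" "(-1::real) \<in> phi_interval" using phi_gt by (simp_all add: phi_power2)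
  have n: "real_analytic_at (\<lambda>y. f (- y)) 0" "real_analytic_at (\<lambda>y. f (y - 1)) 0"
    if "f \<in> analytic_fun_on phi_interval" for f
    using real_analytic_at_neg[of f 0] real_analytic_at_shift[of f 0 "-1"] an[OF that 0(1)] an[OF that 0(2)] by simp_all
  have "real_eigen s (\<lambda>x. a * g x + b * h x)"
    unfolding real_eigen_def
  proof
    fix x assume x: "x \<in> phi_interval"
    then have x': "0 < x + 3" "0 < 2 - x" using phi_gt by (simp_all add: phi_power2)
    show "a * g x + b * h x = rreg s (\<lambda>y. a * g (- y) + b * h (- y)) (x + 3) +
        rreg s (\<lambda>y. a * g (y - 1) + b * h (y - 1)) (2 - x)"
      using g(2) h(2) x unfolding rreg_linear[OF n(1)[OF g(1)] n(1)[OF h(1)] s(1) x'(1)]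
        rreg_linear[OF n(2)[OF g(1)] n(2)[OF h(1)] s(1) x'(2)] real_eigen_def
      by (simp add: algebra_simps)
  qed
  moreover have "(\<lambda>x. a * g x + b * h x) \<in> analytic_fun_on phi_interval"
    using g(1) h(1) unfolding analytic_fun_on_def
    by (auto intro!: real_analytic_at_add real_analytic_at_mult real_analytic_at_const)
  ultimately show ?thesis by (simp add: eigen_space_iff[OF s])
qed

lemma zero_in_eigen_space: "Re s > 0 \<Longrightarrow> s \<noteq> 1/2 \<Longrightarrow> (\<lambda>x. 0) \<in> eigen_space s"
  by (simp add: eigen_space_iff analytic_fun_on_def real_analytic_at_const real_eigen_def rreg_def reg_sum_def reg_num_def)

lemma subspace_eigen_space:
  assumes s: "Re s > 0" "s \<noteq> 1/2"
  shows "cscale.subspace (eigen_space s)"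
proof (rule cscale.subspaceI)
  show "0 \<in> eigen_space s" using zero_in_eigen_space[OF s] by (simp add: zero_fun_def)
  show "g + h \<in> eigen_space s" if "g \<in> eigen_space s" "h \<in> eigen_space s" for g h
    using eigen_space_combination[OF s that, of 1 1] by (simp add: plus_fun_def)
  show "cscale c g \<in> eigen_space s" if "g \<in> eigen_space s" for c g
    using eigen_space_combination[OF s that that, of c 0] by (simp add: cscale_def)
qed

section \<open>Twisting cocycles\<close>

lemma V_omega_add: "f \<in> V_omega s \<Longrightarrow> g \<in> V_omega s \<Longrightarrow> f + g \<in> V_omega s"
  by (simp add: V_omega_iff V_fs_add regular_add)

lemma V_omega_uminus: "f \<in> V_omega s \<Longrightarrow> - f \<in> V_omega s"
  by (simp add: V_omega_iff V_fs_uminus regular_uminus)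

lemma V_omega_zero: "0 \<in> V_omega s"
  by (simp add: V_omega_iff V_fs_zero regular_zero)

lemma V_omega_cslash: "f \<in> V_omega s \<Longrightarrow> cslash s f \<gamma> \<in> V_omega s"
  by (simp add: V_omega_iff V_fs_cslash regular_cslash)

lemma coh_class_eqI:
  assumes V: "\<And>f g. f \<in> V \<Longrightarrow> g \<in> V \<Longrightarrow> f + g \<in> V" "\<And>f. f \<in> V \<Longrightarrow> - f \<in> V"
    and \<psi>: "\<psi> \<in> Z1 s V" "\<psi>' \<in> Z1 s V" and v: "v \<in> V" "\<And>\<gamma>. \<psi> \<gamma> - \<psi>' \<gamma> = v - cslash s v \<gamma>"
  shows "coh_class s V \<psi> = coh_class s V \<psi>'"
proof -
  have sub: "coh_class s V \<psi> \<subseteq> coh_class s V \<psi>'"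
    if "\<psi> \<in> Z1 s V" "\<psi>' \<in> Z1 s V" "v \<in> V" "\<And>\<gamma>. \<psi> \<gamma> - \<psi>' \<gamma> = v - cslash s v \<gamma>" for \<psi> \<psi>' v
  proof
    fix \<xi> assume "\<xi> \<in> coh_class s V \<psi>"
    then have "\<xi> \<in> Z1 s V" "\<psi> - \<xi> \<in> B1 s V" by (auto simp: coh_class_def cohomologous_def)
    then obtain u where u: "u \<in> V" "\<psi> - \<xi> = (\<lambda>\<gamma>. u - cslash s u \<gamma>)" by (auto simp: B1_def)
    have "\<psi>' \<gamma> - \<xi> \<gamma> = (u + - v) - cslash s (u + - v) \<gamma>" for \<gamma>
    proof -
      have "\<psi>' \<gamma> - \<xi> \<gamma> = (\<psi> \<gamma> - \<xi> \<gamma>) - (\<psi> \<gamma> - \<psi>' \<gamma>)" by simp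
      also have "\<psi> \<gamma> - \<xi> \<gamma> = u - cslash s u \<gamma>" using fun_cong[OF u(2), of \<gamma>] by simp
      also have "\<psi> \<gamma> - \<psi>' \<gamma> = v - cslash s v \<gamma>" by (rule that(4))
      finally show ?thesis by (simp add: cslash_linear algebra_simps)
    qed
    then have "\<psi>' - \<xi> = (\<lambda>\<gamma>. (u + - v) - cslash s (u + - v) \<gamma>)" by (simp add: fun_eq_iff)
    then have "\<psi>' - \<xi> \<in> B1 s V" unfolding B1_def using V(1)[OF u(1) V(2)[OF that(3)]] by blast
    then show "\<xi> \<in> coh_class s V \<psi>'" using that(2) \<open>\<xi> \<in> Z1 s V\<close> by (auto simp: coh_class_def cohomologous_def)
  qed
  have "\<psi>' \<gamma> - \<psi> \<gamma> = - v - cslash s (- v) \<gamma>" for \<gamma>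
    using v(2)[of \<gamma>] by (simp add: cslash_linear algebra_simps)
  from sub[OF \<psi> v] sub[OF \<psi>(2,1) V(2)[OF v(1)] this] show ?thesis by (rule equalityI)
qed

lemma mem_coh_class:
  assumes "\<psi> \<in> Z1 s V" "0 \<in> V" shows "\<psi> \<in> coh_class s V \<psi>"
proof -
  have "\<psi> - \<psi> = (\<lambda>\<gamma>. 0 - cslash s 0 \<gamma>)" by (simp add: fun_eq_iff cslash_linear)
  then have "\<psi> - \<psi> \<in> B1 s V" unfolding B1_def using assms(2) by blast
  then show ?thesis using assms(1) by (simp add: coh_class_def cohomologous_def)
qed

lemma coh_class_eq_iff:
  assumes V: "\<And>f g. f \<in> V \<Longrightarrow> g \<in> V \<Longrightarrow> f + g \<in> V" "\<And>f. f \<in> V \<Longrightarrow> - f \<in> V"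
    and \<psi>: "\<psi>' \<in> coh_class s V \<psi>"
  shows "coh_class s V \<psi> = coh_class s V \<psi>'"
proof -
  have "\<psi> \<in> Z1 s V" "\<psi>' \<in> Z1 s V" "\<psi> - \<psi>' \<in> B1 s V" using \<psi> by (auto simp: coh_class_def cohomologous_def)
  then obtain v where v: "v \<in> V" "\<psi> - \<psi>' = (\<lambda>\<gamma>. v - cslash s v \<gamma>)" by (auto simp: B1_def)
  show ?thesis
    by (rule coh_class_eqI[OF V \<open>\<psi> \<in> Z1 s V\<close> \<open>\<psi>' \<in> Z1 s V\<close> v(1)]) (use fun_cong[OF v(2)] in simp_all)
qed

lemma coh_class_V_fs_eq: "\<psi>' \<in> coh_class s (V_fs s) \<psi> \<Longrightarrow> coh_class s (V_fs s) \<psi> = coh_class s (V_fs s) \<psi>'"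
  by (rule coh_class_eq_iff) (auto intro: V_fs_add V_fs_uminus)

lemma coh_class_V_omega_eq:
  "\<psi>' \<in> coh_class s (V_omega s) \<psi> \<Longrightarrow> coh_class s (V_omega s) \<psi> = coh_class s (V_omega s) \<psi>'"
  by (rule coh_class_eq_iff) (auto intro: V_omega_add V_omega_uminus)

lemma Z1_mono: "V \<subseteq> V' \<Longrightarrow> Z1 s V \<subseteq> Z1 s V'"
  by (auto simp: Z1_def)

lemma cohomologous_mono: "V \<subseteq> V' \<Longrightarrow> cohomologous s V \<subseteq> cohomologous s V'"
  unfolding cohomologous_def B1_def using Z1_mono[of V V' s] by blast

text \<open>A parabolic class contains a cocycle satisfying the parabolic condition, and this
  cocycle also represents the image of the class. Thus the main proof can deal with cocycles instead
  of quotient sets.\<close>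

lemma H1_par_image:
  "H1_incl s (V_fs s) ` H1_par s (V_omega s) (V_smp s) =
     {coh_class s (V_fs s) \<psi> | \<psi>. \<psi> \<in> Z1 s (V_omega s) \<and> (\<exists>w\<in>V_smp s. \<psi> gT = w - cslash s w gT)}"
    (is "?L = ?R")
proof -
  have incl: "H1_incl s (V_fs s) (coh_class s (V_omega s) \<psi>) = coh_class s (V_fs s) \<psi>"
    if \<psi>: "\<psi> \<in> Z1 s (V_omega s)" for \<psi>
  proof
    show "H1_incl s (V_fs s) (coh_class s (V_omega s) \<psi>) \<subseteq> coh_class s (V_fs s) \<psi>"
    proof
      fix \<xi> assume "\<xi> \<in> H1_incl s (V_fs s) (coh_class s (V_omega s) \<psi>)"
      then obtain \<psi>' where 1: "(\<psi>, \<psi>') \<in> cohomologous s (V_omega s)" "(\<psi>', \<xi>) \<in> cohomologous s (V_fs s)"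
        by (auto simp: H1_incl_def coh_class_def)
      then have "\<psi>' \<in> coh_class s (V_fs s) \<psi>"
        using cohomologous_mono[OF V_omega_subset_V_fs] by (auto simp: coh_class_def)
      then have "coh_class s (V_fs s) \<psi> = coh_class s (V_fs s) \<psi>'"
        by (rule coh_class_V_fs_eq)
      then show "\<xi> \<in> coh_class s (V_fs s) \<psi>" using 1(2) by (simp add: coh_class_def)
    qed
    show "coh_class s (V_fs s) \<psi> \<subseteq> H1_incl s (V_fs s) (coh_class s (V_omega s) \<psi>)"
      using mem_coh_class[OF \<psi> V_omega_zero] by (auto simp: H1_incl_def coh_class_def)
  qed
  show ?thesis
  proof
    show "?L \<subseteq> ?R"
    proof
      fix X assume "X \<in> ?L"
      then obtain C where C: "C \<in> H1_par s (V_omega s) (V_smp s)" "X = H1_incl s (V_fs s) C" by blast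
      then obtain \<psi> where \<psi>: "C \<in> H1 s (V_omega s)" "\<psi> \<in> C" "\<exists>w\<in>V_smp s. \<psi> gT = w - cslash s w gT"
        by (auto simp: H1_par_def)
      then obtain \<psi>0 where \<psi>0: "\<psi>0 \<in> Z1 s (V_omega s)" "C = coh_class s (V_omega s) \<psi>0"
        by (auto simp: H1_def coh_class_def elim: quotientE)
      have "C = coh_class s (V_omega s) \<psi>"
        using coh_class_V_omega_eq[of \<psi> s \<psi>0] \<psi>(2) \<psi>0(2) by simp
      moreover have "\<psi> \<in> Z1 s (V_omega s)" using \<psi>(2) \<psi>0(2) by (auto simp: coh_class_def cohomologous_def)
      ultimately show "X \<in> ?R" using C(2) incl \<psi>(3) by blast
    qed
    show "?R \<subseteq> ?L"
    proof
      fix X assume "X \<in> ?R"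
      then obtain \<psi> where \<psi>: "X = coh_class s (V_fs s) \<psi>" "\<psi> \<in> Z1 s (V_omega s)" "\<exists>w\<in>V_smp s. \<psi> gT = w - cslash s w gT"
        by blast
      have "coh_class s (V_omega s) \<psi> \<in> H1 s (V_omega s)"
        unfolding H1_def coh_class_def by (rule quotientI[OF \<psi>(2)])
      then have "coh_class s (V_omega s) \<psi> \<in> H1_par s (V_omega s) (V_smp s)"
        unfolding H1_par_def using mem_coh_class[OF \<psi>(2) V_omega_zero] \<psi>(3) by auto
      then show "X \<in> ?L" using incl[OF \<psi>(2)] \<psi>(1) by (metis imageI)
    qed
  qed
qed

lemma Z1_twist:
  assumes \<psi>: "\<psi> \<in> Z1 s (V_fs s)" and v: "v \<in> V_fs s"
  shows "(\<lambda>\<gamma>. \<psi> \<gamma> - (v - cslash s v \<gamma>)) \<in> Z1 s (V_fs s)"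
  unfolding Z1_def
  using Z1D[OF \<psi>] v by (auto simp: cslash_linear cslash_cslash algebra_simps intro!: V_fs_diff V_fs_add V_fs_cslash)

text \<open>A cocycle is determined by its values at the two generators, which removes the definite
  description.\<close>

lemma theta_cocycle_eq:
  assumes "\<psi> \<in> Z1 s (V_fs s)" "\<psi> gS = - theta_c1 s g" "\<psi> gU = - theta_c2 s g"
  shows "theta_cocycle s g = \<psi>"
  unfolding theta_cocycle_def
proof (rule the_equality)
  show "\<psi> \<in> Z1 s (V_fs s) \<and> \<psi> gS = - theta_c1 s g \<and> \<psi> (inverse gT * gS) = - theta_c2 s g"
    using assms by (simp add: gU_def)
  show "\<xi> = \<psi>" if "\<xi> \<in> Z1 s (V_fs s) \<and> \<xi> gS = - theta_c1 s g \<and> \<xi> (inverse gT * gS) = - theta_c2 s g" for \<xi>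
    by (rule Z1_eqI[of \<xi> s "V_fs s" \<psi> "V_fs s"]) (use that assms in \<open>simp_all add: gU_def\<close>)
qed

lemma eq_cofinite_trans: "eq_cofinite f g \<Longrightarrow> eq_cofinite g h \<Longrightarrow> eq_cofinite f h"
  by (metis class_of_eq_iff)

lemma finite_linear_zero: "c \<noteq> 0 \<or> d \<noteq> 0 \<Longrightarrow> finite {x::real. c * x + d = 0}"
proof (cases "c = 0")
  case False
  then have "{x::real. c * x + d = 0} \<subseteq> {- d / c}" by (auto simp: field_simps eq_neg_iff_add_eq_0)
  then show ?thesis by (rule finite_subset) simp
qed auto

lemma finite_moebius_preimage:
  fixes a b c d :: real
  assumes "a * d - b * c = 1" "finite X"
  shows "finite {x. c * x + d \<noteq> 0 \<and> (a * x + b) / (c * x + d) \<in> X}"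
  by (rule finite_subset[OF _ finite_vimage_IntI[OF assms(2) inj_on_moebius[OF assms(1)]]]) auto

lemma eq_cofinite_rslash:
  assumes det: "a * d - b * c = 1" and "eq_cofinite f g"
  shows "eq_cofinite (rslash s f a b c d) (rslash s g a b c d)"
proof (rule eq_cofiniteI)
  let ?X = "{x. f x \<noteq> g x}"
  show "finite {x. c * x + d \<noteq> 0 \<and> (a * x + b) / (c * x + d) \<in> ?X}"
    using assms(2) by (intro finite_moebius_preimage[OF det]) (simp add: eq_cofinite_def)
  show "rslash s f a b c d x = rslash s g a b c d x"
    if "x \<notin> {x. c * x + d \<noteq> 0 \<and> (a * x + b) / (c * x + d) \<in> ?X}" for x
    using that by (auto simp: rslash_def)
qed

lemma class_of_rslash_V_fs:
  assumes det: "a * d - b * c = 1" and h: "finite X" "\<And>x. x \<notin> X \<Longrightarrow> real_analytic_at h x"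
  shows "class_of (rslash s h a b c d) \<in> V_fs s"
  unfolding V_fs_iff
proof (intro exI conjI allI impI)
  let ?Y = "{x. c * x + d = 0} \<union> {x. c * x + d \<noteq> 0 \<and> (a * x + b) / (c * x + d) \<in> X}"
  have "c \<noteq> 0 \<or> d \<noteq> 0" using det by auto
  then show "finite ?Y" using finite_moebius_preimage[OF det h(1)] finite_linear_zero[of c d] by simp
  show "real_analytic_at (rslash s h a b c d) x" if "x \<notin> ?Y" for x
    unfolding rslash_def
    by (intro real_analytic_at_mult real_analytic_at_abs_powr real_analytic_at_moebius h) (use that in auto)
qed (rule refl)

lemma V_omega_representative:
  assumes "f \<in> V_omega s"
  shows "\<exists>h. f = class_of h \<and> (\<forall>x. real_analytic_at h x)"
  using assms by (auto simp: V_omega_def V_omega_on_def analytic_functions_def)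

section \<open>Solving the coboundary equation at the hyperbolic element\<close>

text \<open>Uniform convergence gives analyticity near 0 only. Elsewhere the functional equation
  expresses \<open>v\<close> near \<open>x\<close> by \<open>v\<close> near \<open>r * x\<close>,
  which is closer to 0, and so analyticity spreads over the line.\<close>

lemma scaling_series_analytic:
  assumes a: "\<And>x. real_analytic_at a x" and c: "cmod c < 1" and r: "0 < r" "r < 1"
  defines "v \<equiv> \<lambda>x. \<Sum>n. c ^ n * a (r ^ n * x)"
  shows "real_analytic_at v x" "v x = a x + c * v (r * x)"
proof -
  obtain R F where F: "R > 0" "F holomorphic_on ball 0 R" "\<And>y. \<bar>y\<bar> < R \<Longrightarrow> a y = F (of_real y)"
    using real_analytic_atE[OF a[of 0]] by auto
  have "continuous_on (cball 0 (R/2)) F"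
    using F(1,2) by (intro holomorphic_on_imp_continuous_on) (auto elim: holomorphic_on_subset)
  then have "bounded (F ` cball 0 (R/2))"
    by (intro compact_imp_bounded compact_continuous_image) auto
  then obtain B where "\<forall>u\<in>F ` cball 0 (R/2). norm u \<le> B" unfolding bounded_iff by blast
  then have B: "cmod (F z) \<le> B" if "cmod z \<le> R/2" for z using that by simp
  have rn: "cmod (of_real (r ^ n) * z) \<le> cmod z" for n z
  proof -
    have "r ^ n \<le> 1" using r by (simp add: power_le_one)
    then show ?thesis using r by (simp add: norm_mult norm_power mult_left_le_one_le)
  qed
  have hol: "(\<lambda>z. \<Sum>n. c ^ n * F (of_real (r ^ n) * z)) holomorphic_on ball 0 (R/2)"
  proof (rule holomorphic_suminf)
    show "(\<lambda>z. c ^ n * F (of_real (r ^ n) * z)) holomorphic_on ball 0 (R/2)" for n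
    proof -
      have "(\<lambda>z. of_real (r ^ n) * z) holomorphic_on ball 0 (R/2)" by (intro holomorphic_intros)
      moreover have "(\<lambda>z::complex. of_real (r ^ n) * z) ` ball 0 (R/2) \<subseteq> ball 0 R"
      proof
        fix u :: complex assume "u \<in> (\<lambda>z. of_real (r ^ n) * z) ` ball 0 (R/2)"
        then obtain z where z: "cmod z < R/2" "u = of_real (r ^ n) * z" by auto
        have "cmod u \<le> cmod z" unfolding z(2) by (rule rn)
        then have "cmod u < R" using z(1) F(1) by linarith
        then show "u \<in> ball 0 R" by simp
      qed
      ultimately have "(\<lambda>z. F (of_real (r ^ n) * z)) holomorphic_on ball 0 (R/2)"
        using holomorphic_on_compose_gen[OF _ F(2)] by (auto simp: o_def)
      then show ?thesis by (intro holomorphic_intros)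
    qed
    fix x :: complex
    have bd: "cmod (c ^ n * F (of_real (r ^ n) * y)) \<le> cmod c ^ n * B" if "y \<in> ball x 1 \<inter> ball 0 (R/2)" for n y
      using B[of "of_real (r ^ n) * y"] rn[of n y] that by (simp add: norm_mult norm_power mult_left_mono)
    have "summable (\<lambda>n. cmod c ^ n * B)"
      using c by (intro summable_mult2 summable_geometric) simp
    moreover have "\<forall>\<^sub>F n in sequentially. \<forall>y\<in>ball x 1 \<inter> ball 0 (R/2). cmod (c ^ n * F (of_real (r ^ n) * y)) \<le> cmod c ^ n * B"
      using bd by (intro always_eventually allI ballI)
    ultimately show "\<exists>d>0. \<exists>h. summable h \<and> (\<forall>\<^sub>F n in sequentially. \<forall>y\<in>ball x d \<inter> ball 0 (R/2). cmod (c ^ n * F (of_real (r ^ n) * y)) \<le> h n)"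
      using zero_less_one by blast
  qed simp
  have near: "v y = (\<Sum>n. c ^ n * F (of_real (r ^ n) * of_real y))" if "\<bar>y\<bar> < R/2" for y
  proof -
    have "a (r ^ n * y) = F (of_real (r ^ n) * of_real y)" for n
    proof -
      have "\<bar>r ^ n * y\<bar> \<le> \<bar>y\<bar>" using rn[of n "of_real y"] by (simp add: norm_mult norm_power abs_mult power_abs)
      then show ?thesis using F(3)[of "r ^ n * y"] that by simp
    qed
    then show ?thesis by (simp add: v_def)
  qed
  have base: "real_analytic_at v x" if "\<bar>x\<bar> < R/2" for x
  proof (rule real_analytic_atI[OF open_ball hol])
    have "\<forall>\<^sub>F y in nhds x. y \<in> ball 0 (R/2)" by (rule eventually_nhds_in_open) (use that in auto)
    then show "\<forall>\<^sub>F y in nhds x. v y = (\<Sum>n. c ^ n * F (of_real (r ^ n) * of_real y))"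
      by eventually_elim (rule near, simp)
  qed (use that in simp)
  have summ: "summable (\<lambda>n. c ^ n * a (r ^ n * x))" for x
  proof -
    have "(\<lambda>n. r ^ n * x) \<longlonglongrightarrow> 0 * x" by (intro tendsto_mult tendsto_const LIMSEQ_power_zero) (use r in simp)
    then have "(\<lambda>n. a (r ^ n * x)) \<longlonglongrightarrow> a 0"
      using isCont_tendsto_compose[OF real_analytic_at_isCont[OF a[of 0]]] by simp
    then have "Bseq (\<lambda>n. a (r ^ n * x))" by (intro convergent_imp_Bseq convergentI)
    then obtain K where K: "\<And>n. cmod (a (r ^ n * x)) \<le> K" by (auto simp: Bseq_def)
    show ?thesis
    proof (rule summable_comparison_test')
      show "summable (\<lambda>n. cmod c ^ n * K)" using c by (intro summable_mult2 summable_geometric) simp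
      show "norm (c ^ n * a (r ^ n * x)) \<le> cmod c ^ n * K" for n
        using K[of n] by (simp add: norm_mult norm_power mult_left_mono)
    qed
  qed
  have feq: "v x = a x + c * v (r * x)" for x
  proof -
    have "v x = a x + (\<Sum>n. c ^ Suc n * a (r ^ Suc n * x))"
      using suminf_split_head[OF summ[of x]] by (simp add: v_def)
    also have "(\<lambda>n. c ^ Suc n * a (r ^ Suc n * x)) = (\<lambda>n. c * (c ^ n * a (r ^ n * (r * x))))"
      by (simp add: fun_eq_iff mult_ac)
    also have "(\<Sum>n. c * (c ^ n * a (r ^ n * (r * x)))) = c * v (r * x)"
      unfolding v_def by (rule suminf_mult[OF summ])
    finally show ?thesis .
  qed
  then show "v x = a x + c * v (r * x)" .
  have step: "real_analytic_at v x" if "\<bar>r ^ N * x\<bar> < R/2" for N x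
    using that
  proof (induction N arbitrary: x)
    case (Suc N)
    have "real_analytic_at v (r * x)" by (rule Suc(1)) (use Suc(2) in \<open>simp add: mult_ac\<close>)
    then have "real_analytic_at (\<lambda>y. v (r * y)) x"
      using real_analytic_at_moebius[of v r x 0 0 1] by simp
    then have "real_analytic_at (\<lambda>y. a y + c * v (r * y)) x"
      by (intro real_analytic_at_add real_analytic_at_mult real_analytic_at_const a)
    then show ?case by (rule real_analytic_at_cong) (simp add: feq[symmetric])
  qed (use base in simp)
  have "(\<lambda>N. \<bar>r ^ N * x\<bar>) \<longlonglongrightarrow> \<bar>0 * x\<bar>"
    by (intro tendsto_rabs tendsto_mult tendsto_const LIMSEQ_power_zero) (use r in simp)
  then have "\<forall>\<^sub>F N in sequentially. \<bar>r ^ N * x\<bar> < R/2" by (rule order_tendstoD) (use F(1) in simp)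
  then obtain N where "\<bar>r ^ N * x\<bar> < R/2" using eventually_happens'[OF sequentially_bot] by blast
  then show "real_analytic_at v x" by (rule step)
qed

text \<open>The element TST^2 of the Fibonacci condition, that is
  \<open>x \<mapsto> (x + 1) / (x + 2)\<close>, with eigenvalues \<open>phi + 1\<close> and
  \<open>2 - phi\<close>.\<close>

definition gA :: psl2z where "gA = gT * gS * gT * gT"

lemma gA_psl: "gA = psl 1 1 1 2" by (simp add: gA_def psl_word_simps)

text \<open>Conjugation by a real matrix with \<open>1 / phi \<mapsto> 0\<close>, \<open>- phi \<mapsto> \<infinity>\<close> turns the hyperbolic element \<open>gA\<close> into
  a scaling.\<close>

lemma hyperbolic_solution:
  assumes f: "f \<in> V_omega s" and s: "Re s > 0"
  obtains v where "v \<in> V_fs s" "v - cslash s v gA = f" "\<And>p. p \<noteq> Fin (- phi) \<Longrightarrow> regular s v p"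
proof -
  \<comment> \<open>This normalizes the conjugating matrix, with zero
    \<open>phi - 1 = 1 / phi\<close> and pole \<open>- phi\<close>, to determinant 1.\<close>
  define \<delta> where "\<delta> = sqrt (2 * phi - 1)"
  have \<delta>: "\<delta> > 0" "\<delta> * \<delta> = 2 * phi - 1" using phi_gt by (auto simp: \<delta>_def)
  define a b c d where "a = 1 / \<delta>" "b = (1 - phi) / \<delta>" "c = 1 / \<delta>" "d = phi / \<delta>"
  note abcd = this
  have det: "a * d - b * c = 1"
    using \<delta> phi_gt by (simp add: abcd diff_divide_distrib[symmetric])
  have det': "d * a - (- b) * (- c) = 1" using det by (simp add: algebra_simps)
  obtain f0 where f0: "f = class_of f0" "\<forall>x. real_analytic_at f0 x" using V_omega_representative[OF f] by blast
  define h where "h = rslash s f0 d (-b) (-c) a"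
  have "class_of h \<in> V_omega s" unfolding V_omega_iff
  proof (intro conjI allI)
    show "class_of h \<in> V_fs s" unfolding h_def by (rule class_of_rslash_V_fs[OF det', of "{}"]) (use f0 in auto)
    show "regular s (class_of h) p" for p
      using f f0(1) by (simp add: h_def regular_fun_rslash[OF det'] V_omega_iff)
  qed
  then obtain ah where ah: "class_of h = class_of ah" "\<And>x. real_analytic_at ah x"
    using V_omega_representative by blast
  \<comment> \<open>In the new coordinate \<open>gA\<close> is multiplication by \<open>r\<close>,
    the quotient of its eigenvalues, with the slash factor \<open>C\<close>; the positivity of
    \<open>Re s\<close> makes \<open>cmod C < 1\<close>.\<close>
  define r where "r = (2 - phi)\<^sup>2"
  define C where "C = complex_of_real (phi + 1) powr (-2 * s)"
  have r: "0 < r" "r < 1" using phi_gt power_strict_mono[of "2 - phi" 1 2] by (simp_all add: r_def)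
  have C: "cmod C < 1" using phi_gt s by (simp add: C_def norm_powr_real_powr powr_less_one)
  define vt where "vt x = (\<Sum>n. C ^ n * ah (r ^ n * x))" for x
  have vt: "real_analytic_at vt x" "vt x = ah x + C * vt (r * x)" for x
    unfolding vt_def using scaling_series_analytic[OF ah(2) C r] by blast+
  define v where "v = rslash s vt a b c d"
  show ?thesis
  proof (rule that)
    show V: "class_of v \<in> V_fs s" unfolding v_def by (rule class_of_rslash_V_fs[OF det, of "{}"]) (use vt in auto)
    show "regular s (class_of v) p" if "p \<noteq> Fin (- phi)" for p
    proof -
      obtain y where "rmoebius a b c d p = Fin y"
      proof (cases p)
        case (Fin x)
        have "c * x + d = (x + phi) / \<delta>" by (simp add: abcd add_divide_distrib)
        then show ?thesis using that \<delta>(1) Fin \<open>p \<noteq> Fin (- phi)\<close> by (auto simp: add_eq_0_iff)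
      next
        case Infty
        then show ?thesis using that \<delta>(1) by (auto simp: abcd)
      qed
      then show ?thesis unfolding v_def regular_class_of
        by (intro regular_fun_rslash[OF det]) (simp add: regular_fun_analytic vt(1))
    qed
    have "eq_cofinite (\<lambda>x. v x - slash s v gA x) f0"
    proof -
      have 1: "a * 1 + b * 1 = (2 - phi) * a" "a * 1 + b * 2 = (2 - phi) * b"
        "c * 1 + d * 1 = (phi + 1) * c" "c * 1 + d * 2 = (phi + 1) * d"
        using phi_square \<delta>(1) by (simp_all add: abcd field_simps)
      have sl: "slash s v gA x = rslash s (\<lambda>y. C * vt (r * y)) a b c d x" if "x \<noteq> -2" for x
      proof -
        have "slash s v gA x = rslash s (rslash s vt a b c d) 1 1 1 2 x"
          by (simp add: gA_psl slash_psl v_def)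
        also have "\<dots> = rslash s vt ((2 - phi) * a) ((2 - phi) * b) ((phi + 1) * c) ((phi + 1) * d) x"
          using rslash_rslash[of 1 x 2 s vt a b c d 1 1] that unfolding 1 by auto
        also have "\<dots> = rslash s (\<lambda>y. C * vt (r * y)) a b c d x"
        proof -
          have p1: "(phi + 1) * c * x + (phi + 1) * d = (phi + 1) * (c * x + d)"
            "(2 - phi) * a * x + (2 - phi) * b = (2 - phi) * (a * x + b)" by (simp_all add: algebra_simps)
          have "(2 - phi) / (phi + 1) = (2 - phi) * (1 / (phi + 1))" by simp
          also have "\<dots> = r" unfolding phi_inverse r_def power2_eq_square ..
          finally have "(2 - phi) / (phi + 1) = r" .
          then have p2: "(2 - phi) * (a * x + b) / ((phi + 1) * (c * x + d)) = r * ((a * x + b) / (c * x + d))"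
            by (simp flip: times_divide_times_eq)
          show ?thesis unfolding rslash_def p1 p2 C_def
            using phi_gt by (simp add: mult.assoc[symmetric] abs_powr_mult[symmetric])
        qed
        finally show ?thesis .
      qed
      have "eq_cofinite (\<lambda>x. v x - slash s v gA x) (rslash s ah a b c d)"
      proof (rule eq_cofiniteI[of "{-2}"])
        fix x :: real assume "x \<notin> {-2}"
        then have "v x - slash s v gA x = rslash s vt a b c d x - rslash s (\<lambda>y. C * vt (r * y)) a b c d x"
          using sl by (simp add: v_def)
        also have "\<dots> = rslash s ah a b c d x"
          using vt(2)[of "(a * x + b) / (c * x + d)"] by (simp add: rslash_def algebra_simps)
        finally show "v x - slash s v gA x = rslash s ah a b c d x" .
      qed simp
      moreover have "eq_cofinite (rslash s ah a b c d) (rslash s h a b c d)"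
        using ah(1) by (intro eq_cofinite_rslash[OF det]) (simp add: class_of_eq_iff[symmetric])
      moreover have "eq_cofinite (rslash s h a b c d) f0"
      proof (rule eq_cofiniteI)
        have "c \<noteq> 0 \<or> d \<noteq> 0" using det by auto
        then show "finite {x. c * x + d = 0}" by (rule finite_linear_zero)
        fix x assume "x \<notin> {x. c * x + d = 0}"
        then have "rslash s h a b c d x = rslash s f0 (d * a - b * c) (d * b - b * d) (a * c - c * a) (a * d - c * b) x"
          unfolding h_def by (subst rslash_rslash) (simp_all add: algebra_simps)
        also have "\<dots> = f0 x" using det by (simp add: rslash_def mult.commute)
        finally show "rslash s h a b c d x = f0 x" .
      qed
      ultimately show ?thesis by (metis eq_cofinite_trans)
    qed
    then show "class_of v - cslash s (class_of v) gA = f" by (simp add: class_of_arith f0 class_of_eq_iff)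
  qed
qed

section \<open>Leading asymptotics and difference equations\<close>

text \<open>In other words q(t) = A t^(1 - 2s) + B t^(-2s) + o(t^(-2s)). The second term is there so
  that \<open>A\<close> can be read off from the differences of q, see
  \<open>asym_difference\<close>.\<close>

definition asym :: "complex \<Rightarrow> (real \<Rightarrow> complex) \<Rightarrow> complex \<Rightarrow> bool" where
  "asym s q A \<longleftrightarrow> (\<exists>B. ((\<lambda>t. of_real t powr (2 * s) * (q t - A * of_real t powr (1 - 2 * s))) \<longlongrightarrow> B) at_top)"

lemma powr_one_plus_tendsto:
  "((\<lambda>t. of_real t * ((1 + of_real (a / t)) powr \<beta> - 1)) \<longlongrightarrow> \<beta> * of_real a) at_top" for a :: real and \<beta> :: complex
proof -
  have d: "((\<lambda>u. (1 + of_real a * u) powr \<beta>) has_field_derivative \<beta> * of_real a) (at 0)"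
    by (auto intro!: derivative_eq_intros)
  then have "((\<lambda>u. ((1 + of_real a * u) powr \<beta> - 1) / u) \<longlongrightarrow> \<beta> * of_real a) (at 0)"
    by (simp add: has_field_derivative_iff)
  moreover have "filterlim (\<lambda>t::real. complex_of_real (1 / t)) (at 0) at_top"
  proof -
    have "((\<lambda>t::real. complex_of_real (1 / t)) \<longlongrightarrow> of_real 0) at_top"
      by (intro tendsto_of_real tendsto_divide_0[OF tendsto_const] filterlim_at_top_imp_at_infinity filterlim_ident)
    moreover have "\<forall>\<^sub>F t in at_top. complex_of_real (1 / t) \<noteq> 0"
      using eventually_gt_at_top[of "0::real"] by eventually_elim simp
    ultimately show ?thesis by (simp add: filterlim_at)
  qed
  ultimately have "((\<lambda>t. ((1 + of_real a * of_real (1 / t)) powr \<beta> - 1) / of_real (1 / t)) \<longlongrightarrow> \<beta> * of_real a) at_top"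
    by (rule filterlim_compose)
  then show ?thesis
    by (rule Lim_transform_eventually) (use eventually_gt_at_top[of "0::real"] in \<open>eventually_elim, simp add: mult.commute\<close>)
qed

lemma powr_tendsto_zero:
  assumes "Re \<beta> < 0" shows "((\<lambda>t. complex_of_real t powr \<beta>) \<longlongrightarrow> 0) at_top"
proof (rule Lim_null_comparison[where g = "\<lambda>t. t powr Re \<beta>"])
  show "\<forall>\<^sub>F t in at_top. cmod (complex_of_real t powr \<beta>) \<le> t powr Re \<beta>"
    using eventually_gt_at_top[of "0::real"] by eventually_elim (simp add: norm_powr_real_powr)
  show "((\<lambda>t. t powr Re \<beta>) \<longlongrightarrow> 0) at_top"
    by (rule tendsto_neg_powr[OF assms filterlim_ident])
qed

lemma shift_ratio_powr:
  assumes "t > 0" "t + a > 0"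
  shows "complex_of_real (t + a) powr \<beta> = of_real t powr \<beta> * (1 + of_real (a / t)) powr \<beta>"
proof -
  have "complex_of_real (t + a) = of_real t * of_real (1 + a / t)" using assms by (simp add: field_simps flip: of_real_mult)
  moreover have "1 + a / t > 0" using assms by (simp add: field_simps)
  ultimately have "complex_of_real (t + a) powr \<beta> = of_real t powr \<beta> * of_real (1 + a / t) powr \<beta>"
    using assms by (simp add: powr_times_real del: of_real_add of_real_divide)
  then show ?thesis by simp
qed

lemma shift_powr_diff_tendsto:
  "((\<lambda>t. of_real t powr (1 - \<beta>) * (of_real (t + a) powr \<beta> - of_real t powr \<beta>)) \<longlongrightarrow> \<beta> * of_real a) at_top"
  for a :: real and \<beta> :: complex
proof (rule Lim_transform_eventually[OF powr_one_plus_tendsto])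
  show "\<forall>\<^sub>F t in at_top. of_real t * ((1 + of_real (a / t)) powr \<beta> - 1) =
      of_real t powr (1 - \<beta>) * (of_real (t + a) powr \<beta> - of_real t powr \<beta>)"
    using eventually_gt_at_top[of "\<bar>a\<bar>"]
  proof eventually_elim
    case (elim t)
    then have t: "t > 0" "t + a > 0" by auto
    have p: "complex_of_real t powr (1 - \<beta>) * of_real t powr \<beta> = of_real t"
      using t by (simp flip: powr_add)
    have "of_real t powr (1 - \<beta>) * (of_real (t + a) powr \<beta> - of_real t powr \<beta>) =
       (of_real t powr (1 - \<beta>) * of_real t powr \<beta>) * ((1 + of_real (a / t)) powr \<beta> - 1)"
      unfolding shift_ratio_powr[OF t] by (simp add: algebra_simps)
    then show ?case unfolding p by simp
  qed
qed

lemma shift_powr_tendsto_zero: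
  assumes "Re s > 0"
  shows "((\<lambda>t. of_real (t + a) powr (1 - 2 * s) - complex_of_real t powr (1 - 2 * s)) \<longlongrightarrow> 0) at_top"
proof -
  have "((\<lambda>t. of_real t powr (-2 * s) * (of_real t powr (1 - (1 - 2 * s)) * (of_real (t + a) powr (1 - 2 * s) - complex_of_real t powr (1 - 2 * s))))
     \<longlongrightarrow> 0 * ((1 - 2 * s) * of_real a)) at_top"
    by (intro tendsto_mult shift_powr_diff_tendsto powr_tendsto_zero) (use assms in simp)
  then have "((\<lambda>t. of_real t powr (-2 * s) * (of_real t powr (1 - (1 - 2 * s)) * (of_real (t + a) powr (1 - 2 * s) - complex_of_real t powr (1 - 2 * s))))
     \<longlongrightarrow> 0) at_top" by simp
  then show ?thesis
  proof (rule Lim_transform_eventually)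
    show "\<forall>\<^sub>F t in at_top. of_real t powr (-2 * s) * (of_real t powr (1 - (1 - 2 * s)) * (of_real (t + a) powr (1 - 2 * s) - complex_of_real t powr (1 - 2 * s))) =
       of_real (t + a) powr (1 - 2 * s) - complex_of_real t powr (1 - 2 * s)"
      using eventually_gt_at_top[of "0::real"]
    proof eventually_elim
      case (elim t)
      have "complex_of_real t powr (-2 * s) * of_real t powr (1 - (1 - 2 * s)) = 1"
        using elim by (simp flip: powr_add)
      then show ?case by (simp only: mult.assoc[symmetric] mult_1_left)
    qed
  qed
qed

lemma asym_shift:
  assumes "asym s q A" "Re s > 0"
  shows "((\<lambda>t. q (t + a) - A * of_real t powr (1 - 2 * s)) \<longlongrightarrow> 0) at_top"
proof -
  obtain B where B: "((\<lambda>t. of_real t powr (2 * s) * (q t - A * of_real t powr (1 - 2 * s))) \<longlongrightarrow> B) at_top"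
    using assms(1) by (auto simp: asym_def)
  have "((\<lambda>t. of_real t powr (-2 * s) * (of_real t powr (2 * s) * (q t - A * of_real t powr (1 - 2 * s)))) \<longlongrightarrow> 0 * B) at_top"
    by (intro tendsto_mult B powr_tendsto_zero) (use assms in simp)
  then have "((\<lambda>t. of_real t powr (-2 * s) * (of_real t powr (2 * s) * (q t - A * of_real t powr (1 - 2 * s)))) \<longlongrightarrow> 0) at_top" by simp
  then have 1: "((\<lambda>t. q t - A * of_real t powr (1 - 2 * s)) \<longlongrightarrow> 0) at_top"
  proof (rule Lim_transform_eventually)
    show "\<forall>\<^sub>F t in at_top. of_real t powr (-2 * s) * (of_real t powr (2 * s) * (q t - A * of_real t powr (1 - 2 * s))) = q t - A * of_real t powr (1 - 2 * s)"
      using eventually_gt_at_top[of "0::real"]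
    proof eventually_elim
      case (elim t)
      have "complex_of_real t powr (-2 * s) * of_real t powr (2 * s) = 1" using elim by (simp flip: powr_add)
      then show ?case by (simp only: mult.assoc[symmetric] mult_1_left)
    qed
  qed
  have "filterlim (\<lambda>t::real. t + a) at_top at_top"
    by (rule filterlim_tendsto_add_at_top[OF tendsto_const filterlim_ident, of a, simplified add.commute])
  from filterlim_compose[OF 1 this]
  have 2: "((\<lambda>t. q (t + a) - A * of_real (t + a) powr (1 - 2 * s)) \<longlongrightarrow> 0) at_top" .
  have "((\<lambda>t. (q (t + a) - A * of_real (t + a) powr (1 - 2 * s)) + A * (of_real (t + a) powr (1 - 2 * s) - complex_of_real t powr (1 - 2 * s))) \<longlongrightarrow> 0 + A * 0) at_top"
    by (intro tendsto_add tendsto_mult tendsto_const 2 shift_powr_tendsto_zero assms)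
  then show ?thesis by (simp add: algebra_simps)
qed

text \<open>The contributions of the term with \<open>B\<close> cancel in the limit, because the
  ratio of consecutive powers tends to 1; only the difference of the leading powers remains.\<close>

lemma asym_difference:
  assumes "asym s q A"
  shows "((\<lambda>t. of_real t powr (2 * s) * (q t - q (t + 1))) \<longlongrightarrow> A * (2 * s - 1)) at_top"
proof -
  obtain B where B: "((\<lambda>t. of_real t powr (2 * s) * (q t - A * of_real t powr (1 - 2 * s))) \<longlongrightarrow> B) at_top"
    using assms(1) by (auto simp: asym_def)
  have f1: "filterlim (\<lambda>t::real. t + 1) at_top at_top"
    by (rule filterlim_tendsto_add_at_top[OF tendsto_const filterlim_ident, of 1, simplified add.commute])
  from filterlim_compose[OF B f1]
  have B1: "((\<lambda>t. of_real (t + 1) powr (2 * s) * (q (t + 1) - A * of_real (t + 1) powr (1 - 2 * s))) \<longlongrightarrow> B) at_top" .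
  have R: "((\<lambda>t. (1 + of_real (1 / t)) powr (- (2 * s))) \<longlongrightarrow> (1 + of_real 0) powr (- (2 * s))) at_top"
    by (intro tendsto_intros tendsto_of_real tendsto_divide_0[OF tendsto_const] filterlim_at_top_imp_at_infinity filterlim_ident) simp_all
  have P: "((\<lambda>t. of_real t powr (1 - (1 - 2 * s)) * (of_real (t + 1) powr (1 - 2 * s) - of_real t powr (1 - 2 * s))) \<longlongrightarrow> (1 - 2 * s) * of_real 1) at_top"
    by (rule shift_powr_diff_tendsto)
  have "((\<lambda>t. of_real t powr (2 * s) * (q t - A * of_real t powr (1 - 2 * s))
      - (1 + of_real (1 / t)) powr (- (2 * s)) * (of_real (t + 1) powr (2 * s) * (q (t + 1) - A * of_real (t + 1) powr (1 - 2 * s)))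
      - A * (of_real t powr (1 - (1 - 2 * s)) * (of_real (t + 1) powr (1 - 2 * s) - of_real t powr (1 - 2 * s))))
      \<longlongrightarrow> B - (1 + of_real 0) powr (- (2 * s)) * B - A * ((1 - 2 * s) * of_real 1)) at_top"
    by (intro tendsto_diff tendsto_mult B B1 R P tendsto_const)
  moreover have "B - (1 + of_real 0) powr (- (2 * s)) * B - A * ((1 - 2 * s) * of_real 1) = A * (2 * s - 1)"
    by (simp add: algebra_simps)
  ultimately have lim: "((\<lambda>t. of_real t powr (2 * s) * (q t - A * of_real t powr (1 - 2 * s))
      - (1 + of_real (1 / t)) powr (- (2 * s)) * (of_real (t + 1) powr (2 * s) * (q (t + 1) - A * of_real (t + 1) powr (1 - 2 * s)))
      - A * (of_real t powr (1 - (1 - 2 * s)) * (of_real (t + 1) powr (1 - 2 * s) - of_real t powr (1 - 2 * s))))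
      \<longlongrightarrow> A * (2 * s - 1)) at_top"
    by (simp only:)
  show ?thesis
  proof (rule Lim_transform_eventually[OF lim])
    show "\<forall>\<^sub>F t in at_top. of_real t powr (2 * s) * (q t - A * of_real t powr (1 - 2 * s))
      - (1 + of_real (1 / t)) powr (- (2 * s)) * (of_real (t + 1) powr (2 * s) * (q (t + 1) - A * of_real (t + 1) powr (1 - 2 * s)))
      - A * (of_real t powr (1 - (1 - 2 * s)) * (of_real (t + 1) powr (1 - 2 * s) - of_real t powr (1 - 2 * s)))
      = of_real t powr (2 * s) * (q t - q (t + 1))"
      using eventually_gt_at_top[of "0::real"]
    proof eventually_elim
      case (elim t)
      define T X X1 Y where "T = complex_of_real t powr (2 * s)" "X = complex_of_real t powr (1 - 2 * s)"
        "X1 = complex_of_real (t + 1) powr (1 - 2 * s)" "Y = (1 + complex_of_real (1 / t)) powr (- (2 * s))"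
      have "1 + complex_of_real (1 / t) = of_real (1 + 1 / t)" by simp
      moreover have "1 + 1 / t \<noteq> 0" using elim by (simp add: field_simps)
      ultimately have ne: "1 + complex_of_real (1 / t) \<noteq> 0" by (metis of_real_eq_0_iff)
      have "Y * (T * (1 + complex_of_real (1 / t)) powr (2 * s)) = T * (1 + complex_of_real (1 / t)) powr (- (2 * s) + 2 * s)"
        unfolding powr_add T_X_X1_Y_def by (simp only: mult_ac)
      also have "\<dots> = T" using ne by simp
      finally have Y: "Y * complex_of_real (t + 1) powr (2 * s) = T"
        using shift_ratio_powr[of t 1 "2 * s"] elim by (simp add: T_X_X1_Y_def)
      have e: "1 - (1 - 2 * s) = 2 * s" by simp
      show ?case unfolding e T_X_X1_Y_def[symmetric] mult.assoc[symmetric] Y by (simp add: algebra_simps)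
    qed
  qed
qed

section \<open>Asymptotic behaviour at infinity\<close>

text \<open>The difference equation forces \<open>A = p 0 / (2 * s - 1)\<close>, and then
  \<open>reg_sum_unique\<close> applies. The shift by 2 is adapted to the arguments
  \<open>x + 3\<close> and \<open>2 - x\<close> in \<open>real_eigen\<close>, for which
  \<open>q\<close> is taken at \<open>x + 1\<close> and at \<open>- x\<close>.\<close>

lemma asym_rreg:
  assumes p: "real_analytic_at p 0" and s: "Re s > 0" "s \<noteq> 1/2" and q: "asym s q A" and y0: "y0 \<ge> 0"
    and d: "\<And>y. y > y0 \<Longrightarrow> q (y - 2) - q (y - 1) = of_real y powr (-2 * s) * p (1 / y)" and y: "y > y0"
  shows "q (y - 2) = rreg s p y"
proof -
  have s': "2 * s - 1 \<noteq> 0" using s(2) by (auto simp: field_simps)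
  \<comment> \<open>The limit of \<open>t powr (2 * s)\<close> times \<open>q t - q (t + 1)\<close>
    is computed once from the asymptotics and once from the difference equation.\<close>
  have A: "A * (2 * s - 1) = p 0"
  proof (rule tendsto_unique[OF _ asym_difference[OF q]])
    have p0: "(p \<longlongrightarrow> p 0) (nhds 0)" using real_analytic_at_isCont[OF p] by (simp add: continuous_at_imp_continuous_within isCont_def tendsto_at_iff_tendsto_nhds)
    have "((\<lambda>t::real. 1 / (t + 2)) \<longlongrightarrow> 0) at_top"
      by (intro tendsto_divide_0[OF tendsto_const] filterlim_at_top_imp_at_infinity
          filterlim_tendsto_add_at_top[OF tendsto_const filterlim_ident, of 2, simplified add.commute])
    from filterlim_compose[OF p0 this] have 1: "((\<lambda>t. p (1 / (t + 2))) \<longlongrightarrow> p 0) at_top" .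
    have 2: "((\<lambda>t::real. (1 + complex_of_real (2 / t)) powr (-2 * s)) \<longlongrightarrow> (1 + of_real 0) powr (-2 * s)) at_top"
      by (intro tendsto_intros tendsto_of_real tendsto_divide_0[OF tendsto_const] filterlim_at_top_imp_at_infinity filterlim_ident) simp_all
    have "((\<lambda>t::real. (1 + complex_of_real (2 / t)) powr (-2 * s) * p (1 / (t + 2))) \<longlongrightarrow> p 0) at_top"
      using tendsto_mult[OF 2 1] by simp
    then show "((\<lambda>t. of_real t powr (2 * s) * (q t - q (t + 1))) \<longlongrightarrow> p 0) at_top"
    proof (rule Lim_transform_eventually)
      show "\<forall>\<^sub>F t in at_top. (1 + complex_of_real (2 / t)) powr (-2 * s) * p (1 / (t + 2)) = of_real t powr (2 * s) * (q t - q (t + 1))"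
        using eventually_gt_at_top[of y0]
      proof eventually_elim
        case (elim t)
        then have t: "t > 0" "t + 2 > 0" using y0 by auto
        have "q t - q (t + 1) = of_real (t + 2) powr (-2 * s) * p (1 / (t + 2))"
          using d[of "t + 2"] elim by (simp add: algebra_simps)
        also have "of_real (t + 2) powr (-2 * s) = of_real t powr (-2 * s) * (1 + complex_of_real (2 / t)) powr (-2 * s)"
          using shift_ratio_powr[OF t, of "-2 * s"] by simp
        finally have "of_real t powr (2 * s) * (q t - q (t + 1)) =
            (of_real t powr (2 * s) * of_real t powr (-2 * s)) * ((1 + complex_of_real (2 / t)) powr (-2 * s) * p (1 / (t + 2)))"
          by (simp only: mult_ac)
        also have "complex_of_real t powr (2 * s) * of_real t powr (-2 * s) = 1" using t by (simp flip: powr_add)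
        finally show ?case by simp
      qed
    qed
  qed simp
  have "q (y + real 0 - 2) = reg_sum s (\<lambda>u. p (Re u)) (of_real y)"
  proof (rule reg_sum_unique[OF lipschitz0_real[OF p] s(1) _ s(2), where q = "\<lambda>n. q (y + real n - 2)"])
    show "0 < Re (complex_of_real y)" using y y0 by simp
    show "q (y + real n - 2) - q (y + real (Suc n) - 2) = (of_real y + of_nat n) powr (-2 * s) * p (Re (1 / (of_real y + of_nat n)))" for n
    proof -
      have "q (y + real n - 2) - q (y + real n - 1) = of_real (y + real n) powr (-2 * s) * p (1 / (y + real n))"
        by (rule d) (use y in simp)
      moreover have "y + real (Suc n) - 2 = y + real n - 1" by simp
      ultimately show ?thesis unfolding of_real_inverse_add Re_complex_of_real by simp
    qed
    have "filterlim (\<lambda>n. y + real n) at_top sequentially"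
      by (rule filterlim_tendsto_add_at_top[OF tendsto_const filterlim_real_sequentially])
    from filterlim_compose[OF asym_shift[OF q s(1), of "-2"] this]
    have "(\<lambda>n. q (y + real n + - 2) - A * of_real (y + real n) powr (1 - 2 * s)) \<longlonglongrightarrow> 0" .
    moreover have "A = p (Re 0) / (2 * s - 1)" using A s' by (simp add: field_simps)
    ultimately show "(\<lambda>n. q (y + real n - 2) - p (Re 0) / (2 * s - 1) * (of_real y + of_nat n) powr (1 - 2 * s)) \<longlonglongrightarrow> 0"
      by simp
  qed
  then show ?thesis by (simp add: rreg_def)
qed

lemma slash_gS: "slash s h gS y = of_real \<bar>y\<bar> powr (-2 * s) * h (-1 / y)"
  by (simp add: gS_psl slash_psl rslash_def)

text \<open>What is used of a simple singularity at infinity: first order differentiability at 0 of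
  y times h|S, whose value \<open>l0\<close> there plays the part of a residue.\<close>

definition diff_inf :: "complex \<Rightarrow> cfun \<Rightarrow> complex \<Rightarrow> bool" where
  "diff_inf s f l0 \<longleftrightarrow> (\<exists>h l l1. f = class_of h \<and> (l has_vector_derivative l1) (at 0) \<and> l 0 = l0 \<and>
     (\<forall>\<^sub>F y in at 0. l y = of_real y * slash s h gS y))"

lemma slash_gS_eventually:
  assumes "class_of h = class_of h'" shows "\<forall>\<^sub>F y in at 0. slash s h gS y = slash s h' gS y"
  using assms by (intro eq_cofinite_eventually eq_cofinite_slash) (simp add: class_of_eq_iff)

lemma diff_inf_class:
  assumes "diff_inf s (class_of h) l0"
  obtains l l1 where "(l has_vector_derivative l1) (at 0)" "l 0 = l0" "\<forall>\<^sub>F y in at 0. l y = of_real y * slash s h gS y"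
proof -
  obtain h' l l1 where 1: "class_of h = class_of h'" "(l has_vector_derivative l1) (at 0)" "l 0 = l0"
    "\<forall>\<^sub>F y in at 0. l y = of_real y * slash s h' gS y" using assms by (auto simp: diff_inf_def)
  have "\<forall>\<^sub>F y in at 0. l y = of_real y * slash s h gS y"
    using 1(4) slash_gS_eventually[OF 1(1), of s] by eventually_elim simp
  then show ?thesis using that 1 by blast
qed

lemma real_analytic_at_vector_derivative:
  assumes "real_analytic_at h x" obtains h1 where "(h has_vector_derivative h1) (at x)"
proof -
  obtain r F where F: "r > 0" "F holomorphic_on ball (of_real x) r" "\<And>y. \<bar>y - x\<bar> < r \<Longrightarrow> h y = F (of_real y)"
    using real_analytic_atE[OF assms] by blast
  have "(F has_field_derivative deriv F (of_real x)) (at (of_real x))"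
    by (rule holomorphic_derivI[OF F(2) open_ball]) (use F(1) in simp)
  then have "((\<lambda>y. F (of_real y)) has_vector_derivative deriv F (of_real x)) (at x)"
    by (rule has_vector_derivative_real_field)
  then have "(h has_vector_derivative deriv F (of_real x)) (at x)"
  proof (rule has_vector_derivative_transform_within_open[where S = "ball x r"])
    show "F (of_real y) = h y" if "y \<in> ball x r" for y using that F(3)[of y] by (simp add: dist_norm abs_minus_commute)
  qed (use F(1) in auto)
  then show ?thesis by (rule that)
qed

lemma regular_Infty_rep:
  assumes "regular s (class_of h) Infty"
  obtains \<kappa> where "real_analytic_at \<kappa> 0" "\<forall>\<^sub>F y in at 0. \<kappa> y = slash s h gS y"
  using assms by (auto simp: regular_fun_def slash_gS)

text \<open>A regular function contributes \<open>y * \<kappa> y\<close>, which vanishes at 0, so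
  \<open>l0\<close> does not change.\<close>

lemma diff_inf_minus_regular:
  assumes f: "diff_inf s f l0" and r: "regular s r Infty"
  shows "diff_inf s (f - r) l0"
proof (cases f rule: class_of_cases)
  case (1 h)
  obtain hr where hr: "r = class_of hr" by (rule class_of_cases)
  obtain l l1 where l: "(l has_vector_derivative l1) (at 0)" "l 0 = l0" "\<forall>\<^sub>F y in at 0. l y = of_real y * slash s h gS y"
    using diff_inf_class f 1 by blast
  obtain \<kappa> where k: "real_analytic_at \<kappa> 0" "\<forall>\<^sub>F y in at 0. \<kappa> y = slash s hr gS y"
    using regular_Infty_rep r hr by blast
  have "real_analytic_at (\<lambda>y. of_real y * \<kappa> y) 0"
    by (rule real_analytic_at_mult[OF real_analytic_at_of_real k(1)])
  then obtain d where d: "((\<lambda>y. of_real y * \<kappa> y) has_vector_derivative d) (at 0)"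
    using real_analytic_at_vector_derivative by blast
  have "((\<lambda>y. l y - of_real y * \<kappa> y) has_vector_derivative (l1 - d)) (at 0)"
    by (rule has_vector_derivative_diff[OF l(1) d])
  moreover have "\<forall>\<^sub>F y in at 0. l y - of_real y * \<kappa> y = of_real y * slash s (\<lambda>x. h x - hr x) gS y"
    using l(3) k(2) by eventually_elim (simp add: slash_linear right_diff_distrib)
  moreover have "f - r = class_of (\<lambda>x. h x - hr x)" by (simp add: 1 hr class_of_arith)
  ultimately show ?thesis unfolding diff_inf_def using l(2)
    by (intro exI[of _ "\<lambda>x. h x - hr x"] exI[of _ "\<lambda>y. l y - of_real y * \<kappa> y"] exI[of _ "l1 - d"]) simp
qed

lemma V_smp_diff_inf:
  assumes w: "w \<in> V_smp s" shows "\<exists>l0. diff_inf s w l0"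
proof -
  obtain h where h: "w = class_of h" "w \<in> V_fs s" "\<And>p. p \<in> singularities s w \<Longrightarrow> simple_at s h p"
    using w by (auto simp: V_smp_def)
  show ?thesis
  proof (cases "regular s w Infty")
    case True
    have "(((\<lambda>y. 0) :: real \<Rightarrow> complex) has_vector_derivative 0) (at 0)" by (rule has_vector_derivative_const)
    moreover have "slash s (\<lambda>x. 0) gS y = 0" for y by (simp add: slash_gS)
    ultimately have "diff_inf s 0 0" unfolding diff_inf_def class_of_arith(5)
      by (intro exI[of _ "\<lambda>x. 0"] exI[of _ "\<lambda>y. 0"] exI[of _ 0]) simp
    from diff_inf_minus_regular[OF this regular_uminus[OF True]] show ?thesis by auto
  next
    case False
    then have "simple_at s h Infty" using h singularities_iff[OF h(2)] by blast
    then obtain k where k: "smooth_at k 0" "\<forall>\<^sub>F y in at 0. k y = of_real y * of_real \<bar>y\<bar> powr (-2 * s) * h (-1 / y)"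
      by auto
    obtain U D where "0 \<in> U" "D 0 = k" "\<And>n y. y \<in> U \<Longrightarrow> (D n has_vector_derivative D (Suc n) y) (at y)"
      using k(1) by (auto simp: smooth_at_def)
    then have "(k has_vector_derivative D (Suc 0) 0) (at 0)" by metis
    moreover have "\<forall>\<^sub>F y in at 0. k y = of_real y * slash s h gS y"
      using k(2) by eventually_elim (simp add: slash_gS mult.assoc)
    ultimately show ?thesis unfolding diff_inf_def h(1) by blast
  qed
qed

lemma has_vector_derivative_quotient:
  assumes "(l has_vector_derivative l1) (at (0::real))"
  shows "((\<lambda>y. (l y - l 0) / complex_of_real y) \<longlongrightarrow> l1) (at 0)"
proof -
  have "((\<lambda>y. norm (l y - l 0 - (y - 0) *\<^sub>R l1) / norm (y - 0)) \<longlongrightarrow> 0) (at 0)"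
    using assms unfolding has_vector_derivative_def has_derivative_iff_norm by simp
  then have "((\<lambda>y. norm ((l y - l 0) / complex_of_real y - l1)) \<longlongrightarrow> 0) (at 0)"
  proof (rule Lim_transform_eventually)
    show "\<forall>\<^sub>F y in at 0. norm (l y - l 0 - (y - 0) *\<^sub>R l1) / norm (y - 0) = norm ((l y - l 0) / complex_of_real y - l1)"
      using eventually_neq_at_within[of 0 0 UNIV]
    proof eventually_elim
      case (elim y)
      have "(l y - l 0) / complex_of_real y - l1 = (l y - l 0 - (y - 0) *\<^sub>R l1) / complex_of_real y"
        using elim by (simp add: scaleR_conv_of_real diff_divide_distrib)
      then show ?case by (simp add: norm_divide)
    qed
  qed
  then show ?thesis by (metis (no_types) LIM_zero_cancel tendsto_norm_zero_cancel)
qed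

text \<open>Under \<open>x = - 1 / y\<close> the factor \<open>y\<close> has opposite signs at the
  two ends of the line, hence so have the leading coefficients.\<close>

lemma diff_inf_asym:
  assumes "diff_inf s (class_of h) l0"
  shows "asym s h (- l0)" "asym s (\<lambda>t. h (- t)) l0"
proof -
  obtain l l1 where l: "(l has_vector_derivative l1) (at 0)" "l 0 = l0" "\<forall>\<^sub>F y in at 0. l y = of_real y * slash s h gS y"
    using diff_inf_class[OF assms] .
  note q = has_vector_derivative_quotient[OF l(1)]
  have inv: "((\<lambda>t::real. 1 / t) \<longlongrightarrow> 0) at_top"
    by (intro tendsto_divide_0[OF tendsto_const] filterlim_at_top_imp_at_infinity filterlim_ident)
  have f1: "filterlim (\<lambda>t::real. 1 / t) (at 0) at_top" unfolding filterlim_at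
    using inv eventually_gt_at_top[of "0::real"] by (auto elim!: eventually_mono)
  have f2: "filterlim (\<lambda>t::real. - (1 / t)) (at 0) at_top" unfolding filterlim_at
    using tendsto_minus[OF inv] eventually_gt_at_top[of "0::real"] by (auto elim!: eventually_mono)
  have powr: "complex_of_real (1 / t) powr (- (2 * s)) = of_real t powr (2 * s)"
    "complex_of_real t powr (2 * s) * of_real t powr (1 - 2 * s) = of_real t" if "t > 0" for t
  proof -
    have "complex_of_real (1 / t) powr (- (2 * s)) * of_real t powr (- (2 * s)) = 1"
      using that powr_times_real[of "complex_of_real (1 / t)" "complex_of_real t" "- (2 * s)"] by simp
    then show "complex_of_real (1 / t) powr (- (2 * s)) = of_real t powr (2 * s)"
      using that by (simp add: powr_minus field_simps)
    show "complex_of_real t powr (2 * s) * of_real t powr (1 - 2 * s) = of_real t"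
      using that by (simp flip: powr_add)
  qed
  show "asym s (\<lambda>t. h (- t)) l0" unfolding asym_def
  proof (rule exI, rule Lim_transform_eventually[OF filterlim_compose[OF q f1]])
    show "\<forall>\<^sub>F t in at_top. (l (1 / t) - l 0) / complex_of_real (1 / t) = of_real t powr (2 * s) * (h (- t) - l0 * of_real t powr (1 - 2 * s))"
      using eventually_compose_filterlim[OF l(3) f1] eventually_gt_at_top[of "0::real"]
    proof eventually_elim
      case (elim t)
      then have "l (1 / t) = of_real (1 / t) * (of_real t powr (2 * s) * h (- t))"
        using powr(1)[of t] by (simp add: slash_gS)
      then have "(l (1 / t) - l 0) / complex_of_real (1 / t) = of_real t powr (2 * s) * h (- t) - l0 * of_real t"
        using elim(2) by (simp add: l(2) field_simps)
      then show ?case using powr(2)[OF elim(2)] by (simp add: right_diff_distrib mult.left_commute)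
    qed
  qed
  show "asym s h (- l0)" unfolding asym_def
  proof (rule exI, rule Lim_transform_eventually[OF filterlim_compose[OF q f2]])
    show "\<forall>\<^sub>F t in at_top. (l (- (1 / t)) - l 0) / complex_of_real (- (1 / t)) = of_real t powr (2 * s) * (h t - - l0 * of_real t powr (1 - 2 * s))"
      using eventually_compose_filterlim[OF l(3) f2] eventually_gt_at_top[of "0::real"]
    proof eventually_elim
      case (elim t)
      then have "l (- (1 / t)) = - of_real (1 / t) * (of_real t powr (2 * s) * h t)"
        using powr(1)[of t] by (simp add: slash_gS)
      then have "(l (- (1 / t)) - l 0) / complex_of_real (- (1 / t)) = of_real t powr (2 * s) * h t + l0 * of_real t"
        using elim(2) by (simp add: l(2) field_simps)
      then show ?case using powr(2)[OF elim(2)] by (simp add: distrib_left mult.left_commute)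
    qed
  qed
qed

lemma asym_uminus: "asym s q A \<Longrightarrow> asym s (\<lambda>t. - q t) (- A)"
proof -
  assume "asym s q A"
  then obtain B where "((\<lambda>t. of_real t powr (2 * s) * (q t - A * of_real t powr (1 - 2 * s))) \<longlongrightarrow> B) at_top"
    by (auto simp: asym_def)
  from tendsto_minus[OF this] show ?thesis unfolding asym_def
    by (intro exI[of _ "- B"]) (simp add: algebra_simps)
qed

text \<open>If \<open>x\<close> is singular, then so is \<open>x + 1\<close>, because w - w|T is
  regular; this would produce infinitely many singularities.\<close>

lemma parabolic_w_regular:
  assumes w: "w \<in> V_fs s" and d: "\<And>x. regular s (w - cslash s w gT) (Fin x)"
  shows "regular s w (Fin x)"
proof (rule ccontr)
  assume nr: "\<not> regular s w (Fin x)"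
  have step: "\<not> regular s w (Fin (x + 1))" if "\<not> regular s w (Fin x)" for x
  proof
    assume "regular s w (Fin (x + 1))"
    then have "regular s (cslash s w gT) (Fin x)" by (simp add: regular_cslash gT_psl moebius_psl)
    from regular_add[OF d this] have "regular s w (Fin x)" by simp
    with that show False ..
  qed
  have "\<not> regular s w (Fin (x + real n))" for n
    by (induction n) (use nr step in \<open>auto simp: add.assoc[symmetric] add.commute[of 1]\<close>)
  then have "range (\<lambda>n. Fin (x + real n)) \<subseteq> {p. \<not> regular s w p}" by auto
  then have "finite (range (\<lambda>n. Fin (x + real n)))" using finite_nonregular[OF w] finite_subset by blast
  moreover have "inj (\<lambda>n. Fin (x + real n))" by (auto simp: inj_def)
  ultimately show False using finite_imageD by blast
qed

lemma V_omega_on_representative: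
  assumes "f \<in> V_fs s" "\<And>x. x \<notin> X \<Longrightarrow> regular s f (Fin x)"
  shows "\<exists>h. f = class_of h \<and> (\<forall>x. x \<notin> X \<longrightarrow> real_analytic_at h x)"
proof -
  have "f \<in> V_omega_on s (Fin ` (- X))" by (rule V_omega_onI) (use assms in auto)
  then show ?thesis by (auto simp: V_omega_on_def analytic_functions_def)
qed

lemma class_of_eq_at:
  assumes "class_of f = class_of g" "real_analytic_at f x" "real_analytic_at g x"
  shows "f x = g x"
  by (rule eventually_at_eq_imp_nhds_eq)
     (use assms in \<open>auto intro!: real_analytic_at_isCont eq_cofinite_eventually simp: class_of_eq_iff[symmetric]\<close>)

lemma rslash_analytic:
  assumes "c * x + d \<noteq> 0" "real_analytic_at h ((a * x + b) / (c * x + d))"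
  shows "real_analytic_at (rslash s h a b c d) x"
  unfolding rslash_def using assms
  by (intro real_analytic_at_mult real_analytic_at_abs_powr real_analytic_at_moebius) auto

section \<open>From parabolic cocycles to eigenfunctions\<close>

lemma moebius_gens:
  "moebius gT (Fin x) = Fin (x + 1)" "moebius gT Infty = Infty"
  "moebius gU (Fin x) = (if x = 0 then Infty else Fin (- 1 - 1 / x))" "moebius gU Infty = Fin (-1)"
  "moebius gS (Fin x) = (if x = 0 then Infty else Fin (- (1 / x)))" "moebius gS Infty = Fin 0"
  by (auto simp: gT_psl gU_psl gS_psl moebius_psl field_simps)

lemma slash_gens:
  "slash s h gT x = h (x + 1)"
  "slash s h (inverse gT) x = h (x - 1)"
  "slash s h gU x = of_real \<bar>x\<bar> powr (-2 * s) * h ((- x - 1) / x)"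
  "slash s h (gS * gT) x = of_real \<bar>x + 1\<bar> powr (-2 * s) * h (- 1 / (x + 1))"
  "slash s h (gS * gT * gS) x = of_real \<bar>x - 1\<bar> powr (-2 * s) * h (- x / (x - 1))"
proof -
  have 1: "gS * gT = psl 0 (-1) 1 1" "gS * gT * gS = psl (-1) 0 1 (-1)" by (simp_all add: psl_word_simps)
  show "slash s h gT x = h (x + 1)" "slash s h (inverse gT) x = h (x - 1)"
    by (simp_all add: gT_psl gT_inverse_psl psl_inverse slash_psl rslash_def)
  show "slash s h gU x = of_real \<bar>x\<bar> powr (-2 * s) * h ((- x - 1) / x)"
    by (simp add: gU_psl slash_psl rslash_def)
  show "slash s h (gS * gT) x = of_real \<bar>x + 1\<bar> powr (-2 * s) * h (- 1 / (x + 1))"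
    "slash s h (gS * gT * gS) x = of_real \<bar>x - 1\<bar> powr (-2 * s) * h (- x / (x - 1))"
    unfolding 1(2) unfolding 1(1) by (simp_all add: slash_psl rslash_def)
qed

text \<open>A function agreeing with a cocycle value on the fundamental intervals reproduces that value
  through the definition of \<open>theta_c1\<close> and \<open>theta_c2\<close>.\<close>

lemma theta_c_eq:
  assumes c: "c \<in> Z1 s V"
    and h: "c gU = - class_of H" "\<And>x. - phi < x \<Longrightarrow> x < phi \<Longrightarrow> theta_h s g x = H x"
    and k: "c gS = - class_of K" "\<And>x. - phi < x \<Longrightarrow> x < 1 / phi \<Longrightarrow> theta_k s g x = K x"
  shows "theta_c1 s g = - c gS" "theta_c2 s g = - c gU"
proof -
  have p: "1 / phi = phi - 1" "phi * phi = phi + 1" "1 < phi" "phi < 2"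
    using phi_inverse phi_square phi_gt by auto
  \<comment> \<open>The relations S^2 = 1 and, below, U^3 = 1 determine the values of
    \<open>c\<close> outside the fundamental intervals by those inside, precisely as in
    \<open>theta_c1\<close> and \<open>theta_c2\<close>.\<close>
  have "0 = c (gS * gS)" by (simp add: gS_gS Z1_one[OF c])
  then have "c gS = - cslash s (c gS) gS" by (simp add: Z1D(1)[OF c] add_eq_0_iff)
  then have "- c gS = - cslash s (- c gS) gS" by (simp only: cslash_linear)
  then have "class_of K = - cslash s (class_of K) gS" by (simp add: k(1))
  then have "class_of K = class_of (\<lambda>x. - slash s K gS x)" by (simp only: class_of_arith)
  then have e1: "finite {x. K x \<noteq> - slash s K gS x}" by (simp add: class_of_eq_iff eq_cofinite_def)
  have "eq_cofinite (\<lambda>x. if x \<in> {- phi <..< 1 / phi} then theta_k s g x else - slash s (theta_k s g) gS x) K"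
  proof (rule eq_cofiniteI)
    show "finite ({x. K x \<noteq> - slash s K gS x} \<union> {- phi, 1 / phi})" using e1 by simp
    fix x assume x: "x \<notin> {x. K x \<noteq> - slash s K gS x} \<union> {- phi, 1 / phi}"
    show "(if x \<in> {- phi <..< 1 / phi} then theta_k s g x else - slash s (theta_k s g) gS x) = K x"
    proof (cases "x \<in> {- phi <..< 1 / phi}")
      case False
      with x have x': "x < - phi \<or> phi - 1 < x" using p by auto
      have "phi * (phi - 1) = 1" using p by (simp add: algebra_simps)
      then have f1: "1 < phi * x" if "phi - 1 < x" using that p by (metis mult_strict_left_mono less_trans zero_less_one)
      have f2: "phi * x < 0" if "x < - phi" using that p by (intro mult_pos_neg) auto
      have "- phi < -1 / x \<and> -1 / x < 1 / phi"
        using x'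
      proof
        assume a: "x < - phi"
        then show ?thesis using p f2 by (auto simp: field_simps)
      next
        assume a: "phi - 1 < x"
        then have "0 < x" using p by linarith
        then show ?thesis using f1[OF a] p by (auto simp: field_simps intro: less_trans[of _ 0])
      qed
      then have "theta_k s g (-1 / x) = K (-1 / x)" by (intro k(2)) auto
      then show ?thesis unfolding if_not_P[OF False] using x by (simp add: slash_gS)
    qed (use k(2) in auto)
  qed
  then show "theta_c1 s g = - c gS" by (simp add: theta_c1_def k(1) class_of_eq_iff)
  have "0 = c (gU * gU * gU)" by (simp only: gU_gU_gU Z1_one[OF c])
  also have "\<dots> = cslash s (c (gU * gU)) gU + c gU" by (rule Z1D(1)[OF c])
  also have "c (gU * gU) = cslash s (c gU) gU + c gU" by (rule Z1D(1)[OF c])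
  also have "cslash s (cslash s (c gU) gU + c gU) gU = cslash s (c gU) (gS * gT) + cslash s (c gU) gU"
    by (simp only: cslash_linear cslash_cslash gU_gU)
  finally have "c gU = - (cslash s (c gU) (gS * gT) + cslash s (c gU) gU)"
    by (intro minus_unique[symmetric]) simp
  then have "c gU = - (cslash s (c gU) gU + cslash s (c gU) (gS * gT))" by (simp only: add.commute)
  then have "- c gU = - (cslash s (- c gU) gU + cslash s (- c gU) (gS * gT))"
    by (simp only: cslash_linear minus_add_distrib)
  then have "class_of H = - (cslash s (class_of H) gU + cslash s (class_of H) (gS * gT))" by (simp add: h(1))
  then have "class_of H = class_of (\<lambda>x. - (slash s H gU x + slash s H (gS * gT) x))" by (simp only: class_of_arith)
  then have e2: "finite {x. H x \<noteq> - (slash s H gU x + slash s H (gS * gT) x)}" by (simp add: class_of_eq_iff eq_cofinite_def)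
  have "eq_cofinite (\<lambda>x. if x \<in> {- phi <..< phi} then theta_h s g x
      else - (slash s (theta_h s g) gU x + slash s (theta_h s g) (gS * gT) x)) H"
  proof (rule eq_cofiniteI)
    show "finite ({x. H x \<noteq> - (slash s H gU x + slash s H (gS * gT) x)} \<union> {- phi, phi})" using e2 by simp
    fix x assume x: "x \<notin> {x. H x \<noteq> - (slash s H gU x + slash s H (gS * gT) x)} \<union> {- phi, phi}"
    show "(if x \<in> {- phi <..< phi} then theta_h s g x
      else - (slash s (theta_h s g) gU x + slash s (theta_h s g) (gS * gT) x)) = H x"
    proof (cases "x \<in> {- phi <..< phi}")
      case False
      with x have x': "x < - phi \<or> phi < x" by auto
      have a1: "phi * x < 1 + x" "1 + phi * x < - x" if "x < - phi"
      proof -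
        have "(phi - 1) * x < 0" using that p by (intro mult_pos_neg) auto
        then have "phi * x - x < 0" by (simp only: left_diff_distrib mult_1_left)
        then show "phi * x < 1 + x" by linarith
        have "(phi + 1) * x < (phi + 1) * (- phi)" using that p by (intro mult_strict_left_mono) auto
        then have "phi * x + x < - (phi * phi + phi)" by (simp add: algebra_simps)
        then show "1 + phi * x < - x" using p by linarith
      qed
      have b1: "1 < phi * x - x" "0 < phi * x" if "phi < x"
      proof -
        have "(phi - 1) * phi < (phi - 1) * x" using that p by (intro mult_strict_left_mono) auto
        then show "1 < phi * x - x" using p by (simp add: algebra_simps)
        show "0 < phi * x" using that p by simp
      qed
      have "- phi < (- x - 1) / x \<and> (- x - 1) / x < phi"
        using x'
      proof
        assume a: "x < - phi"
        then show ?thesis using a1[OF a] p by (auto simp: field_simps)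
      next
        assume b: "phi < x"
        then have "0 < x" using p by linarith
        then show ?thesis using b b1[OF b] p by (auto simp: field_simps)
      qed
      then have 1: "theta_h s g ((- x - 1) / x) = H ((- x - 1) / x)" by (intro h(2)) auto
      have "- phi < -1 / (x + 1) \<and> -1 / (x + 1) < phi"
      proof -
        have "phi * (phi - 1) = 1" using p by (simp add: algebra_simps)
        then have "phi * (- x - 1) > 1" if "x < - phi" using that p
          by (smt (verit) mult_less_cancel_left_pos)
        moreover have "phi * (x + 1) > 1" if "phi < x"
          using that p by (smt (verit) mult_less_cancel_left_pos)
        ultimately show ?thesis using x' p by (auto simp: field_simps)
      qed
      then have 2: "theta_h s g (-1 / (x + 1)) = H (-1 / (x + 1))" by (intro h(2)) auto
      show ?thesis unfolding if_not_P[OF False] using x 1 2 by (simp add: slash_gens)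
    qed (use h(2) in auto)
  qed
  then show "theta_c2 s g = - c gU" 
    unfolding theta_c2_def gU_def[symmetric] h(1) by (simp add: class_of_eq_iff)
qed

text \<open>Subtracting the coboundary of \<open>v\<close> gives a cocycle \<open>c\<close> with
  \<open>c gA = 0\<close>. For such a cocycle the slash images of \<open>G = c gT - c gU\<close> are
  cocycle values again (\<open>E1\<close>, \<open>E2\<close>, \<open>E6\<close>), and therefore the
  two parts of G = Qp - Q|T obey the difference equations of the regularized sums of
  \<open>g\<close>.\<close>

lemma parabolic_to_eigen:
  assumes s: "Re s > 0" "s \<noteq> 1/2" and \<psi>: "\<psi> \<in> Z1 s (V_omega s)"
    and w: "w \<in> V_smp s" "\<psi> gT = w - cslash s w gT"
  shows "\<exists>g\<in>eigen_space s. theta s g = coh_class s (V_fs s) \<psi>"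
proof -
  have p: "1 / phi = phi - 1" "phi * phi = phi + 1" "1 < phi" "phi < 2"
    using phi_inverse phi_square phi_gt by auto
  have \<psi>r: "regular s (\<psi> \<gamma>) q" for \<gamma> q using Z1D(2)[OF \<psi>] by (simp add: V_omega_iff)
  have \<psi>f: "\<psi> \<in> Z1 s (V_fs s)" using \<psi> Z1_mono[OF V_omega_subset_V_fs] by blast
  have wf: "w \<in> V_fs s" using w(1) by (auto simp: V_smp_def)
  have wr: "regular s w (Fin x)" for x
    by (rule parabolic_w_regular[OF wf]) (use \<psi>r[of gT] w(2) in simp)
  obtain v where v: "v \<in> V_fs s" "v - cslash s v gA = \<psi> gA" "\<And>q. q \<noteq> Fin (- phi) \<Longrightarrow> regular s v q"
    using hyperbolic_solution[OF Z1D(2)[OF \<psi>] s(1)] by blast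
  define c where "c \<gamma> = \<psi> \<gamma> - (v - cslash s v \<gamma>)" for \<gamma>
  have cZ: "c \<in> Z1 s (V_fs s)" unfolding c_def by (rule Z1_twist[OF \<psi>f v(1)])
  note cm = Z1D(1)[OF cZ] and c1 = Z1_one[OF cZ]
  have cA: "c gA = 0" using v(2) by (simp add: c_def)
  have cAi: "c (inverse gA * \<gamma>) = c \<gamma>" for \<gamma>
    using Z1_inverse[OF cZ, of gA] by (simp add: cm cA cslash_linear)
  let ?ST2 = "gS * gT\<^sup>2" and ?W = "inverse gT * gS * (inverse gT)\<^sup>2"
  have words: "gA = gT * ?ST2" "gU * ?ST2 = gT" "gU * inverse gT * (gS * (inverse gT)\<^sup>2) = gS * inverse gT"
    "inverse gA * (gS * (inverse gT)\<^sup>2) = gU * inverse gT" "inverse gA * (gS * inverse gT) = gU"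
    "inverse gT * (gS * (inverse gT)\<^sup>2) = ?W" "gU * inverse gT = gS * gT * gS" "gU * (gS * gT * gS) = gS"
    by (simp_all add: psl_word_simps gA_psl)
  define G where "G = c gT - c gU"
  have cST2: "c ?ST2 = - cslash s (c gT) ?ST2" "c ?ST2 = c gT - cslash s (c gU) ?ST2"
    using cA cm[of gT ?ST2] cm[of gU ?ST2] unfolding words by (simp_all add: add_eq_0_iff)
  have E1: "cslash s G ?ST2 = - c gT"
    using cST2 unfolding G_def by (simp add: cslash_linear algebra_simps)
  have cTi: "c (inverse gT) = - cslash s (c gT) (inverse gT)" by (rule Z1_inverse[OF cZ])
  have E2: "cslash s G (inverse gT) = - c (gS * gT * gS)"
    using cm[of gU "inverse gT"] cTi unfolding G_def words by (simp add: cslash_linear algebra_simps)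
  have E6: "cslash s G ?W = c (gS * gT * gS) - c gU"
  proof -
    have "cslash s G ?W = - cslash s (c (gU * inverse gT)) (gS * (inverse gT)\<^sup>2)"
      unfolding words(6)[symmetric] cslash_cslash[symmetric] E2 words(7) by (simp add: cslash_linear)
    also have "\<dots> = - (c (gS * inverse gT) - c (gS * (inverse gT)\<^sup>2))"
      using cm[of "gU * inverse gT" "gS * (inverse gT)\<^sup>2"] unfolding words(3) by simp
    also have "c (gS * inverse gT) = c gU" using cAi[of "gS * inverse gT"] unfolding words(5) by simp
    also have "c (gS * (inverse gT)\<^sup>2) = c (gS * gT * gS)"
      using cAi[of "gS * (inverse gT)\<^sup>2"] unfolding words(4) words(7) by simp
    finally show ?thesis by simp
  qed
  have cf: "c \<gamma> \<in> V_fs s" for \<gamma> by (rule Z1D(2)[OF cZ])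
  have Gf: "G \<in> V_fs s" unfolding G_def by (intro V_fs_diff cf)
  \<comment> \<open>In \<open>G\<close> the function \<open>v\<close> itself cancels; only v|T and
    v|U remain, which are singular at the preimages \<open>- (phi\<^sup>2)\<close> and
    \<open>phi\<close> of \<open>- phi\<close> under T and U.\<close>
  have Gr: "regular s G q" if "q \<noteq> Fin (- (phi\<^sup>2))" "q \<noteq> Fin phi" for q
  proof -
    have "G = (\<psi> gT + cslash s v gT) - (\<psi> gU + cslash s v gU)" by (simp add: G_def c_def)
    moreover have "moebius gT q \<noteq> Fin (- phi)" using that(1) by (cases q) (auto simp: moebius_gens phi_power2)
    moreover have "moebius gU q \<noteq> Fin (- phi)"
    proof (cases q)
      case (Fin x)
      have "x = phi" if "- 1 - 1 / x = - phi" "x \<noteq> 0"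
      proof -
        have "1 = x * (phi - 1)" using that by (simp add: field_simps)
        then have "phi * 1 = x * (phi * phi - phi)" by algebra
        then show ?thesis using p by simp
      qed
      then show ?thesis using that(2) Fin by (auto simp: moebius_gens)
    qed (use p in \<open>simp add: moebius_gens\<close>)
    ultimately show ?thesis by (simp add: regular_add regular_diff \<psi>r regular_cslash v(3))
  qed
  obtain g0 where g0: "G = class_of g0" "\<And>x. x \<notin> {- (phi\<^sup>2), phi} \<Longrightarrow> real_analytic_at g0 x"
    using V_omega_on_representative[OF Gf, of "{- (phi\<^sup>2), phi}"] Gr by auto
  define g where "g x = (if x \<in> phi_interval then g0 x else 0)" for x
  have gg0: "g x = g0 x" if "x \<in> phi_interval" for x using that by (simp add: g_def)
  have gan: "real_analytic_at g x" if "x \<in> phi_interval" for x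
  proof (rule real_analytic_at_cong)
    show "real_analytic_at g0 x" by (rule g0(2)) (use that in auto)
    have "\<forall>\<^sub>F y in nhds x. y \<in> phi_interval" by (rule eventually_nhds_in_open) (use that in auto)
    then show "\<forall>\<^sub>F y in nhds x. g y = g0 y" by eventually_elim (rule gg0)
  qed
  have gfun: "g \<in> analytic_fun_on phi_interval" using gan by (auto simp: analytic_fun_on_def g_def)
  \<comment> \<open>By the parabolic condition \<open>c gT\<close> is the coboundary of
    \<open>Q\<close>. The sum over the first function is found in \<open>Q\<close> at plus infinity,
    the other one in \<open>Qp\<close> at minus infinity.\<close>
  define Q where "Q = w - v"
  define Qp where "Qp = Q - c gU"
  have Qf: "Q \<in> V_fs s" "Qp \<in> V_fs s" unfolding Q_def Qp_def by (intro V_fs_diff wf v(1) cf)+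
  have QT: "Q - cslash s Q gT = c gT" by (simp add: Q_def c_def w(2) cslash_linear)
  have QpT: "Qp - cslash s Qp (inverse gT) = cslash s G ?W"
  proof -
    have "cslash s (Q - cslash s Q gT) (inverse gT) = cslash s (c gT) (inverse gT)" by (simp only: QT)
    then have 1: "cslash s Q (inverse gT) = Q - c (inverse gT)"
      by (simp add: cslash_linear cslash_cslash gT_inverse cslash_one cTi algebra_simps)
    have 2: "cslash s (c gU) (inverse gT) = c (gS * gT * gS) - c (inverse gT)"
      using cm[of gU "inverse gT"] unfolding words by simp
    show ?thesis unfolding Qp_def E6 cslash_linear 1 2 by simp
  qed
  have GQ: "G = Qp - cslash s Q gT" using QT by (simp add: G_def Qp_def algebra_simps)
  obtain q0 where q0: "Q = class_of q0" "\<And>x. x \<noteq> - phi \<Longrightarrow> real_analytic_at q0 x"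
  proof -
    have "regular s Q (Fin x)" if "x \<notin> {- phi}" for x
      unfolding Q_def by (intro regular_diff wr v(3)) (use that in simp)
    then have "\<exists>h. Q = class_of h \<and> (\<forall>x. x \<notin> {- phi} \<longrightarrow> real_analytic_at h x)"
      by (rule V_omega_on_representative[OF Qf(1)])
    then show ?thesis using that by auto
  qed
  have Upole: "moebius gU (Fin x) \<noteq> Fin (- phi)" if "x \<noteq> phi" for x
  proof
    assume a: "moebius gU (Fin x) = Fin (- phi)"
    then have x: "x \<noteq> 0" "- 1 - 1 / x = - phi" by (auto simp: moebius_gens split: if_splits)
    then have "1 = x * (phi - 1)" by (simp add: field_simps)
    then have "phi * 1 = x * (phi * phi - phi)" by algebra
    then show False using p that by simp
  qed
  obtain q1 where q1: "Qp = class_of q1" "\<And>x. x \<noteq> phi \<Longrightarrow> real_analytic_at q1 x"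
  proof -
    have "Qp = w - (\<psi> gU + cslash s v gU)" by (simp add: Qp_def Q_def c_def)
    then have "regular s Qp (Fin x)" if "x \<notin> {phi}" for x
      using that Upole[of x] by (simp add: regular_diff regular_add wr \<psi>r regular_cslash v(3))
    then have "\<exists>h. Qp = class_of h \<and> (\<forall>x. x \<notin> {phi} \<longrightarrow> real_analytic_at h x)"
      by (rule V_omega_on_representative[OF Qf(2)])
    then show ?thesis using that by auto
  qed
  \<comment> \<open>Both \<open>v\<close> and \<open>c gU\<close> are regular at infinity, so
    \<open>Q\<close> and \<open>Qp\<close> inherit \<open>l0\<close> from \<open>w\<close>; the
    simple singularity of \<open>w\<close> thus provides the asymptotics that
    \<open>asym_rreg\<close> asks for.\<close>
  obtain l0 where l0: "diff_inf s w l0" using V_smp_diff_inf[OF w(1)] by blast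
  have dQ: "diff_inf s Q l0" unfolding Q_def by (rule diff_inf_minus_regular[OF l0 v(3)]) simp
  have "regular s (c gU) Infty"
    unfolding c_def by (intro regular_diff \<psi>r) (use p in \<open>simp_all add: v(3) regular_cslash moebius_gens\<close>)
  then have dQp: "diff_inf s Qp l0" unfolding Qp_def by (rule diff_inf_minus_regular[OF dQ])
  have asym0: "asym s (\<lambda>t. - q0 t) l0" using asym_uminus[OF diff_inf_asym(1)[of s q0 l0]] dQ q0(1) by simp
  have asym1: "asym s (\<lambda>t. q1 (- t)) l0" using diff_inf_asym(2)[of s q1 l0] dQp q1(1) by simp
  have an0: "real_analytic_at (\<lambda>y. g (- y)) 0" "real_analytic_at (\<lambda>y. g (y - 1)) 0"
    using real_analytic_at_neg[of g 0] real_analytic_at_shift[of g 0 "-1"] gan[of 0] gan[of "-1"] p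
    by (simp_all add: phi_power2)
  have rec: "1 / y < phi + 1" if "2 - phi < y" for y
  proof -
    have "1 / y < 1 / (2 - phi)" using that p by (intro divide_strict_left_mono) auto
    also have "1 / (2 - phi) = phi + 1" using p by (simp add: field_simps)
    finally show ?thesis .
  qed
  have m: "- q0 (y - 2) = rreg s (\<lambda>y. g (- y)) y" if y: "2 - phi < y" for y
  proof (rule asym_rreg[OF an0(1) s asym0 _ _ y])
    show "0 \<le> 2 - phi" using p by simp
    fix y assume y: "2 - phi < y"
    have y0: "0 < y" using y p by linarith
    have "class_of (\<lambda>x. q0 x - q0 (x + 1)) = class_of (\<lambda>x. - slash s g0 ?ST2 x)"
    proof -
      have "class_of (\<lambda>x. q0 x - q0 (x + 1)) = Q - cslash s Q gT"
        by (simp add: q0(1) class_of_arith slash_gens)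
      also have "\<dots> = - cslash s G ?ST2" by (simp add: QT E1)
      also have "\<dots> = class_of (\<lambda>x. - slash s g0 ?ST2 x)" by (simp only: g0(1) class_of_arith)
      finally show ?thesis .
    qed
    then have "q0 (y - 2) - q0 (y - 2 + 1) = - slash s g0 ?ST2 (y - 2)"
    proof (rule class_of_eq_at)
      have "real_analytic_at (\<lambda>x. q0 (x + 1)) (y - 2)" by (rule real_analytic_at_shift) (rule q0(2), use y in linarith)
      then show "real_analytic_at (\<lambda>x. q0 x - q0 (x + 1)) (y - 2)"
        by (intro real_analytic_at_diff q0(2)) (use y in auto)
      have ST2: "?ST2 = psl 0 (-1) 1 2" by (simp add: psl_word_simps)
      have "real_analytic_at (rslash s g0 0 (-1) 1 2) (y - 2)"
      proof (rule rslash_analytic)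
        have "0 < 1 / y" using y0 by simp
        then have "- (1 / y) \<noteq> phi" "- (1 / y) \<noteq> - (phi\<^sup>2)" unfolding phi_power2 using rec[OF y] p by linarith+
        then have "real_analytic_at g0 (- (1 / y))" by (intro g0(2)) blast
        moreover have "(0 * (y - 2) + - 1) / (1 * (y - 2) + 2) = - (1 / y)" by simp
        ultimately show "real_analytic_at g0 ((0 * (y - 2) + - 1) / (1 * (y - 2) + 2))" by (simp only:)
      qed (use y0 in simp)
      then show "real_analytic_at (\<lambda>x. - slash s g0 ?ST2 x) (y - 2)"
        unfolding ST2 by (intro real_analytic_at_minus) (simp add: slash_psl)
    qed
    also have "slash s g0 ?ST2 (y - 2) = of_real y powr (-2 * s) * g0 (- (1 / y))" using y0 by (simp add: slash_words)
    also have "g0 (- (1 / y)) = g (- (1 / y))"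
      by (rule gg0[symmetric]) (use rec[OF y] y0 p in \<open>auto simp: phi_power2 intro: less_trans[of _ 0]\<close>)
    finally show "- q0 (y - 2) - - q0 (y - 1) = of_real y powr (-2 * s) * g (- (1 / y))" by (simp add: algebra_simps)
  qed
  have pl: "q1 (- (y - 2)) = rreg s (\<lambda>y. g (y - 1)) y" if y: "2 - phi < y" for y
  proof (rule asym_rreg[OF an0(2) s asym1 _ _ y])
    show "0 \<le> 2 - phi" using p by simp
    fix y assume y: "2 - phi < y"
    have y0: "0 < y" using y p by linarith
    have "class_of (\<lambda>x. q1 x - q1 (x - 1)) = class_of (slash s g0 ?W)"
    proof -
      have "class_of (\<lambda>x. q1 x - q1 (x - 1)) = Qp - cslash s Qp (inverse gT)"
        by (simp add: q1(1) class_of_arith slash_gens)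
      also have "\<dots> = cslash s G ?W" by (rule QpT)
      also have "\<dots> = class_of (slash s g0 ?W)" by (simp only: g0(1) class_of_arith)
      finally show ?thesis .
    qed
    then have "q1 (2 - y) - q1 (2 - y - 1) = slash s g0 ?W (2 - y)"
    proof (rule class_of_eq_at)
      have "real_analytic_at (\<lambda>x. q1 (x + (-1))) (2 - y)" by (rule real_analytic_at_shift) (rule q1(2), use y in linarith)
      then show "real_analytic_at (\<lambda>x. q1 x - q1 (x - 1)) (2 - y)"
        by (intro real_analytic_at_diff q1(2)) (use y in auto)
      have W: "?W = psl (-1) 1 1 (-2)" by (simp add: psl_word_simps)
      have "real_analytic_at (rslash s g0 (-1) 1 1 (-2)) (2 - y)"
      proof (rule rslash_analytic)
        have "0 < 1 / y" using y0 by simp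
        then have "1 / y - 1 \<noteq> phi" "1 / y - 1 \<noteq> - (phi\<^sup>2)" unfolding phi_power2 using rec[OF y] p by linarith+
        then have "real_analytic_at g0 (1 / y - 1)" by (intro g0(2)) blast
        moreover have "(-1 * (2 - y) + 1) / (1 * (2 - y) + -2) = 1 / y - 1" using y0 by (simp add: field_simps)
        ultimately show "real_analytic_at g0 ((-1 * (2 - y) + 1) / (1 * (2 - y) + -2))" by (simp only:)
      qed (use y0 in simp)
      then show "real_analytic_at (slash s g0 ?W) (2 - y)"
        unfolding W by (simp add: slash_psl)
    qed
    also have "slash s g0 ?W (2 - y) = of_real y powr (-2 * s) * g0 (1 / y - 1)"
    proof -
      have "(1 - (2 - y)) / (2 - y - 2) = 1 / y - 1" using y0 by (simp add: field_simps)
      then show ?thesis unfolding slash_words using y0 by simp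
    qed
    also have "g0 (1 / y - 1) = g (1 / y - 1)"
    proof (rule gg0[symmetric])
      have "0 < 1 / y" using y0 by simp
      then have "- phi < 1 / y" using p by linarith
      then show "1 / y - 1 \<in> phi_interval" using rec[OF y] p by (simp add: phi_power2)
    qed
    finally show "q1 (- (y - 2)) - q1 (- (y - 1)) = of_real y powr (-2 * s) * g (1 / y - 1)" by (simp add: algebra_simps)
  qed
  have "real_eigen s g" unfolding real_eigen_def
  proof
    fix x assume x: "x \<in> phi_interval"
    have "class_of g0 = class_of (\<lambda>x. q1 x - q0 (x + 1))"
      using GQ by (simp add: g0(1) q1(1) q0(1) class_of_arith slash_gens)
    then have "g0 x = q1 x - q0 (x + 1)"
    proof (rule class_of_eq_at)
      show "real_analytic_at g0 x" by (rule g0(2)) (use x in auto)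
      have "real_analytic_at (\<lambda>x. q0 (x + 1)) x"
        by (rule real_analytic_at_shift) (rule q0(2), use x in \<open>auto simp: phi_power2\<close>)
      then show "real_analytic_at (\<lambda>x. q1 x - q0 (x + 1)) x"
        by (intro real_analytic_at_diff q1(2)) (use x in auto)
    qed
    moreover have "- q0 (x + 1) = rreg s (\<lambda>y. g (- y)) (x + 3)" using m[of "x + 3"] x p by (simp add: phi_power2 add.commute)
    moreover have "q1 x = rreg s (\<lambda>y. g (y - 1)) (2 - x)" using pl[of "2 - x"] x p by (simp add: phi_power2)
    ultimately show "g x = rreg s (\<lambda>y. g (- y)) (x + 3) + rreg s (\<lambda>y. g (y - 1)) (2 - x)"
      using gg0[OF x] by simp
  qed
  then have gW: "g \<in> eigen_space s" using gfun by (simp add: eigen_space_iff[OF s])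
  \<comment> \<open>\<open>H\<close> and \<open>K\<close> repeat \<open>theta_h\<close> and
    \<open>theta_k\<close> with the global representative \<open>g0\<close> of \<open>G\<close>;
    their classes are found from \<open>E1\<close> and \<open>E2\<close>.\<close>
  define H where "H x = g0 x + slash s g0 ?ST2 x" for x
  define K where "K x = slash s g0 (inverse gT) x + slash s H (gS * gT * gS) x" for x
  have Hc: "class_of H = - c gU"
  proof -
    have "class_of H = G + cslash s G ?ST2" unfolding H_def g0(1) class_of_arith ..
    then show ?thesis by (simp add: E1) (simp add: G_def)
  qed
  have Kc: "class_of K = - c gS"
  proof -
    have "class_of K = cslash s G (inverse gT) + cslash s (- c gU) (gS * gT * gS)"
      unfolding K_def Hc[symmetric] g0(1) class_of_arith ..
    also have "cslash s (- c gU) (gS * gT * gS) = - (c gS - c (gS * gT * gS))"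
      using cm[of gU "gS * gT * gS"] unfolding words by (simp add: cslash_linear)
    finally show ?thesis by (simp add: E2)
  qed
  have hH: "theta_h s g x = H x" if "- phi < x" "x < phi" for x
  proof -
    have y: "2 - phi < x + 2" using that by simp
    have "0 < 1 / (x + 2)" using y p by simp
    then have "- (1 / (x + 2)) < phi" using p by linarith
    then have "-1 / (x + 2) \<in> phi_interval" using rec[OF y] by (simp add: phi_power2)
    moreover have "x \<in> phi_interval" using that p by (simp add: phi_power2)
    ultimately show ?thesis by (simp add: theta_h_def H_def slash_words gg0)
  qed
  have kK: "theta_k s g x = K x" if x: "- phi < x" "x < 1 / phi" for x
  proof -
    have x1: "0 < 1 - x" using x p by simp
    have "(phi - 1) * (1 - x) > (phi - 1) * (2 - phi)" using x p by (intro mult_strict_left_mono) auto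
    have e: "- x / (x - 1) = 1 / (1 - x) - 1" using x1 by (simp add: field_simps)
    have "1 / (1 - x) < phi + 1" by (rule rec) (use x p in linarith)
    moreover have "1 / (1 - x) > 1 / (1 + phi)" using x x1 p by (intro divide_strict_left_mono) auto
    ultimately have "- phi < - x / (x - 1)" "- x / (x - 1) < phi"
      unfolding e using phi_inverse(2) p by (simp_all add: add.commute)
    then have 1: "theta_h s g (- x / (x - 1)) = H (- x / (x - 1))" by (rule hH)
    have "x - 1 \<in> phi_interval" using x p by (simp add: phi_power2)
    then show ?thesis by (simp add: theta_k_def K_def slash_gens gg0) (simp add: 1[simplified])
  qed
  have "theta_cocycle s g = c"
  proof (rule theta_cocycle_eq[OF cZ])
    show "c gS = - theta_c1 s g" "c gU = - theta_c2 s g"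
      using theta_c_eq[OF cZ _ hH _ kK] Hc Kc by simp_all
  qed
  then have "theta s g = coh_class s (V_fs s) c" by (simp add: theta_def)
  also have "\<dots> = coh_class s (V_fs s) \<psi>"
  proof (rule coh_class_eqI)
    show "- v \<in> V_fs s" by (rule V_fs_uminus[OF v(1)])
    show "c \<gamma> - \<psi> \<gamma> = - v - cslash s (- v) \<gamma>" for \<gamma> by (simp add: c_def cslash_linear)
  qed (auto intro: V_fs_add V_fs_uminus cZ \<psi>f)
  finally show ?thesis using gW by blast
qed

section \<open>An additive Cousin problem and smoothness from sectors\<close>

text \<open>A denominator linear in \<open>x\<close> covers both the Cauchy kernel
  \<open>1 / (t - y)\<close> and its form \<open>1 / (1 + t * x)\<close> in the coordinate
  \<open>x = - 1 / y\<close>. By compactness it stays away from 0 for \<open>x\<close> near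
  \<open>x0\<close>.\<close>

lemma segment_integral_holomorphic:
  assumes f: "continuous_on (closed_segment a b) f"
    and c: "continuous_on (closed_segment a b) c0" "continuous_on (closed_segment a b) c1"
    and nz: "\<And>t. t \<in> closed_segment a b \<Longrightarrow> c0 t + c1 t * x0 \<noteq> 0"
  shows "\<exists>e>0. (\<lambda>x. contour_integral (linepath a b) (\<lambda>t. f t / (c0 t + c1 t * x))) holomorphic_on ball x0 e"
proof -
  let ?S = "closed_segment a b"
  have "compact ((\<lambda>t. c0 t + c1 t * x0) ` ?S)"
    by (intro compact_continuous_image continuous_intros c) simp
  then have "\<exists>d>0. \<forall>u\<in>(\<lambda>t. c0 t + c1 t * x0) ` ?S. d \<le> dist 0 u"
    using nz by (intro separate_point_closed compact_imp_closed) auto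
  then obtain d where d: "d > 0" "\<And>t. t \<in> ?S \<Longrightarrow> d \<le> cmod (c0 t + c1 t * x0)" by (auto simp: dist_norm)
  have "compact (c1 ` ?S)" by (intro compact_continuous_image c) simp
  then have "bounded (c1 ` ?S)" by (rule compact_imp_bounded)
  then obtain M where "\<forall>u\<in>c1 ` ?S. cmod u \<le> M" unfolding bounded_iff by blast
  then have M: "cmod (c1 t) \<le> \<bar>M\<bar>" if "t \<in> ?S" for t using that by force
  define e where "e = d / (2 * (\<bar>M\<bar> + 1))"
  have e: "e > 0" "\<bar>M\<bar> * e < d"
  proof -
    show "e > 0" using d(1) by (simp add: e_def)
    have "k * (d / (2 * k)) = d / 2" if "k > 0" for k :: real using that by simp
    from this[of "\<bar>M\<bar> + 1"] have "(\<bar>M\<bar> + 1) * e = d / 2" unfolding e_def by linarith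
    then have "\<bar>M\<bar> * e + e = d / 2" by (simp add: distrib_right)
    then show "\<bar>M\<bar> * e < d" using \<open>e > 0\<close> d(1) by linarith
  qed
  have nz': "c0 t + c1 t * x \<noteq> 0" if "t \<in> ?S" "x \<in> ball x0 e" for t x
  proof
    assume 0: "c0 t + c1 t * x = 0"
    have "c0 t + c1 t * x0 = c1 t * (x0 - x)" using 0 by (simp add: algebra_simps eq_neg_iff_add_eq_0)
    then have "cmod (c0 t + c1 t * x0) = cmod (c1 t) * cmod (x0 - x)" by (simp add: norm_mult)
    also have "\<dots> \<le> \<bar>M\<bar> * e" using M[OF that(1)] that(2) by (intro mult_mono) (auto simp: dist_norm)
    finally show False using d(2)[OF that(1)] e(2) by simp
  qed
  let ?l = "linepath a b"
  have l: "?l u \<in> ?S" if "u \<in> {0..1}" for u using that linepath_image_01[of a b] by blast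
  have cl: "continuous_on {0..1} (\<lambda>u. g (?l u))" if "continuous_on ?S g" for g :: "complex \<Rightarrow> complex"
    by (rule continuous_on_compose2[OF that]) (use l in \<open>auto intro!: continuous_on_linepath\<close>)
  have cl2: "continuous_on (ball x0 e \<times> {0..1}) (\<lambda>p. g (?l (snd p)))" if "continuous_on ?S g" for g :: "complex \<Rightarrow> complex"
    by (rule continuous_on_compose2[OF cl[OF that]]) (auto intro!: continuous_intros)
  have "(\<lambda>x. integral (cbox 0 1) (\<lambda>u. f (?l u) / (c0 (?l u) + c1 (?l u) * x) * (b - a))) holomorphic_on ball x0 e"
  proof (rule leibniz_rule_holomorphic[where fx = "\<lambda>x u. - (f (?l u) * c1 (?l u)) / (c0 (?l u) + c1 (?l u) * x)\<^sup>2 * (b - a)"])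
    show "((\<lambda>x. f (?l u) / (c0 (?l u) + c1 (?l u) * x) * (b - a)) has_field_derivative
        - (f (?l u) * c1 (?l u)) / (c0 (?l u) + c1 (?l u) * x)\<^sup>2 * (b - a)) (at x within ball x0 e)"
      if "x \<in> ball x0 e" "u \<in> cbox 0 1" for x u
      using nz'[OF l that(1), of u] that(2)
      by (auto intro!: derivative_eq_intros simp: power2_eq_square)
    show "(\<lambda>u. f (?l u) / (c0 (?l u) + c1 (?l u) * x) * (b - a)) integrable_on cbox 0 1" if "x \<in> ball x0 e" for x
    proof (intro integrable_continuous)
      have "continuous_on ?S (\<lambda>t. f t / (c0 t + c1 t * x))"
        using nz'[OF _ that] by (intro continuous_intros f c) auto
      from continuous_on_mult_right[OF cl[OF this], of "b - a"]
      show "continuous_on (cbox 0 1) (\<lambda>u. f (?l u) / (c0 (?l u) + c1 (?l u) * x) * (b - a))"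
        by (simp only: cbox_interval)
    qed
    show "continuous_on (ball x0 e \<times> cbox 0 1) (\<lambda>(x, u). - (f (?l u) * c1 (?l u)) / (c0 (?l u) + c1 (?l u) * x)\<^sup>2 * (b - a))"
      unfolding split_beta using nz'[OF l] by (auto intro!: continuous_intros cl2 f c)
  qed auto
  moreover have "contour_integral ?l g = integral (cbox 0 1) (\<lambda>u. g (?l u) * (b - a))" for g
    by (simp add: contour_integral_integral)
  ultimately have "(\<lambda>x. contour_integral ?l (\<lambda>t. f t / (c0 t + c1 t * x))) holomorphic_on ball x0 e" by presburger
  then show ?thesis using e(1) by blast
qed

text \<open>A sector at 0 with a right angle, cut off at real part \<open>r\<close>. Its sides
  through 0 lie on the lines \<open>Im t = Re t\<close> and \<open>Im t = - Re t\<close>; as they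
  avoid the real axis, integrals over them are analytic on the whole line in the coordinate at
  infinity.\<close>

definition tri :: "real \<Rightarrow> complex set" where
  "tri r = convex hull {0, Complex r (- r), Complex r r}"

lemma tri_iff:
  assumes r: "r > 0" shows "z \<in> tri r \<longleftrightarrow> \<bar>Im z\<bar> \<le> Re z \<and> Re z \<le> r"
proof
  assume "z \<in> tri r"
  then obtain u v w where uvw: "0 \<le> u" "0 \<le> v" "0 \<le> w" "u + v + w = 1"
    "z = u *\<^sub>R 0 + v *\<^sub>R Complex r (- r) + w *\<^sub>R Complex r r"
    unfolding tri_def convex_hull_3 by blast
  have "Re z = (v + w) * r" "Im z = (w - v) * r" using uvw(5) by (simp_all add: algebra_simps)
  moreover have "(v + w) * r \<le> 1 * r" using uvw r by (intro mult_right_mono) auto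
  moreover have "(w - v) * r \<le> (v + w) * r" "- ((w - v) * r) \<le> (v + w) * r"
    using uvw r by (simp_all add: algebra_simps)
  ultimately show "\<bar>Im z\<bar> \<le> Re z \<and> Re z \<le> r" by auto
next
  assume z: "\<bar>Im z\<bar> \<le> Re z \<and> Re z \<le> r"
  have "z = (1 - Re z / r) *\<^sub>R 0 + ((Re z - Im z) / (2 * r)) *\<^sub>R Complex r (- r) + ((Re z + Im z) / (2 * r)) *\<^sub>R Complex r r"
    using r by (simp add: complex_eq_iff field_simps)
  moreover have "0 \<le> 1 - Re z / r" "0 \<le> (Re z - Im z) / (2 * r)" "0 \<le> (Re z + Im z) / (2 * r)"
    "(1 - Re z / r) + (Re z - Im z) / (2 * r) + (Re z + Im z) / (2 * r) = 1"
    using r z by (auto simp: field_simps)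
  ultimately show "z \<in> tri r" unfolding tri_def convex_hull_3 by blast
qed

lemma tri_interior:
  assumes "0 < y" "y < r" shows "complex_of_real y \<in> interior (tri r)"
proof (rule interiorI)
  show "open {z. \<bar>Im z\<bar> < Re z \<and> Re z < r}"
    by (intro open_Collect_conj open_Collect_less continuous_intros)
  show "{z. \<bar>Im z\<bar> < Re z \<and> Re z < r} \<subseteq> tri r"
  proof
    fix z assume "z \<in> {z. \<bar>Im z\<bar> < Re z \<and> Re z < r}"
    then show "z \<in> tri r" using assms by (simp add: tri_iff)
  qed
qed (use assms in auto)

lemma tri_segments:
  assumes r: "r > 0"
  shows "t \<in> closed_segment 0 (Complex r (- r)) \<Longrightarrow> Im t = - Re t \<and> t \<in> tri r"
    and "t \<in> closed_segment (Complex r (- r)) (Complex r r) \<Longrightarrow> Re t = r \<and> t \<in> tri r"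
    and "t \<in> closed_segment (Complex r r) 0 \<Longrightarrow> Im t = Re t \<and> t \<in> tri r"
proof -
  have sub: "closed_segment a b \<subseteq> tri r" if "a \<in> {0, Complex r (- r), Complex r r}" "b \<in> {0, Complex r (- r), Complex r r}" for a b
    unfolding tri_def by (rule closed_segment_subset_convex_hull) (use that in \<open>auto intro: hull_inc\<close>)
  show "t \<in> closed_segment 0 (Complex r (- r)) \<Longrightarrow> Im t = - Re t \<and> t \<in> tri r"
    using sub[of 0 "Complex r (- r)"] by (auto simp: closed_segment_def)
  show "t \<in> closed_segment (Complex r (- r)) (Complex r r) \<Longrightarrow> Re t = r \<and> t \<in> tri r"
  proof -
    assume t: "t \<in> closed_segment (Complex r (- r)) (Complex r r)"
    then obtain u where "t = (1 - u) *\<^sub>R Complex r (- r) + u *\<^sub>R Complex r r" unfolding closed_segment_def by blast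
    then have "Re t = (1 - u) * r + u * r" by simp
    then show "Re t = r \<and> t \<in> tri r" using t sub[of "Complex r (- r)" "Complex r r"] by (auto simp: left_diff_distrib)
  qed
  show "t \<in> closed_segment (Complex r r) 0 \<Longrightarrow> Im t = Re t \<and> t \<in> tri r"
    using sub[of "Complex r r" 0] by (auto simp: closed_segment_def)
qed

text \<open>The point \<open>y\<close> lies inside the triangle and \<open>- y\<close> outside, so
  these are Cauchy's formula and Cauchy's theorem. Only continuity is asked for on the boundary,
  since at the vertex 0 nothing better will be known.\<close>

lemma tri_cauchy:
  assumes r: "r > 0" and F: "continuous_on (tri r) F" "\<And>z. z \<in> interior (tri r) \<Longrightarrow> F field_differentiable at z"
    and y: "0 < y" "y < r"
  shows "contour_integral (linepath 0 (Complex r (- r))) (\<lambda>t. F t / (t - of_real y)) +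
         contour_integral (linepath (Complex r (- r)) (Complex r r)) (\<lambda>t. F t / (t - of_real y)) +
         contour_integral (linepath (Complex r r) 0) (\<lambda>t. F t / (t - of_real y)) = 2 * pi * \<i> * F (of_real y)" (is ?A)
    and "contour_integral (linepath 0 (Complex r (- r))) (\<lambda>t. F t / (t + of_real y)) +
         contour_integral (linepath (Complex r (- r)) (Complex r r)) (\<lambda>t. F t / (t + of_real y)) +
         contour_integral (linepath (Complex r r) 0) (\<lambda>t. F t / (t + of_real y)) = 0" (is ?B)
proof -
  let ?p = "Complex r (- r)" and ?q = "Complex r r"
  let ?\<gamma> = "linepath 0 ?p +++ linepath ?p ?q +++ linepath ?q 0"
  have int: "complex_of_real y \<in> interior (convex hull {0, ?p, ?q})"
    using tri_interior[OF y] by (simp add: tri_def)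
  have wn: "winding_number ?\<gamma> (of_real y) = 1"
    using winding_number_triangle[OF int] y r by (simp add: algebra_simps)
  have path: "path_image ?\<gamma> \<subseteq> tri r - {of_real y}"
  proof -
    have "complex_of_real y \<notin> closed_segment 0 ?p" "complex_of_real y \<notin> closed_segment ?p ?q" "complex_of_real y \<notin> closed_segment ?q 0"
      using tri_segments[OF r, of "of_real y"] y by auto
    then have "path_image ?\<gamma> \<subseteq> (closed_segment 0 ?p \<union> closed_segment ?p ?q \<union> closed_segment ?q 0) - {of_real y}"
      by (auto simp: path_image_join)
    then show ?thesis using tri_segments[OF r] by blast
  qed
  have "((\<lambda>w. F w / (w - of_real y)) has_contour_integral (2 * pi * \<i> * winding_number ?\<gamma> (of_real y) * F (of_real y))) ?\<gamma>"
    by (rule Cauchy_integral_formula_weak[where S = "tri r" and k = "{}"])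
       (use F int path in \<open>auto simp: tri_def\<close>)
  then show ?A unfolding wn by (intro has_chain_integral_chain_integral3) simp
  have nz: "t + of_real y \<noteq> 0" if "t \<in> tri r" for t
  proof
    assume "t + of_real y = 0"
    then have "Re t = - y" by (simp add: complex_eq_iff)
    then show False using that y tri_iff[OF r, of t] by auto
  qed
  have "((\<lambda>t. F t / (t + of_real y)) has_contour_integral 0) ?\<gamma>"
  proof (rule Cauchy_theorem_triangle_cofinite[where S = "{}"])
    show "continuous_on (convex hull {0, ?p, ?q}) (\<lambda>t. F t / (t + of_real y))"
      using F(1) nz unfolding tri_def[symmetric] by (intro continuous_intros) auto
    show "(\<lambda>t. F t / (t + of_real y)) field_differentiable at z" if "z \<in> interior (convex hull {0, ?p, ?q}) - {}" for z
    proof -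
      have z: "z \<in> interior (tri r)" using that by (simp add: tri_def)
      then have "z \<in> tri r" using interior_subset by blast
      then show ?thesis using F(2)[OF z] nz by (intro derivative_intros) auto
    qed
  qed simp
  then show ?B by (rule has_chain_integral_chain_integral3)
qed

text \<open>Additive Cousin problem for a function given on two opposite sectors at \<open>0\<close>: Cauchy's formula over
  the boundary of both triangles, where the sides through \<open>0\<close> produce the part that is regular off \<open>0\<close>
  (the function \<open>I\<close>, in the coordinate \<open>-1/y\<close>) and the remaining sides the part that is regular at \<open>0\<close>.\<close>

lemma cousin_split:
  assumes r: "r > 0" and F: "continuous_on (tri r) F" "\<And>z. z \<in> interior (tri r) \<Longrightarrow> F field_differentiable at z"
    and G: "continuous_on (tri r) G" "\<And>z. z \<in> interior (tri r) \<Longrightarrow> G field_differentiable at z"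
  obtains B I e where "e > 0" "B holomorphic_on ball 0 e"
    "\<And>x::real. \<exists>d>0. I holomorphic_on ball (of_real x) d"
    "\<And>y. 0 < y \<Longrightarrow> y < r \<Longrightarrow> F (of_real y) = B (of_real y) - 1 / of_real y * I (- (1 / of_real y))"
    "\<And>y. 0 < y \<Longrightarrow> y < r \<Longrightarrow> G (of_real y) = B (- of_real y) + 1 / of_real y * I (1 / of_real y)"
proof -
  define p q where "p = Complex r (- r)" and "q = Complex r r"
  note seg = tri_segments[OF r, folded p_def q_def]
  note cau = tri_cauchy[OF r, folded p_def q_def]
  define K :: complex where "K = 1 / (2 * pi * \<i>)"
  have K: "K * (2 * pi * \<i> * z) = z" for z by (simp add: K_def)
  let ?J = "\<lambda>a b \<phi>. contour_integral (linepath a b) \<phi>"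
  define B where "B y = K * (?J p q (\<lambda>t. F t / (t + (-1) * y)) + ?J p q (\<lambda>t. G t / (t + 1 * y)))" for y
  define I where "I x = K * (?J 0 p (\<lambda>t. F t / (1 + t * x)) + ?J q 0 (\<lambda>t. F t / (1 + t * x))
      + ?J 0 p (\<lambda>t. G t / (-1 + t * x)) + ?J q 0 (\<lambda>t. G t / (-1 + t * x)))" for x
  have cont: "continuous_on (closed_segment 0 p) H" "continuous_on (closed_segment p q) H" "continuous_on (closed_segment q 0) H"
    if "continuous_on (tri r) H" for H :: "complex \<Rightarrow> complex"
    using that seg by (auto elim!: continuous_on_subset)
  have nzpq: "t + (-1) * 0 \<noteq> 0" "t + 1 * 0 \<noteq> 0" if "t \<in> closed_segment p q" for t
    using seg(2)[OF that] r by auto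
  \<comment> \<open>On the sides through 0 the real and imaginary parts have equal modulus, so
    \<open>t * x\<close> with real \<open>x\<close> is never 1 or -1.\<close>
  have nz0: "1 + t * of_real x \<noteq> 0 \<and> -1 + t * of_real x \<noteq> 0" if "t \<in> closed_segment 0 p \<or> t \<in> closed_segment q 0" for t x
  proof -
    have *: "Im t = - Re t \<or> Im t = Re t" using that seg by auto
    have False if "t * of_real x = c" "Re c \<noteq> 0" "Im c = 0" for c
    proof -
      have "Re t * x = Re c" "Im t * x = Im c" using that(1) by (auto simp: complex_eq_iff)
      then show False using that * by auto
    qed
    from this[of 1] this[of "-1"] show ?thesis by (auto simp: add_eq_0_iff algebra_simps)
  qed
  obtain e1 where e1: "e1 > 0" "(\<lambda>y. ?J p q (\<lambda>t. F t / (t + (-1) * y))) holomorphic_on ball 0 e1"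
    using segment_integral_holomorphic[OF cont(2)[OF F(1)] _ _ nzpq(1)] by (auto intro: continuous_intros)
  obtain e2 where e2: "e2 > 0" "(\<lambda>y. ?J p q (\<lambda>t. G t / (t + 1 * y))) holomorphic_on ball 0 e2"
    using segment_integral_holomorphic[OF cont(2)[OF G(1)] _ _ nzpq(2)] by (auto intro: continuous_intros)
  show ?thesis
  proof (rule that[of "min e1 e2" B I])
    show "min e1 e2 > 0" using e1 e2 by simp
    show "B holomorphic_on ball 0 (min e1 e2)" unfolding B_def
      by (intro holomorphic_intros holomorphic_on_subset[OF e1(2)] holomorphic_on_subset[OF e2(2)]) auto
    show "\<exists>d>0. I holomorphic_on ball (of_real x) d" for x :: real
    proof -
      obtain d1 where d1: "d1 > 0" "(\<lambda>x. ?J 0 p (\<lambda>t. F t / (1 + t * x))) holomorphic_on ball (of_real x) d1"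
        using segment_integral_holomorphic[OF cont(1)[OF F(1)], of "\<lambda>_. 1" "\<lambda>t. t" "of_real x"] nz0 by (auto intro: continuous_intros)
      obtain d2 where d2: "d2 > 0" "(\<lambda>x. ?J q 0 (\<lambda>t. F t / (1 + t * x))) holomorphic_on ball (of_real x) d2"
        using segment_integral_holomorphic[OF cont(3)[OF F(1)], of "\<lambda>_. 1" "\<lambda>t. t" "of_real x"] nz0 by (auto intro: continuous_intros)
      obtain d3 where d3: "d3 > 0" "(\<lambda>x. ?J 0 p (\<lambda>t. G t / (-1 + t * x))) holomorphic_on ball (of_real x) d3"
        using segment_integral_holomorphic[OF cont(1)[OF G(1)], of "\<lambda>_. -1" "\<lambda>t. t" "of_real x"] nz0 by (auto intro: continuous_intros)
      obtain d4 where d4: "d4 > 0" "(\<lambda>x. ?J q 0 (\<lambda>t. G t / (-1 + t * x))) holomorphic_on ball (of_real x) d4"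
        using segment_integral_holomorphic[OF cont(3)[OF G(1)], of "\<lambda>_. -1" "\<lambda>t. t" "of_real x"] nz0 by (auto intro: continuous_intros)
      let ?d = "min (min d1 d2) (min d3 d4)"
      have "I holomorphic_on ball (of_real x) ?d" unfolding I_def
        by (intro holomorphic_intros holomorphic_on_subset[OF d1(2)] holomorphic_on_subset[OF d2(2)]
            holomorphic_on_subset[OF d3(2)] holomorphic_on_subset[OF d4(2)]) auto
      moreover have "?d > 0" using d1 d2 d3 d4 by simp
      ultimately show ?thesis by blast
    qed
    have ci: "(\<lambda>t. H t / (c + t * of_real x)) contour_integrable_on linepath a b"
      if "continuous_on (tri r) H" "c = 1 \<or> c = -1" "a = 0 \<and> b = p \<or> a = q \<and> b = 0" for H c x a b
      using that cont[OF that(1)] nz0[of _ x]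
      by (intro contour_integrable_continuous_linepath continuous_intros) auto
    fix y assume y: "0 < y" "y < r"
    let ?y = "complex_of_real y"
    \<comment> \<open>Division by \<open>y\<close> turns the kernel at \<open>y\<close> into one at
      \<open>k / y\<close>, that is at \<open>1 / y\<close> or \<open>- 1 / y\<close>.\<close>
    have lm: "?J a b (\<lambda>t. H t / (t + d * ?y)) = k / ?y * ?J a b (\<lambda>t. H t / (c + t * (k / ?y)))"
      if "continuous_on (tri r) H" "c = 1 \<or> c = -1" "k = 1 \<or> k = -1" "a = 0 \<and> b = p \<or> a = q \<and> b = 0" "d = c * k" for H c k d a b
    proof -
      have k: "k / ?y = of_real ((if k = 1 then 1 else -1) / y)" using that(3) by auto
      have "H t / (t + d * ?y) = k / ?y * (H t / (c + t * (k / ?y)))" for t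
      proof -
        have "k * k = 1" using that(3) by auto
        then have "t + d * ?y = k * (?y * (c + t * (k / ?y)))" using y(1) that(5) by (simp add: field_simps)
        moreover have "H t / (k * (?y * X)) = k / ?y * (H t / X)" for X
          using \<open>k * k = 1\<close> that(3) by auto
        ultimately show ?thesis by simp
      qed
      then have "?J a b (\<lambda>t. H t / (t + d * ?y)) = ?J a b (\<lambda>t. k / ?y * (H t / (c + t * (k / ?y))))" by simp
      also have "\<dots> = k / ?y * ?J a b (\<lambda>t. H t / (c + t * (k / ?y)))"
        by (rule contour_integral_lmul) (unfold k, rule ci[OF that(1,2,4)])
      finally show ?thesis .
    qed
    have alg: "b + K * (- 1 / ?y * j1 + - 1 / ?y * j2 + - 1 / ?y * j3 + - 1 / ?y * j4) = b - 1 / ?y * (K * (j1 + j2 + j3 + j4))"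
      "b + K * (1 / ?y * j1 + 1 / ?y * j2 + 1 / ?y * j3 + 1 / ?y * j4) = b + 1 / ?y * (K * (j1 + j2 + j3 + j4))"
      for b j1 j2 j3 j4 by (simp_all add: algebra_simps)
    have neg: "- (1 / ?y) = - 1 / ?y" by simp
    show "F ?y = B ?y - 1 / ?y * I (- (1 / ?y))"
    proof -
      \<comment> \<open>The second bracket is 0 by Cauchy's theorem. Adding it makes the
        contributions of both triangles enter, so that the same \<open>B\<close> and
        \<open>I\<close> serve for \<open>F\<close> and for \<open>G\<close>.\<close>
      have "2 * pi * \<i> * F ?y = (?J 0 p (\<lambda>t. F t / (t + (-1) * ?y)) + ?J p q (\<lambda>t. F t / (t + (-1) * ?y)) + ?J q 0 (\<lambda>t. F t / (t + (-1) * ?y)))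
         + (?J 0 p (\<lambda>t. G t / (t + 1 * ?y)) + ?J p q (\<lambda>t. G t / (t + 1 * ?y)) + ?J q 0 (\<lambda>t. G t / (t + 1 * ?y)))"
        using cau(1)[OF F y] cau(2)[OF G y] by simp
      then have "F ?y = B ?y + K * (?J 0 p (\<lambda>t. F t / (t + (-1) * ?y)) + ?J q 0 (\<lambda>t. F t / (t + (-1) * ?y))
         + ?J 0 p (\<lambda>t. G t / (t + 1 * ?y)) + ?J q 0 (\<lambda>t. G t / (t + 1 * ?y)))"
        unfolding B_def using K[of "F ?y"] by (simp only: distrib_left add_ac)
      also have "?J 0 p (\<lambda>t. F t / (t + (-1) * ?y)) = -1 / ?y * ?J 0 p (\<lambda>t. F t / (1 + t * (-1 / ?y)))"
        by (rule lm[OF F(1)]) auto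
      also have "?J q 0 (\<lambda>t. F t / (t + (-1) * ?y)) = -1 / ?y * ?J q 0 (\<lambda>t. F t / (1 + t * (-1 / ?y)))"
        by (rule lm[OF F(1)]) auto
      also have "?J 0 p (\<lambda>t. G t / (t + 1 * ?y)) = -1 / ?y * ?J 0 p (\<lambda>t. G t / (-1 + t * (-1 / ?y)))"
        by (rule lm[OF G(1)]) auto
      also have "?J q 0 (\<lambda>t. G t / (t + 1 * ?y)) = -1 / ?y * ?J q 0 (\<lambda>t. G t / (-1 + t * (-1 / ?y)))"
        by (rule lm[OF G(1)]) auto
      finally show ?thesis unfolding I_def neg alg .
    qed
    show "G ?y = B (- ?y) + 1 / ?y * I (1 / ?y)"
    proof -
      have "2 * pi * \<i> * G ?y = (?J 0 p (\<lambda>t. G t / (t + (-1) * ?y)) + ?J p q (\<lambda>t. G t / (t + (-1) * ?y)) + ?J q 0 (\<lambda>t. G t / (t + (-1) * ?y)))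
         + (?J 0 p (\<lambda>t. F t / (t + 1 * ?y)) + ?J p q (\<lambda>t. F t / (t + 1 * ?y)) + ?J q 0 (\<lambda>t. F t / (t + 1 * ?y)))"
        using cau(1)[OF G y] cau(2)[OF F y] by simp
      moreover have "B (- ?y) = K * (?J p q (\<lambda>t. F t / (t + 1 * ?y)) + ?J p q (\<lambda>t. G t / (t + (-1) * ?y)))"
        unfolding B_def by simp
      ultimately have "G ?y = B (- ?y) + K * (?J 0 p (\<lambda>t. F t / (t + 1 * ?y)) + ?J q 0 (\<lambda>t. F t / (t + 1 * ?y))
         + ?J 0 p (\<lambda>t. G t / (t + (-1) * ?y)) + ?J q 0 (\<lambda>t. G t / (t + (-1) * ?y)))"
        using K[of "G ?y"] by (simp only: distrib_left add_ac)
      also have "?J 0 p (\<lambda>t. F t / (t + 1 * ?y)) = 1 / ?y * ?J 0 p (\<lambda>t. F t / (1 + t * (1 / ?y)))"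
        by (rule lm[OF F(1)]) auto
      also have "?J q 0 (\<lambda>t. F t / (t + 1 * ?y)) = 1 / ?y * ?J q 0 (\<lambda>t. F t / (1 + t * (1 / ?y)))"
        by (rule lm[OF F(1)]) auto
      also have "?J 0 p (\<lambda>t. G t / (t + (-1) * ?y)) = 1 / ?y * ?J 0 p (\<lambda>t. G t / (-1 + t * (1 / ?y)))"
        by (rule lm[OF G(1)]) auto
      also have "?J q 0 (\<lambda>t. G t / (t + (-1) * ?y)) = 1 / ?y * ?J q 0 (\<lambda>t. G t / (-1 + t * (1 / ?y)))"
        by (rule lm[OF G(1)]) auto
      finally show ?thesis unfolding I_def neg alg .
    qed
  qed
qed

section \<open>Smoothness on the line from expansions in two opposite disks\<close>

text \<open>The disk tangent to the imaginary axis at 0, which is the image of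
  \<open>Re w > m\<close> under inversion.\<close>

definition tdisc :: "real \<Rightarrow> complex set" where
  "tdisc m = ball (of_real (1 / (2 * m))) (1 / (2 * m))"

lemma open_tdisc: "open (tdisc m)"
  by (simp add: tdisc_def)

lemma tdisc_iff:
  assumes "m > 0" shows "z \<in> tdisc m \<longleftrightarrow> z \<noteq> 0 \<and> m < Re (1 / z)"
proof -
  have "z \<in> tdisc m \<longleftrightarrow> (cmod (of_real (1 / (2 * m)) - z))\<^sup>2 < (1 / (2 * m))\<^sup>2"
  proof -
    have "1 / (2 * m) > 0" using assms by simp
    then show ?thesis unfolding tdisc_def mem_ball dist_norm
      by (metis less_imp_le norm_ge_zero power2_less_imp_less power_strict_mono zero_less_numeral)
  qed
  also have "(cmod (of_real (1 / (2 * m)) - z))\<^sup>2 = (1 / (2 * m) - Re z)\<^sup>2 + (Im z)\<^sup>2"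
    by (simp add: cmod_power2)
  also have "\<dots> < (1 / (2 * m))\<^sup>2 \<longleftrightarrow> m * ((Re z)\<^sup>2 + (Im z)\<^sup>2) < Re z"
  proof -
    have "(1 / (2 * m) - Re z)\<^sup>2 = (1 / (2 * m))\<^sup>2 - Re z / m + (Re z)\<^sup>2"
      using assms by (simp add: power2_diff)
    then have "(1 / (2 * m) - Re z)\<^sup>2 + (Im z)\<^sup>2 < (1 / (2 * m))\<^sup>2 \<longleftrightarrow> (Re z)\<^sup>2 + (Im z)\<^sup>2 < Re z / m" by linarith
    then show ?thesis using assms by (simp add: pos_less_divide_eq mult.commute)
  qed
  also have "\<dots> \<longleftrightarrow> z \<noteq> 0 \<and> m < Re (1 / z)"
  proof (cases "z = 0")
    case False
    then have "0 < (Re z)\<^sup>2 + (Im z)\<^sup>2" by (simp add: complex_eq_iff sum_power2_gt_zero_iff)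
    then show ?thesis using False by (simp add: Re_divide pos_less_divide_eq)
  qed simp
  finally show ?thesis .
qed

text \<open>The radius proportional to \<open>u\<close> is what Cauchy's inequality for derivatives
  near 0 needs.\<close>

lemma ball_subset_tdisc:
  assumes "m > 0" "0 < u" "u < 1 / (4 * m)"
  shows "cball (of_real u) (u / 3) \<subseteq> tdisc m"
proof
  fix z assume "z \<in> cball (complex_of_real u) (u / 3)"
  then have z: "cmod (of_real u - z) \<le> u / 3" by (simp add: dist_norm)
  have R: "Re z \<ge> 2 * u / 3" using z abs_Re_le_cmod[of "of_real u - z"] by simp
  have "cmod z \<le> cmod (of_real u) + cmod (z - of_real u)" by (metis add.commute norm_triangle_sub)
  also have "\<dots> \<le> 4 * u / 3" using z assms(2) by (simp add: norm_minus_commute)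
  finally have "(cmod z)\<^sup>2 \<le> (4 * u / 3)\<^sup>2" by (intro power_mono) auto
  then have "(Re z)\<^sup>2 + (Im z)\<^sup>2 \<le> (4 * u / 3)\<^sup>2" unfolding cmod_power2 .
  also have "(4 * u / 3)\<^sup>2 = 16 * u * u / 9" by (simp add: power2_eq_square)
  finally have "(Re z)\<^sup>2 + (Im z)\<^sup>2 \<le> 16 * u * u / 9" .
  then have "m * ((Re z)\<^sup>2 + (Im z)\<^sup>2) \<le> m * (16 * u * u / 9)" using assms(1) by (intro mult_left_mono) auto
  also have "\<dots> < 2 * u / 3"
  proof -
    have "m * u < 1 / 4" using assms by (simp add: field_simps)
    then have "(m * u) * (16 * u / 9) < 1 / 4 * (16 * u / 9)" using assms(2) by (intro mult_strict_right_mono) auto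
    then show ?thesis using assms(2) by (simp add: field_simps)
  qed
  also have "\<dots> \<le> Re z" by (rule R)
  finally have *: "m * ((Re z)\<^sup>2 + (Im z)\<^sup>2) < Re z" .
  have z0: "z \<noteq> 0" using R assms(2) by auto
  then have "0 < (Re z)\<^sup>2 + (Im z)\<^sup>2" by (simp add: complex_eq_iff sum_power2_gt_zero_iff)
  with * have "m < Re (1 / z)" by (simp add: Re_divide pos_less_divide_eq)
  then show "z \<in> tdisc m" using tdisc_iff[OF assms(1)] z0 by simp
qed

lemma higher_deriv_poly: "(deriv ^^ n) (poly p) = poly ((pderiv ^^ n) p)" for p :: "complex poly"
proof (induction n)
  case (Suc n)
  have "deriv (poly q) = poly (pderiv q)" for q :: "complex poly"
    by (rule ext) (simp add: DERIV_imp_deriv)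
  with Suc show ?case by simp
qed simp

text \<open>Asymptotic expansions of holomorphic functions may be differentiated. The remainder
  after degree \<open>n + 2\<close> is of order |z|^(n + 2); Cauchy's inequality on the circle of
  radius \<open>u / 3\<close> costs a factor \<open>u ^ n\<close> and leaves u^2, negligible after
  division by \<open>u\<close>.\<close>

lemma asymptotic_higher_deriv:
  assumes m: "m > 0" and F: "F holomorphic_on tdisc m"
    and as: "\<And>K. K \<ge> 2 \<Longrightarrow> \<exists>C. \<forall>z\<in>tdisc m. cmod (F z - (\<Sum>k<K. b k * z ^ k)) \<le> C * cmod z ^ (K - 1)"
  shows "((\<lambda>u. ((deriv ^^ n) F (of_real u) - fact n * b n) / of_real u) \<longlongrightarrow> fact (Suc n) * b (Suc n)) (at_right 0)"
proof -
  obtain C where C: "\<And>z. z \<in> tdisc m \<Longrightarrow> cmod (F z - (\<Sum>k<n+3. b k * z ^ k)) \<le> C * cmod z ^ (n + 2)"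
    using as[of "n + 3"] by auto
  define p where "p = (\<Sum>k<n+3. monom (b k) k)"
  have p: "poly p z = (\<Sum>k<n+3. b k * z ^ k)" for z by (simp add: p_def poly_sum poly_monom)
  have cp: "coeff p k = b k" if "k < n + 3" for k
    using that by (simp add: p_def coeff_sum if_distrib cong: if_cong)
  define q where "q = (pderiv ^^ n) p"
  have q0: "poly q 0 = fact n * b n" "poly (pderiv q) 0 = fact (Suc n) * b (Suc n)"
    using coeff_higher_pderiv[of n p 0] coeff_higher_pderiv[of "Suc n" p 0] cp[of n] cp[of "Suc n"]
    by (simp_all add: q_def poly_0_coeff_0 pochhammer_fact)
  have der: "((\<lambda>u. (poly q (of_real u) - poly q 0) / complex_of_real u) \<longlongrightarrow> poly (pderiv q) 0) (at_right 0)"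
  proof -
    have 1: "((\<lambda>z. (poly q z - poly q 0) / (z - 0)) \<longlongrightarrow> poly (pderiv q) 0) (at 0)"
      using poly_DERIV[of q 0] by (simp add: has_field_derivative_iff)
    have "((\<lambda>u. complex_of_real u) \<longlongrightarrow> of_real 0) (at_right 0)" by (intro tendsto_of_real tendsto_ident_at)
    then have 2: "filterlim complex_of_real (at 0) (at_right 0)"
      by (intro filterlim_atI) (simp_all add: eventually_at_filter)
    show ?thesis using filterlim_compose[OF 1 2] by simp
  qed
  define C' where "C' = fact n * (C * (4/3) ^ (n + 2)) * 3 ^ n"
  have bd: "cmod ((deriv ^^ n) F (of_real u) - poly q (of_real u)) \<le> C' * u\<^sup>2" if u: "0 < u" "u < 1 / (4 * m)" for u
  proof -
    have sub: "cball (of_real u) (u / 3) \<subseteq> tdisc m" by (rule ball_subset_tdisc[OF m u])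
    have C0: "C \<ge> 0"
    proof -
      have "of_real u \<in> tdisc m" using sub u by auto
      from C[OF this] have "0 \<le> C * cmod (of_real u) ^ (n + 2)" using norm_ge_zero order_trans by blast
      then have "0 \<le> C * u ^ (n + 2)" using u by (simp add: norm_power)
      moreover have "u ^ (n + 2) > 0" using u by (intro zero_less_power)
      ultimately show ?thesis by (meson mult_neg_pos not_le)
    qed
    have hol: "(\<lambda>z. F z - poly p z) holomorphic_on tdisc m" by (intro holomorphic_intros F)
    have "cmod ((deriv ^^ n) (\<lambda>z. F z - poly p z) (of_real u)) \<le> fact n * (C * (4 * u / 3) ^ (n + 2)) / (u / 3) ^ n"
    proof (rule Cauchy_inequality)
      show "(\<lambda>z. F z - poly p z) holomorphic_on ball (of_real u) (u / 3)"
        using sub ball_subset_cball by (blast intro: holomorphic_on_subset[OF hol])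
      show "continuous_on (cball (of_real u) (u / 3)) (\<lambda>z. F z - poly p z)"
        using holomorphic_on_imp_continuous_on[OF holomorphic_on_subset[OF hol sub]] .
      show "cmod (F z - poly p z) \<le> C * (4 * u / 3) ^ (n + 2)" if "cmod (of_real u - z) = u / 3" for z
      proof -
        have "z \<in> tdisc m" using sub that by (auto simp: dist_norm)
        then have "cmod (F z - poly p z) \<le> C * cmod z ^ (n + 2)" unfolding p by (rule C)
        moreover have "cmod z \<le> cmod (of_real u) + cmod (z - of_real u)" by (metis add.commute norm_triangle_sub)
        then have "cmod z \<le> 4 * u / 3" using that u by (simp add: norm_minus_commute)
        then have "C * cmod z ^ (n + 2) \<le> C * (4 * u / 3) ^ (n + 2)" using C0 by (intro mult_left_mono power_mono) auto
        ultimately show ?thesis by linarith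
      qed
    qed (use u in simp)
    moreover have "(deriv ^^ n) (\<lambda>z. F z - poly p z) (of_real u) = (deriv ^^ n) F (of_real u) - (deriv ^^ n) (poly p) (of_real u)"
      by (rule higher_deriv_diff[OF F]) (use sub u in \<open>auto simp: subset_iff intro!: holomorphic_intros open_tdisc\<close>)
    moreover have "fact n * (C * (4 * u / 3) ^ (n + 2)) / (u / 3) ^ n = C' * u\<^sup>2"
      using u by (simp add: C'_def power_mult_distrib power_divide power_add power2_eq_square field_simps)
    ultimately show ?thesis by (simp add: higher_deriv_poly q_def)
  qed
  have "((\<lambda>u. ((deriv ^^ n) F (of_real u) - poly q (of_real u)) / complex_of_real u) \<longlongrightarrow> 0) (at_right 0)"
  proof (rule Lim_null_comparison[where g = "\<lambda>u. C' * u"])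
    have "\<forall>\<^sub>F u in at_right 0. u \<in> {0<..<1 / (4 * m)}" by (rule eventually_at_right_real) (use m in simp)
    then show "\<forall>\<^sub>F u in at_right 0. cmod (((deriv ^^ n) F (of_real u) - poly q (of_real u)) / complex_of_real u) \<le> C' * u"
    proof eventually_elim
      case (elim u)
      then show ?case using bd[of u] by (simp add: norm_divide divide_le_eq power2_eq_square mult.assoc)
    qed
    show "((\<lambda>u. C' * u) \<longlongrightarrow> 0) (at_right 0)" by (auto intro!: tendsto_eq_intros)
  qed
  from tendsto_add[OF this der] show ?thesis
    by (simp add: q0 add_divide_distrib[symmetric])
qed

lemma has_vector_derivative_quotientI:
  assumes "((\<lambda>y. (l y - l 0) / complex_of_real y) \<longlongrightarrow> l1) (at (0::real))"
  shows "(l has_vector_derivative l1) (at 0)"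
proof -
  have "((\<lambda>y. norm ((l y - l 0) / complex_of_real y - l1)) \<longlongrightarrow> 0) (at 0)"
    using assms by (intro tendsto_norm_zero LIM_zero)
  then have "((\<lambda>y. norm (l y - l 0 - (y - 0) *\<^sub>R l1) / norm (y - 0)) \<longlongrightarrow> 0) (at 0)"
  proof (rule Lim_transform_eventually)
    show "\<forall>\<^sub>F y in at 0. norm ((l y - l 0) / complex_of_real y - l1) = norm (l y - l 0 - (y - 0) *\<^sub>R l1) / norm (y - 0)"
      using eventually_neq_at_within[of 0 0 UNIV]
    proof eventually_elim
      case (elim y)
      have "(l y - l 0) / complex_of_real y - l1 = (l y - l 0 - (y - 0) *\<^sub>R l1) / complex_of_real y"
        using elim by (simp add: scaleR_conv_of_real diff_divide_distrib)
      then show ?case by (simp add: norm_divide)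
    qed
  qed
  then show ?thesis unfolding has_vector_derivative_def has_derivative_iff_norm
    by (simp add: bounded_linear_scaleR_left)
qed

text \<open>The two expansions are one formal series in \<open>y\<close>: since \<open>G\<close> is
  evaluated at \<open>- y\<close>, its coefficients carry \<open>(-1) ^ k\<close>. By
  \<open>asymptotic_higher_deriv\<close> the derivatives of every order then fit together at
  0.\<close>

lemma smooth_from_sectors:
  assumes m: "m > 0" and F: "F holomorphic_on tdisc m" and G: "G holomorphic_on tdisc m"
    and asF: "\<And>K. K \<ge> 2 \<Longrightarrow> \<exists>C. \<forall>z\<in>tdisc m. cmod (F z - (\<Sum>k<K. b k * z ^ k)) \<le> C * cmod z ^ (K - 1)"
    and asG: "\<And>K. K \<ge> 2 \<Longrightarrow> \<exists>C. \<forall>z\<in>tdisc m. cmod (G z - (\<Sum>k<K. (-1) ^ k * b k * z ^ k)) \<le> C * cmod z ^ (K - 1)"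
  shows "smooth_at (\<lambda>y. if y = 0 then b 0 else if y > 0 then F (of_real y) else G (of_real (- y))) 0"
proof -
  define D where "D n y = (if y = 0 then fact n * b n else if y > 0 then (deriv ^^ n) F (of_real y)
      else (-1) ^ n * (deriv ^^ n) G (of_real (- y)))" for n and y :: real
  define U where "U = {- (1 / (4 * m)) <..< 1 / (4 * m)}"
  have inT: "complex_of_real u \<in> tdisc m" if "0 < u" "u < 1 / (4 * m)" for u
    using ball_subset_tdisc[OF m that] that by auto
  have op: "open (tdisc m)" by (simp add: tdisc_def)
  have dF: "((deriv ^^ n) H has_field_derivative (deriv ^^ Suc n) H z) (at z)" if "H holomorphic_on tdisc m" "z \<in> tdisc m" for H n z
    using holomorphic_derivI[OF holomorphic_higher_deriv[OF that(1) op, of n] op that(2)] by simp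
  have "(D n has_vector_derivative D (Suc n) y) (at y)" if "y \<in> U" for n y
  proof -
    consider "y = 0" | "y > 0" | "y < 0" by linarith
    then show ?thesis
    proof cases
      case 1
      have right: "((\<lambda>y. (D n y - D n 0) / complex_of_real y) \<longlongrightarrow> D (Suc n) 0) (at_right 0)"
      proof -
        have a: "((\<lambda>u. ((deriv ^^ n) F (of_real u) - fact n * b n) / complex_of_real u) \<longlongrightarrow> D (Suc n) 0) (at_right 0)"
          using asymptotic_higher_deriv[OF m F asF, of n] by (simp add: D_def)
        show ?thesis
          by (rule Lim_transform_eventually[OF a]) (auto simp: D_def eventually_at_filter)
      qed
      have "((\<lambda>y. (D n (- y) - D n 0) / complex_of_real (- y)) \<longlongrightarrow> D (Suc n) 0) (at_right 0)"
      proof -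
        have "((\<lambda>u. ((deriv ^^ n) G (of_real u) - fact n * ((-1) ^ n * b n)) / complex_of_real u) \<longlongrightarrow>
            fact (Suc n) * ((-1) ^ Suc n * b (Suc n))) (at_right 0)"
          by (rule asymptotic_higher_deriv[OF m G, of "\<lambda>k. (-1) ^ k * b k"]) (rule asG)
        then have "((\<lambda>u. - ((-1) ^ n) * (((deriv ^^ n) G (of_real u) - fact n * ((-1) ^ n * b n)) / complex_of_real u)) \<longlongrightarrow>
            - ((-1) ^ n) * (fact (Suc n) * ((-1) ^ Suc n * b (Suc n)))) (at_right 0)"
          by (intro tendsto_mult tendsto_const)
        also have "- ((-1) ^ n) * (fact (Suc n) * ((-1) ^ Suc n * b (Suc n))) = D (Suc n) 0"
          by (simp add: D_def power_add[symmetric] mult.left_commute[of "(-1) ^ n"])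
        finally have a: "((\<lambda>u. - ((-1) ^ n) * (((deriv ^^ n) G (of_real u) - fact n * ((-1) ^ n * b n)) / complex_of_real u)) \<longlongrightarrow> D (Suc n) 0) (at_right 0)" .
        show ?thesis
        proof (rule Lim_transform_eventually[OF a])
          show "\<forall>\<^sub>F u in at_right 0. - ((-1) ^ n) * (((deriv ^^ n) G (of_real u) - fact n * ((-1) ^ n * b n)) / complex_of_real u)
              = (D n (- u) - D n 0) / complex_of_real (- u)"
            unfolding eventually_at_filter
          proof (intro always_eventually allI impI)
            fix u :: real assume "u \<in> {0<..}"
            then have u: "u > 0" by simp
            have s1: "(-1) ^ n * ((-1) ^ n * x) = x" for x :: complex
              by (simp add: power_mult_distrib[symmetric] mult.assoc[symmetric])
            have "- ((-1) ^ n) * (((deriv ^^ n) G (of_real u) - fact n * ((-1) ^ n * b n)) / complex_of_real u)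
               = ((-1) ^ n * (deriv ^^ n) G (of_real u) - fact n * ((-1) ^ n * ((-1) ^ n * b n))) / complex_of_real (- u)"
              using u by (simp add: field_simps)
            also have "\<dots> = (D n (- u) - D n 0) / complex_of_real (- u)" unfolding s1 using u by (simp add: D_def)
            finally show "- ((-1) ^ n) * (((deriv ^^ n) G (of_real u) - fact n * ((-1) ^ n * b n)) / complex_of_real u)
               = (D n (- u) - D n 0) / complex_of_real (- u)" .
          qed
        qed
      qed
      then have "((\<lambda>y. (D n y - D n 0) / complex_of_real y) \<longlongrightarrow> D (Suc n) 0) (at_left 0)"
        by (simp add: filterlim_at_left_to_right)
      then have "((\<lambda>y. (D n y - D n 0) / complex_of_real y) \<longlongrightarrow> D (Suc n) 0) (at 0)"
        using right by (intro filterlim_split_at)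
      then show ?thesis unfolding 1 by (rule has_vector_derivative_quotientI)
    next
      case 2
      have "((\<lambda>x. (deriv ^^ n) F (of_real x)) has_vector_derivative (deriv ^^ Suc n) F (of_real y)) (at y)"
        by (rule has_vector_derivative_real_field[OF dF[OF F]]) (use 2 that inT[of y] in \<open>simp add: U_def\<close>)
      then have "(D n has_vector_derivative (deriv ^^ Suc n) F (of_real y)) (at y)"
        by (rule has_vector_derivative_transform_within_open[where S = "{0<..}"]) (use 2 in \<open>auto simp: D_def\<close>)
      then show ?thesis using 2 by (simp add: D_def)
    next
      case 3
      have "((\<lambda>z. (-1) ^ n * (deriv ^^ n) G (- z)) has_field_derivative (-1) ^ n * ((deriv ^^ Suc n) G (- of_real y) * (-1))) (at (of_real y))"
        by (intro DERIV_cmult DERIV_chain2[OF dF[OF G]] derivative_eq_intros)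
           (use 3 that inT[of "- y"] in \<open>auto simp: U_def\<close>)
      then have "((\<lambda>x. (-1) ^ n * (deriv ^^ n) G (- of_real x)) has_vector_derivative (-1) ^ n * ((deriv ^^ Suc n) G (- of_real y) * (-1))) (at y)"
        by (rule has_vector_derivative_real_field)
      then have "(D n has_vector_derivative (-1) ^ n * ((deriv ^^ Suc n) G (- of_real y) * (-1))) (at y)"
        by (rule has_vector_derivative_transform_within_open[where S = "{..<0}"]) (use 3 in \<open>auto simp: D_def\<close>)
      then show ?thesis using 3 by (simp add: D_def)
    qed
  qed
  moreover have "D 0 = (\<lambda>y. if y = 0 then b 0 else if y > 0 then F (of_real y) else G (of_real (- y)))"
    by (rule ext) (simp add: D_def)
  moreover have "open U" "0 \<in> U" using m by (auto simp: U_def)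
  ultimately show ?thesis unfolding smooth_at_def by blast
qed

section \<open>Asymptotic expansions of regularized sums\<close>

lemma holomorphic_factor_linear:
  assumes "f holomorphic_on ball 0 \<rho>" "\<rho> > 0"
  obtains f1 where "f1 holomorphic_on ball 0 \<rho>" "f1 0 = deriv f 0" "\<And>z. f z = f 0 + z * f1 z"
proof
  show "(\<lambda>z. if z = 0 then deriv f 0 else (f z - f 0) / (z - 0)) holomorphic_on ball 0 \<rho>"
    by (rule pole_lemma) (use assms in auto)
qed auto

lemma one_plus_nonpos:
  assumes "cmod z < 1" shows "1 + z \<notin> \<real>\<^sub>\<le>\<^sub>0"
proof -
  have "Re (1 + z) > 0" using assms abs_Re_le_cmod[of z] by auto
  then show ?thesis by (auto simp: complex_nonpos_Reals_iff)
qed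

text \<open>For \<open>z = 1 / w\<close> the bracket is the relative difference of the power \<beta>
  between \<open>w\<close> and \<open>w + 1\<close>, which is of first order in \<open>z\<close>. A
  multiple of it removes the leading term of \<open>z * \<tau> z\<close> and leaves something
  divisible by \<open>z\<^sup>2\<close>: this yields one coefficient of the expansion.\<close>

lemma expansion_step:
  assumes \<tau>: "\<tau> holomorphic_on ball 0 \<rho>" and \<rho>: "0 < \<rho>" "\<rho> \<le> 1" and \<beta>: "\<beta> \<noteq> 0"
  shows "\<exists>\<tau>1. \<tau>1 holomorphic_on ball 0 \<rho> \<and>
    (\<forall>z. z * \<tau> z = - (\<tau> 0 / \<beta>) * (1 - (1 + z) powr \<beta>) + z\<^sup>2 * \<tau>1 z)"
proof -
  have nz: "1 + z \<notin> \<real>\<^sub>\<le>\<^sub>0" if "z \<in> ball 0 \<rho>" for z :: complex using that \<rho> by (intro one_plus_nonpos) auto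
  have "(\<lambda>z. (1 + z) powr \<beta>) holomorphic_on ball 0 \<rho>" using nz by (intro holomorphic_intros) auto
  then obtain p1 where p1: "p1 holomorphic_on ball 0 \<rho>" "p1 0 = deriv (\<lambda>z. (1 + z) powr \<beta>) 0"
    "\<And>z. (1 + z) powr \<beta> = (1 + 0) powr \<beta> + z * p1 z"
    using holomorphic_factor_linear[of _ \<rho>] \<rho>(1) by blast
  have "((\<lambda>z. (1 + z) powr \<beta>) has_field_derivative \<beta>) (at 0)"
    by (auto intro!: derivative_eq_intros)
  then have p10: "p1 0 = \<beta>" using p1(2) DERIV_imp_deriv by fastforce
  obtain p2 where p2: "p2 holomorphic_on ball 0 \<rho>" "\<And>z. p1 z = p1 0 + z * p2 z"
    using holomorphic_factor_linear[OF p1(1) \<rho>(1)] by metis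
  obtain t1 where t1: "t1 holomorphic_on ball 0 \<rho>" "\<And>z. \<tau> z = \<tau> 0 + z * t1 z"
    using holomorphic_factor_linear[OF \<tau> \<rho>(1)] by metis
  show ?thesis
  proof (intro exI conjI allI)
    show "(\<lambda>z. t1 z - \<tau> 0 / \<beta> * p2 z) holomorphic_on ball 0 \<rho>" by (intro holomorphic_intros t1 p2)
    fix z
    have P: "(1 + z) powr \<beta> = 1 + z * (\<beta> + z * p2 z)" using p1(3)[of z] p2(2)[of z] p10 by simp
    have T: "z * \<tau> z = z * (\<tau> 0 + z * t1 z)" by (subst t1(2)) (rule refl)
    have "- (\<tau> 0 / \<beta>) * (1 - (1 + (z * (\<beta> + z * p2 z)))) + z\<^sup>2 * (t1 z - \<tau> 0 / \<beta> * p2 z) = z * (\<tau> 0 + z * t1 z)"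
      using \<beta> by (simp add: power2_eq_square divide_simps) (simp add: algebra_simps)
    then show "z * \<tau> z = - (\<tau> 0 / \<beta>) * (1 - (1 + z) powr \<beta>) + z\<^sup>2 * (t1 z - \<tau> 0 / \<beta> * p2 z)"
      unfolding T P by simp
  qed
qed

text \<open>The power |w + n|^(-p) is split: |w| <= |w + n| gives |w|^(2 - p), and n + 1 <= 2 |w +
  n| gives the summable factor 4 (n + 1)^(-2). The exponent is not optimal, which is harmless as
  expansions of every order are available.\<close>

lemma telescoping_bound:
  assumes m: "m \<ge> 1" and p: "p \<ge> 2" and c: "c \<ge> 0"
    and d: "\<And>w. Re w > m \<Longrightarrow> cmod (D w - D (w + 1)) \<le> c * cmod w powr (- p)"
    and lim: "\<And>w. Re w > m \<Longrightarrow> (\<lambda>n. D (w + of_nat n)) \<longlonglongrightarrow> 0"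
  shows "\<exists>C. \<forall>w. Re w > m \<longrightarrow> cmod (D w) \<le> C * cmod w powr (2 - p)"
proof (intro exI allI impI)
  fix w :: complex assume w: "Re w > m"
  let ?h = "\<lambda>n. 4 * inverse (real (Suc n) ^ 2)"
  have sh: "summable ?h"
    by (intro summable_mult, subst summable_Suc_iff) (rule inverse_power_summable, simp)
  have w1: "cmod w \<ge> 1" using w m complex_Re_le_cmod[of w] by linarith
  have bd: "cmod (D (w + of_nat n) - D (w + of_nat (Suc n))) \<le> c * cmod w powr (2 - p) * ?h n" for n
  proof -
    have ge: "cmod w \<le> cmod (w + of_nat n)" "real n \<le> cmod (w + of_nat n)"
      using cmod_add_of_real_ge[of w "real n"] w m by auto
    then have half: "real (Suc n) / 2 \<le> cmod (w + of_nat n)" using w1 by simp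
    have pos: "cmod (w + of_nat n) > 0" using ge(1) w1 by linarith
    have "cmod (D (w + of_nat n) - D (w + of_nat n + 1)) \<le> c * cmod (w + of_nat n) powr (- p)"
      using w by (intro d) (simp add: add_strict_increasing)
    also have "cmod (w + of_nat n) powr (- p) = cmod (w + of_nat n) powr (2 - p) * inverse (cmod (w + of_nat n) ^ 2)"
      using pos by (simp add: powr_diff powr_minus powr_numeral divide_inverse)
    also have "\<dots> \<le> cmod w powr (2 - p) * ?h n"
    proof (intro mult_mono)
      show "cmod (w + of_nat n) powr (2 - p) \<le> cmod w powr (2 - p)"
        using ge(1) w1 p by (intro powr_mono2') auto
      have "(real (Suc n) / 2)\<^sup>2 \<le> cmod (w + of_nat n) ^ 2" using half by (intro power_mono) auto
      then have "inverse (cmod (w + of_nat n) ^ 2) \<le> inverse ((real (Suc n) / 2)\<^sup>2)" by (intro le_imp_inverse_le) auto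
      also have "\<dots> = ?h n" by (simp add: power_divide) (rule divide_inverse)
      finally show "inverse (cmod (w + of_nat n) ^ 2) \<le> ?h n" .
    qed auto
    finally have "cmod (D (w + of_nat n) - D (w + of_nat n + 1)) \<le> c * (cmod w powr (2 - p) * ?h n)"
      using c by (simp add: mult_left_mono)
    then show ?thesis by (simp add: add_ac mult.assoc)
  qed
  have "(\<lambda>n. D (w + of_nat n) - D (w + of_nat (Suc n))) sums (D (w + of_nat 0) - 0)"
    by (rule telescope_sums'[OF lim[OF w]])
  then have "D w = (\<Sum>n. D (w + of_nat n) - D (w + of_nat (Suc n)))" by (simp add: sums_iff)
  also have "cmod \<dots> \<le> (\<Sum>n. c * cmod w powr (2 - p) * ?h n)"
    by (rule norm_suminf_le) (use bd summable_mult[OF sh] in \<open>auto simp: mult.assoc\<close>)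
  also have "\<dots> = c * cmod w powr (2 - p) * (\<Sum>n. ?h n)" by (rule suminf_mult[OF sh])
  finally show "cmod (D w) \<le> (c * (\<Sum>n. ?h n)) * cmod w powr (2 - p)" by (simp add: mult_ac)
qed

text \<open>No branch jump occurs, because \<open>w\<close> and \<open>1 + 1 / w\<close> lie in the
  right half plane and their arguments add up to less than pi in modulus.\<close>

lemma powr_add_one:
  assumes "Re w > 1" shows "(w + 1) powr \<beta> = w powr \<beta> * (1 + 1 / w) powr \<beta>"
proof -
  have w0: "w \<noteq> 0" using assms by auto
  have "cmod (1 / w) < 1" using reciprocal_Re_Im(5)[of 1 w] assms by simp
  moreover have "Re (1 / w) > 0" using reciprocal_Re_Im(1)[of 1 w] assms by simp
  ultimately have R: "Re (1 + 1 / w) > 0" by simp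
  have "(w * (1 + 1 / w)) powr \<beta> = w powr \<beta> * (1 + 1 / w) powr \<beta>"
  proof (cases "1 + 1 / w = 0")
    case False
    have "Ln (w * (1 + 1 / w)) = Ln w + Ln (1 + 1 / w)"
    proof (rule Ln_times_simple[OF w0 False])
      have "\<bar>Im (Ln w)\<bar> < pi / 2" using assms w0 Re_Ln_pos_lt[of w] by auto
      moreover have "\<bar>Im (Ln (1 + 1 / w))\<bar> < pi / 2" using R False Re_Ln_pos_lt[of "1 + 1 / w"] by blast
      ultimately show "- pi < Im (Ln w) + Im (Ln (1 + 1 / w))" "Im (Ln w) + Im (Ln (1 + 1 / w)) \<le> pi" by linarith+
    qed
    moreover have "w * (1 + 1 / w) \<noteq> 0" using w0 False by (simp only: mult_eq_0_iff simp_thms)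
    ultimately show ?thesis using w0 False by (simp only: powr_def exp_add[symmetric] distrib_left if_False simp_thms)
  qed (use R in simp)
  then show ?thesis using w0 by (simp add: distrib_left)
qed

lemma powr_shift_tendsto_zero:
  assumes "Re w > 0" "Re \<beta> < 0" shows "(\<lambda>n. (w + of_nat n) powr \<beta>) \<longlonglongrightarrow> 0"
proof (rule Lim_null_comparison)
  show "\<forall>\<^sub>F n in sequentially. cmod ((w + of_nat n) powr \<beta>) \<le> real n powr Re \<beta> * exp (pi * \<bar>Im \<beta>\<bar>)"
  proof (rule eventually_sequentiallyI[of 1])
    fix n :: nat assume n: "n \<ge> 1"
    have "cmod ((w + of_nat n) powr \<beta>) \<le> cmod (w + of_nat n) powr Re \<beta> * exp (pi * \<bar>Im \<beta>\<bar>)"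
      using assms by (intro norm_powr_right_half) (simp add: add_pos_nonneg)
    also have "\<dots> \<le> real n powr Re \<beta> * exp (pi * \<bar>Im \<beta>\<bar>)"
      using cmod_add_of_real_ge(2)[of w "real n"] assms n by (intro mult_right_mono powr_mono2') auto
    finally show "cmod ((w + of_nat n) powr \<beta>) \<le> real n powr Re \<beta> * exp (pi * \<bar>Im \<beta>\<bar>)" .
  qed
  have "(\<lambda>n. real n powr Re \<beta>) \<longlonglongrightarrow> 0"
    by (rule tendsto_neg_powr[OF assms(2) filterlim_real_sequentially])
  from tendsto_mult_left_zero[OF this]
  show "(\<lambda>n. real n powr Re \<beta> * exp (pi * \<bar>Im \<beta>\<bar>)) \<longlonglongrightarrow> 0" .
qed

text \<open>The remainder is allowed one power more than the first omitted term;
  \<open>telescoping_bound\<close> gives this much, and it suffices since \<open>K\<close> is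
  arbitrary.\<close>

definition has_expansion :: "complex \<Rightarrow> real \<Rightarrow> (complex \<Rightarrow> complex) \<Rightarrow> (nat \<Rightarrow> complex) \<Rightarrow> bool" where
  "has_expansion s m H a \<longleftrightarrow> H holomorphic_on {w. m < Re w} \<and> (\<forall>K\<ge>2. \<exists>C. \<forall>w. m < Re w \<longrightarrow>
     cmod (H w - (\<Sum>k<K. a k * w powr (1 - 2 * s - of_nat k))) \<le> C * cmod w powr (2 - 2 * Re s - K))"

text \<open>Along \<open>w + n\<close> only the term with \<open>a 0\<close> needs a hypothesis; the
  later powers tend to 0 because \<open>Re s > 0\<close>.\<close>

lemma has_expansionI:
  assumes s: "Re s > 0" and m: "m \<ge> 1" and hol: "H holomorphic_on {w. m < Re w}"
    and lim: "\<And>w. m < Re w \<Longrightarrow> (\<lambda>n. H (w + of_nat n) - a 0 * (w + of_nat n) powr (1 - 2 * s)) \<longlonglongrightarrow> 0"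
    and bd: "\<And>K. K \<ge> 2 \<Longrightarrow> \<exists>c\<ge>0. \<forall>w. m < Re w \<longrightarrow>
      cmod ((H w - (\<Sum>k<K. a k * w powr (1 - 2 * s - of_nat k)))
        - (H (w + 1) - (\<Sum>k<K. a k * (w + 1) powr (1 - 2 * s - of_nat k)))) \<le> c * cmod w powr (- (2 * Re s + K))"
  shows "has_expansion s m H a"
  unfolding has_expansion_def
proof (intro conjI hol allI impI)
  fix K :: nat assume K: "K \<ge> 2"
  let ?D = "\<lambda>w. H w - (\<Sum>k<K. a k * w powr (1 - 2 * s - of_nat k))"
  obtain c where c: "c \<ge> 0" "\<And>w. m < Re w \<Longrightarrow> cmod (?D w - ?D (w + 1)) \<le> c * cmod w powr (- (2 * Re s + K))"
    using bd[OF K] by blast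
  have "\<exists>C. \<forall>w. m < Re w \<longrightarrow> cmod (?D w) \<le> C * cmod w powr (2 - (2 * Re s + K))"
  proof (rule telescoping_bound[OF m _ c(1)])
    show "2 \<le> 2 * Re s + real K" using s K by simp
    show "cmod (?D w - ?D (w + 1)) \<le> c * cmod w powr (- (2 * Re s + K))" if "m < Re w" for w by (rule c(2)[OF that])
    fix w assume w: "m < Re w"
    obtain K' where K': "K = Suc K'" using K by (cases K) auto
    have "(\<lambda>n. (H (w + of_nat n) - a 0 * (w + of_nat n) powr (1 - 2 * s))
        - (\<Sum>k<K'. a (Suc k) * (w + of_nat n) powr (1 - 2 * s - of_nat (Suc k)))) \<longlonglongrightarrow> 0 - (\<Sum>k<K'. a (Suc k) * 0)"
      using w m s by (intro tendsto_diff lim tendsto_sum tendsto_mult tendsto_const powr_shift_tendsto_zero) auto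
    moreover have "(\<Sum>k<K. a k * v powr (1 - 2 * s - of_nat k)) = a 0 * v powr (1 - 2 * s)
        + (\<Sum>k<K'. a (Suc k) * v powr (1 - 2 * s - of_nat (Suc k)))" for v
      unfolding K' by (subst sum.lessThan_Suc_shift) simp
    ultimately show "(\<lambda>n. ?D (w + of_nat n)) \<longlonglongrightarrow> 0" by (simp add: algebra_simps)
  qed
  then show "\<exists>C. \<forall>w. m < Re w \<longrightarrow> cmod (?D w) \<le> C * cmod w powr (2 - 2 * Re s - K)" by (simp add: algebra_simps)
qed

text \<open>The second function satisfies the difference equation of the first one read at
  \<open>- w\<close>, so formally it is the same solution at the other end of the line. This is why
  both have the same coefficients up to the sign \<open>- ((-1) ^ k)\<close>.\<close>

lemma reg_sum_expansion:
  assumes s: "Re s > 0" "s \<noteq> 1/2" and \<tau>: "\<tau> holomorphic_on ball 0 \<rho>'" "\<rho>' > 0"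
  obtains m a where "m \<ge> 1" "has_expansion s m (reg_sum s \<tau>) a"
    "has_expansion s m (\<lambda>w. reg_sum s (\<lambda>y. - \<tau> (- y)) (w + 1)) (\<lambda>k. - ((-1) ^ k * a k))"
proof -
  define \<rho> where "\<rho> = min \<rho>' 1"
  have \<rho>: "0 < \<rho>" "\<rho> \<le> 1" using \<tau>(2) by (auto simp: \<rho>_def)
  have \<tau>': "\<tau> holomorphic_on ball 0 \<rho>" by (rule holomorphic_on_subset[OF \<tau>(1)]) (auto simp: \<rho>_def)
  define \<beta> where "\<beta> k = 1 - 2 * s - of_nat k" for k
  have \<beta>: "\<beta> k \<noteq> 0" for k
  proof (cases k)
    case 0 then show ?thesis using s(2) by (auto simp: \<beta>_def field_simps)
  next
    case (Suc j)
    then have "Re (\<beta> k) < 0" using s(1) by (simp add: \<beta>_def)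
    then show ?thesis by auto
  qed
  \<comment> \<open>\<open>T k\<close> is the numerator that is left when
    \<open>expansion_step\<close> has removed \<open>k\<close> terms.\<close>
  have "\<exists>T. \<forall>k. (T k holomorphic_on ball 0 \<rho> \<and> (k = 0 \<longrightarrow> T k = \<tau>)) \<and>
      (\<forall>z. z * T k z = - (T k 0 / \<beta> k) * (1 - (1 + z) powr \<beta> k) + z\<^sup>2 * T (Suc k) z)"
  proof (rule dependent_nat_choice)
    show "\<exists>x. x holomorphic_on ball 0 \<rho> \<and> ((0::nat) = 0 \<longrightarrow> x = \<tau>)" using \<tau>' by blast
    show "\<exists>y. (y holomorphic_on ball 0 \<rho> \<and> (Suc k = 0 \<longrightarrow> y = \<tau>)) \<and>
        (\<forall>z. z * x z = - (x 0 / \<beta> k) * (1 - (1 + z) powr \<beta> k) + z\<^sup>2 * y z)"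
      if "x holomorphic_on ball 0 \<rho> \<and> (k = 0 \<longrightarrow> x = \<tau>)" for x k
      using expansion_step[OF _ \<rho> \<beta>, of x k] that by auto
  qed
  then obtain T where T: "\<And>k. T k holomorphic_on ball 0 \<rho>" "T 0 = \<tau>"
    "\<And>k z. z * T k z = - (T k 0 / \<beta> k) * (1 - (1 + z) powr \<beta> k) + z\<^sup>2 * T (Suc k) z" by blast
  define a where "a k = - (T k 0 / \<beta> k)" for k
  \<comment> \<open>For \<open>Re w > m\<close> the point \<open>1 / w\<close> lies in the disk of
    radius \<open>\<rho> / 2\<close>, on which each \<open>T k\<close> is bounded.\<close>
  define m where "m = 2 / \<rho>"
  have m: "m \<ge> 1" "m > 1" using \<rho> by (simp_all add: m_def field_simps)
  have inv: "cmod (1 / w) < \<rho> / 2" if "m < Re w" for w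
    using reciprocal_Re_Im(5)[OF that] m \<rho> by (simp add: m_def)
  have Tb: "\<exists>c\<ge>0. \<forall>z. cmod z \<le> \<rho> / 2 \<longrightarrow> cmod (T k z) \<le> c" for k
  proof -
    have "continuous_on (cball 0 (\<rho> / 2)) (T k)"
      using \<rho> by (intro holomorphic_on_imp_continuous_on holomorphic_on_subset[OF T(1)]) auto
    then have "bounded (T k ` cball 0 (\<rho> / 2))" by (intro compact_imp_bounded compact_continuous_image) auto
    then obtain c where "\<forall>u\<in>T k ` cball 0 (\<rho> / 2). cmod u \<le> c" unfolding bounded_iff by blast
    then show ?thesis by (intro exI[of _ "\<bar>c\<bar>"]) force
  qed
  have pw: "w powr (\<beta> k) * (1 / w) = w powr (- 2 * s - of_nat k)" "w powr (\<beta> k) * (1 / w)\<^sup>2 = w powr (- 2 * s - of_nat (Suc k))"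
    if "w \<noteq> 0" for w k
  proof -
    have "w powr (\<beta> k - 1) = w powr (\<beta> k) * (1 / w)" "w powr (\<beta> k - 2) = w powr (\<beta> k) * (1 / w)\<^sup>2"
      using that by (simp_all add: powr_diff power2_eq_square)
    moreover have "\<beta> k - 1 = - 2 * s - of_nat k" "\<beta> k - 2 = - 2 * s - of_nat (Suc k)" by (simp_all add: \<beta>_def)
    ultimately show "w powr (\<beta> k) * (1 / w) = w powr (- 2 * s - of_nat k)" "w powr (\<beta> k) * (1 / w)\<^sup>2 = w powr (- 2 * s - of_nat (Suc k))"
      by simp_all
  qed
  have lip: "lipschitz0 \<tau>" by (rule lipschitz0_holomorphic[OF \<tau>' \<rho>(1)]) simp
  have hol': "(\<lambda>y. - \<tau> (- y)) holomorphic_on ball 0 \<rho>"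
    by (intro holomorphic_intros holomorphic_on_compose_gen[OF _ \<tau>', unfolded o_def]) auto
  have lip': "lipschitz0 (\<lambda>y. - \<tau> (- y))" by (rule lipschitz0_holomorphic[OF hol' \<rho>(1)]) simp
  have half: "open {w. m < Re w}" by (intro open_Collect_less continuous_intros)
  have hol: "reg_sum s P holomorphic_on {w. m < Re w}" if "lipschitz0 P" "P holomorphic_on ball 0 \<rho>" for P
  proof (rule reg_sum_holomorphic[OF that(1) s(1) half])
    show "(\<lambda>w. P (1 / (w + of_nat n))) holomorphic_on {w. m < Re w}" for n
    proof (rule holomorphic_on_compose_gen[OF _ that(2), unfolded o_def])
      show "(\<lambda>w. 1 / (w + of_nat n)) holomorphic_on {w. m < Re w}"
      proof (intro holomorphic_intros)
        fix w assume "w \<in> {w. m < Re w}"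
        then have "Re (w + of_nat n) > 0" using m by simp
        then show "w + of_nat n \<noteq> 0" by (metis less_irrefl zero_complex.sel(1))
      qed
      show "(\<lambda>w. 1 / (w + of_nat n)) ` {w. m < Re w} \<subseteq> ball 0 \<rho>"
      proof (rule image_subsetI)
        fix w assume "w \<in> {w. m < Re w}"
        then have "m < Re (w + of_nat n)" by simp
        from inv[OF this] show "1 / (w + of_nat n) \<in> ball 0 \<rho>" using \<rho>(1) by simp
      qed
    qed
  qed (use m in auto)
  have a0: "a 0 = \<tau> 0 / (2 * s - 1)" using T(2) \<beta>[of 0] by (simp add: a_def \<beta>_def minus_divide_right)
  show thesis
  proof (rule that[OF m(1), of a])
    show "has_expansion s m (reg_sum s \<tau>) a"
    proof (rule has_expansionI[OF s(1) m(1) hol[OF lip \<tau>']])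
      show "(\<lambda>n. reg_sum s \<tau> (w + of_nat n) - a 0 * (w + of_nat n) powr (1 - 2 * s)) \<longlonglongrightarrow> 0" if "m < Re w" for w
        unfolding a0 using that m by (intro reg_sum_asymp lip s) auto
      fix K :: nat
      obtain c where c: "c \<ge> 0" "\<And>z. cmod z \<le> \<rho> / 2 \<Longrightarrow> cmod (T K z) \<le> c" using Tb by blast
      show "\<exists>c\<ge>0. \<forall>w. m < Re w \<longrightarrow>
        cmod ((reg_sum s \<tau> w - (\<Sum>k<K. a k * w powr (1 - 2 * s - of_nat k)))
          - (reg_sum s \<tau> (w + 1) - (\<Sum>k<K. a k * (w + 1) powr (1 - 2 * s - of_nat k)))) \<le> c * cmod w powr (- (2 * Re s + K))"
      proof (intro exI[of _ "exp (pi * \<bar>Im (2 * s)\<bar>) * c"] conjI allI impI)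
        fix w assume w: "m < Re w"
        then have w0: "w \<noteq> 0" "Re w > 1" "Re w > 0" using m by auto
        have step: "a k * w powr \<beta> k - a k * (w + 1) powr \<beta> k
            = w powr (- 2 * s - of_nat k) * T k (1 / w) - w powr (- 2 * s - of_nat (Suc k)) * T (Suc k) (1 / w)" for k
        proof -
          have "a k * w powr \<beta> k - a k * (w + 1) powr \<beta> k = w powr \<beta> k * (a k * (1 - (1 + 1 / w) powr \<beta> k))"
            unfolding powr_add_one[OF w0(2)] by (simp add: algebra_simps)
          also have "a k * (1 - (1 + 1 / w) powr \<beta> k) = 1 / w * T k (1 / w) - (1 / w)\<^sup>2 * T (Suc k) (1 / w)"
            using T(3)[of "1 / w" k] by (simp add: a_def)
          finally show ?thesis unfolding pw(1)[OF w0(1), of k, symmetric] pw(2)[OF w0(1), of k, symmetric] by (simp add: algebra_simps)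
        qed
        have sum: "(\<Sum>k<K. a k * w powr \<beta> k) - (\<Sum>k<K. a k * (w + 1) powr \<beta> k)
            = w powr (- 2 * s) * \<tau> (1 / w) - w powr (- 2 * s - of_nat K) * T K (1 / w)"
          unfolding sum_subtractf[symmetric] step by (subst sum_lessThan_telescope') (simp add: T(2))
        have rec: "reg_sum s \<tau> w = w powr (- 2 * s) * \<tau> (1 / w) + reg_sum s \<tau> (w + 1)"
          by (rule reg_sum_rec[OF lip s(1) w0(3) s(2)])
        have "(reg_sum s \<tau> w - (\<Sum>k<K. a k * w powr \<beta> k)) - (reg_sum s \<tau> (w + 1) - (\<Sum>k<K. a k * (w + 1) powr \<beta> k))
           = w powr (- 2 * s - of_nat K) * T K (1 / w)" using sum rec by (simp add: algebra_simps)
        moreover have "cmod (w powr (- 2 * s - of_nat K) * T K (1 / w))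
            \<le> (cmod w powr (- (2 * Re s + K)) * exp (pi * \<bar>Im (2 * s)\<bar>)) * c"
          unfolding norm_mult
        proof (rule mult_mono)
          show "cmod (w powr (- 2 * s - of_nat K)) \<le> cmod w powr (- (2 * Re s + K)) * exp (pi * \<bar>Im (2 * s)\<bar>)"
            using norm_powr_right_half[OF w0(3), of "- 2 * s - of_nat K"] by simp
          show "cmod (T K (1 / w)) \<le> c" using inv[OF w] by (intro c(2)) simp
        qed auto
        ultimately show "cmod ((reg_sum s \<tau> w - (\<Sum>k<K. a k * w powr (1 - 2 * s - of_nat k)))
          - (reg_sum s \<tau> (w + 1) - (\<Sum>k<K. a k * (w + 1) powr (1 - 2 * s - of_nat k))))
          \<le> exp (pi * \<bar>Im (2 * s)\<bar>) * c * cmod w powr (- (2 * Re s + K))"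
          unfolding \<beta>_def by (simp add: mult_ac)
      qed (use c in simp)
    qed
    show "has_expansion s m (\<lambda>w. reg_sum s (\<lambda>y. - \<tau> (- y)) (w + 1)) (\<lambda>k. - ((-1) ^ k * a k))"
    proof (rule has_expansionI[OF s(1) m(1)])
      show "(\<lambda>w. reg_sum s (\<lambda>y. - \<tau> (- y)) (w + 1)) holomorphic_on {w. m < Re w}"
        by (rule holomorphic_on_shift[OF hol[OF lip' hol']]) simp
      show "(\<lambda>n. reg_sum s (\<lambda>y. - \<tau> (- y)) (w + of_nat n + 1) - - ((-1) ^ 0 * a 0) * (w + of_nat n) powr (1 - 2 * s)) \<longlonglongrightarrow> 0"
        if w: "m < Re w" for w
      proof -
        let ?H = "\<lambda>n. reg_sum s (\<lambda>y. - \<tau> (- y)) (w + of_nat n) + a 0 * (w + of_nat n) powr (1 - 2 * s)"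
        have "?H \<longlonglongrightarrow> 0"
          using reg_sum_asymp[OF lip' s(1), of w] that m unfolding a0 by simp
        \<comment> \<open>The sums at \<open>w + n\<close> and \<open>w + n + 1\<close> differ by
          this single term.\<close>
        moreover have "(\<lambda>n. (w + of_nat n) powr (- 2 * s) * - \<tau> (- (1 / (w + of_nat n)))) \<longlonglongrightarrow> 0 * - \<tau> (- 0)"
        proof (intro tendsto_mult tendsto_minus powr_shift_tendsto_zero)
          have "continuous_on (ball 0 \<rho>) \<tau>" using \<tau>' by (rule holomorphic_on_imp_continuous_on)
          then have "isCont \<tau> (- 0)" using \<rho>(1) by (simp add: continuous_on_eq_continuous_at)
          moreover have "(\<lambda>n. - (1 / (w + of_nat n))) \<longlonglongrightarrow> - 0"
          proof (rule tendsto_minus, rule tendsto_divide_0[OF tendsto_const])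
            show "filterlim (\<lambda>n. w + of_nat n) at_infinity sequentially"
              by (rule tendsto_add_filterlim_at_infinity[OF tendsto_const tendsto_of_nat])
          qed
          ultimately show "(\<lambda>n. \<tau> (- (1 / (w + of_nat n)))) \<longlonglongrightarrow> \<tau> (- 0)" by (rule isCont_tendsto_compose)
        qed (use that m s in auto)
        ultimately have "(\<lambda>n. ?H n - (w + of_nat n) powr (- 2 * s) * - \<tau> (- (1 / (w + of_nat n)))) \<longlonglongrightarrow> 0 - 0 * - \<tau> (- 0)"
          by (rule tendsto_diff)
        moreover have "?H n - (w + of_nat n) powr (- 2 * s) * - \<tau> (- (1 / (w + of_nat n)))
           = reg_sum s (\<lambda>y. - \<tau> (- y)) (w + of_nat n + 1) - - ((-1) ^ 0 * a 0) * (w + of_nat n) powr (1 - 2 * s)" for n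
          using reg_sum_rec[OF lip' s(1) _ s(2), of "w + of_nat n"] w m by simp
        ultimately show ?thesis by (simp only: mult_zero_left diff_0_right)
      qed
      fix K :: nat
      obtain c where c: "c \<ge> 0" "\<And>z. cmod z \<le> \<rho> / 2 \<Longrightarrow> cmod (T K z) \<le> c" using Tb by blast
      let ?v = "\<lambda>k. - ((-1) ^ k * a k)" and ?L = "\<lambda>w. reg_sum s (\<lambda>y. - \<tau> (- y)) (w + 1)"
      show "\<exists>c\<ge>0. \<forall>w. m < Re w \<longrightarrow>
        cmod ((?L w - (\<Sum>k<K. ?v k * w powr (1 - 2 * s - of_nat k)))
          - (?L (w + 1) - (\<Sum>k<K. ?v k * (w + 1) powr (1 - 2 * s - of_nat k)))) \<le> c * cmod w powr (- (2 * Re s + K))"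
      proof (intro exI[of _ "exp (pi * \<bar>Im (2 * s)\<bar>) * c"] conjI allI impI)
        fix w assume w: "m < Re w"
        define u where "u = w + 1"
        have u: "m < Re u" "u \<noteq> 0" "Re u > 0" "Re w > 1" "w \<noteq> 0" using w m by (auto simp: u_def complex_eq_iff)
        \<comment> \<open>The powers are compared at \<open>u = w + 1\<close>, where
          \<open>w = u * (1 - 1 / u)\<close>; the second factor has positive real part since
          \<open>Re (1 / u) < 1\<close>.\<close>
        have shiftback: "w powr \<beta> k = u powr \<beta> k * (1 + - (1 / u)) powr \<beta> k" for k
        proof -
          have R1: "Re (1 / u) < 1" using reciprocal_Re_Im(2)[of 1 u] u m by simp
          then have R: "Re (1 + - (1 / u)) > 0" by simp
          then have nz: "1 + - (1 / u) \<noteq> 0" by fastforce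
          have "Ln (u * (1 + - (1 / u))) = Ln u + Ln (1 + - (1 / u))"
          proof (rule Ln_times_simple[OF u(2) nz])
            have "\<bar>Im (Ln u)\<bar> < pi / 2" using u(2,3) Re_Ln_pos_lt by blast
            moreover have "\<bar>Im (Ln (1 + - (1 / u)))\<bar> < pi / 2" using R nz Re_Ln_pos_lt by blast
            ultimately show "- pi < Im (Ln u) + Im (Ln (1 + - (1 / u)))" "Im (Ln u) + Im (Ln (1 + - (1 / u))) \<le> pi" by linarith+
          qed
          moreover have "u * (1 + - (1 / u)) = u - 1" using u(2) by (simp add: algebra_simps)
          then have "u * (1 + - (1 / u)) = w" by (simp add: u_def)
          ultimately have "Ln w = Ln u + Ln (1 + - (1 / u))" by simp
          then show ?thesis using u(2,5) nz by (simp only: powr_def exp_add[symmetric] distrib_left if_False simp_thms)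
        qed
        have sgn: "(-1) ^ Suc k = - ((-1) ^ k :: complex)" for k by simp
        have step: "?v k * w powr \<beta> k - ?v k * u powr \<beta> k
            = - ((-1) ^ k) * (u powr (- 2 * s - of_nat k) * T k (- (1 / u)))
              - - ((-1) ^ Suc k) * (u powr (- 2 * s - of_nat (Suc k)) * T (Suc k) (- (1 / u)))" for k
        proof -
          have "?v k * w powr \<beta> k - ?v k * u powr \<beta> k = (-1) ^ k * (u powr \<beta> k * (a k * (1 - (1 + - (1 / u)) powr \<beta> k)))"
            unfolding shiftback by (simp add: algebra_simps)
          also have "a k * (1 - (1 + - (1 / u)) powr \<beta> k) = - (1 / u) * T k (- (1 / u)) - (1 / u)\<^sup>2 * T (Suc k) (- (1 / u))"
            using T(3)[of "- (1 / u)" k] by (simp add: a_def)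
          finally show ?thesis unfolding pw(1)[OF u(2), of k, symmetric] pw(2)[OF u(2), of k, symmetric] sgn by (simp add: algebra_simps)
        qed
        have sum: "(\<Sum>k<K. ?v k * w powr \<beta> k) - (\<Sum>k<K. ?v k * u powr \<beta> k)
            = - (u powr (- 2 * s) * \<tau> (- (1 / u))) - - ((-1) ^ K) * (u powr (- 2 * s - of_nat K) * T K (- (1 / u)))"
          unfolding sum_subtractf[symmetric] step by (subst sum_lessThan_telescope') (simp add: T(2))
        have rec: "?L w = u powr (- 2 * s) * - \<tau> (- (1 / u)) + ?L u"
          unfolding u_def[symmetric] by (rule reg_sum_rec[OF lip' s(1) u(3) s(2)])
        have "(?L w - (\<Sum>k<K. ?v k * w powr \<beta> k)) - (?L u - (\<Sum>k<K. ?v k * u powr \<beta> k))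
           = (?L w - ?L u) - ((\<Sum>k<K. ?v k * w powr \<beta> k) - (\<Sum>k<K. ?v k * u powr \<beta> k))" by (simp only: algebra_simps)
        also have "\<dots> = - ((-1) ^ K) * (u powr (- 2 * s - of_nat K) * T K (- (1 / u)))"
          unfolding sum rec by simp
        finally have eq: "(?L w - (\<Sum>k<K. ?v k * w powr \<beta> k)) - (?L u - (\<Sum>k<K. ?v k * u powr \<beta> k))
           = - ((-1) ^ K) * (u powr (- 2 * s - of_nat K) * T K (- (1 / u)))" .
        have "cmod (- ((-1) ^ K) * (u powr (- 2 * s - of_nat K) * T K (- (1 / u))))
            = cmod (u powr (- 2 * s - of_nat K)) * cmod (T K (- (1 / u)))" by (simp add: norm_mult norm_power)
        also have "\<dots> \<le> (cmod w powr (- (2 * Re s + K)) * exp (pi * \<bar>Im (2 * s)\<bar>)) * c"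
        proof (rule mult_mono)
          have "cmod (u powr (- 2 * s - of_nat K)) \<le> cmod u powr (- (2 * Re s + K)) * exp (pi * \<bar>Im (2 * s)\<bar>)"
            using norm_powr_right_half[OF u(3), of "- 2 * s - of_nat K"] by simp
          also have "\<dots> \<le> cmod w powr (- (2 * Re s + K)) * exp (pi * \<bar>Im (2 * s)\<bar>)"
            using cmod_add_of_real_ge(1)[of w 1] u s by (intro mult_right_mono powr_mono2') (auto simp: u_def)
          finally show "cmod (u powr (- 2 * s - of_nat K)) \<le> cmod w powr (- (2 * Re s + K)) * exp (pi * \<bar>Im (2 * s)\<bar>)" .
          show "cmod (T K (- (1 / u))) \<le> c" using inv[OF u(1)] by (intro c(2)) simp
        qed auto
        finally show "cmod ((?L w - (\<Sum>k<K. ?v k * w powr (1 - 2 * s - of_nat k)))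
          - (?L (w + 1) - (\<Sum>k<K. ?v k * (w + 1) powr (1 - 2 * s - of_nat k))))
          \<le> exp (pi * \<bar>Im (2 * s)\<bar>) * c * cmod w powr (- (2 * Re s + K))"
          using eq unfolding \<beta>_def u_def by (simp add: mult_ac)
      qed (use c in simp)
    qed
  qed
qed

lemma powr_reciprocal:
  assumes "Re z > 0" shows "(1 / z) powr \<beta> = z powr (- \<beta>)"
proof -
  have "z \<noteq> 0" "z \<notin> \<real>\<^sub>\<le>\<^sub>0" using assms by (auto simp: complex_nonpos_Reals_iff)
  then have "Ln (inverse z) = - Ln z" by (intro Ln_inverse)
  then show ?thesis using \<open>z \<noteq> 0\<close> by (simp add: powr_def inverse_eq_divide)
qed

lemma tdisc_D:
  assumes "m > 0" "z \<in> tdisc m"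
  shows "z \<noteq> 0" "m < Re (1 / z)" "Re z > 0"
proof -
  show z: "z \<noteq> 0" "m < Re (1 / z)" using assms tdisc_iff by auto
  have "Re (1 / (1 / z)) > 0" by (rule reciprocal_Re_Im(1)[OF z(2) assms(1)])
  then show "Re z > 0" by simp
qed

text \<open>Multiplication by \<open>z powr (1 - 2 * s)\<close> turns the powers of
  \<open>1 / z\<close> into the monomials \<open>z ^ k\<close>; the principal powers combine because
  \<open>Re z > 0\<close>.\<close>

lemma has_expansion_sector:
  assumes m: "m \<ge> 1" and H: "has_expansion s m H a"
  shows "(\<lambda>z. z powr (1 - 2 * s) * H (1 / z)) holomorphic_on tdisc m"
    and "K \<ge> 2 \<Longrightarrow> \<exists>C. \<forall>z\<in>tdisc m. cmod (z powr (1 - 2 * s) * H (1 / z) - (\<Sum>k<K. a k * z ^ k)) \<le> C * cmod z ^ (K - 1)"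
proof -
  have m0: "m > 0" using m by simp
  note td = tdisc_D[OF m0]
  have hol: "H holomorphic_on {w. m < Re w}" using H by (simp add: has_expansion_def)
  have "(\<lambda>z. H (1 / z)) holomorphic_on tdisc m"
    by (rule holomorphic_on_compose_gen[OF _ hol, unfolded o_def]) (use td in \<open>auto intro!: holomorphic_intros\<close>)
  moreover have "z \<notin> \<real>\<^sub>\<le>\<^sub>0" if "z \<in> tdisc m" for z using td(3)[OF that] by (auto simp: complex_nonpos_Reals_iff)
  ultimately show "(\<lambda>z. z powr (1 - 2 * s) * H (1 / z)) holomorphic_on tdisc m"
    by (intro holomorphic_intros) auto
  assume K: "K \<ge> 2"
  obtain C where C: "\<And>w. m < Re w \<Longrightarrow>
     cmod (H w - (\<Sum>k<K. a k * w powr (1 - 2 * s - of_nat k))) \<le> C * cmod w powr (2 - 2 * Re s - K)"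
    using H K unfolding has_expansion_def by blast
  show "\<exists>C. \<forall>z\<in>tdisc m. cmod (z powr (1 - 2 * s) * H (1 / z) - (\<Sum>k<K. a k * z ^ k)) \<le> C * cmod z ^ (K - 1)"
  proof (intro exI[of _ "exp (pi * \<bar>Im (1 - 2 * s)\<bar>) * C"] ballI)
    fix z assume "z \<in> tdisc m"
    note z = td[OF this]
    have pw: "z powr (1 - 2 * s) * (1 / z) powr (1 - 2 * s - of_nat k) = z ^ k" for k
    proof -
      have "z powr (1 - 2 * s) * (1 / z) powr (1 - 2 * s - of_nat k) = z powr (of_nat k)"
        unfolding powr_reciprocal[OF z(3)] by (simp add: powr_add[symmetric])
      then show ?thesis using z(1) by (simp add: powr_nat)
    qed
    have "z powr (1 - 2 * s) * H (1 / z) - (\<Sum>k<K. a k * z ^ k)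
        = z powr (1 - 2 * s) * (H (1 / z) - (\<Sum>k<K. a k * (1 / z) powr (1 - 2 * s - of_nat k)))"
      unfolding right_diff_distrib sum_distrib_left pw[symmetric] by (simp add: mult_ac)
    then have "cmod (z powr (1 - 2 * s) * H (1 / z) - (\<Sum>k<K. a k * z ^ k))
        = cmod (z powr (1 - 2 * s)) * cmod (H (1 / z) - (\<Sum>k<K. a k * (1 / z) powr (1 - 2 * s - of_nat k)))"
      by (simp only: norm_mult)
    also have "\<dots> \<le> (cmod z powr Re (1 - 2 * s) * exp (pi * \<bar>Im (1 - 2 * s)\<bar>)) * (C * cmod (1 / z) powr (2 - 2 * Re s - K))"
      by (intro mult_mono norm_powr_right_half z C) auto
    also have "cmod (1 / z) powr (2 - 2 * Re s - K) = cmod z powr (- (2 - 2 * Re s - K))"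
      unfolding powr_minus_divide using z(1) by (simp add: norm_divide powr_divide)
    also have "(cmod z powr Re (1 - 2 * s) * exp (pi * \<bar>Im (1 - 2 * s)\<bar>)) * (C * cmod z powr (- (2 - 2 * Re s - K)))
       = exp (pi * \<bar>Im (1 - 2 * s)\<bar>) * C * (cmod z powr Re (1 - 2 * s) * cmod z powr (- (2 - 2 * Re s - K)))"
      by (simp only: mult_ac)
    also have "cmod z powr Re (1 - 2 * s) * cmod z powr (- (2 - 2 * Re s - K)) = cmod z powr real (K - 1)"
      unfolding powr_add[symmetric] using K by (simp add: of_nat_diff)
    also have "\<dots> = cmod z ^ (K - 1)" using z(1) by (subst powr_realpow) auto
    finally show "cmod (z powr (1 - 2 * s) * H (1 / z) - (\<Sum>k<K. a k * z ^ k))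
        \<le> exp (pi * \<bar>Im (1 - 2 * s)\<bar>) * C * cmod z ^ (K - 1)" .
  qed
qed

lemma smooth_at_holomorphic:
  assumes "open S" "F holomorphic_on S" "of_real x \<in> S"
  shows "smooth_at (\<lambda>y. F (of_real y)) x"
  unfolding smooth_at_def
proof (intro exI conjI ballI allI)
  show "open (complex_of_real -` S)" using assms(1) by (intro open_vimage continuous_intros)
  fix n :: nat and y :: real assume "y \<in> complex_of_real -` S"
  then have y: "of_real y \<in> S" by simp
  have "((deriv ^^ n) F has_field_derivative (deriv ^^ Suc n) F (of_real y)) (at (of_real y))"
    using holomorphic_derivI[OF holomorphic_higher_deriv[OF assms(2,1), of n] assms(1) y] by simp
  from has_vector_derivative_real_field[OF this]
  show "((\<lambda>y. (deriv ^^ n) F (complex_of_real y)) has_vector_derivative (deriv ^^ Suc n) F (of_real y)) (at y)" .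
qed (use assms in auto)

lemma smooth_at_diff:
  assumes "smooth_at f x" "smooth_at g x" shows "smooth_at (\<lambda>y. f y - g y) x"
proof -
  obtain U D where D: "open U" "x \<in> U" "D 0 = f" "\<And>n y. y \<in> U \<Longrightarrow> (D n has_vector_derivative D (Suc n) y) (at y)"
    using assms(1) unfolding smooth_at_def by blast
  obtain V E where E: "open V" "x \<in> V" "E 0 = g" "\<And>n y. y \<in> V \<Longrightarrow> (E n has_vector_derivative E (Suc n) y) (at y)"
    using assms(2) unfolding smooth_at_def by blast
  show ?thesis unfolding smooth_at_def
  proof (intro exI[of _ "U \<inter> V"] exI[of _ "\<lambda>n y. D n y - E n y"] conjI ballI allI)
    show "open (U \<inter> V)" "x \<in> U \<inter> V" "(\<lambda>y. D 0 y - E 0 y) = (\<lambda>y. f y - g y)" using D E by auto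
    show "((\<lambda>y. D n y - E n y) has_vector_derivative D (Suc n) y - E (Suc n) y) (at y)" if "y \<in> U \<inter> V" for n y
      using that by (intro has_vector_derivative_diff D E) auto
  qed
qed

text \<open>In the sector |z|^2 <= 2 (Re z)^2 <= 2 r Re z, and \<open>2 * m * r < 1\<close>.\<close>

lemma tri_minus_zero_subset:
  assumes "m > 0" "0 < r" "r < 1 / (2 * m)" "z \<in> tri r" "z \<noteq> 0"
  shows "z \<in> tdisc m"
proof -
  have z: "\<bar>Im z\<bar> \<le> Re z" "Re z \<le> r" using assms tri_iff by auto
  have pos: "Re z > 0" using z(1) assms(5) by (cases "Re z = 0") (auto simp: complex_eq_iff)
  have "(Im z)\<^sup>2 \<le> (Re z)\<^sup>2" using z(1) by (simp add: abs_le_square_iff[symmetric])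
  then have "m * ((Re z)\<^sup>2 + (Im z)\<^sup>2) \<le> m * (2 * (Re z * Re z))"
    using assms(1) by (intro mult_left_mono) (auto simp: power2_eq_square)
  also have "\<dots> = (2 * m * Re z) * Re z" by simp
  also have "\<dots> < 1 * Re z"
  proof (rule mult_strict_right_mono[OF _ pos])
    have "2 * m * Re z \<le> 2 * m * r" using z(2) assms(1) by simp
    also have "\<dots> < 1" using assms(1,3) by (simp add: field_simps)
    finally show "2 * m * Re z < 1" .
  qed
  finally have *: "m * ((Re z)\<^sup>2 + (Im z)\<^sup>2) < Re z" by simp
  have "0 < (Re z)\<^sup>2 + (Im z)\<^sup>2" using pos by (simp add: sum_power2_gt_zero_iff)
  with * have "m < Re (1 / z)" by (simp add: Re_divide pos_less_divide_eq)
  then show ?thesis using assms(1,5) tdisc_iff by auto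
qed

lemma zero_notin_interior_tri:
  assumes "r > 0" shows "0 \<notin> interior (tri r)"
proof
  assume "0 \<in> interior (tri r)"
  then obtain e where e: "e > 0" "ball 0 e \<subseteq> tri r" unfolding mem_interior by blast
  have "- complex_of_real (e / 2) \<in> ball 0 e" using e(1) by simp
  then have "- complex_of_real (e / 2) \<in> tri r" using e(2) by blast
  then show False using tri_iff[OF assms] e(1) by auto
qed

text \<open>\<open>tri_cauchy\<close> requires continuity up to the vertex, where the expansion
  supplies the limit \<open>b 0\<close>. The factor \<open>E\<close> is the weight of the
  application.\<close>

lemma sector_extension:
  assumes m: "m > 0" and r: "0 < r" "r < 1 / (2 * m)" and F: "F holomorphic_on tdisc m"
    and as: "\<exists>C. \<forall>z\<in>tdisc m. cmod (F z - (\<Sum>k<2. b k * z ^ k)) \<le> C * cmod z ^ (2 - 1)"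
    and E: "E holomorphic_on S" "open S" "tri r \<subseteq> S" "E 0 = 1"
  defines "G \<equiv> \<lambda>z. if z = 0 then b 0 else F z * E z"
  shows "continuous_on (tri r) G" "z \<in> interior (tri r) \<Longrightarrow> G field_differentiable at z"
proof -
  have op: "open (tdisc m)" by (rule open_tdisc)
  have dif: "G field_differentiable at z" if z: "z \<in> tdisc m" "z \<in> S" for z
  proof -
    have z0: "z \<noteq> 0" using tdisc_D[OF m z(1)] by blast
    have "(\<lambda>z. F z * E z) holomorphic_on tdisc m \<inter> S"
      by (intro holomorphic_intros holomorphic_on_subset[OF F] holomorphic_on_subset[OF E(1)]) auto
    then have "(\<lambda>z. F z * E z) field_differentiable at z"
      by (rule holomorphic_on_imp_differentiable_at) (use z op E(2) in auto)
    moreover have "\<forall>\<^sub>F w in nhds z. G w = F w * E w"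
      using t1_space_nhds[OF z0] by eventually_elim (simp add: G_def)
    ultimately show ?thesis using DERIV_cong_ev[of z z G "\<lambda>w. F w * E w"] by (auto simp: field_differentiable_def)
  qed
  have sub: "z \<in> tdisc m" if "z \<in> tri r" "z \<noteq> 0" for z by (rule tri_minus_zero_subset[OF m r that])
  show "G field_differentiable at z" if z: "z \<in> interior (tri r)"
  proof -
    have "z \<noteq> 0" using zero_notin_interior_tri[OF r(1)] z by auto
    moreover have "z \<in> tri r" using z interior_subset by blast
    ultimately show ?thesis using dif sub E(3) by blast
  qed
  show "continuous_on (tri r) G" unfolding continuous_on_eq_continuous_within
  proof
    fix z assume z: "z \<in> tri r"
    show "continuous (at z within tri r) G"
    proof (cases "z = 0")
      case False
      then have "G field_differentiable at z" using z dif sub E(3) by blast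
      then show ?thesis by (rule continuous_at_imp_continuous_at_within[OF field_differentiable_imp_continuous_at])
    next
      case True
      obtain C where C: "\<And>z. z \<in> tdisc m \<Longrightarrow> cmod (F z - (\<Sum>k<2. b k * z ^ k)) \<le> C * cmod z ^ (2 - 1)" using as by blast
      have "((\<lambda>z. F z - (\<Sum>k<2. b k * z ^ k)) \<longlongrightarrow> 0) (at 0 within tri r)"
      proof (rule Lim_null_comparison)
        show "\<forall>\<^sub>F z in at 0 within tri r. cmod (F z - (\<Sum>k<2. b k * z ^ k)) \<le> C * cmod z"
          unfolding eventually_at_filter using C sub by (intro always_eventually) force
        show "((\<lambda>z. C * cmod z) \<longlongrightarrow> 0) (at 0 within tri r)" by (auto intro!: tendsto_eq_intros)
      qed
      moreover have "((\<lambda>z. \<Sum>k<2. b k * z ^ k) \<longlongrightarrow> b 0) (at 0 within tri r)"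
        by (auto simp: numeral_2_eq_2 intro!: tendsto_eq_intros)
      ultimately have "((\<lambda>z. F z - (\<Sum>k<2. b k * z ^ k) + (\<Sum>k<2. b k * z ^ k)) \<longlongrightarrow> 0 + b 0) (at 0 within tri r)"
        by (rule tendsto_add)
      then have F0: "(F \<longlongrightarrow> b 0) (at 0 within tri r)" by simp
      have "isCont E 0"
        using E z True holomorphic_on_imp_continuous_on[OF E(1)] continuous_on_eq_continuous_at[OF E(2)] by blast
      then have "(E \<longlongrightarrow> 1) (at 0)" unfolding isCont_def E(4) .
      then have "(E \<longlongrightarrow> 1) (at 0 within tri r)" by (rule tendsto_within_subset) simp
      from tendsto_mult[OF F0 this] have "((\<lambda>z. F z * E z) \<longlongrightarrow> b 0) (at 0 within tri r)" by simp
      then have "(G \<longlongrightarrow> b 0) (at 0 within tri r)"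
        by (rule Lim_transform_eventually) (auto simp: G_def eventually_at_filter)
      then show ?thesis unfolding True continuous_within by (simp add: G_def)
    qed
  qed
qed

text \<open>The weight is analytic along the whole real line, and |y|^(-2s) (1 + 1/y^2)^(-s) = (1 +
  y^2)^(-s), so its inverse is invariant under S for the slash action. Multiplying by the weight
  turns the slash action of S into plain substitution.\<close>

lemma one_plus_square_powr:
  fixes s :: complex
  defines "E \<equiv> \<lambda>z. (1 + z\<^sup>2) powr s" and "S \<equiv> {z. 0 < Re (1 + z\<^sup>2)}"
  shows "open S" "E holomorphic_on S" "complex_of_real x \<in> S" "cmod z < 1 \<Longrightarrow> z \<in> S"
proof -
  show "open S" unfolding S_def by (intro open_Collect_less continuous_intros)
  have "1 + z\<^sup>2 \<notin> \<real>\<^sub>\<le>\<^sub>0" if "z \<in> S" for z using that by (auto simp: S_def complex_nonpos_Reals_iff)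
  then show "E holomorphic_on S" unfolding E_def by (intro holomorphic_intros) auto
  have "Re (1 + (complex_of_real x)\<^sup>2) = 1 + x\<^sup>2" by (simp add: power2_eq_square)
  then show "complex_of_real x \<in> S" unfolding S_def by (simp add: add_pos_nonneg)
  assume "cmod z < 1"
  then have "cmod (z\<^sup>2) < 1" by (simp add: norm_power power_less_one_iff)
  then show "z \<in> S" using abs_Re_le_cmod[of "z\<^sup>2"] by (auto simp: S_def)
qed

text \<open>The splitting reads Rf(y) E(y) = B(y) - I(-1/y) / y with Rf(y) = y (Q|S)(y). The part
  with I is analytic away from infinity and gives \<open>w\<close>; the constant B(0) is moved to
  it, so that B(y) - B(0) is divisible by \<open>y\<close>. Then (Q + w)|S is analytic at 0, and y
  (w|S) is a difference of an analytic and a smooth function.\<close>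

lemma parabolic_correction:
  assumes s: "Re s > 0" "s \<noteq> 1/2" and \<tau>: "\<tau> holomorphic_on ball 0 \<rho>" "\<rho> > 0"
    and R: "\<And>x. x > M \<Longrightarrow> Q x = reg_sum s \<tau> (of_real x)"
    and L: "\<And>x. x > M \<Longrightarrow> Q (- x) = reg_sum s (\<lambda>y. - \<tau> (- y)) (of_real x + 1)"
  obtains w where "\<And>x. real_analytic_at w x" "simple_at s w Infty" "regular_fun s (\<lambda>x. Q x + w x) Infty"
proof -
  obtain m a where m: "m \<ge> 1" and exR: "has_expansion s m (reg_sum s \<tau>) a"
    and exL: "has_expansion s m (\<lambda>w. reg_sum s (\<lambda>y. - \<tau> (- y)) (w + 1)) (\<lambda>k. - ((-1) ^ k * a k))"
    using reg_sum_expansion[OF s \<tau>] by metis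
  have m0: "m > 0" using m by simp
  define b where "b k = - ((-1) ^ k * a k)" for k
  define F where "F z = z powr (1 - 2 * s) * reg_sum s (\<lambda>y. - \<tau> (- y)) (1 / z + 1)" for z
  define G where "G z = - (z powr (1 - 2 * s) * reg_sum s \<tau> (1 / z))" for z
  have F: "F holomorphic_on tdisc m" unfolding F_def by (rule has_expansion_sector(1)[OF m exL])
  have G: "G holomorphic_on tdisc m" unfolding G_def by (intro holomorphic_intros has_expansion_sector(1)[OF m exR])
  have asF: "\<exists>C. \<forall>z\<in>tdisc m. cmod (F z - (\<Sum>k<K. b k * z ^ k)) \<le> C * cmod z ^ (K - 1)" if "K \<ge> 2" for K
    unfolding F_def b_def by (rule has_expansion_sector(2)[OF m exL that])
  have asG: "\<exists>C. \<forall>z\<in>tdisc m. cmod (G z - (\<Sum>k<K. (-1) ^ k * b k * z ^ k)) \<le> C * cmod z ^ (K - 1)" if "K \<ge> 2" for K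
  proof -
    have sg: "(-1) ^ k * b k = - a k" for k by (simp add: b_def mult.assoc[symmetric] power_mult_distrib[symmetric])
    have "cmod (G z - (\<Sum>k<K. (-1) ^ k * b k * z ^ k)) = cmod (z powr (1 - 2 * s) * reg_sum s \<tau> (1 / z) - (\<Sum>k<K. a k * z ^ k))" for z
      unfolding sg G_def by (simp add: sum_negf norm_minus_commute)
    then show ?thesis using has_expansion_sector(2)[OF m exR that] by simp
  qed
  define Rf where "Rf y = (if y = 0 then b 0 else if y > 0 then F (of_real y) else G (of_real (- y)))" for y :: real
  have smooth: "smooth_at Rf 0" unfolding Rf_def by (rule smooth_from_sectors[OF m0 F G asF asG])
  define r where "r = 1 / (4 * m)"
  have r: "0 < r" "r < 1 / (2 * m)" "r \<le> 1 / 4" using m by (auto simp: r_def field_simps)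
  define E where "E z = (1 + z\<^sup>2) powr s" for z :: complex
  define S where "S = {z::complex. 0 < Re (1 + z\<^sup>2)}"
  note ES = one_plus_square_powr[folded S_def]
  have triS: "tri r \<subseteq> S"
  proof
    fix z assume "z \<in> tri r"
    then have "\<bar>Im z\<bar> \<le> r" "\<bar>Re z\<bar> \<le> r" using tri_iff[OF r(1)] by auto
    then have "cmod z < 1" using cmod_le[of z] r(3) by linarith
    then show "z \<in> S" by (rule ES(4))
  qed
  have E: "E holomorphic_on S" "open S" "E 0 = 1" unfolding E_def using ES by auto
  define Fh where "Fh z = (if z = 0 then b 0 else F z * E z)" for z
  define Gh where "Gh z = (if z = 0 then b 0 else G z * E z)" for z
  have b0: "(\<lambda>k. (-1) ^ k * b k) 0 = b 0" by simp
  obtain B I e where BI: "e > 0" "B holomorphic_on ball 0 e" "\<And>x::real. \<exists>d>0. I holomorphic_on ball (of_real x) d"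
    and FB: "\<And>y. 0 < y \<Longrightarrow> y < r \<Longrightarrow> Fh (of_real y) = B (of_real y) - 1 / of_real y * I (- (1 / of_real y))"
    and GB: "\<And>y. 0 < y \<Longrightarrow> y < r \<Longrightarrow> Gh (of_real y) = B (- of_real y) + 1 / of_real y * I (1 / of_real y)"
  proof (rule cousin_split[OF r(1), of Fh Gh])
    show "continuous_on (tri r) Fh" "\<And>z. z \<in> interior (tri r) \<Longrightarrow> Fh field_differentiable at z"
      unfolding Fh_def using sector_extension[OF m0 r(1,2) F asF[of 2] E(1,2) triS E(3)] by auto
    show "continuous_on (tri r) Gh" "\<And>z. z \<in> interior (tri r) \<Longrightarrow> Gh field_differentiable at z"
      unfolding Gh_def using sector_extension[OF m0 r(1,2) G asG[of 2] E(1,2) triS E(3)] unfolding b0 by auto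
  qed (rule that)
  obtain B1 where B1: "B1 holomorphic_on ball 0 e" "\<And>z. B z = B 0 + z * B1 z"
    using holomorphic_factor_linear[OF BI(2,1)] by metis
  define E' where "E' z = (1 + z\<^sup>2) powr (- s)" for z :: complex
  have E': "E' holomorphic_on S" unfolding E'_def by (rule ES(2))
  have EE: "E' (of_real y) * E (of_real y) = 1" for y :: real
  proof -
    have "1 + (complex_of_real y)\<^sup>2 \<noteq> 0" using ES(3)[of y] unfolding S_def mem_Collect_eq by (metis less_irrefl zero_complex.sel(1))
    then show ?thesis by (simp add: E_def E'_def powr_minus)
  qed
  \<comment> \<open>In the coordinate \<open>x = - 1 / y\<close> this is minus the singular part of
    \<open>Rf y / y\<close>, including the pole from \<open>B 0\<close>, as \<open>wS\<close>
    shows.\<close>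
  define w where "w x = E' (of_real x) * (of_real x * (B 0 + of_real x * I (of_real x)))" for x :: real
  define \<kappa> where "\<kappa> z = E' z * B1 z" for z
  have \<kappa>: "\<kappa> holomorphic_on ball 0 e \<inter> S" unfolding \<kappa>_def
    by (intro holomorphic_intros holomorphic_on_subset[OF E'] holomorphic_on_subset[OF B1(1)]) auto
  have opS: "open (ball 0 e \<inter> S)" "complex_of_real 0 \<in> ball 0 e \<inter> S" using E(2) ES(3)[of 0] BI(1) by auto
  have RB: "Rf y * E (of_real y) = B (of_real y) - 1 / of_real y * I (- (1 / of_real y))" if "y \<noteq> 0" "\<bar>y\<bar> < r" for y :: real
  proof (cases "y > 0")
    case True
    then show ?thesis using FB[of y] that by (simp add: Rf_def Fh_def)
  next
    case False
    have "E (of_real (- y)) = E (of_real y)" by (simp add: E_def)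
    then show ?thesis using GB[of "- y"] False that by (simp add: Rf_def Gh_def)
  qed
  have RQ: "of_real \<bar>y\<bar> powr (- 2 * s) * Q (- 1 / y) = Rf y / of_real y" if y: "y \<noteq> 0" "\<bar>y\<bar> < 1 / (\<bar>M\<bar> + 1)" for y :: real
  proof -
    have big: "1 / \<bar>y\<bar> > M"
    proof -
      have "\<bar>y\<bar> * (\<bar>M\<bar> + 1) < 1" using y(2) by (simp add: pos_less_divide_eq add_nonneg_pos)
      then have "\<bar>M\<bar> + 1 < 1 / \<bar>y\<bar>" using y(1) by (simp add: pos_less_divide_eq mult.commute)
      then show ?thesis by linarith
    qed
    have p: "of_real u powr (1 - 2 * s) / complex_of_real u = of_real u powr (- 2 * s)" if "u > 0" for u :: real
      using that powr_diff[of "complex_of_real u" "1 - 2 * s" 1] by simp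
    have p2: "of_real u powr (1 - 2 * s) = complex_of_real u * of_real u powr (- 2 * s)" if "u > 0" for u :: real
      unfolding p[OF that, symmetric] using that by simp
    show ?thesis
    proof (cases "y > 0")
      case True
      have "Q (- 1 / y) = reg_sum s (\<lambda>y. - \<tau> (- y)) (1 / of_real y + 1)" using L[of "1 / y"] big True by simp
      then show ?thesis using True p[of y] by (simp add: Rf_def F_def divide_simps mult_ac)
    next
      case False
      then have u: "- y > 0" using y by simp
      have "Q (- 1 / y) = reg_sum s \<tau> (1 / of_real (- y))" using R[of "1 / (- y)"] big u by simp
      moreover have "\<bar>y\<bar> = - y" using u by simp
      moreover have "Rf y = - (of_real (- y) powr (1 - 2 * s) * reg_sum s \<tau> (1 / of_real (- y)))"
        using u by (simp add: Rf_def G_def)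
      moreover have "of_real (- y) powr (1 - 2 * s) = - of_real y * of_real (- y) powr (- 2 * s)"
        using p2[OF u] by simp
      ultimately show ?thesis using y(1) by (simp only:) simp
    qed
  qed
  have wS: "of_real \<bar>y\<bar> powr (- 2 * s) * w (- 1 / y) = - (E' (of_real y) * (B 0 - 1 / of_real y * I (- (1 / of_real y))) / of_real y)"
    if y: "y \<noteq> 0" for y :: real
  proof -
    have "of_real \<bar>y\<bar> powr (- 2 * s) * E' (of_real (- 1 / y)) = E' (of_real y)"
    proof -
      have 1: "1 + (complex_of_real (- 1 / y))\<^sup>2 = of_real ((1 + y\<^sup>2) / y\<^sup>2)" using y by (simp add: field_simps)
      have "complex_of_real (\<bar>y\<bar>\<^sup>2) powr (- s) = of_real \<bar>y\<bar> powr (- 2 * s)"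
        using abs_powr_mult[of y "- s" y] y by (simp add: power2_eq_square powr_add[symmetric])
      moreover have "complex_of_real \<bar>y\<^sup>2\<bar> powr (- s) * of_real \<bar>(1 + y\<^sup>2) / y\<^sup>2\<bar> powr (- s) = of_real \<bar>1 + y\<^sup>2\<bar> powr (- s)"
        using y by (subst abs_powr_mult) simp
      ultimately have "of_real \<bar>y\<bar> powr (- 2 * s) * of_real ((1 + y\<^sup>2) / y\<^sup>2) powr (- s) = complex_of_real (1 + y\<^sup>2) powr (- s)"
        by (simp add: abs_of_nonneg)
      then show ?thesis unfolding E'_def 1 by simp
    qed
    then have "of_real \<bar>y\<bar> powr (- 2 * s) * w (- 1 / y) = E' (of_real y) * (of_real (- 1 / y) * (B 0 + of_real (- 1 / y) * I (of_real (- 1 / y))))"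
      unfolding w_def by (simp only: mult.assoc[symmetric])
    then show ?thesis using y by (simp add: field_simps)
  qed
  define \<delta> where "\<delta> = min r (1 / (\<bar>M\<bar> + 1))"
  have \<delta>: "\<delta> > 0" using r(1) by (simp add: \<delta>_def add_nonneg_pos)
  have key: "\<kappa> (of_real y) = Rf y / of_real y + of_real \<bar>y\<bar> powr (- 2 * s) * w (- 1 / y)" if y: "y \<noteq> 0" "\<bar>y\<bar> < \<delta>" for y :: real
  proof -
    have "Rf y = E' (of_real y) * (Rf y * E (of_real y))" using EE[of y] by (simp add: mult_ac)
    also have "Rf y * E (of_real y) = B (of_real y) - 1 / of_real y * I (- (1 / of_real y))" using y by (intro RB) (auto simp: \<delta>_def)
    finally have "Rf y / of_real y + of_real \<bar>y\<bar> powr (- 2 * s) * w (- 1 / y)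
        = E' (of_real y) * (B (of_real y) - B 0) / of_real y"
      unfolding wS[OF y(1)] by (simp add: diff_divide_distrib[symmetric] right_diff_distrib)
    also have "\<dots> = \<kappa> (of_real y)" using y(1) by (subst B1(2)) (simp add: \<kappa>_def)
    finally show ?thesis by simp
  qed
  have ev: "\<forall>\<^sub>F y in at 0. y \<noteq> 0 \<and> \<bar>y\<bar> < \<delta>"
    using eventually_at_ball'[OF \<delta>, of 0 UNIV] by eventually_elim (auto simp: dist_real_def)
  show thesis
  proof (rule that)
    fix x :: real
    obtain d where d: "d > 0" "I holomorphic_on ball (of_real x) d" using BI(3) by blast
    have "(\<lambda>z. E' z * (z * (B 0 + z * I z))) holomorphic_on ball (of_real x) d \<inter> S"
      by (intro holomorphic_intros holomorphic_on_subset[OF E'] holomorphic_on_subset[OF d(2)]) auto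
    then show "real_analytic_at w x" unfolding w_def
      using E(2) ES(3)[of x] d(1) by (intro real_analytic_at_holomorphic[where S = "ball (of_real x) d \<inter> S"]) auto
  next
    have "smooth_at (\<lambda>y. (\<lambda>z. z * \<kappa> z) (of_real y)) 0"
      by (rule smooth_at_holomorphic[OF opS(1) _ opS(2)]) (intro holomorphic_intros \<kappa>)
    from smooth_at_diff[OF this smooth] have "smooth_at (\<lambda>y. of_real y * \<kappa> (of_real y) - Rf y) 0" by simp
    moreover have "\<forall>\<^sub>F y in at 0. of_real y * \<kappa> (of_real y) - Rf y = of_real y * of_real \<bar>y\<bar> powr (- 2 * s) * w (- 1 / y)"
      using ev by eventually_elim (simp add: key algebra_simps)
    ultimately show "simple_at s w Infty" unfolding simple_at.simps by blast
  next
    have "real_analytic_at (\<lambda>y. \<kappa> (of_real y)) 0" by (rule real_analytic_at_holomorphic[OF opS(1) \<kappa> opS(2)])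
    moreover have "\<forall>\<^sub>F y in at 0. \<kappa> (of_real y) = of_real \<bar>y\<bar> powr (- 2 * s) * (Q (- 1 / y) + w (- 1 / y))"
      using ev
    proof eventually_elim
      case (elim y)
      then show ?case using key[of y] RQ[of y] by (simp add: distrib_left \<delta>_def)
    qed
    ultimately show "regular_fun s (\<lambda>x. Q x + w x) Infty" unfolding regular_fun_def rp1.case by blast
  qed
qed

section \<open>From eigenfunctions to parabolic cocycles\<close>

text \<open>The factor of the slash action at a real number; identities between such factors reduce
  to products of reals up to sign, by \<open>jfac_prod\<close>.\<close>

definition jfac :: "complex \<Rightarrow> real \<Rightarrow> complex" where
  "jfac s x = of_real \<bar>x\<bar> powr (-2 * s)"

lemma jfac_prod: "a * b = c \<or> a * b = - c \<Longrightarrow> jfac s a * jfac s b = jfac s c"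
  unfolding jfac_def abs_powr_mult by auto

lemma jfac_one: "jfac s 1 = 1" "jfac s (- 1) = 1"
  by (simp_all add: jfac_def)

lemma recip_less: "0 < a \<Longrightarrow> a < t \<Longrightarrow> 1 / t < 1 / (a::real)"
  by (simp add: frac_less2)

lemma phi_recip: "1 / (phi - 1) = phi" "1 / (2 - phi) = phi + 1"
proof -
  have "phi * (phi - 1) = 1" "(phi + 1) * (2 - phi) = 1" using phi_square by (simp_all add: algebra_simps)
  then show "1 / (phi - 1) = phi" "1 / (2 - phi) = phi + 1" using phi_gt by (simp_all add: divide_eq_eq)
qed

section \<open>The arcs bounded by -phi, 1/phi and phi under S and U\<close>

text \<open>S exchanges the end points \<open>- phi\<close> and \<open>phi - 1 = 1 / phi\<close>,
  hence also the two arcs between them, on which \<open>theta_c1\<close> is defined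
  separately.\<close>

lemma region_S:
  shows "x < - phi \<or> phi - 1 < x \<Longrightarrow> x \<noteq> 0 \<and> - phi < - 1 / x \<and> - 1 / x < phi - 1"
    and "- phi < x \<Longrightarrow> x < phi - 1 \<Longrightarrow> x \<noteq> 0 \<Longrightarrow> - 1 / x < - phi \<or> phi - 1 < - 1 / x"
proof -
  note p = phi_gt phi_inverse phi_recip
  show "x \<noteq> 0 \<and> - phi < - 1 / x \<and> - 1 / x < phi - 1" if "x < - phi \<or> phi - 1 < x"
    using that
  proof
    assume a: "x < - phi"
    then have "1 / (- x) < 1 / phi" "0 < 1 / (- x)" using recip_less[of phi "- x"] p by (auto intro!: divide_pos_pos)
    moreover have "1 / (- x) = - 1 / x" by simp
    ultimately show ?thesis using a p by linarith
  next
    assume a: "phi - 1 < x"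
    then have "1 / x < 1 / (phi - 1)" "0 < 1 / x" using recip_less[of "phi - 1" x] p by (auto intro!: divide_pos_pos)
    moreover have "- 1 / x = - (1 / x)" by simp
    ultimately show ?thesis using a p by linarith
  qed
  assume x: "- phi < x" "x < phi - 1" "x \<noteq> 0"
  show "- 1 / x < - phi \<or> phi - 1 < - 1 / x"
  proof (cases "x > 0")
    case True
    then have "1 / (phi - 1) < 1 / x" using recip_less[of x "phi - 1"] x by simp
    then show ?thesis using p by simp
  next
    case False
    then have "1 / phi < 1 / (- x)" using recip_less[of "- x" phi] x by simp
    then show ?thesis using p by simp
  qed
qed

text \<open>The point \<open>phi - 2\<close> cuts (-phi, phi) into two arcs, and U permutes these
  and the outer arc cyclically; so U and U^2 send the outer arc into the interval.\<close>

lemma region_U: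
  assumes "x < - phi \<or> phi < x"
  shows "x \<noteq> 0" "x \<noteq> - 1" "- phi < (- x - 1) / x" "(- x - 1) / x < phi" "- phi < - 1 / (x + 1)" "- 1 / (x + 1) < phi"
proof -
  note p = phi_gt phi_inverse phi_recip
  show nz: "x \<noteq> 0" "x \<noteq> - 1" using assms p by auto
  have e: "(- x - 1) / x = - 1 + - 1 / x" using nz by (simp add: field_simps)
  have 1: "x < - phi \<or> phi - 1 < x" using assms p by auto
  have "- 1 / x > 1 - phi"
    using assms
  proof
    assume "phi < x"
    then have "1 / x < 1 / phi" using recip_less[of phi x] p by simp
    then show ?thesis using p by simp
  next
    assume "x < - phi"
    then have "- 1 / x > 0" using p by (intro divide_neg_neg) auto
    then show ?thesis using p by linarith
  qed
  with region_S(1)[OF 1] show "- phi < (- x - 1) / x" "(- x - 1) / x < phi" unfolding e using p by linarith+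
  have "- phi < - 1 / (x + 1) \<and> - 1 / (x + 1) < phi"
    using assms
  proof
    assume "phi < x"
    then have "1 / (x + 1) < 1 / phi" "0 < 1 / (x + 1)" using recip_less[of phi "x + 1"] p by (auto intro!: divide_pos_pos)
    moreover have "- 1 / (x + 1) = - (1 / (x + 1))" by simp
    ultimately show ?thesis using p by linarith
  next
    assume "x < - phi"
    then have "1 / (- (x + 1)) < 1 / (phi - 1)" "0 < 1 / (- (x + 1))"
      using recip_less[of "phi - 1" "- (x + 1)"] p by (auto intro!: divide_pos_pos)
    then have "- (1 / (x + 1)) < 1 / (phi - 1)" "0 < - (1 / (x + 1))" by (simp_all only: divide_minus_right)
    moreover have "- 1 / (x + 1) = - (1 / (x + 1))" by simp
    ultimately show ?thesis using p by linarith
  qed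
  then show "- phi < - 1 / (x + 1)" "- 1 / (x + 1) < phi" by auto
qed

lemma region_U_rotate:
  shows "phi - 2 < x \<Longrightarrow> x < phi \<Longrightarrow> x \<noteq> 0 \<Longrightarrow> (- x - 1) / x < - phi \<or> phi < (- x - 1) / x"
    and "- phi < x \<Longrightarrow> x < phi - 2 \<Longrightarrow> x \<noteq> - 1 \<Longrightarrow> - 1 / (x + 1) < - phi \<or> phi < - 1 / (x + 1)"
proof -
  note p = phi_gt phi_inverse phi_recip
  assume x: "phi - 2 < x" "x < phi" "x \<noteq> 0"
  have e: "(- x - 1) / x = - 1 - 1 / x" using x by (simp add: field_simps)
  show "(- x - 1) / x < - phi \<or> phi < (- x - 1) / x"
  proof (cases "x > 0")
    case True
    then show ?thesis using recip_less[of x phi] x p unfolding e by linarith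
  next
    case False
    then have "1 / (2 - phi) < 1 / (- x)" using recip_less[of "- x" "2 - phi"] x by simp
    moreover have "1 / (- x) = - (1 / x)" by simp
    ultimately show ?thesis using p unfolding e by linarith
  qed
next
  note p = phi_gt phi_inverse phi_recip
  assume x: "- phi < x" "x < phi - 2" "x \<noteq> - 1"
  show "- 1 / (x + 1) < - phi \<or> phi < - 1 / (x + 1)"
  proof (cases "x + 1 > 0")
    case True
    then have "1 / (phi - 1) < 1 / (x + 1)" using recip_less[of "x + 1" "phi - 1"] x by simp
    moreover have "- 1 / (x + 1) = - (1 / (x + 1))" by simp
    ultimately show ?thesis using p by linarith
  next
    case False
    then have "1 / (phi - 1) < 1 / (- (x + 1))" using recip_less[of "- (x + 1)" "phi - 1"] x by simp
    then have "1 / (phi - 1) < - (1 / (x + 1))" by (simp only: divide_minus_right)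
    moreover have "- 1 / (x + 1) = - (1 / (x + 1))" by simp
    ultimately show ?thesis using p by linarith
  qed
qed

lemma theta_h_eq: "theta_h s g x = g x + jfac s (x + 2) * g (- 1 / (x + 2))"
  by (simp add: theta_h_def slash_words jfac_def)

lemma theta_k_eq: "theta_k s g x = g (x - 1) + jfac s (x - 1) * theta_h s g (- x / (x - 1))"
  by (simp add: theta_k_def slash_words slash_gens jfac_def)

definition theta_f1 :: "complex \<Rightarrow> (real \<Rightarrow> complex) \<Rightarrow> real \<Rightarrow> complex" where
  "theta_f1 s g x = (if x \<in> {- phi <..< 1 / phi} then theta_k s g x else - slash s (theta_k s g) gS x)"

definition theta_f2 :: "complex \<Rightarrow> (real \<Rightarrow> complex) \<Rightarrow> real \<Rightarrow> complex" where
  "theta_f2 s g x = (if x \<in> {- phi <..< phi} then theta_h s g x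
     else - (slash s (theta_h s g) gU x + slash s (theta_h s g) (gS * gT) x))"

lemma theta_c_class: "theta_c1 s g = class_of (theta_f1 s g)" "theta_c2 s g = class_of (theta_f2 s g)"
  unfolding theta_c1_def theta_c2_def theta_f1_def[abs_def] theta_f2_def[abs_def] gU_def by (rule refl)+

lemma theta_f1_in: "- phi < x \<Longrightarrow> x < phi - 1 \<Longrightarrow> theta_f1 s g x = theta_k s g x"
  using phi_inverse by (simp add: theta_f1_def)

lemma theta_f1_out: "x < - phi \<or> phi - 1 < x \<Longrightarrow> theta_f1 s g x = - (jfac s x * theta_k s g (- 1 / x))"
  using phi_inverse by (auto simp: theta_f1_def slash_gS jfac_def)

lemma theta_f2_in: "- phi < x \<Longrightarrow> x < phi \<Longrightarrow> theta_f2 s g x = theta_h s g x"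
  by (simp add: theta_f2_def)

lemma theta_f2_out: "x < - phi \<or> phi < x \<Longrightarrow>
   theta_f2 s g x = - (jfac s x * theta_h s g ((- x - 1) / x) + jfac s (x + 1) * theta_h s g (- 1 / (x + 1)))"
  by (auto simp: theta_f2_def slash_gens jfac_def)

section \<open>Transformation formulas for the pieces of the cocycle\<close>

lemma theta_f2_S:
  assumes "x \<noteq> 0" "x \<noteq> 1" "- 1 / x < - phi \<or> phi < - 1 / x"
  shows "jfac s x * theta_f2 s g (- 1 / x) = - (theta_h s g (x - 1) + jfac s (x - 1) * theta_h s g (- x / (x - 1)))"
proof -
  have a: "(- (- 1 / x) - 1) / (- 1 / x) = x - 1" "- 1 / (- 1 / x + 1) = - x / (x - 1)"
    using assms by (simp_all add: field_simps)
  have "jfac s x * jfac s (- 1 / x) = jfac s 1" using assms by (intro jfac_prod) simp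
  moreover have "jfac s x * jfac s (- 1 / x + 1) = jfac s (x - 1)" using assms by (intro jfac_prod) (simp add: field_simps)
  ultimately have j: "jfac s x * jfac s (- 1 / x) = 1" "jfac s x * jfac s (- 1 / x + 1) = jfac s (x - 1)" by (simp_all only: jfac_one)
  show ?thesis unfolding theta_f2_out[OF assms(3)] a
    by (simp only: mult_minus_right distrib_left mult.assoc[symmetric] j mult_1_left)
qed

lemma theta_k_S:
  assumes "x \<noteq> 0" "x \<noteq> - 1"
  shows "jfac s x * theta_k s g (- 1 / x) = jfac s x * g ((- x - 1) / x) + jfac s (x + 1) * theta_h s g (- 1 / (x + 1))"
proof -
  have a: "- 1 / x - 1 = (- x - 1) / x" using assms by (simp add: field_simps)
  have "x + 1 \<noteq> 0" using assms by linarith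
  then have b: "- (- 1 / x) / ((- x - 1) / x) = - 1 / (x + 1)" using assms by (simp add: divide_simps)
  have j: "jfac s x * jfac s ((- x - 1) / x) = jfac s (x + 1)" using assms by (intro jfac_prod) (simp add: field_simps)
  show ?thesis unfolding theta_k_eq[of s g "- 1 / x"] a b by (simp only: distrib_left mult.assoc[symmetric] j)
qed

lemma theta_h_minus_g_S:
  assumes "x \<noteq> 0" "x \<noteq> 1"
  shows "jfac s x * theta_h s g ((- x - 1) / x) = jfac s x * g ((- x - 1) / x) + jfac s (x - 1) * g (- x / (x - 1))"
proof -
  have a: "(- x - 1) / x + 2 = (x - 1) / x" using assms by (simp add: field_simps)
  have b: "- 1 / ((x - 1) / x) = - x / (x - 1)" by simp
  have j: "jfac s x * jfac s ((x - 1) / x) = jfac s (x - 1)" using assms by (intro jfac_prod) simp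
  show ?thesis unfolding theta_h_eq[of s g "(- x - 1) / x"] a b by (simp only: distrib_left mult.assoc[symmetric] j)
qed

lemma theta_h_T:
  assumes "x \<noteq> 1" "x \<noteq> 2"
  shows "jfac s (x - 1) * theta_h s g (- x / (x - 1)) = jfac s (x - 1) * g (- x / (x - 1)) + jfac s (x - 2) * g ((1 - x) / (x - 2))"
proof -
  have nz: "x - 1 \<noteq> 0" "x - 2 \<noteq> 0" using assms by auto
  have a: "- x / (x - 1) + 2 = (x - 2) / (x - 1)" using nz by (simp add: divide_simps) 
  have b: "- 1 / ((x - 2) / (x - 1)) = (1 - x) / (x - 2)" by (simp add: minus_divide_left)
  have j: "jfac s (x - 1) * jfac s ((x - 2) / (x - 1)) = jfac s (x - 2)" using nz by (intro jfac_prod) simp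
  show ?thesis unfolding theta_h_eq[of s g "- x / (x - 1)"] a b by (simp only: distrib_left mult.assoc[symmetric] j)
qed

text \<open>A function with this property solves \<open>c gT = q - cslash s q gT\<close> for the cocycle \<open>c\<close> of \<open>g\<close>,
  up to a regular function at infinity that \<open>parabolic_correction\<close> provides.\<close>

definition eigen_potential :: "complex \<Rightarrow> (real \<Rightarrow> complex) \<Rightarrow> real \<Rightarrow> complex" where
  "eigen_potential s g x = (if - phi < x then - rreg s (\<lambda>y. g (- y)) (x + 2)
     else rreg s (\<lambda>y. g (y - 1)) (2 - x) - theta_f2 s g x)"

lemma eigen_analytic:
  assumes "g \<in> analytic_fun_on phi_interval"
  shows "- (phi + 1) < x \<Longrightarrow> x < phi \<Longrightarrow> real_analytic_at g x"
    and "real_analytic_at (\<lambda>y. g (- y)) 0" "real_analytic_at (\<lambda>y. g (y - 1)) 0"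
proof -
  show a: "real_analytic_at g x" if "- (phi + 1) < x" "x < phi" for x
    using assms that phi_power2 by (simp add: analytic_fun_on_def)
  show "real_analytic_at (\<lambda>y. g (- y)) 0" by (rule real_analytic_at_neg, rule a) (use phi_gt in auto)
  have "real_analytic_at (\<lambda>y. g (y + - 1)) 0" by (rule real_analytic_at_shift, rule a) (use phi_gt in auto)
  then show "real_analytic_at (\<lambda>y. g (y - 1)) 0" by simp
qed

text \<open>By the four term equation h = g|T^(-1) + g|T^(-1)ST^(-2), while h|STS contains
  g|T^(-1)ST^(-2) as well. In h - k the common terms cancel and g|STS is left.\<close>

lemma theta_h_minus_k:
  assumes s: "Re s > 0" "s \<noteq> 1/2" and g: "g \<in> analytic_fun_on phi_interval" and e: "real_eigen s g"
    and y: "- phi < y" "y < phi" "y \<noteq> 1"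
  shows "theta_h s g y - theta_k s g y = - (jfac s (y - 1) * g (- y / (y - 1)))"
proof -
  have "theta_h s g y = g (y - 1) + jfac s (y - 2) * g ((1 - y) / (y - 2))"
    using real_eigen_FE4[OF s g e y(1,2)] by (simp add: theta_h_def slash_words jfac_def)
  moreover have "theta_k s g y = g (y - 1) + (jfac s (y - 1) * g (- y / (y - 1)) + jfac s (y - 2) * g ((1 - y) / (y - 2)))"
    unfolding theta_k_eq[of s g y] using theta_h_T[of y s g] y phi_gt by simp
  ultimately show ?thesis by simp
qed

text \<open>\<open>theta_h_minus_k\<close> slashed with S: for these \<open>x\<close> the point
  \<open>- 1 / x\<close> lies in both fundamental intervals.\<close>

lemma theta_f_large:
  assumes s: "Re s > 0" "s \<noteq> 1/2" and g: "g \<in> analytic_fun_on phi_interval" and e: "real_eigen s g"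
    and x: "x < - phi \<or> phi - 1 < x"
  shows "jfac s x * theta_f2 s g (- 1 / x) + theta_f1 s g x = - (jfac s (x + 1) * g (- 1 / (x + 1)))"
proof -
  have p: "x \<noteq> 0" "- phi < - 1 / x" "- 1 / x < phi" "x \<noteq> - 1" using region_S(1)[OF x] x phi_gt by auto
  have x1: "x + 1 \<noteq> 0" using p by linarith
  have y1: "- 1 / x \<noteq> 1" using p by (simp add: divide_eq_eq)
  have a: "- (- 1 / x) / (- 1 / x - 1) = - 1 / (x + 1)" using p x1 by (simp add: divide_simps)
  have j: "jfac s x * jfac s (- 1 / x - 1) = jfac s (x + 1)" using p by (intro jfac_prod) (simp add: field_simps)
  have "jfac s x * theta_f2 s g (- 1 / x) + theta_f1 s g x = jfac s x * (theta_h s g (- 1 / x) - theta_k s g (- 1 / x))"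
    unfolding theta_f1_out[OF x] theta_f2_in[OF p(2,3)] by (simp add: right_diff_distrib)
  also have "\<dots> = - (jfac s (x + 1) * g (- 1 / (x + 1)))"
    unfolding theta_h_minus_k[OF s g e p(2,3) y1] a by (simp only: mult_minus_right mult.assoc[symmetric] j)
  finally show ?thesis .
qed

text \<open>The right-hand side is minus the cocycle value at T^(-1) = US. The three cases record
  where \<open>x - 1\<close> and \<open>x\<close> lie relative to the break point
  \<open>- phi\<close>.\<close>

lemma eigen_potential_difference:
  assumes s: "Re s > 0" "s \<noteq> 1/2" and g: "g \<in> analytic_fun_on phi_interval" and e: "real_eigen s g"
    and x: "x \<notin> {0, - phi, phi - 1, 1 - phi}"
  shows "eigen_potential s g (x - 1) - eigen_potential s g x = jfac s x * theta_f2 s g (- 1 / x) + theta_f1 s g x"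
proof -
  note p = phi_gt phi_inverse phi_recip
  note an = eigen_analytic[OF g]
  have x': "x \<noteq> 0" "x \<noteq> - phi" "x \<noteq> phi - 1" "x \<noteq> 1 - phi" using x by auto
  consider "1 - phi < x" | "x < - phi" | "- phi < x" "x < 1 - phi" using x' by linarith
  then show ?thesis
  proof cases
    case 1
    \<comment> \<open>Both points lie to the right of the break point, so one step of the recursion
      of the first sum gives the difference.\<close>
    have "rreg s (\<lambda>y. g (- y)) (x + 1) = of_real (x + 1) powr (-2 * s) * g (- (1 / (x + 1))) + rreg s (\<lambda>y. g (- y)) (x + 1 + 1)"
      by (rule rreg_rec[OF an(2) s]) (use 1 p in linarith)
    moreover have "of_real (x + 1) powr (-2 * s) = jfac s (x + 1)" using 1 p by (simp add: jfac_def)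
    moreover have "eigen_potential s g (x - 1) = - rreg s (\<lambda>y. g (- y)) (x + 1)" "eigen_potential s g x = - rreg s (\<lambda>y. g (- y)) (x + 1 + 1)"
      using 1 p by (simp_all add: eigen_potential_def add.commute)
    ultimately have L: "eigen_potential s g (x - 1) - eigen_potential s g x = - (jfac s (x + 1) * g (- 1 / (x + 1)))" by simp
    show ?thesis
    proof (cases "x < phi - 1")
      case True
      have "- 1 / x < - phi \<or> phi < - 1 / x"
      proof (cases "x > 0")
        case True
        then have "1 / (phi - 1) < 1 / x" using recip_less[of x "phi - 1"] \<open>x < phi - 1\<close> by simp
        then show ?thesis using p by simp
      next
        case False
        then have "1 / (phi - 1) < 1 / (- x)" using recip_less[of "- x" "phi - 1"] 1 x' by simp
        then show ?thesis using p by simp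
      qed
      then have "jfac s x * theta_f2 s g (- 1 / x) + theta_f1 s g x = g (x - 1) - theta_h s g (x - 1)"
        using theta_f2_S[of x s g] theta_f1_in[of x s g] theta_k_eq[of s g x] x' 1 True p by simp
      also have "\<dots> = - (jfac s (x + 1) * g (- 1 / (x + 1)))" by (simp add: theta_h_eq add.commute)
      finally show ?thesis unfolding L by simp
    next
      case False
      then show ?thesis unfolding L using theta_f_large[OF s g e, of x] x' by simp
    qed
  next
    case 2
    have nz: "x \<noteq> 1" "x \<noteq> 2" "x \<noteq> 0" "x \<noteq> - 1" using 2 p by auto
    \<comment> \<open>Both points lie to the left: to the recursion of the second sum come the
      values of c2 outside its fundamental interval, and everything is reduced to values of g and h
      inside.\<close>
    have "rreg s (\<lambda>y. g (y - 1)) (2 - x) = of_real (2 - x) powr (-2 * s) * g (1 / (2 - x) - 1) + rreg s (\<lambda>y. g (y - 1)) (2 - x + 1)"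
      by (rule rreg_rec[OF an(3) s]) (use 2 p in linarith)
    moreover have "of_real (2 - x) powr (-2 * s) = jfac s (x - 2)" using 2 p by (simp add: jfac_def)
    moreover have "1 / (2 - x) - 1 = (1 - x) / (x - 2)" using 2 p by (simp add: divide_simps) (simp add: algebra_simps)
    moreover have "eigen_potential s g (x - 1) = rreg s (\<lambda>y. g (y - 1)) (2 - x + 1) - theta_f2 s g (x - 1)"
      "eigen_potential s g x = rreg s (\<lambda>y. g (y - 1)) (2 - x) - theta_f2 s g x"
      using 2 p by (simp_all add: eigen_potential_def algebra_simps)
    ultimately have L: "eigen_potential s g (x - 1) - eigen_potential s g x
       = - (jfac s (x - 2) * g ((1 - x) / (x - 2))) - theta_f2 s g (x - 1) + theta_f2 s g x" by simp
    have f2x: "theta_f2 s g x = - (jfac s x * theta_h s g ((- x - 1) / x) + jfac s (x + 1) * theta_h s g (- 1 / (x + 1)))"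
      by (rule theta_f2_out) (use 2 in simp)
    have "theta_f2 s g (x - 1) = - (jfac s (x - 1) * theta_h s g ((- (x - 1) - 1) / (x - 1)) + jfac s (x - 1 + 1) * theta_h s g (- 1 / (x - 1 + 1)))"
      by (rule theta_f2_out) (use 2 in simp)
    then have f2x1: "theta_f2 s g (x - 1) = - (jfac s (x - 1) * theta_h s g (- x / (x - 1)) + jfac s x * theta_h s g (- 1 / x))" by simp
    have f2y: "theta_f2 s g (- 1 / x) = theta_h s g (- 1 / x)"
      using region_S(1)[of x] 2 p by (intro theta_f2_in) auto
    have f1x: "theta_f1 s g x = - (jfac s x * theta_k s g (- 1 / x))" by (rule theta_f1_out) (use 2 in simp)
    show ?thesis unfolding L f2x f2x1 f2y f1x theta_k_S[OF nz(3,4)] theta_h_T[OF nz(1,2)] theta_h_minus_g_S[OF nz(3,1)]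
      by (simp add: algebra_simps)
  next
    case 3
    \<comment> \<open>The break point lies between \<open>x - 1\<close> and \<open>x\<close>, and
      the eigenfunction equation itself joins the two sums.\<close>
    have "x - 1 \<in> phi_interval" using 3 p phi_power2 by simp
    then have "g (x - 1) = rreg s (\<lambda>y. g (- y)) (x - 1 + 3) + rreg s (\<lambda>y. g (y - 1)) (2 - (x - 1))"
      using e unfolding real_eigen_def by blast
    moreover have "eigen_potential s g (x - 1) = rreg s (\<lambda>y. g (y - 1)) (2 - (x - 1)) - theta_f2 s g (x - 1)"
      "eigen_potential s g x = - rreg s (\<lambda>y. g (- y)) (x + 2)"
      using 3 p by (simp_all add: eigen_potential_def)
    ultimately have L: "eigen_potential s g (x - 1) - eigen_potential s g x = g (x - 1) - theta_f2 s g (x - 1)" by (simp add: add.commute)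
    have "theta_f2 s g (x - 1) = - (jfac s (x - 1) * theta_h s g ((- (x - 1) - 1) / (x - 1)) + jfac s (x - 1 + 1) * theta_h s g (- 1 / (x - 1 + 1)))"
      by (rule theta_f2_out) (use 3 in simp)
    then have f2x1: "theta_f2 s g (x - 1) = - (jfac s (x - 1) * theta_h s g (- x / (x - 1)) + jfac s x * theta_h s g (- 1 / x))" by simp
    have "1 / (- x) < 1 / (phi - 1)" "0 < 1 / (- x)" using recip_less[of "phi - 1" "- x"] 3 p by (auto intro!: divide_pos_pos)
    moreover have "1 / (- x) = - 1 / x" by simp
    ultimately have "theta_f2 s g (- 1 / x) = theta_h s g (- 1 / x)" using p by (intro theta_f2_in) linarith+
    moreover have "theta_f1 s g x = theta_k s g x" by (rule theta_f1_in) (use 3 p in linarith)+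
    ultimately show ?thesis unfolding L f2x1 theta_k_eq by (simp add: algebra_simps)
  qed
qed

text \<open>At 0 the second terms on both sides of the four term equation coincide. The equality
  makes the leading coefficients at the two ends of the line fit together.\<close>

lemma eigen_value_minus_one:
  assumes "Re s > 0" "s \<noteq> 1/2" "g \<in> analytic_fun_on phi_interval" "real_eigen s g"
  shows "g (- 1) = g 0"
  using real_eigen_FE4[OF assms, of 0] phi_gt by (simp add: slash_words)

lemma theta_h_analytic:
  assumes g: "g \<in> analytic_fun_on phi_interval" and x: "- phi < x" "x < phi"
  shows "real_analytic_at (theta_h s g) x"
proof -
  note p = phi_gt phi_inverse phi_recip
  have eq: "theta_h s g = (\<lambda>x. g x + rslash s g 0 (- 1) 1 2 x)"
    by (rule ext) (simp add: theta_h_eq rslash_def jfac_def)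
  have "1 / (x + 2) < 1 / (2 - phi)" "0 < 1 / (x + 2)" using recip_less[of "2 - phi" "x + 2"] x p by (auto intro!: divide_pos_pos)
  then have "real_analytic_at g (- (1 / (x + 2)))" using p by (intro eigen_analytic(1)[OF g]) linarith+
  then have b: "real_analytic_at g ((0 * x + - 1) / (1 * x + 2))" by simp
  show ?thesis unfolding eq
    by (intro real_analytic_at_add rslash_analytic[OF _ b] eigen_analytic(1)[OF g]) (use x p in auto)
qed

lemma theta_k_analytic:
  assumes g: "g \<in> analytic_fun_on phi_interval" and x: "- phi < x" "x < phi - 1"
  shows "real_analytic_at (theta_k s g) x"
proof -
  note p = phi_gt phi_inverse phi_recip
  have eq: "theta_k s g = (\<lambda>x. g (x + - 1) + rslash s (theta_h s g) (- 1) 0 1 (- 1) x)"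
    by (rule ext) (simp add: theta_k_eq rslash_def jfac_def)
  have "1 / (phi + 1) < 1 / (1 - x)" "1 / (1 - x) < 1 / (2 - phi)"
    using recip_less[of "1 - x" "phi + 1"] recip_less[of "2 - phi" "1 - x"] x p by auto
  moreover have "(- 1 * x + 0) / (1 * x + - 1) = 1 / (1 - x) - 1"
  proof -
    have "1 - x \<noteq> 0" "x - 1 \<noteq> 0" using x p by linarith+
    then show ?thesis by (simp add: divide_simps) (simp add: algebra_simps)
  qed
  ultimately have b: "real_analytic_at (theta_h s g) ((- 1 * x + 0) / (1 * x + - 1))"
    using p by (intro theta_h_analytic[OF g]) linarith+
  show ?thesis unfolding eq
    by (intro real_analytic_at_add rslash_analytic[OF _ b] real_analytic_at_shift eigen_analytic(1)[OF g]) (use x p in auto)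
qed

lemma theta_f1_analytic:
  assumes g: "g \<in> analytic_fun_on phi_interval" and x: "x \<notin> {- phi, phi - 1}"
  shows "real_analytic_at (theta_f1 s g) x"
proof (cases "- phi < x \<and> x < phi - 1")
  case True
  have "\<forall>\<^sub>F y in nhds x. y \<in> {- phi <..< phi - 1}" using True by (intro eventually_nhds_in_open) auto
  then have "\<forall>\<^sub>F y in nhds x. theta_f1 s g y = theta_k s g y" by eventually_elim (simp add: theta_f1_in)
  then show ?thesis using True by (intro real_analytic_at_cong[OF theta_k_analytic[OF g]]) auto
next
  case False
  then have x': "x < - phi \<or> phi - 1 < x" using x by auto
  have "\<forall>\<^sub>F y in nhds x. y \<in> {..< - phi} \<union> {phi - 1 <..}" using x' by (intro eventually_nhds_in_open) auto
  then have ev: "\<forall>\<^sub>F y in nhds x. theta_f1 s g y = - rslash s (theta_k s g) 0 (- 1) 1 0 y"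
    by eventually_elim (auto simp: theta_f1_out rslash_def jfac_def)
  have "real_analytic_at (theta_k s g) ((0 * x + - 1) / (1 * x + 0))"
    using region_S(1)[OF x'] by (intro theta_k_analytic[OF g]) auto
  then have "real_analytic_at (\<lambda>y. - rslash s (theta_k s g) 0 (- 1) 1 0 y) x"
    using region_S(1)[OF x'] by (intro real_analytic_at_minus rslash_analytic) auto
  from real_analytic_at_cong[OF this ev] show ?thesis .
qed

lemma theta_f2_analytic:
  assumes g: "g \<in> analytic_fun_on phi_interval" and x: "x \<notin> {- phi, phi}"
  shows "real_analytic_at (theta_f2 s g) x"
proof (cases "- phi < x \<and> x < phi")
  case True
  have "\<forall>\<^sub>F y in nhds x. y \<in> {- phi <..< phi}" using True by (intro eventually_nhds_in_open) auto
  then have "\<forall>\<^sub>F y in nhds x. theta_f2 s g y = theta_h s g y" by eventually_elim (simp add: theta_f2_in)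
  then show ?thesis using True by (intro real_analytic_at_cong[OF theta_h_analytic[OF g]]) auto
next
  case False
  then have x': "x < - phi \<or> phi < x" using x by auto
  note r = region_U[OF x']
  have "\<forall>\<^sub>F y in nhds x. y \<in> {..< - phi} \<union> {phi <..}" using x' by (intro eventually_nhds_in_open) auto
  then have ev: "\<forall>\<^sub>F y in nhds x. theta_f2 s g y = - (rslash s (theta_h s g) (- 1) (- 1) 1 0 y + rslash s (theta_h s g) 0 (- 1) 1 1 y)"
    by eventually_elim (auto simp: theta_f2_out rslash_def jfac_def)
  have 1: "real_analytic_at (theta_h s g) ((- 1 * x + - 1) / (1 * x + 0))"
    using r by (intro theta_h_analytic[OF g]) auto
  have 2: "real_analytic_at (theta_h s g) ((0 * x + - 1) / (1 * x + 1))"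
    using r by (intro theta_h_analytic[OF g]) auto
  have "x + 1 \<noteq> 0" using r(2) by linarith
  then have "real_analytic_at (\<lambda>y. - (rslash s (theta_h s g) (- 1) (- 1) 1 0 y + rslash s (theta_h s g) 0 (- 1) 1 1 y)) x"
    using r(1) by (intro real_analytic_at_minus real_analytic_at_add rslash_analytic[OF _ 1] rslash_analytic[OF _ 2]) auto
  from real_analytic_at_cong[OF this ev] show ?thesis .
qed

lemma eigen_potential_analytic:
  assumes s: "Re s > 0" "s \<noteq> 1/2" and g: "g \<in> analytic_fun_on phi_interval" and x: "x \<noteq> - phi"
  shows "real_analytic_at (eigen_potential s g) x"
proof (cases "- phi < x")
  case True
  note p = phi_gt phi_inverse phi_recip
  have "real_analytic_at (\<lambda>y. g (- y)) (1 / (x + 2 + real n))" for n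
  proof (rule real_analytic_at_neg, rule eigen_analytic(1)[OF g])
    have "1 / (x + 2 + real n) < 1 / (2 - phi)" "0 < 1 / (x + 2 + real n)"
      using recip_less[of "2 - phi" "x + 2 + real n"] True p by (auto intro!: divide_pos_pos)
    then show "- (phi + 1) < - (1 / (x + 2 + real n))" "- (1 / (x + 2 + real n)) < phi" using p by linarith+
  qed
  then have "real_analytic_at (rreg s (\<lambda>y. g (- y))) (x + 2)"
    by (intro rreg_analytic eigen_analytic(2)[OF g] s) (use True p in auto)
  then have an: "real_analytic_at (\<lambda>y. - rreg s (\<lambda>y. g (- y)) (y + 2)) x"
    by (intro real_analytic_at_minus real_analytic_at_shift)
  have "\<forall>\<^sub>F y in nhds x. y \<in> {- phi <..}" using True by (intro eventually_nhds_in_open) auto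
  then have "\<forall>\<^sub>F y in nhds x. eigen_potential s g y = - rreg s (\<lambda>y. g (- y)) (y + 2)"
    by eventually_elim (simp add: eigen_potential_def)
  from real_analytic_at_cong[OF an this] show ?thesis .
next
  case False
  note p = phi_gt phi_inverse phi_recip
  have x': "x < - phi" using False x by simp
  have "real_analytic_at (\<lambda>y. g (y + - 1)) (1 / (2 - x + real n))" for n
  proof (rule real_analytic_at_shift, rule eigen_analytic(1)[OF g])
    have "1 / (2 - x + real n) < 1 / 1" "0 < 1 / (2 - x + real n)"
      using recip_less[of 1 "2 - x + real n"] x' p by (auto intro!: divide_pos_pos)
    then show "- (phi + 1) < 1 / (2 - x + real n) + - 1" "1 / (2 - x + real n) + - 1 < phi" using p by linarith+
  qed
  then have "real_analytic_at (rreg s (\<lambda>y. g (y - 1))) (2 - x)"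
    by (intro rreg_analytic eigen_analytic(3)[OF g] s) (use x' p in auto)
  then have an: "real_analytic_at (\<lambda>y. rreg s (\<lambda>y. g (y - 1)) (2 - y) - theta_f2 s g y) x"
    by (intro real_analytic_at_diff real_analytic_at_reflect theta_f2_analytic[OF g]) (use x' p in auto)
  have "\<forall>\<^sub>F y in nhds x. y \<in> {..< - phi}" using x' by (intro eventually_nhds_in_open) auto
  then have "\<forall>\<^sub>F y in nhds x. eigen_potential s g y = rreg s (\<lambda>y. g (y - 1)) (2 - y) - theta_f2 s g y"
    by eventually_elim (simp add: eigen_potential_def)
  from real_analytic_at_cong[OF an this] show ?thesis .
qed

lemma theta_f1_relation:
  assumes "x \<notin> {0, - phi, phi - 1}"
  shows "jfac s x * theta_f1 s g (- 1 / x) + theta_f1 s g x = 0"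
proof (cases "- phi < x \<and> x < phi - 1")
  case True
  have "jfac s x * jfac s (- 1 / x) = jfac s 1" using assms by (intro jfac_prod) simp
  then have j: "jfac s x * (jfac s (- 1 / x) * X) = X" for X by (simp only: mult.assoc[symmetric] jfac_one mult_1_left)
  have "theta_f1 s g (- 1 / x) = - (jfac s (- 1 / x) * theta_k s g (- 1 / (- 1 / x)))"
    using True assms by (intro theta_f1_out region_S(2)) auto
  then show ?thesis using True j by (simp add: theta_f1_in)
next
  case False
  then have x: "x < - phi \<or> phi - 1 < x" using assms by auto
  show ?thesis unfolding theta_f1_out[OF x] using region_S(1)[OF x] by (simp add: theta_f1_in)
qed

text \<open>The left-hand side \<open>R\<close> is invariant under U and vanishes on the outer arc
  by construction; the other points of the line are rotated into this arc by U or U^2.\<close>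

lemma theta_f2_relation:
  assumes "x \<notin> {0, - 1, - phi, phi, phi - 2}"
  shows "slash s (theta_f2 s g) (gU * gU) x + slash s (theta_f2 s g) gU x + theta_f2 s g x = 0"
proof -
  define R where "R = (\<lambda>x. slash s (theta_f2 s g) (gU * gU) x + slash s (theta_f2 s g) gU x + theta_f2 s g x)"
  have R0: "R x = 0" if x: "x < - phi \<or> phi < x" for x
  proof -
    note r = region_U[OF x]
    have "slash s (theta_f2 s g) gU x = jfac s x * theta_h s g ((- x - 1) / x)"
      "slash s (theta_f2 s g) (gU * gU) x = jfac s (x + 1) * theta_h s g (- 1 / (x + 1))"
      using theta_f2_in[OF r(3,4), of s g] theta_f2_in[OF r(5,6), of s g]
      unfolding gU_gU slash_gens jfac_def by (simp_all only:)
    then show ?thesis unfolding R_def theta_f2_out[OF x] by simp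
  qed
  have U: "slash s R gU x = R x" if "x \<noteq> 0" for x
  proof -
    have sl: "slash s (slash s f \<gamma>) gU x = slash s f (\<gamma> * gU) x" for f \<gamma>
      unfolding gU_psl by (rule slash_slash) (use that in auto)
    have one: "slash s f 1 x = f x" for f by (simp add: one_psl slash_psl rslash_one)
    show ?thesis unfolding R_def slash_linear sl gU_gU_gU one by simp
  qed
  have step: "R x = jfac s x * R ((- x - 1) / x)" if "x \<noteq> 0" for x
    using U[OF that] by (simp add: slash_gens jfac_def)
  have x: "x \<noteq> 0" "x \<noteq> - 1" "x \<noteq> - phi" "x \<noteq> phi" "x \<noteq> phi - 2" using assms by auto
  consider "x < - phi \<or> phi < x" | "phi - 2 < x" "x < phi" | "- phi < x" "x < phi - 2" using x by linarith
  then have "R x = 0"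
  proof cases
    case 2
    from R0[OF region_U_rotate(1)[OF 2 x(1)]] show ?thesis using step[OF x(1)] by simp
  next
    case 3
    define y where "y = (- x - 1) / x"
    have x1: "x + 1 \<noteq> 0" using x by linarith
    have y: "y \<noteq> 0" "(- y - 1) / y = - 1 / (x + 1)" using x x1 unfolding y_def by (auto simp: divide_simps)
    from R0[OF region_U_rotate(2)[OF 3 x(2)]] have "R y = 0" using step[OF y(1)] y(2) by simp
    then show ?thesis using step[OF x(1)] by (simp add: y_def)
  qed (rule R0)
  then show ?thesis by (simp add: R_def)
qed

lemma shifted_nat_at_top: "filterlim (\<lambda>n. x + real n) at_top sequentially"
  by (rule filterlim_tendsto_add_at_top[OF tendsto_const filterlim_real_sequentially])

lemma rreg_shift_limit:
  assumes p: "real_analytic_at p 0" and s: "Re s > 0" and x: "x + a > 0"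
  shows "(\<lambda>n. rreg s p (x + a + real n) - p 0 / (2 * s - 1) * of_real (x + real n) powr (1 - 2 * s)) \<longlonglongrightarrow> 0"
proof -
  have e: "complex_of_real (x + a) + of_nat n = of_real (x + a + real n)" for n by simp
  have "(\<lambda>n. reg_sum s (\<lambda>y. p (Re y)) (of_real (x + a) + of_nat n)
     - p (Re 0) / (2 * s - 1) * (of_real (x + a) + of_nat n) powr (1 - 2 * s)) \<longlonglongrightarrow> 0"
    by (rule reg_sum_asymp[OF lipschitz0_real[OF p] s]) (use x in simp)
  then have 1: "(\<lambda>n. rreg s p (x + a + real n) - p 0 / (2 * s - 1) * of_real (x + a + real n) powr (1 - 2 * s)) \<longlonglongrightarrow> 0"
    unfolding e rreg_def by simp
  have "(\<lambda>n. of_real (x + real n + a) powr (1 - 2 * s) - of_real (x + real n) powr (1 - 2 * s)) \<longlonglongrightarrow> (0 :: complex)"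
    by (rule filterlim_compose[OF shift_powr_tendsto_zero[OF s] shifted_nat_at_top])
  then have 2: "(\<lambda>n. p 0 / (2 * s - 1) * (of_real (x + real n + a) powr (1 - 2 * s) - of_real (x + real n) powr (1 - 2 * s))) \<longlonglongrightarrow> 0"
    by (rule tendsto_mult_right_zero)
  have c: "x + real n + a = x + a + real n" for n by simp
  show ?thesis using tendsto_add[OF 1 2] unfolding c by (simp add: right_diff_distrib)
qed

lemma jfac_tendsto_zero:
  assumes "Re s > 0" shows "(\<lambda>n. jfac s (y + real n)) \<longlonglongrightarrow> 0"
proof (rule Lim_transform_eventually)
  show "(\<lambda>n. of_real (y + real n) powr (- 2 * s)) \<longlonglongrightarrow> 0"
    by (rule filterlim_compose[OF powr_tendsto_zero shifted_nat_at_top]) (use assms in simp)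
  have "\<forall>\<^sub>F n in sequentially. 0 < y + real n"
    using shifted_nat_at_top[of y] by (simp add: filterlim_at_top_dense)
  then show "\<forall>\<^sub>F n in sequentially. of_real (y + real n) powr (- 2 * s) = jfac s (y + real n)"
    by eventually_elim (simp add: jfac_def)
qed

lemma reciprocal_tendsto_zero: "(\<lambda>n. 1 / (y + real n)) \<longlonglongrightarrow> 0"
  by (rule tendsto_divide_0[OF tendsto_const filterlim_at_top_imp_at_infinity[OF shifted_nat_at_top]])

lemma theta_f2_tendsto_zero:
  assumes s: "Re s > 0" and g: "g \<in> analytic_fun_on phi_interval" and t: "t > 2"
  shows "(\<lambda>n. theta_f2 s g (- (t + real n))) \<longlonglongrightarrow> 0"
proof -
  let ?H = "theta_h s g"
  have eq: "theta_f2 s g (- (t + real n)) = - (jfac s (t + real n) * ?H (1 / (t + real n) - 1)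
      + jfac s (t - 1 + real n) * ?H (1 / (t - 1 + real n)))" for n
  proof -
    let ?u = "t + real n"
    have u: "?u > 2" using t by simp
    have "theta_f2 s g (- ?u) = - (jfac s (- ?u) * ?H ((- (- ?u) - 1) / (- ?u)) + jfac s (- ?u + 1) * ?H (- 1 / (- ?u + 1)))"
      by (rule theta_f2_out) (use u phi_gt in linarith)
    moreover have "(- (- ?u) - 1) / (- ?u) = 1 / ?u - 1" "- 1 / (- ?u + 1) = 1 / (t - 1 + real n)"
      using u by (simp_all add: divide_simps) (simp add: algebra_simps)
    moreover have "jfac s (- ?u) = jfac s ?u" "jfac s (- ?u + 1) = jfac s (t - 1 + real n)"
      using jfac_prod[of "- 1" "- ?u" ?u s] jfac_prod[of "- 1" "- ?u + 1" "t - 1 + real n" s] by (simp_all add: jfac_one)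
    ultimately show ?thesis by simp
  qed
  have c: "isCont ?H (0 - 1)" "isCont ?H 0"
    using phi_gt by (intro real_analytic_at_isCont theta_h_analytic[OF g]; simp)+
  have "(\<lambda>n. - (jfac s (t + real n) * ?H (1 / (t + real n) - 1) + jfac s (t - 1 + real n) * ?H (1 / (t - 1 + real n))))
     \<longlonglongrightarrow> - (0 * ?H (0 - 1) + 0 * ?H 0)"
    by (intro tendsto_minus tendsto_add tendsto_mult jfac_tendsto_zero[OF s] isCont_tendsto_compose[OF c(1)]
        isCont_tendsto_compose[OF c(2)] tendsto_diff tendsto_const reciprocal_tendsto_zero)
  then show ?thesis unfolding eq by simp
qed

text \<open>By \<open>eigen_potential_difference\<close> and \<open>theta_f_large\<close> the
  potential satisfies at both ends the same difference equation, with -g|ST on the right, so one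
  numerator \<tau> serves for both. With the leading terms, \<open>reg_sum_unique\<close> identifies
  it.\<close>

lemma eigen_potential_reg_sum:
  assumes s: "Re s > 0" "s \<noteq> 1/2" and g: "g \<in> analytic_fun_on phi_interval" and e: "real_eigen s g"
  obtains \<tau> \<rho> M where "\<tau> holomorphic_on ball 0 \<rho>" "\<rho> > 0"
    "\<And>x. x > M \<Longrightarrow> eigen_potential s g x = reg_sum s \<tau> (of_real x)"
    "\<And>x. x > M \<Longrightarrow> eigen_potential s g (- x) = reg_sum s (\<lambda>y. - \<tau> (- y)) (of_real x + 1)"
proof -
  let ?Q = "eigen_potential s g"
  have "real_analytic_at g 0" by (rule eigen_analytic(1)[OF g]) (use phi_gt in auto)
  then obtain r F where r: "r > 0" and F: "F holomorphic_on ball (of_real 0) r" "\<And>y. \<bar>y - 0\<bar> < r \<Longrightarrow> g y = F (of_real y)"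
    by (rule real_analytic_atE) (rule that)
  define \<rho> where "\<rho> = min (1 / 4) (r / 2)"
  have \<rho>: "\<rho> > 0" "\<rho> \<le> 1 / 4" "2 * \<rho> \<le> r" using r by (auto simp: \<rho>_def)
  \<comment> \<open>This is -g|ST^2 in the coordinate \<open>z = 1 / x\<close>, because
    \<open>x + 2 = x * (1 + 2 * z)\<close>.\<close>
  define \<tau> where "\<tau> z = - ((1 + 2 * z) powr (- 2 * s) * F (- z / (1 + 2 * z)))" for z
  have small: "1 + 2 * z \<notin> \<real>\<^sub>\<le>\<^sub>0" "1 + 2 * z \<noteq> 0" "cmod (- z / (1 + 2 * z)) < r" if z: "cmod z < \<rho>" for z
  proof -
    show "1 + 2 * z \<notin> \<real>\<^sub>\<le>\<^sub>0" using z \<rho> by (intro one_plus_nonpos) (simp add: norm_mult)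
    then show "1 + 2 * z \<noteq> 0" by auto
    have "1 - cmod (2 * z) \<le> cmod (1 + 2 * z)" using norm_diff_ineq[of 1 "2 * z"] by simp
    then have h: "1 / 2 \<le> cmod (1 + 2 * z)" using z \<rho> by (simp add: norm_mult)
    have "cmod z < r * (1 / 2)" using z \<rho> by simp
    also have "\<dots> \<le> r * cmod (1 + 2 * z)" using h r by (intro mult_left_mono) auto
    finally have "cmod z < r * cmod (1 + 2 * z)" .
    moreover have "cmod (1 + 2 * z) > 0" using h by linarith
    ultimately show "cmod (- z / (1 + 2 * z)) < r" by (simp add: norm_divide pos_divide_less_eq)
  qed
  have hol: "\<tau> holomorphic_on ball 0 \<rho>"
  proof -
    have "(\<lambda>z. F (- z / (1 + 2 * z))) holomorphic_on ball 0 \<rho>"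
      by (rule holomorphic_on_compose_gen[OF _ F(1), unfolded o_def]) (use small in \<open>auto intro!: holomorphic_intros\<close>)
    then show ?thesis unfolding \<tau>_def using small(1) by (intro holomorphic_intros) auto
  qed
  have hol': "(\<lambda>y. - \<tau> (- y)) holomorphic_on ball 0 \<rho>"
    by (intro holomorphic_intros holomorphic_on_compose_gen[OF _ hol, unfolded o_def]) auto
  have lip: "lipschitz0 \<tau>" "lipschitz0 (\<lambda>y. - \<tau> (- y))"
    by (rule lipschitz0_holomorphic[OF hol \<rho>(1)], simp) (rule lipschitz0_holomorphic[OF hol' \<rho>(1)], simp)
  have \<tau>r: "\<tau> (of_real t) = - (jfac s (1 + 2 * t) * g (- t / (1 + 2 * t)))" if t: "\<bar>t\<bar> < \<rho>" for t :: real
  proof -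
    have p: "1 + 2 * t > 0" using t \<rho> by linarith
    have c: "- of_real t / (1 + 2 * of_real t) = complex_of_real (- t / (1 + 2 * t))" by simp
    have "\<bar>- t / (1 + 2 * t)\<bar> < r" using small(3)[of "of_real t"] t unfolding c norm_of_real by simp
    then have "g (- t / (1 + 2 * t)) = F (of_real (- t / (1 + 2 * t)))" by (intro F(2)) simp
    moreover have "(1 + 2 * complex_of_real t) powr (- 2 * s) = jfac s (1 + 2 * t)" using p by (simp add: jfac_def)
    ultimately show ?thesis unfolding \<tau>_def c by (simp only:)
  qed
  have \<tau>0: "\<tau> 0 = - g 0" using \<tau>r[of 0] \<rho>(1) by (simp add: jfac_one)
  define M where "M = 1 / \<rho>"
  have M: "M \<ge> 4" using \<rho> by (simp add: M_def pos_le_divide_eq)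
  have inv: "\<bar>1 / x\<bar> < \<rho>" if "x > M" for x
  proof -
    have "1 < x * \<rho>" using that \<rho>(1) by (simp add: M_def pos_divide_less_eq)
    then show ?thesis using that M by (simp add: pos_divide_less_eq mult.commute)
  qed
  have E1: "of_real x powr (- 2 * s) * \<tau> (of_real (1 / x)) = - (jfac s (x + 2) * g (- 1 / (x + 2)))" if "x > M" for x :: real
  proof -
    have x: "x > 4" using that M by simp
    have "of_real x powr (- 2 * s) = jfac s x" using x by (simp add: jfac_def)
    moreover have "jfac s x * jfac s (1 + 2 * (1 / x)) = jfac s (x + 2)" using x by (intro jfac_prod) (simp add: distrib_left)
    moreover have "- (1 / x) / (1 + 2 * (1 / x)) = - 1 / (x + 2)" using x by (simp add: divide_simps)
    ultimately show ?thesis unfolding \<tau>r[OF inv[OF that]] by (simp only: mult_minus_right mult.assoc[symmetric])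
  qed
  have E2: "of_real x powr (- 2 * s) * - \<tau> (- of_real (1 / x)) = jfac s (2 - x) * g (- 1 / (2 - x))" if "x > M" for x :: real
  proof -
    have x: "x > 4" using that M by simp
    have "of_real x powr (- 2 * s) = jfac s x" using x by (simp add: jfac_def)
    moreover have "jfac s x * jfac s (1 + 2 * (- (1 / x))) = jfac s (2 - x)" using x by (intro jfac_prod) (simp add: right_diff_distrib)
    moreover have "- (- (1 / x)) / (1 + 2 * (- (1 / x))) = - 1 / (2 - x)"
    proof -
      have "x - 2 \<noteq> 0" "2 - x \<noteq> 0" "x \<noteq> 0" using x by linarith+
      moreover have "1 + 2 * (- (1 / x)) = (x - 2) / x" using x by (simp add: field_simps)
      ultimately show ?thesis by (simp add: divide_simps)
    qed
    moreover have "- \<tau> (- of_real (1 / x)) = jfac s (1 + 2 * (- (1 / x))) * g (- (- (1 / x)) / (1 + 2 * (- (1 / x))))"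
      using \<tau>r[of "- (1 / x)"] inv[OF that] by simp
    ultimately show ?thesis by (simp only: mult.assoc[symmetric])
  qed
  have dif: "?Q (x - 1) - ?Q x = - (jfac s (x + 1) * g (- 1 / (x + 1)))" if "x < - 2 \<or> 2 < x" for x
  proof -
    have "x \<notin> {0, - phi, phi - 1, 1 - phi}" "x < - phi \<or> phi - 1 < x" using that phi_gt by auto
    then show ?thesis using eigen_potential_difference[OF s g e] theta_f_large[OF s g e] by simp
  qed
  show thesis
  proof (rule that[OF hol \<rho>(1)])
    fix x assume x: "x > M"
    then have x4: "x > 4" using M by simp
    have "?Q (x + real 0) = reg_sum s \<tau> (of_real x)"
    proof (rule reg_sum_unique[OF lip(1) s(1) _ s(2), where q = "\<lambda>n. ?Q (x + real n)"])
      show "Re (complex_of_real x) > 0" using x4 by simp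
      show "?Q (x + real n) - ?Q (x + real (Suc n)) = (of_real x + of_nat n) powr (- 2 * s) * \<tau> (1 / (of_real x + of_nat n))" for n
      proof -
        have xn: "x + real n > M" using x by simp
        have "?Q (x + real n) - ?Q (x + real (Suc n)) = - (jfac s (x + real n + 2) * g (- 1 / (x + real n + 2)))"
          using dif[of "x + real n + 1"] x4 by (simp add: add_ac)
        then show ?thesis using E1[OF xn] unfolding of_real_inverse_add by simp
      qed
      have "(\<lambda>n. - (rreg s (\<lambda>y. g (- y)) (x + 2 + real n) - g (- 0) / (2 * s - 1) * of_real (x + real n) powr (1 - 2 * s))) \<longlonglongrightarrow> - 0"
        by (intro tendsto_minus rreg_shift_limit[OF eigen_analytic(2)[OF g] s(1)]) (use x4 in simp)
      moreover have "?Q (x + real n) = - rreg s (\<lambda>y. g (- y)) (x + 2 + real n)" for n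
        using x4 phi_gt by (simp add: eigen_potential_def add_ac)
      ultimately show "(\<lambda>n. ?Q (x + real n) - \<tau> 0 / (2 * s - 1) * (of_real x + of_nat n) powr (1 - 2 * s)) \<longlonglongrightarrow> 0"
        unfolding \<tau>0 by simp
    qed
    then show "?Q x = reg_sum s \<tau> (of_real x)" by simp
    have "?Q (- (x + real 0)) = reg_sum s (\<lambda>y. - \<tau> (- y)) (of_real x + 1)"
    proof (rule reg_sum_unique[OF lip(2) s(1) _ s(2), where q = "\<lambda>n. ?Q (- (x + real n))"])
      show "Re (complex_of_real x + 1) > 0" using x4 by simp
      have c: "complex_of_real x + 1 = of_real (x + 1)" by simp
      show "?Q (- (x + real n)) - ?Q (- (x + real (Suc n)))
          = (of_real x + 1 + of_nat n) powr (- 2 * s) * - \<tau> (- (1 / (of_real x + 1 + of_nat n)))" for n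
      proof -
        have xn: "x + 1 + real n > M" using x by simp
        have a: "- (x + real n) - 1 = - (x + real (Suc n))" "- (x + real n) + 1 = 2 - (x + 1 + real n)" by simp_all
        have "?Q (- (x + real n)) - ?Q (- (x + real (Suc n))) = jfac s (2 - (x + 1 + real n)) * g (- 1 / (2 - (x + 1 + real n)))"
          using dif[of "- (x + real n)"] x4 unfolding a by (simp add: algebra_simps)
        also have "\<dots> = of_real (x + 1 + real n) powr (- 2 * s) * - \<tau> (- of_real (1 / (x + 1 + real n)))"
          by (rule E2[OF xn, symmetric])
        finally show ?thesis unfolding c of_real_inverse_add by simp
      qed
      have 1: "(\<lambda>n. rreg s (\<lambda>y. g (y - 1)) (x + 1 + 1 + real n) - g (0 - 1) / (2 * s - 1) * of_real (x + 1 + real n) powr (1 - 2 * s)) \<longlonglongrightarrow> 0"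
        by (rule rreg_shift_limit[OF eigen_analytic(3)[OF g] s(1)]) (use x4 in simp)
      have 2: "(\<lambda>n. theta_f2 s g (- (x + real n))) \<longlonglongrightarrow> 0" by (rule theta_f2_tendsto_zero[OF s(1) g]) (use x4 in simp)
      have Qn: "?Q (- (x + real n)) = rreg s (\<lambda>y. g (y - 1)) (x + 1 + 1 + real n) - theta_f2 s g (- (x + real n))" for n
      proof -
        have a: "2 - - (x + real n) = x + 1 + 1 + real n" by simp
        have "\<not> - phi < - (x + real n)" using x4 phi_gt by linarith
        then show ?thesis by (simp only: eigen_potential_def a if_False)
      qed
      \<comment> \<open>The second sum has its leading term from \<open>g (- 1)\<close>, whereas
        \<tau> is built from \<open>g\<close> at 0.\<close>
      have g1: "g (- 1) = g 0" by (rule eigen_value_minus_one[OF s g e])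
      have eqn: "?Q (- (x + real n)) - - \<tau> (- 0) / (2 * s - 1) * (of_real x + 1 + of_nat n) powr (1 - 2 * s)
         = rreg s (\<lambda>y. g (y - 1)) (x + 1 + 1 + real n) - g (0 - 1) / (2 * s - 1) * of_real (x + 1 + real n) powr (1 - 2 * s)
           - theta_f2 s g (- (x + real n))" for n
        unfolding Qn by (simp add: \<tau>0 g1)
      show "(\<lambda>n. ?Q (- (x + real n)) - - \<tau> (- 0) / (2 * s - 1) * (of_real x + 1 + of_nat n) powr (1 - 2 * s)) \<longlonglongrightarrow> 0"
        using tendsto_diff[OF 1 2] by (simp only: eqn diff_0_right)
    qed
    then show "?Q (- x) = reg_sum s (\<lambda>y. - \<tau> (- y)) (of_real x + 1)" by simp
  qed
qed

lemma moebius_gT_inverse: "moebius (inverse gT) (Fin x) = Fin (x - 1)" "moebius (inverse gT) Infty = Infty"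
  by (simp_all add: gT_inverse_psl moebius_psl)

lemma theta_cocycle_exists:
  assumes g: "g \<in> analytic_fun_on phi_interval"
  obtains c where "c \<in> Z1 s (V_fs s)" "c gS = - theta_c1 s g" "c gU = - theta_c2 s g" "theta_cocycle s g = c"
proof -
  have fs: "theta_c1 s g \<in> V_fs s" "theta_c2 s g \<in> V_fs s"
  proof -
    show "theta_c1 s g \<in> V_fs s" unfolding theta_c_class V_fs_iff
      by (rule exI[of _ "theta_f1 s g"], rule exI[of _ "{- phi, phi - 1}"]) (use theta_f1_analytic[OF g] in auto)
    show "theta_c2 s g \<in> V_fs s" unfolding theta_c_class V_fs_iff
      by (rule exI[of _ "theta_f2 s g"], rule exI[of _ "{- phi, phi}"]) (use theta_f2_analytic[OF g] in auto)
  qed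
  have r1: "cslash s (theta_c1 s g) gS + theta_c1 s g = 0"
    unfolding theta_c_class class_of_arith class_of_eq_iff
    by (rule eq_cofiniteI[of "{0, - phi, phi - 1}"]) (use theta_f1_relation in \<open>auto simp: slash_gS jfac_def\<close>)
  have r2: "cslash s (theta_c2 s g) (gU * gU) + cslash s (theta_c2 s g) gU + theta_c2 s g = 0"
    unfolding theta_c_class class_of_arith class_of_eq_iff
    by (rule eq_cofiniteI[of "{0, - 1, - phi, phi, phi - 2}"]) (use theta_f2_relation in auto)
  have "cslash s (- theta_c1 s g) gS + - theta_c1 s g = - (cslash s (theta_c1 s g) gS + theta_c1 s g)"
    by (simp add: cslash_linear)
  then have n1: "cslash s (- theta_c1 s g) gS + - theta_c1 s g = 0" unfolding r1 by simp
  have "cslash s (- theta_c2 s g) (gU * gU) + cslash s (- theta_c2 s g) gU + - theta_c2 s g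
      = - (cslash s (theta_c2 s g) (gU * gU) + cslash s (theta_c2 s g) gU + theta_c2 s g)"
    by (simp add: cslash_linear)
  then have n2: "cslash s (- theta_c2 s g) (gU * gU) + cslash s (- theta_c2 s g) gU + - theta_c2 s g = 0" unfolding r2 by simp
  obtain c where c: "c \<in> Z1 s (V_fs s)" "c gS = - theta_c1 s g" "c gU = - theta_c2 s g"
    by (rule cocycle_exists[OF V_fs_uminus[OF fs(1)] V_fs_uminus[OF fs(2)] n1 n2])
  then show thesis using that theta_cocycle_eq by blast
qed

lemma Z1_V_omegaI:
  assumes \<psi>: "\<psi> \<in> Z1 s (V_fs s)" and S: "\<psi> gS \<in> V_omega s" and U: "\<psi> gU \<in> V_omega s"
  shows "\<psi> \<in> Z1 s (V_omega s)"
proof -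
  have "\<psi> \<gamma> \<in> V_omega s" for \<gamma>
  proof (induction \<gamma> rule: psl_induct)
    case 1
    show ?case by (simp add: Z1_one[OF \<psi>] V_omega_zero)
  next
    case (2 \<gamma>)
    then show ?case unfolding Z1D(1)[OF \<psi>] by (intro V_omega_add V_omega_cslash assms(2))
  next
    case (3 \<gamma>)
    then show ?case unfolding Z1D(1)[OF \<psi>] by (intro V_omega_add V_omega_cslash assms(3))
  qed
  then show ?thesis using Z1D(1)[OF \<psi>] unfolding Z1_def by blast
qed

text \<open>After twisting by \<open>v = V + W\<close> the value at T^(-1) is the coboundary of the
  analytic \<open>w\<close> at real points and regular at infinity for other reasons. The relations
  T^(-1) = US and S^2 = 1 then carry regularity to the exceptional points of the values at S and
  U.\<close>

lemma eigen_to_parabolic: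
  assumes s: "Re s > 0" "s \<noteq> 1/2" and gE: "g \<in> eigen_space s"
  shows "\<exists>\<psi>. theta s g = coh_class s (V_fs s) \<psi> \<and> \<psi> \<in> Z1 s (V_omega s) \<and> (\<exists>w\<in>V_smp s. \<psi> gT = w - cslash s w gT)"
proof -
  have g: "g \<in> analytic_fun_on phi_interval" and e: "real_eigen s g" using gE eigen_space_iff[OF s] by auto
  define C1 where "C1 = theta_c1 s g"
  define C2 where "C2 = theta_c2 s g"
  obtain c where c: "c \<in> Z1 s (V_fs s)" "c gS = - C1" "c gU = - C2" "theta_cocycle s g = c"
    unfolding C1_def C2_def by (rule theta_cocycle_exists[OF g, of s])
  let ?Q = "eigen_potential s g" and ?Ti = "inverse gT"
  obtain \<tau> \<rho> M where PT: "\<tau> holomorphic_on ball 0 \<rho>" "\<rho> > 0"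
    "\<And>x. x > M \<Longrightarrow> ?Q x = reg_sum s \<tau> (of_real x)"
    "\<And>x. x > M \<Longrightarrow> ?Q (- x) = reg_sum s (\<lambda>y. - \<tau> (- y)) (of_real x + 1)"
    by (rule eigen_potential_reg_sum[OF s g e]) blast
  obtain w where w: "\<And>x. real_analytic_at w x" "simple_at s w Infty" "regular_fun s (\<lambda>x. ?Q x + w x) Infty"
    by (rule parabolic_correction[OF s PT(1,2), where M = M and Q = ?Q]) (rule PT(3,4) that; assumption)+
  define V where "V = class_of ?Q"
  define W where "W = class_of w"
  define v where "v = V + W"
  have v_class: "v = class_of (\<lambda>x. ?Q x + w x)" by (simp add: v_def V_def W_def class_of_arith)
  have van: "real_analytic_at (\<lambda>x. ?Q x + w x) x" if "x \<noteq> - phi" for x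
    by (intro real_analytic_at_add w eigen_potential_analytic[OF s g that])
  have vfs: "v \<in> V_fs s" unfolding v_class V_fs_iff 
    by (rule exI[of _ "\<lambda>x. ?Q x + w x"], rule exI[of _ "{- phi}"]) (use van in auto)
  have vreg: "regular s v (Fin x)" if "x \<noteq> - phi" for x
    unfolding v_class regular_class_of by (rule regular_fun_analytic[OF van[OF that]])
  have vinf: "regular s v Infty" unfolding v_class regular_class_of by (rule w(3))
  have Wreg: "regular s W (Fin x)" for x unfolding W_def regular_class_of by (rule regular_fun_analytic[OF w(1)])
  have C1reg: "regular s C1 (Fin x)" if "x \<notin> {- phi, phi - 1}" for x
    unfolding C1_def theta_c_class regular_class_of by (rule regular_fun_analytic[OF theta_f1_analytic[OF g that]])
  have C2reg: "regular s C2 (Fin x)" if "x \<notin> {- phi, phi}" for x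
    unfolding C2_def theta_c_class regular_class_of by (rule regular_fun_analytic[OF theta_f2_analytic[OF g that]])
  have sq: "\<psi> gS = - cslash s (\<psi> gS) gS" if "\<psi> \<in> Z1 s (V_fs s)" for \<psi>
  proof -
    have "0 = \<psi> (gS * gS)" by (simp add: gS_gS Z1_one[OF that])
    then show ?thesis by (simp add: Z1D(1)[OF that] add_eq_0_iff)
  qed
  have C1inf: "regular s C1 Infty"
  proof -
    have "- C1 = cslash s C1 gS" using sq[OF c(1)] unfolding c(2) cslash_linear by simp
    then have "C1 = - cslash s C1 gS" by (metis minus_minus)
    moreover have "regular s (- cslash s C1 gS) Infty"
      using C1reg[of 0] phi_gt by (intro regular_uminus) (simp add: regular_cslash moebius_gens)
    ultimately show ?thesis by simp
  qed
  have cTi: "c ?Ti = - cslash s C2 gS - C1"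
    unfolding gT_inverse_eq Z1D(1)[OF c(1)] c(2,3) cslash_linear by simp
  have VT: "cslash s V ?Ti - V = cslash s C2 gS + C1"
    unfolding V_def C1_def C2_def theta_c_class class_of_arith class_of_eq_iff
    by (rule eq_cofiniteI[of "{0, - phi, phi - 1, 1 - phi}"])
       (use eigen_potential_difference[OF s g e] in \<open>simp_all add: slash_gens slash_gS jfac_def\<close>)
  define \<psi> where "\<psi> \<gamma> = c \<gamma> - (v - cslash s v \<gamma>)" for \<gamma>
  have \<psi>Z: "\<psi> \<in> Z1 s (V_fs s)" unfolding \<psi>_def by (rule Z1_twist[OF c(1) vfs])
  have \<psi>Ti: "\<psi> ?Ti = cslash s W ?Ti - W"
  proof -
    have "\<psi> ?Ti = - (cslash s C2 gS + C1) + (cslash s V ?Ti - V) + (cslash s W ?Ti - W)"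
      unfolding \<psi>_def cTi v_def cslash_linear by (simp add: algebra_simps)
    then show ?thesis unfolding VT by simp
  qed
  have TiR: "regular s (\<psi> ?Ti) p" for p
  proof (cases p)
    case (Fin x)
    show ?thesis unfolding Fin \<psi>Ti by (intro regular_diff Wreg) (simp add: regular_cslash moebius_gT_inverse Wreg)
  next
    case Infty
    \<comment> \<open>The formula \<open>\<psi>Ti\<close> is of no help at infinity, where
      \<open>w\<close> may be singular; there \<open>v\<close> and the cocycle values are regular
      separately.\<close>
    have "regular s (cslash s C2 gS) Infty" using C2reg[of 0] phi_gt by (simp add: regular_cslash moebius_gens)
    moreover have "regular s (cslash s v ?Ti) Infty" by (simp add: regular_cslash moebius_gT_inverse vinf)
    ultimately show ?thesis unfolding Infty \<psi>_def cTi by (intro regular_diff regular_uminus C1inf vinf)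
  qed
  have US: "\<psi> ?Ti = cslash s (\<psi> gU) gS + \<psi> gS" unfolding gT_inverse_eq by (rule Z1D(1)[OF \<psi>Z])
  have S0: "regular s (\<psi> gS) (Fin x)" if x: "x \<noteq> - phi" "x \<noteq> phi - 1" for x
  proof -
    have "regular s (cslash s v gS) (Fin x)"
    proof (cases "x = 0")
      case True then show ?thesis by (simp add: regular_cslash moebius_gens vinf)
    next
      case False
      have "- (1 / x) \<noteq> - phi"
      proof
        assume "- (1 / x) = - phi"
        then have "phi * x = 1" using False by (simp add: field_simps)
        then have "x = 1 / phi" using phi_gt by (simp add: eq_divide_eq mult.commute)
        then show False using x phi_inverse by simp
      qed
      then show ?thesis using False vreg by (simp add: regular_cslash moebius_gens)
    qed
    then show ?thesis unfolding \<psi>_def c(2) using x by (intro regular_diff regular_uminus C1reg vreg) auto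
  qed
  have Sinf: "regular s (\<psi> gS) Infty"
  proof -
    have "regular s (cslash s v gS) Infty" using vreg[of 0] phi_gt by (simp add: regular_cslash moebius_gens)
    then show ?thesis unfolding \<psi>_def c(2) by (intro regular_diff regular_uminus C1inf vinf)
  qed
  have S1: "regular s (\<psi> gS) (Fin (- phi))"
  proof -
    \<comment> \<open>S maps \<open>- phi\<close> to \<open>phi - 1\<close>, and at this point
      \<open>C2\<close>, \<open>v\<close> and v|U are all regular, since U(phi - 1) = - phi -
      1.\<close>
    have "regular s (cslash s v gU) (Fin (phi - 1))"
      using vreg[of "- 1 - 1 / (phi - 1)"] vreg[of "- 1 - phi"] phi_recip phi_gt by (simp add: regular_cslash moebius_gens)
    then have "regular s (\<psi> gU) (Fin (phi - 1))"
      unfolding \<psi>_def c(3) using phi_gt by (intro regular_diff regular_uminus C2reg vreg) auto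
    then have R: "regular s (cslash s (\<psi> gU) gS) (Fin (- phi))"
      using phi_gt phi_inverse by (simp add: regular_cslash moebius_gens)
    have eq: "\<psi> gS = \<psi> ?Ti - cslash s (\<psi> gU) gS" unfolding US by simp
    show ?thesis by (subst eq) (rule regular_diff[OF TiR R])
  qed
  have S2: "regular s (\<psi> gS) (Fin (phi - 1))"
  proof -
    \<comment> \<open>The anti-invariance under S carries regularity from \<open>- phi\<close> to
      \<open>phi - 1\<close>.\<close>
    have "regular s (cslash s (\<psi> gS) gS) (Fin (phi - 1))"
      using S1 phi_gt phi_recip by (simp add: regular_cslash moebius_gens)
    then have "regular s (- cslash s (\<psi> gS) gS) (Fin (phi - 1))" by (rule regular_uminus)
    then show ?thesis using sq[OF \<psi>Z] by simp
  qed
  have SR: "regular s (\<psi> gS) p" for p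
  proof (cases p)
    case (Fin x)
    then show ?thesis using S0[of x] S1 S2 by (cases "x = - phi"; cases "x = phi - 1") auto
  qed (use Sinf in simp)
  have UR: "regular s (\<psi> gU) p" for p
  proof -
    have "cslash s (\<psi> ?Ti - \<psi> gS) gS = \<psi> gU" unfolding US by (simp add: cslash_cslash gS_gS cslash_one)
    moreover have "regular s (cslash s (\<psi> ?Ti - \<psi> gS) gS) p"
      unfolding regular_cslash by (rule regular_diff[OF TiR SR])
    ultimately show ?thesis by simp
  qed
  have \<psi>om: "\<psi> \<in> Z1 s (V_omega s)"
    using Z1D(2)[OF \<psi>Z] SR UR by (intro Z1_V_omegaI[OF \<psi>Z]) (simp_all add: V_omega_iff)
  have "0 = \<psi> (?Ti * gT)" unfolding gT_inverse(2) Z1_one[OF \<psi>Z] ..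
  also have "\<dots> = cslash s (cslash s W ?Ti - W) gT + \<psi> gT" unfolding Z1D(1)[OF \<psi>Z] \<psi>Ti ..
  also have "cslash s (cslash s W ?Ti - W) gT = W - cslash s W gT"
    by (simp add: cslash_linear cslash_cslash gT_inverse cslash_one)
  finally have T0: "0 = W - cslash s W gT + \<psi> gT" .
  have "\<psi> gT = - (W - cslash s W gT)" by (rule minus_unique[OF T0[symmetric], symmetric])
  then have \<psi>T: "\<psi> gT = - W - cslash s (- W) gT" by (simp add: cslash_linear)
  have Wsmp: "- W \<in> V_smp s"
  proof -
    have cl: "- W = class_of (\<lambda>x. - w x)" by (simp add: W_def class_of_arith)
    have Wfs: "class_of (\<lambda>x. - w x) \<in> V_fs s"
      unfolding V_fs_iff by (rule exI[of _ "\<lambda>x. - w x"], rule exI[of _ "{}"]) (use real_analytic_at_minus[OF w(1)] in auto)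
    have "simple_at s (\<lambda>x. - w x) p" if p: "p \<in> singularities s (class_of (\<lambda>x. - w x))" for p
    proof (cases p)
      case (Fin x)
      have "regular s (class_of (\<lambda>x. - w x)) (Fin x)"
        unfolding regular_class_of by (rule regular_fun_analytic[OF real_analytic_at_minus[OF w(1)]])
      then show ?thesis using p singularities_iff[OF Wfs] unfolding Fin by blast
    next
      case Infty
      obtain k where k: "smooth_at k 0" "\<forall>\<^sub>F y in at 0. k y = of_real y * of_real \<bar>y\<bar> powr (- 2 * s) * w (- 1 / y)"
        using w(2) unfolding simple_at.simps by blast
      have "smooth_at (\<lambda>y. (\<lambda>z. 0) (complex_of_real y)) 0" by (rule smooth_at_holomorphic[of UNIV]) auto
      from smooth_at_diff[OF this k(1)] have "smooth_at (\<lambda>y. - k y) 0" by simp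
      moreover have "\<forall>\<^sub>F y in at 0. - k y = of_real y * of_real \<bar>y\<bar> powr (- 2 * s) * - w (- 1 / y)"
        using k(2) by eventually_elim simp
      ultimately show ?thesis unfolding Infty simple_at.simps by blast
    qed
    then show ?thesis unfolding cl V_smp_def using Wfs by blast
  qed
  have "theta s g = coh_class s (V_fs s) c" by (simp add: theta_def c(4))
  also have "\<dots> = coh_class s (V_fs s) \<psi>"
    by (rule coh_class_eqI[OF _ _ c(1) \<psi>Z vfs]) (auto intro: V_fs_add V_fs_uminus simp: \<psi>_def)
  finally show ?thesis using \<psi>om \<psi>T Wsmp by blast
qed

theorem theorem2p7:
  fixes s :: complex
  assumes "0 < Re s" and "Re s < 1" and "s \<noteq> 1/2"
  shows "(\<forall>(f1, f2)\<in>transfer_fixed s. \<exists>g\<in>FE4 s {-(phi^2) <..< phi}. analytic_extension f1 g)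
    \<and> eigen_space s \<subseteq> FE4 s {-(phi^2) <..< phi}
    \<and> cscale.subspace (eigen_space s)
    \<and> theta s ` eigen_space s = H1_incl s (V_fs s) ` H1_par s (V_omega s) (V_smp s)"
proof (intro conjI)
  note s = assms(1,3)
  show "\<forall>(f1, f2)\<in>transfer_fixed s. \<exists>g\<in>FE4 s {-(phi^2) <..< phi}. analytic_extension f1 g"
  proof (rule ballI, clarify)
    fix f1 f2 assume "(f1, f2) \<in> transfer_fixed s"
    then obtain g where g: "analytic_extension f1 g" "real_eigen s g" by (rule transfer_fixed_imp_real_eigen[OF s])
    then have "g \<in> FE4 s phi_interval" by (intro real_eigen_imp_FE4[OF s]) (simp_all add: analytic_extension_def)
    then show "\<exists>g\<in>FE4 s {-(phi^2) <..< phi}. analytic_extension f1 g" using g(1) by blast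
  qed
  show "eigen_space s \<subseteq> FE4 s {-(phi^2) <..< phi}"
  proof
    fix g assume "g \<in> eigen_space s"
    then have "g \<in> analytic_fun_on phi_interval" "real_eigen s g" using eigen_space_iff[OF s] by auto
    then show "g \<in> FE4 s {-(phi^2) <..< phi}" by (rule real_eigen_imp_FE4[OF s])
  qed
  show "cscale.subspace (eigen_space s)" by (rule subspace_eigen_space[OF s])
  show "theta s ` eigen_space s = H1_incl s (V_fs s) ` H1_par s (V_omega s) (V_smp s)"
    unfolding H1_par_image
  proof (intro subset_antisym subsetI)
    fix C assume "C \<in> theta s ` eigen_space s"
    then obtain g where g: "g \<in> eigen_space s" "C = theta s g" by (rule imageE) (rule that)
    show "C \<in> {coh_class s (V_fs s) \<psi> |\<psi>. \<psi> \<in> Z1 s (V_omega s) \<and> (\<exists>w\<in>V_smp s. \<psi> gT = w - cslash s w gT)}"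
      using eigen_to_parabolic[OF s g(1)] unfolding g(2) mem_Collect_eq .
  next
    fix C assume "C \<in> {coh_class s (V_fs s) \<psi> |\<psi>. \<psi> \<in> Z1 s (V_omega s) \<and> (\<exists>w\<in>V_smp s. \<psi> gT = w - cslash s w gT)}"
    then obtain \<psi> w where \<psi>: "C = coh_class s (V_fs s) \<psi>" "\<psi> \<in> Z1 s (V_omega s)"
      and w: "w \<in> V_smp s" "\<psi> gT = w - cslash s w gT" by auto
    obtain g where "g \<in> eigen_space s" "theta s g = coh_class s (V_fs s) \<psi>"
      using parabolic_to_eigen[OF s \<psi>(2) w] by (rule bexE) (rule that)
    then show "C \<in> theta s ` eigen_space s" unfolding \<psi>(1) by (intro image_eqI[where x = g]) simp_all
  qed
qed

end
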